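(* For $w_1,w_2\in\mathbb{C}_+$ and $\gamma\in\mathbb{C}^4$ put $q=e^{\pi iw_1/w_2}$ and $$a=-e^{2\pi i\gamma_0/w_2}q,\quad b=-e^{2\pi i\gamma_1/w_2}q,\quad c=-e^{2\pi i\gamma_2/w_2}q,\quad d=-e^{2\pi i\gamma_3/w_2}q,$$ and for $n\in\mathbb{Z}_{\ge0}$ let $\lambda_n=iw+i\hat\gamma_0+inw_1$. Then for all $n\in\mathbb{Z}_{\ge0}$ $$S(w_1,w_2,\gamma;x,\lambda_n)=r_n(x;a,b,c,d\,|\,q^2)$$ (as meromorphic functions of $(w_1,w_2,\gamma,x)$).
   Context: Convention: $\pm$ inside the argument of a function means a product over both signs, e.g. $f(z\pm a)=f(z+a)f(z-a)$; square roots are the principal branch. $\mathbb{C}_+=\{z\in\mathbb{C}:\Re(z)>0\}$; for $w_1,w_2\in\mathbb{C}_+$ set $w=(w_1+w_2)/2$. Askey-Wilson polynomials: $(a;q)_n=\prod_{k=0}^{n-1}(1-aq^k)$, $(a_1,\dots,a_k;q)_n=\prod_j(a_j;q)_n$, $${}_{s+1}\phi_s\left[\begin{array}{c}a_1,\ldots,a_{s+1}\\ b_1,\ldots,b_s\end{array};q,z\right]=\sum_{k=0}^\infty\frac{(a_1,\ldots,a_{s+1};q)_k}{(b_1,\ldots,b_s,q;q)_k}z^k,$$ $$r_n(x;a,b,c,d\,|\,q)={}_4\phi_3\left[\begin{array}{c}q^{-n},\,abcdq^{n-1},\,ae^{2\pi x/w_2},\,ae^{-2\pi x/w_2}\\ ab,\,ac,\,ad\end{array};q,q\right]$$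 (a terminating series). In $r_n(x;a,b,c,d\,|\,q^2)$ the base is $q^2$. Hyperbolic gamma function: for $|\Im(z)|<\Re(w)$, $G(z)=G(w_1,w_2;z)=\exp\Big(i\int_0^\infty\Big(\frac{\sin(2yz)}{2\sinh(w_1y)\sinh(w_2y)}-\frac{z}{w_1w_2y}\Big)\frac{dy}{y}\Big)$, continued meromorphically to $z\in\mathbb{C}$ by $G(z+iw_1/2)=2\cosh(\pi z/w_2)G(z-iw_1/2)$ and $G(z+iw_2/2)=2\cosh(\pi z/w_1)G(z-iw_2/2)$. Parameters: $\gamma=(\gamma_0,\gamma_1,\gamma_2,\gamma_3)\in\mathbb{C}^4$ corresponds to $(\rho,\sigma,\tau,\upsilon)\in\mathbb{C}^4$ via $\gamma_0=-\rho+\sigma$, $\gamma_1=\rho+\sigma$, $\gamma_2=-\tau-\upsilon$, $\gamma_3=\tau-\upsilon$. Dual parameters $\hat\gamma$: $\hat\gamma_0=\frac12(\gamma_0+\gamma_1+\gamma_2+\gamma_3)$, $\hat\gamma_1=\frac12(\gamma_0+\gamma_1-\gamma_2-\gamma_3)$, $\hat\gamma_2=\frac12(\gamma_0-\gamma_1+\gamma_2-\gamma_3)$, $\hat\gamma_3=\frac12(\gamma_0-\gamma_1-\gamma_2+\gamma_3)$. The function $S$: let $\xi=\max(|\Re\rho|,|\Re\sigma|,|\Re\tau|,|\Re\upsilon|)$ and $\zeta=w/2-\xi-|\Im(\lambda/2)|$. For $w_1,w_2>0$, $\zeta>0$, $|\Im x|<\zeta$ put $$\psi(\gamma;x,\lambda)=\int_{\mathbb{R}}\frac{G(z+x+\lambda/2-iw/2\pm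 i\tau)\,G(z-\lambda/2-iw/2\pm i\sigma)}{G(z+x-\lambda/2+iw/2\pm i\rho)\,G(z+\lambda/2+iw/2\pm i\upsilon)}\,dz ;$$ $\psi$ extends to a meromorphic function of $(w_1,w_2,\rho,\sigma,\tau,\upsilon,x,\lambda)\in\mathbb{C}_+^2\times\mathbb{C}^6$. With $\Delta(\gamma;x)=\frac{G(x+i\gamma_2)G(x+i\gamma_3)}{G(x-i\gamma_0)G(x-i\gamma_1)}$ and $N(\gamma)=\prod_{j=1}^3G(i\gamma_0+i\gamma_j+iw)$, define the meromorphic function $$S(w_1,w_2,\gamma;x,\lambda)=\frac{N(\gamma)\,\psi(\gamma;x,\lambda)}{\sqrt{w_1w_2}\,\Delta(\gamma;x)\,\Delta(\hat\gamma;\lambda)}.$$ *)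

theory Defs
  imports "HOL-Complex_Analysis.Complex_Analysis"
begin

section \<open>Holomorphic and meromorphic functions of several complex variables\<close>

text \<open>Points of \<open>\<complex>\<^sup>m\<close> are written as nested tuples of complex numbers.\<close>

class complex_space = real_normed_vector +
  fixes scaleC :: "complex \<Rightarrow> 'a \<Rightarrow> 'a"
  assumes scaleC_add_right: "scaleC c (u + v) = scaleC c u + scaleC c v"
    and scaleC_add_left: "scaleC (c + d) u = scaleC c u + scaleC d u"
    and scaleC_scaleC: "scaleC c (scaleC d u) = scaleC (c * d) u"
    and scaleC_of_real: "scaleC (of_real r) u = scaleR r u"

instantiation complex :: complex_space
begin
definition "scaleC c (z::complex) = c * z"
instance
  by standard (auto simp: scaleC_complex_def algebra_simps scaleR_conv_of_real)
end

instantiation prod :: (complex_space, complex_space) complex_space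
begin
definition "scaleC c p = (scaleC c (fst p), scaleC c (snd p))"
instance
  by standard
    (auto simp: scaleC_prod_def scaleC_add_right scaleC_add_left scaleC_scaleC scaleC_of_real
       prod_eq_iff)
end

definition holo :: "('a::complex_space \<Rightarrow> complex) \<Rightarrow> 'a set \<Rightarrow> bool" where
  "holo f U \<longleftrightarrow> open U \<and>
     (\<forall>p\<in>U. \<exists>D. (f has_derivative D) (at p) \<and> (\<forall>c v. D (scaleC c v) = c * D v))"

text \<open>Holomorphic on \<open>U\<close> and not identically zero on any connected component of \<open>U\<close>.\<close>

definition holo_nz :: "('a::complex_space \<Rightarrow> complex) \<Rightarrow> 'a set \<Rightarrow> bool" where
  "holo_nz h U \<longleftrightarrow> holo h U \<and> interior {p\<in>U. h p = 0} = {}"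

text \<open>
  A meromorphic function is represented by a total function whose values on a thin analytic
  set (poles, points of indeterminacy, and places where a formula reads \<open>0 / 0\<close>) are
  irrelevant.  Two representatives are identified if they agree locally outside the zero set of
  a nontrivial holomorphic function.
\<close>

definition mero_eq :: "('a::complex_space \<Rightarrow> complex) \<Rightarrow> ('a \<Rightarrow> complex) \<Rightarrow> 'a set \<Rightarrow> bool" where
  "mero_eq f g A \<longleftrightarrow>
     (\<forall>p\<in>A. \<exists>U k. p \<in> U \<and> holo_nz k U \<and> (\<forall>z\<in>U. k z \<noteq> 0 \<longrightarrow> f z = g z))"

definition mero_quotient ::
    "('a::complex_space \<Rightarrow> complex) \<Rightarrow> ('a \<Rightarrow> complex) \<Rightarrow> ('a \<Rightarrow> complex) \<Rightarrow> 'a set \<Rightarrow> bool" where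
  "mero_quotient f g h U \<longleftrightarrow> holo g U \<and> holo_nz h U \<and> mero_eq f (\<lambda>z. g z / h z) U"

definition mero :: "('a::complex_space \<Rightarrow> complex) \<Rightarrow> 'a set \<Rightarrow> bool" where
  "mero f A \<longleftrightarrow> (\<forall>p\<in>A. \<exists>U g h. p \<in> U \<and> mero_quotient f g h U)"

text \<open>
  The meromorphic function \<open>F\<close> can be restricted along \<open>\<phi>\<close> (the image of \<open>\<phi>\<close> is not contained
  in the polar set of \<open>F\<close>), and its pullback \<open>F \<circ> \<phi>\<close> equals \<open>f\<close> as a meromorphic function on
  the open set \<open>A\<close>.  The pullback is taken through a local quotient representation \<open>g / h\<close>
  of \<open>F\<close>, since the values of a representative \<open>F\<close> on the thin set \<open>\<phi> ` A\<close> carry no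
  information.
\<close>

definition mero_pullback_eq ::
    "('b::complex_space \<Rightarrow> complex) \<Rightarrow> ('a::complex_space \<Rightarrow> 'b) \<Rightarrow> ('a \<Rightarrow> complex) \<Rightarrow> 'a set \<Rightarrow> bool" where
  "mero_pullback_eq F \<phi> f A \<longleftrightarrow>
     (\<forall>p\<in>A. \<exists>W g h U. mero_quotient F g h W \<and> p \<in> U \<and> \<phi> ` U \<subseteq> W \<and>
        mero_quotient f (g \<circ> \<phi>) (h \<circ> \<phi>) U)"


section \<open>Askey--Wilson polynomials\<close>

definition qpoch :: "complex \<Rightarrow> complex \<Rightarrow> nat \<Rightarrow> complex" where
  "qpoch a q n = (\<Prod>k<n. 1 - a * q ^ k)"

definition qhyp :: "complex list \<Rightarrow> complex list \<Rightarrow> complex \<Rightarrow> complex \<Rightarrow> complex" where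
  "qhyp as bs q z =
     (\<Sum>k. (\<Prod>a\<leftarrow>as. qpoch a q k) / (\<Prod>b\<leftarrow>bs @ [q]. qpoch b q k) * z ^ k)"

definition askey_wilson ::
    "complex \<Rightarrow> nat \<Rightarrow> complex \<Rightarrow> complex \<Rightarrow> complex \<Rightarrow> complex \<Rightarrow> complex \<Rightarrow> complex \<Rightarrow> complex" where
  "askey_wilson w\<^sub>2 n x a b c d q =
     qhyp [q powi (- int n), a * b * c * d * q powi (int n - 1),
           a * exp (2 * of_real pi * x / w\<^sub>2), a * exp (- (2 * of_real pi * x / w\<^sub>2))]
          [a * b, a * c, a * d] q q"


section \<open>The hyperbolic gamma function\<close>

definition G_strip :: "complex \<Rightarrow> complex \<Rightarrow> complex \<Rightarrow> complex" where
  "G_strip w\<^sub>1 w\<^sub>2 z =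
     exp (\<i> * (LBINT y:{0<..}.
       (sin (2 * of_real y * z) / (2 * sinh (w\<^sub>1 * of_real y) * sinh (w\<^sub>2 * of_real y))
          - z / (w\<^sub>1 * w\<^sub>2 * of_real y)) / of_real y))"

text \<open>
  The continuation is the unique one with the library's normalisation of values (\<open>0\<close> at poles);
  the difference equations are imposed at all points where both sides are free of poles.
\<close>

definition G :: "complex \<Rightarrow> complex \<Rightarrow> complex \<Rightarrow> complex" where
  "G w\<^sub>1 w\<^sub>2 = (THE f. f nicely_meromorphic_on UNIV \<and>
     (\<forall>z. \<bar>Im z\<bar> < Re ((w\<^sub>1 + w\<^sub>2) / 2) \<longrightarrow> f z = G_strip w\<^sub>1 w\<^sub>2 z) \<and>
     (\<forall>z. \<not> is_pole f (z + \<i> * w\<^sub>1 / 2) \<and> \<not> is_pole f (z - \<i> * w\<^sub>1 / 2) \<longrightarrow>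
        f (z + \<i> * w\<^sub>1 / 2) = 2 * cosh (of_real pi * z / w\<^sub>2) * f (z - \<i> * w\<^sub>1 / 2)) \<and>
     (\<forall>z. \<not> is_pole f (z + \<i> * w\<^sub>2 / 2) \<and> \<not> is_pole f (z - \<i> * w\<^sub>2 / 2) \<longrightarrow>
        f (z + \<i> * w\<^sub>2 / 2) = 2 * cosh (of_real pi * z / w\<^sub>1) * f (z - \<i> * w\<^sub>2 / 2)))"


section \<open>The function \<open>\<psi>\<close> and its meromorphic extension\<close>

type_synonym quadruple = "complex \<times> complex \<times> complex \<times> complex"

text \<open>The value \<open>f (z + a) f (z - a)\<close>, written \<open>f (z \<plusminus> a)\<close> in the literature.\<close>

definition pm :: "(complex \<Rightarrow> complex) \<Rightarrow> complex \<Rightarrow> complex \<Rightarrow> complex" where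
  "pm f z a = f (z + a) * f (z - a)"

definition psi_integral ::
    "complex \<Rightarrow> complex \<Rightarrow> quadruple \<Rightarrow> complex \<Rightarrow> complex \<Rightarrow> complex" where
  "psi_integral w\<^sub>1 w\<^sub>2 = (\<lambda>(\<rho>, \<sigma>, \<tau>, \<upsilon>) x l.
     let w = (w\<^sub>1 + w\<^sub>2) / 2 in
     LBINT z.
       (pm (G w\<^sub>1 w\<^sub>2) (of_real z + x + l / 2 - \<i> * w / 2) (\<i> * \<tau>) *
        pm (G w\<^sub>1 w\<^sub>2) (of_real z - l / 2 - \<i> * w / 2) (\<i> * \<sigma>)) /
       (pm (G w\<^sub>1 w\<^sub>2) (of_real z + x - l / 2 + \<i> * w / 2) (\<i> * \<rho>) *
        pm (G w\<^sub>1 w\<^sub>2) (of_real z + l / 2 + \<i> * w / 2) (\<i> * \<upsilon>)))"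

definition zeta :: "real \<Rightarrow> real \<Rightarrow> quadruple \<Rightarrow> complex \<Rightarrow> real" where
  "zeta w\<^sub>1 w\<^sub>2 = (\<lambda>(\<rho>, \<sigma>, \<tau>, \<upsilon>) l.
     (w\<^sub>1 + w\<^sub>2) / 2 / 2 - Max {\<bar>Re \<rho>\<bar>, \<bar>Re \<sigma>\<bar>, \<bar>Re \<tau>\<bar>, \<bar>Re \<upsilon>\<bar>} - \<bar>Im (l / 2)\<bar>)"

text \<open>
  \<open>\<Psi>\<close>, a function of \<open>(w\<^sub>1, w\<^sub>2, (\<rho>, \<sigma>, \<tau>, \<upsilon>), x, \<lambda>)\<close>, is the meromorphic extension
  of \<open>\<psi>\<close>.  The integral is only available for real \<open>w\<^sub>1, w\<^sub>2\<close>, but by the identity theorem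
  this determines \<open>\<Psi>\<close> up to \<^const>\<open>mero_eq\<close>.
\<close>

definition psi_extension ::
    "(complex \<times> complex \<times> quadruple \<times> complex \<times> complex \<Rightarrow> complex) \<Rightarrow> bool" where
  "psi_extension \<Psi> \<longleftrightarrow>
     mero \<Psi> {(w\<^sub>1, w\<^sub>2, p, x, l). Re w\<^sub>1 > 0 \<and> Re w\<^sub>2 > 0} \<and>
     (\<forall>(w\<^sub>1::real) (w\<^sub>2::real) p x l.
        w\<^sub>1 > 0 \<and> w\<^sub>2 > 0 \<and> zeta w\<^sub>1 w\<^sub>2 p l > 0 \<and> \<bar>Im x\<bar> < zeta w\<^sub>1 w\<^sub>2 p l \<longrightarrow>
        \<Psi> (of_real w\<^sub>1, of_real w\<^sub>2, p, x, l) = psi_integral (of_real w\<^sub>1) (of_real w\<^sub>2) p x l)"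


section \<open>The function \<open>S\<close>\<close>

text \<open>The inverse of \<open>\<gamma> = (-\<rho> + \<sigma>, \<rho> + \<sigma>, -\<tau> - \<upsilon>, \<tau> - \<upsilon>)\<close>.\<close>

definition rho_of_gamma :: "quadruple \<Rightarrow> quadruple" where
  "rho_of_gamma = (\<lambda>(\<gamma>\<^sub>0, \<gamma>\<^sub>1, \<gamma>\<^sub>2, \<gamma>\<^sub>3).
     ((\<gamma>\<^sub>1 - \<gamma>\<^sub>0) / 2, (\<gamma>\<^sub>0 + \<gamma>\<^sub>1) / 2, (\<gamma>\<^sub>3 - \<gamma>\<^sub>2) / 2, - (\<gamma>\<^sub>2 + \<gamma>\<^sub>3) / 2))"

lemma rho_of_gamma_iff:
  "rho_of_gamma (\<gamma>\<^sub>0, \<gamma>\<^sub>1, \<gamma>\<^sub>2, \<gamma>\<^sub>3) = (\<rho>, \<sigma>, \<tau>, \<upsilon>) \<longleftrightarrow>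
     \<gamma>\<^sub>0 = - \<rho> + \<sigma> \<and> \<gamma>\<^sub>1 = \<rho> + \<sigma> \<and> \<gamma>\<^sub>2 = - \<tau> - \<upsilon> \<and> \<gamma>\<^sub>3 = \<tau> - \<upsilon>"
proof
  assume "rho_of_gamma (\<gamma>\<^sub>0, \<gamma>\<^sub>1, \<gamma>\<^sub>2, \<gamma>\<^sub>3) = (\<rho>, \<sigma>, \<tau>, \<upsilon>)"
  then have "\<rho> = (\<gamma>\<^sub>1 - \<gamma>\<^sub>0) / 2" "\<sigma> = (\<gamma>\<^sub>0 + \<gamma>\<^sub>1) / 2" "\<tau> = (\<gamma>\<^sub>3 - \<gamma>\<^sub>2) / 2" "\<upsilon> = - (\<gamma>\<^sub>2 + \<gamma>\<^sub>3) / 2"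
    by (simp_all add: rho_of_gamma_def)
  then show "\<gamma>\<^sub>0 = - \<rho> + \<sigma> \<and> \<gamma>\<^sub>1 = \<rho> + \<sigma> \<and> \<gamma>\<^sub>2 = - \<tau> - \<upsilon> \<and> \<gamma>\<^sub>3 = \<tau> - \<upsilon>"
    by (simp only:) (simp add: add_divide_distrib diff_divide_distrib)
qed (simp add: rho_of_gamma_def)

definition dual :: "quadruple \<Rightarrow> quadruple" where
  "dual = (\<lambda>(\<gamma>\<^sub>0, \<gamma>\<^sub>1, \<gamma>\<^sub>2, \<gamma>\<^sub>3).
     ((\<gamma>\<^sub>0 + \<gamma>\<^sub>1 + \<gamma>\<^sub>2 + \<gamma>\<^sub>3) / 2, (\<gamma>\<^sub>0 + \<gamma>\<^sub>1 - \<gamma>\<^sub>2 - \<gamma>\<^sub>3) / 2,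
      (\<gamma>\<^sub>0 - \<gamma>\<^sub>1 + \<gamma>\<^sub>2 - \<gamma>\<^sub>3) / 2, (\<gamma>\<^sub>0 - \<gamma>\<^sub>1 - \<gamma>\<^sub>2 + \<gamma>\<^sub>3) / 2))"

definition Delta :: "complex \<Rightarrow> complex \<Rightarrow> quadruple \<Rightarrow> complex \<Rightarrow> complex" where
  "Delta w\<^sub>1 w\<^sub>2 = (\<lambda>(\<gamma>\<^sub>0, \<gamma>\<^sub>1, \<gamma>\<^sub>2, \<gamma>\<^sub>3) x.
     (G w\<^sub>1 w\<^sub>2 (x + \<i> * \<gamma>\<^sub>2) * G w\<^sub>1 w\<^sub>2 (x + \<i> * \<gamma>\<^sub>3)) /
     (G w\<^sub>1 w\<^sub>2 (x - \<i> * \<gamma>\<^sub>0) * G w\<^sub>1 w\<^sub>2 (x - \<i> * \<gamma>\<^sub>1)))"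

definition N_factor :: "complex \<Rightarrow> complex \<Rightarrow> quadruple \<Rightarrow> complex" where
  "N_factor w\<^sub>1 w\<^sub>2 = (\<lambda>(\<gamma>\<^sub>0, \<gamma>\<^sub>1, \<gamma>\<^sub>2, \<gamma>\<^sub>3).
     \<Prod>\<gamma>\<^sub>j\<leftarrow>[\<gamma>\<^sub>1, \<gamma>\<^sub>2, \<gamma>\<^sub>3]. G w\<^sub>1 w\<^sub>2 (\<i> * \<gamma>\<^sub>0 + \<i> * \<gamma>\<^sub>j + \<i> * ((w\<^sub>1 + w\<^sub>2) / 2)))"

definition S_fun ::
    "(complex \<times> complex \<times> quadruple \<times> complex \<times> complex \<Rightarrow> complex) \<Rightarrow>
     complex \<times> complex \<times> quadruple \<times> complex \<times> complex \<Rightarrow> complex" where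
  "S_fun \<Psi> = (\<lambda>(w\<^sub>1, w\<^sub>2, \<gamma>, x, l).
     N_factor w\<^sub>1 w\<^sub>2 \<gamma> * \<Psi> (w\<^sub>1, w\<^sub>2, rho_of_gamma \<gamma>, x, l) /
     (csqrt (w\<^sub>1 * w\<^sub>2) * Delta w\<^sub>1 w\<^sub>2 \<gamma> x * Delta w\<^sub>1 w\<^sub>2 (dual \<gamma>) l))"

end

theory Submission
  imports Defs
begin

text \<open>
  For real \<open>w1, w2\<close> the contour of \<open>\<psi>\<close> is shifted past \<open>n + 1\<close> poles.  In \<open>S\<close> the shifted integral
  carries a factor that vanishes at \<open>\<lambda> = \<lambda>\<^sub>n\<close>, and the residues form a convolution of two finite
  \<open>q\<close>-series, which Sears' transformation turns into the Askey-Wilson polynomial.  The expression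
  is holomorphic on a convex domain of complex parameters in which real \<open>w1, w2\<close> form a uniqueness
  set; dividing out common zeros on the hyperplane \<open>\<lambda> = \<lambda>\<^sub>n\<close> continues the identity to all parameters.
\<close>

section \<open>Calculus of functions of several complex variables\<close>

text \<open>At \<open>\<lambda>\<^sub>n\<close> the formula for S reads zero times infinity. The
  factor G with argument \<lambda> - i(\<sigma> - \<upsilon>) vanishes there, while \<psi> has a
  pole: its contour is pinched n + 1 times, because the m-th pole of the numerator factor with
  +\<sigma>, below the contour, meets the k-th pole of 1/G with +\<upsilon>, above it, whenever m +
  k = n. Crossing the lower poles first leaves an integral without a pinch and explicit residues, in
  which the difference equation of G cancels the zero. The second period is taken much larger than
  the first. Then every gamma function needed in this computation has its argument in the strip
  where G is the exponential of an integral, so its growth and its holomorphy in the periods follow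
  from estimates of that integral. The original integral exists for real periods only; complex
  periods enter through the shifted line, whose offset is a complex linear function of the
  parameters. Values of a meromorphic representative on the hyperplane carry no information. The
  restriction has to go through local quotients, and a quotient whose two terms both vanish on the
  hyperplane is useless until it is reduced.\<close>

abbreviation (input) "cpi \<equiv> complex_of_real pi"

text \<open>Cauchy estimates along complex lines need the norm to be homogeneous for complex
  scalars; \<open>complex_space\<close> ties it to real scaling only.\<close>

class cnormed_space = complex_space +
  assumes norm_scaleC: "norm (scaleC c v) = cmod c * norm v"

instance complex :: cnormed_space by standard (simp add: scaleC_complex_def norm_mult)

instance prod :: (cnormed_space, cnormed_space) cnormed_space
proof
  fix c :: complex and v :: "'a \<times> 'b"
  have "(cmod c * norm (fst v))\<^sup>2 + (cmod c * norm (snd v))\<^sup>2 = (cmod c)\<^sup>2 * ((norm (fst v))\<^sup>2 + (norm (snd v))\<^sup>2)"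
    by (simp add: power_mult_distrib algebra_simps)
  then show "norm (scaleC c v) = cmod c * norm v" by (simp add: scaleC_prod_def norm_prod_def norm_scaleC real_sqrt_mult)
qed

lemma scaleC_zero_left [simp]: "scaleC 0 (v::'a::complex_space) = 0"
  using scaleC_of_real[of 0 v] by simp

lemma scaleC_one [simp]: "scaleC 1 (v::'a::complex_space) = v"
  using scaleC_of_real[of 1 v] by simp

lemma scaleC_zero_right [simp]: "scaleC c (0::'a::complex_space) = 0"
  using scaleC_add_right[of c 0 0] by simp

lemma bounded_linear_scaleC_left: "bounded_linear (\<lambda>c. scaleC c (v::'a::cnormed_space))"
  by (rule bounded_linear_intro[where K = "norm v"])
    (simp_all add: scaleC_add_left scaleR_conv_of_real scaleC_scaleC[symmetric] scaleC_of_real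
      norm_scaleC)

text \<open>The pointwise condition inside \<open>holo\<close>, with a general target, so that maps
  between parameter spaces can be composed by a chain rule.\<close>

definition cdiff :: "('a::complex_space \<Rightarrow> 'b::complex_space) \<Rightarrow> 'a \<Rightarrow> bool" where
  "cdiff f p \<longleftrightarrow>
     (\<exists>D. (f has_derivative D) (at p) \<and> (\<forall>c v. D (scaleC c v) = scaleC c (D v)))"

lemma holo_iff_cdiff: "holo f U \<longleftrightarrow> open U \<and> (\<forall>p\<in>U. cdiff f p)"
  by (simp add: holo_def cdiff_def scaleC_complex_def)

lemma holoI: "open U \<Longrightarrow> (\<And>p. p \<in> U \<Longrightarrow> cdiff f p) \<Longrightarrow> holo f U"
  by (simp add: holo_iff_cdiff)

lemma holoD: "holo f U \<Longrightarrow> p \<in> U \<Longrightarrow> cdiff f p"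
  by (simp add: holo_iff_cdiff)

lemma holo_open: "holo f U \<Longrightarrow> open U"
  by (simp add: holo_iff_cdiff)

lemma holo_subset: "holo f U \<Longrightarrow> open V \<Longrightarrow> V \<subseteq> U \<Longrightarrow> holo f V"
  by (auto simp: holo_iff_cdiff)

lemma cdiff_isCont: "cdiff f p \<Longrightarrow> isCont f p"
  unfolding cdiff_def using has_derivative_continuous by blast

lemma holo_continuous_on: "holo f U \<Longrightarrow> continuous_on U f"
  by (intro continuous_at_imp_continuous_on ballI cdiff_isCont holoD)

lemma cdiff_cong_open:
  assumes "cdiff f p" "open U" "p \<in> U" "\<And>z. z \<in> U \<Longrightarrow> f z = g z"
  shows "cdiff g p" using assms unfolding cdiff_def by (meson has_derivative_transform_within_open)

named_theorems cdiff_intros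

lemma cdiff_const [cdiff_intros]: "cdiff (\<lambda>_. c) p"
  unfolding cdiff_def by (rule exI[of _ "\<lambda>_. 0"]) simp

lemma cdiff_ident [cdiff_intros]: "cdiff (\<lambda>x. x) p"
  unfolding cdiff_def by (rule exI[of _ "\<lambda>x. x"]) simp

lemma cdiff_compose:
  assumes "cdiff f p" "cdiff g (f p)"
  shows "cdiff (\<lambda>x. g (f x)) p"
proof -
  obtain D E where D: "(f has_derivative D) (at p)" "\<And>c v. D (scaleC c v) = scaleC c (D v)"
    and E: "(g has_derivative E) (at (f p))" "\<And>c v. E (scaleC c v) = scaleC c (E v)" using assms unfolding cdiff_def by blast
  have "((\<lambda>x. g (f x)) has_derivative (\<lambda>v. E (D v))) (at p)" using has_derivative_compose[OF D(1) E(1)] .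
  then show ?thesis unfolding cdiff_def using D(2) E(2) by (intro exI[of _ "\<lambda>v. E (D v)"]) simp
qed

lemma cdiff_Pair [cdiff_intros]:
  assumes "cdiff f p" "cdiff g p"
  shows "cdiff (\<lambda>x. (f x, g x)) p"
proof -
  obtain D E where D: "(f has_derivative D) (at p)" "\<And>c v. D (scaleC c v) = scaleC c (D v)"
    and E: "(g has_derivative E) (at p)" "\<And>c v. E (scaleC c v) = scaleC c (E v)" using assms unfolding cdiff_def by blast
  show ?thesis unfolding cdiff_def by (rule exI[of _ "\<lambda>v. (D v, E v)"]) (simp add: has_derivative_Pair D E scaleC_prod_def)
qed

lemma cdiff_fst [cdiff_intros]: "cdiff f p \<Longrightarrow> cdiff (\<lambda>x. fst (f x)) p"
  by (rule cdiff_compose, assumption, unfold cdiff_def, rule exI[of _ fst])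
    (auto simp: scaleC_prod_def intro: derivative_eq_intros)

lemma cdiff_snd [cdiff_intros]: "cdiff f p \<Longrightarrow> cdiff (\<lambda>x. snd (f x)) p"
  by (rule cdiff_compose, assumption, unfold cdiff_def, rule exI[of _ snd])
    (auto simp: scaleC_prod_def intro: derivative_eq_intros)

lemma cdiff_scaleC_left:
  fixes v :: "'b::cnormed_space"
  shows "cdiff f p \<Longrightarrow> cdiff (\<lambda>x. scaleC (f x) v) p"
  by (rule cdiff_compose, assumption, unfold cdiff_def, rule exI[of _ "\<lambda>c. scaleC c v"])
    (simp add: bounded_linear_imp_has_derivative[OF bounded_linear_scaleC_left]
      scaleC_complex_def scaleC_scaleC)

lemma cdiff_add [cdiff_intros]:
  assumes "cdiff f p" "cdiff g p"
  shows "cdiff (\<lambda>x. f x + g x) p"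
proof -
  obtain D E where D: "(f has_derivative D) (at p)" "\<And>c v. D (scaleC c v) = scaleC c (D v)"
    and E: "(g has_derivative E) (at p)" "\<And>c v. E (scaleC c v) = scaleC c (E v)" using assms unfolding cdiff_def by blast
  show ?thesis unfolding cdiff_def by (rule exI[of _ "\<lambda>v. D v + E v"]) (simp add: has_derivative_add D E scaleC_add_right)
qed

lemma cdiff_field:
  fixes g :: "complex \<Rightarrow> complex"
  assumes "cdiff f p" "(g has_field_derivative g') (at (f p))"
  shows "cdiff (\<lambda>x. g (f x)) p"
proof (rule cdiff_compose[OF assms(1)])
  show "cdiff g (f p)" unfolding cdiff_def by (rule exI[of _ "\<lambda>v. g' * v"])
      (use assms(2) in \<open>auto simp: has_field_derivative_def scaleC_complex_def\<close>)
qed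

lemma cdiff_complex_iff: "cdiff (g::complex \<Rightarrow> complex) z \<longleftrightarrow> g field_differentiable (at z)"
proof
  assume "cdiff g z"
  then obtain D where D: "(g has_derivative D) (at z)" "\<And>c v. D (c * v) = c * D v"
    unfolding cdiff_def scaleC_complex_def by blast
  have "D = (\<lambda>v. D 1 * v)" proof
    fix v show "D v = D 1 * v" using D(2)[of v 1] by (simp add: mult.commute)
  qed
  with D(1) show "g field_differentiable (at z)" unfolding field_differentiable_def has_field_derivative_def by metis
next
  assume "g field_differentiable (at z)"
  then show "cdiff g z" using cdiff_field[OF cdiff_ident] unfolding field_differentiable_def by blast
qed

lemma cdiff_uminus [cdiff_intros]:
  "cdiff f p \<Longrightarrow> cdiff (\<lambda>x. - f x :: complex) p" by (rule cdiff_field[where g = uminus]) (auto intro!: derivative_eq_intros)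

lemma cdiff_diff [cdiff_intros]:
  fixes f g :: "'a::complex_space \<Rightarrow> complex"
  shows "cdiff f p \<Longrightarrow> cdiff g p \<Longrightarrow> cdiff (\<lambda>x. f x - g x) p" using cdiff_add[OF _ cdiff_uminus] by simp

lemma cdiff_mult [cdiff_intros]:
  fixes f g :: "'a::complex_space \<Rightarrow> complex"
  assumes "cdiff f p" "cdiff g p"
  shows "cdiff (\<lambda>x. f x * g x) p"
proof -
  obtain D E where D: "(f has_derivative D) (at p)" "\<And>c v. D (scaleC c v) = c * D v"
    and E: "(g has_derivative E) (at p)" "\<And>c v. E (scaleC c v) = c * E v"
    using assms unfolding cdiff_def scaleC_complex_def by blast
  show ?thesis unfolding cdiff_def by (rule exI[of _ "\<lambda>v. f p * E v + D v * g p"]) (use has_derivative_mult[OF D(1) E(1)] in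
        \<open>simp add: D(2) E(2) scaleC_complex_def distrib_left mult.left_commute mult.assoc\<close>)
qed

lemma cdiff_inverse [cdiff_intros]:
  "cdiff f p \<Longrightarrow> f p \<noteq> 0 \<Longrightarrow> cdiff (\<lambda>x. inverse (f x :: complex)) p"
  by (rule cdiff_field[where g = inverse]) (auto intro!: derivative_eq_intros)

lemma cdiff_divide [cdiff_intros]:
  fixes f g :: "'a::complex_space \<Rightarrow> complex"
  shows "cdiff f p \<Longrightarrow> cdiff g p \<Longrightarrow> g p \<noteq> 0 \<Longrightarrow> cdiff (\<lambda>x. f x / g x) p" unfolding divide_inverse by (intro cdiff_intros)

lemma cdiff_power [cdiff_intros]:
  fixes f :: "'a::complex_space \<Rightarrow> complex"
  shows "cdiff f p \<Longrightarrow> cdiff (\<lambda>x. f x ^ n) p" by (rule cdiff_field[where g = "\<lambda>x. x ^ n"]) (auto intro!: derivative_eq_intros)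

lemma cdiff_elementary [cdiff_intros]:
  fixes f :: "'a::complex_space \<Rightarrow> complex"
  assumes "cdiff f p"
  shows "cdiff (\<lambda>x. exp (f x)) p" "cdiff (\<lambda>x. sin (f x)) p" "cdiff (\<lambda>x. cos (f x)) p"
    "cdiff (\<lambda>x. sinh (f x)) p" "cdiff (\<lambda>x. cosh (f x)) p" by (rule cdiff_field[OF assms], auto intro!: derivative_eq_intros)+

lemma cdiff_csqrt [cdiff_intros]:
  "cdiff f p \<Longrightarrow> f p \<notin> \<real>\<^sub>\<le>\<^sub>0 \<Longrightarrow> cdiff (\<lambda>x. csqrt (f x)) p"
  by (rule cdiff_field[where g = csqrt]) (auto intro!: derivative_eq_intros)

lemma cdiff_sum [cdiff_intros]:
  fixes f :: "'i \<Rightarrow> 'a::complex_space \<Rightarrow> complex"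
  shows "(\<And>i. i \<in> I \<Longrightarrow> cdiff (f i) p) \<Longrightarrow> cdiff (\<lambda>x. \<Sum>i\<in>I. f i x) p"
  by (induction I rule: infinite_finite_induct) (simp_all add: cdiff_intros)

lemma cdiff_prod [cdiff_intros]:
  fixes f :: "'i \<Rightarrow> 'a::complex_space \<Rightarrow> complex"
  shows "(\<And>i. i \<in> I \<Longrightarrow> cdiff (f i) p) \<Longrightarrow> cdiff (\<lambda>x. \<Prod>i\<in>I. f i x) p"
  by (induction I rule: infinite_finite_induct) (simp_all add: cdiff_intros)

lemma holo_compose:
  assumes "holo g V" "open U" "\<And>p. p \<in> U \<Longrightarrow> cdiff f p" "f ` U \<subseteq> V"
  shows "holo (\<lambda>x. g (f x)) U"
proof (rule holoI[OF assms(2)])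
  fix p assume p: "p \<in> U"
  with assms(4) have "f p \<in> V" by auto
  then show "cdiff (\<lambda>x. g (f x)) p" by (rule cdiff_compose[OF assms(3)[OF p] holoD[OF assms(1)]])
qed

lemma holo_mult: "holo f U \<Longrightarrow> holo g U \<Longrightarrow> holo (\<lambda>x. f x * g x) U"
  by (simp add: holo_iff_cdiff cdiff_intros)

lemma holo_diff: "holo f U \<Longrightarrow> holo g U \<Longrightarrow> holo (\<lambda>x. f x - g x) U"
  by (simp add: holo_iff_cdiff cdiff_intros)

lemma holo_complex_iff: "holo f U \<longleftrightarrow> open U \<and> f holomorphic_on U"
  by (cases "open U") (simp_all add: holo_iff_cdiff cdiff_complex_iff holomorphic_on_open field_differentiable_def)

lemma cdiff_line:
  fixes p v :: "'a::cnormed_space"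
  shows "cdiff (\<lambda>s. p + scaleC s v) s" by (intro cdiff_intros cdiff_scaleC_left)

lemma open_slice:
  fixes p v :: "'a::cnormed_space"
  assumes "open U"
  shows "open {s. p + scaleC s v \<in> U}"
proof -
  have "open ((\<lambda>s. p + scaleC s v) -` U)" using assms cdiff_isCont[OF cdiff_line]
    by (intro open_vimage continuous_at_imp_continuous_on) auto
  then show ?thesis by (simp add: vimage_def)
qed

lemma convex_slice:
  fixes p v :: "'a::cnormed_space"
  assumes "convex U"
  shows "convex {s. p + scaleC s v \<in> U}"
proof (rule convexI)
  fix s t :: complex and a b :: real
  assume st: "s \<in> {s. p + scaleC s v \<in> U}" "t \<in> {s. p + scaleC s v \<in> U}"
    and ab: "0 \<le> a" "0 \<le> b" "a + b = 1"
  have "p + scaleC (a *\<^sub>R s + b *\<^sub>R t) v = a *\<^sub>R (p + scaleC s v) + b *\<^sub>R (p + scaleC t v)" proof -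
    have "a *\<^sub>R (p + scaleC s v) + b *\<^sub>R (p + scaleC t v) = (a + b) *\<^sub>R p + (a *\<^sub>R scaleC s v + b *\<^sub>R scaleC t v)"
      by (simp add: scaleR_add_right scaleR_add_left)
    also have "a *\<^sub>R scaleC s v + b *\<^sub>R scaleC t v = scaleC (a *\<^sub>R s + b *\<^sub>R t) v"
      by (simp add: scaleC_add_left scaleR_conv_of_real scaleC_scaleC[symmetric] scaleC_of_real)
    finally show ?thesis using ab by simp
  qed
  then show "a *\<^sub>R s + b *\<^sub>R t \<in> {s. p + scaleC s v \<in> U}"
    using convexD[OF assms, of "p + scaleC s v" "p + scaleC t v" a b] st ab by simp
qed

text \<open>Several variables are reduced to one by restricting to complex lines p + s v; on a
  convex set such a slice is convex, hence connected.\<close>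

lemma holo_slice:
  fixes p v :: "'a::cnormed_space"
  assumes "holo f U"
  shows "(\<lambda>s. f (p + scaleC s v)) holomorphic_on {s. p + scaleC s v \<in> U}"
proof -
  have "holo (\<lambda>s. f (p + scaleC s v)) {s. p + scaleC s v \<in> U}"
    by (rule holo_compose[OF assms open_slice[OF holo_open[OF assms]] cdiff_line]) auto
  then show ?thesis by (simp add: holo_complex_iff)
qed

lemmas open_Collects = open_Collect_conj open_Collect_less

section \<open>Uniqueness principles\<close>

text \<open>A complex line joins a point of V to p, and its slice of the convex set U is connected,
  so the one-variable identity theorem applies.\<close>

lemma holo_identity:
  fixes f :: "'a::cnormed_space \<Rightarrow> complex"
  assumes "holo f U" "convex U" "open V" "V \<subseteq> U" "V \<noteq> {}"
    and "\<And>p. p \<in> V \<Longrightarrow> f p = 0" and "p \<in> U"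
  shows "f p = 0"
proof -
  obtain p0 where p0: "p0 \<in> V" using assms(5) by blast
  define v where "v = p - p0"
  have "f (p0 + scaleC 1 v) = 0" proof (rule analytic_continuation_open[where f = "\<lambda>s. f (p0 + scaleC s v)"
        and s = "{s. p0 + scaleC s v \<in> V}" and s' = "{s. p0 + scaleC s v \<in> U}" and g = "\<lambda>_. 0"])
    show "open {s. p0 + scaleC s v \<in> V}" "open {s. p0 + scaleC s v \<in> U}"
      by (rule open_slice[OF assms(3)], rule open_slice[OF holo_open[OF assms(1)]])
    show "connected {s. p0 + scaleC s v \<in> U}" by (intro convex_connected convex_slice assms)
    show "{s. p0 + scaleC s v \<in> V} \<noteq> {}" using p0 by (auto intro!: exI[of _ 0])
    show "1 \<in> {s. p0 + scaleC s v \<in> U}" using assms by (simp add: v_def)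
    show "(\<lambda>s. f (p0 + scaleC s v)) holomorphic_on {s. p0 + scaleC s v \<in> U}" by (rule holo_slice[OF assms(1)])
  qed (use assms in auto)
  then show ?thesis by (simp add: v_def)
qed

lemma holo_nz_holo: "holo_nz h U \<Longrightarrow> holo h U"
  by (simp add: holo_nz_def)

lemma holo_nz_open: "holo_nz h U \<Longrightarrow> open U"
  by (rule holo_open[OF holo_nz_holo])

text \<open>The test-set form of nontriviality passes directly to open subsets, products and
  preimages under open maps.\<close>

lemma holo_nz_iff:
  "holo_nz h U \<longleftrightarrow> holo h U \<and> (\<forall>V. open V \<and> V \<subseteq> U \<and> V \<noteq> {} \<longrightarrow> (\<exists>p\<in>V. h p \<noteq> 0))"
proof (intro iffI conjI allI impI)
  fix V assume h: "holo_nz h U" and V: "open V \<and> V \<subseteq> U \<and> V \<noteq> {}"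
  show "\<exists>p\<in>V. h p \<noteq> 0" proof (rule ccontr)
    assume "\<not> (\<exists>p\<in>V. h p \<noteq> 0)"
    then have "V \<subseteq> interior {p \<in> U. h p = 0}" using V by (intro interior_maximal) auto
    with V h show False by (auto simp: holo_nz_def)
  qed
next
  assume h: "holo h U \<and> (\<forall>V. open V \<and> V \<subseteq> U \<and> V \<noteq> {} \<longrightarrow> (\<exists>p\<in>V. h p \<noteq> 0))"
  define V where "V = interior {p \<in> U. h p = 0}"
  have V: "open V" "V \<subseteq> U" "\<And>p. p \<in> V \<Longrightarrow> h p = 0" using interior_subset[of "{p \<in> U. h p = 0}"] by (auto simp: V_def)
  have "V = {}" proof (rule ccontr)
    assume "V \<noteq> {}"
    with h V(1,2) have "\<exists>p\<in>V. h p \<noteq> 0" by simp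
    with V(3) show False by blast
  qed
  with h show "holo_nz h U" by (simp add: holo_nz_def V_def)
qed (simp add: holo_nz_def)

lemma holo_nzD:
  "holo_nz h U \<Longrightarrow> open V \<Longrightarrow> V \<subseteq> U \<Longrightarrow> V \<noteq> {} \<Longrightarrow> \<exists>p\<in>V. h p \<noteq> 0" by (simp add: holo_nz_iff)

lemma holo_nz_subset: "holo_nz h U \<Longrightarrow> open V \<Longrightarrow> V \<subseteq> U \<Longrightarrow> holo_nz h V"
  unfolding holo_nz_iff using holo_subset[of h U V] by (meson order_trans)

lemma holo_nz_nonzero: "holo h U \<Longrightarrow> (\<And>p. p \<in> U \<Longrightarrow> h p \<noteq> 0) \<Longrightarrow> holo_nz h U"
  unfolding holo_nz_iff by (auto simp: subset_iff)

lemma holo_nz_convex: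
  fixes h :: "'a::cnormed_space \<Rightarrow> complex"
  assumes "holo h U" "convex U" "z \<in> U" "h z \<noteq> 0"
  shows "holo_nz h U" unfolding holo_nz_iff
proof (intro conjI allI impI assms(1), rule ccontr)
  fix V assume V: "open V \<and> V \<subseteq> U \<and> V \<noteq> {}" and "\<not> (\<exists>p\<in>V. h p \<noteq> 0)"
  then show False using holo_identity[OF assms(1,2), of V z] assms by auto
qed

lemma open_nonzero:
  assumes "holo h U"
  shows "open {p \<in> U. h p \<noteq> 0}"
proof -
  have "open (U \<inter> h -` (- {0}))" by (rule continuous_open_preimage[OF holo_continuous_on[OF assms] holo_open[OF assms]])
      (simp add: open_Compl)
  then show ?thesis by (simp add: vimage_def Int_def)
qed

lemma holo_nz_zero:
  assumes "holo_nz k U" "holo g U" "\<And>p. p \<in> U \<Longrightarrow> k p \<noteq> 0 \<Longrightarrow> g p = 0" "p \<in> U"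
  shows "g p = 0"
proof (rule ccontr)
  assume "g p \<noteq> 0"
  then have "\<exists>q\<in>{q \<in> U. g q \<noteq> 0}. k q \<noteq> 0" using assms by (intro holo_nzD[OF assms(1)] open_nonzero) auto
  then show False using assms(3) by blast
qed

text \<open>The points of V where f is nonzero form a nonempty open set, and g cannot vanish
  identically on that set.\<close>

lemma holo_nz_mult:
  assumes "holo_nz f U" "holo_nz g U"
  shows "holo_nz (\<lambda>p. f p * g p) U" unfolding holo_nz_iff
proof (intro conjI allI impI)
  show "holo (\<lambda>p. f p * g p) U" using assms by (intro holo_mult holo_nz_holo)
  fix V assume V: "open V \<and> V \<subseteq> U \<and> V \<noteq> {}"
  then have f: "holo f V" using holo_subset[OF holo_nz_holo[OF assms(1)]] by simp
  have "{p \<in> V. f p \<noteq> 0} \<noteq> {}" using V holo_nzD[OF assms(1), of V] by auto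
  then have "\<exists>p\<in>{p \<in> V. f p \<noteq> 0}. g p \<noteq> 0" using V by (intro holo_nzD[OF assms(2)] open_nonzero[OF f]) auto
  then show "\<exists>p\<in>V. f p * g p \<noteq> 0" by auto
qed

lemma real_points_zero:
  fixes F :: "complex \<Rightarrow> complex"
  assumes "F holomorphic_on ball (of_real a) e" "e > 0"
    and "\<And>r::real. of_real r \<in> ball (of_real a :: complex) e \<Longrightarrow> F (of_real r) = 0"
    and "z \<in> ball (of_real a) e"
  shows "F z = 0"
proof (rule analytic_continuation[where U = "of_real ` {a - e<..<a + e}"
      and S = "ball (of_real a) e" and \<xi> = "of_real a" and f = F and w = z])
  show "F holomorphic_on ball (of_real a) e" "z \<in> ball (of_real a) e" by fact+
  show "complex_of_real ` {a - e<..<a + e} \<subseteq> ball (of_real a) e" by (auto simp: dist_of_real dist_real_def)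
  show "complex_of_real a islimpt of_real ` {a - e<..<a + e}" unfolding islimpt_approachable proof (intro allI impI)
    fix d :: real assume "d > 0"
    then have "a + min (d / 2) (e / 2) \<in> {a - e<..<a + e}"
      "complex_of_real (a + min (d / 2) (e / 2)) \<noteq> complex_of_real a"
      "dist (complex_of_real (a + min (d / 2) (e / 2))) (complex_of_real a) < d"
      using \<open>e > 0\<close> unfolding dist_of_real of_real_eq_iff by (auto simp: dist_real_def min_def)
    then show "\<exists>x'\<in>complex_of_real ` {a - e<..<a + e}.
        x' \<noteq> complex_of_real a \<and> dist x' (complex_of_real a) < d" by blast
  qed
  show "F z = 0" if "z \<in> of_real ` {a - e<..<a + e}" for z using that assms(3) by (auto simp: dist_of_real dist_real_def)
  show "complex_of_real a \<in> ball (of_real a) e" using assms by simp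
qed auto

text \<open>Points whose first two coordinates are real form a uniqueness set: near one of them the
  two coordinates can be freed one after the other. This is what allows identities for real periods
  to be carried to complex ones.\<close>

lemma holo_totally_real:
  fixes f :: "complex \<times> complex \<times> 'b::cnormed_space \<Rightarrow> complex"
  assumes holo: "holo f U" and "convex U" and ab: "(of_real a, of_real b, c) \<in> U"
    and zero: "\<And>(x::real) (y::real) z. (of_real x, of_real y, z) \<in> U \<Longrightarrow>
                 f (of_real x, of_real y, z) = 0"
    and "p \<in> U"
  shows "f p = 0"
proof -
  obtain X YZ where X: "open X" "open YZ" "complex_of_real a \<in> X" "(complex_of_real b, c) \<in> YZ"
    "X \<times> YZ \<subseteq> U" by (rule open_prod_elim[OF holo_open[OF holo] ab]) auto
  obtain Y Z where Y: "open Y" "open Z" "complex_of_real b \<in> Y" "c \<in> Z" "Y \<times> Z \<subseteq> YZ" by (rule open_prod_elim[OF X(2,4)]) auto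
  obtain d where d: "d > 0" "ball (of_real a) d \<subseteq> X" using openE[OF X(1,3)] by auto
  obtain e where e: "e > 0" "ball (of_real b) e \<subseteq> Y" using openE[OF Y(1,3)] by auto
  have sub: "(x, y, z) \<in> U" if "x \<in> ball (of_real a) d" "y \<in> ball (of_real b) e" "z \<in> Z" for x y z proof -
    have "(y, z) \<in> YZ" "x \<in> X" using that d e Y by auto
    then show ?thesis using X by auto
  qed
  \<comment> \<open>Only the first coordinate is freed here; the second one stays real until the
    next step.\<close>
  have 1: "f (x, of_real y, z) = 0" if "x \<in> ball (of_real a) d" "of_real y \<in> ball (complex_of_real b) e" "z \<in> Z" for x y z
  proof (rule real_points_zero[where F = "\<lambda>x. f (x, of_real y, z)" and a = a and e = d])
    have "holo (\<lambda>x. f (x, of_real y, z)) (ball (of_real a) d)"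
      by (rule holo_compose[OF holo]) (use sub that in \<open>auto intro!: cdiff_intros\<close>)
    then show "(\<lambda>x. f (x, of_real y, z)) holomorphic_on ball (of_real a) d" by (simp add: holo_complex_iff)
  qed (use that sub zero d in auto)
  have 2: "f (x, y, z) = 0" if "x \<in> ball (of_real a) d" "y \<in> ball (complex_of_real b) e" "z \<in> Z" for x y z
  proof (rule real_points_zero[where F = "\<lambda>y. f (x, y, z)" and a = b and e = e])
    have "holo (\<lambda>y. f (x, y, z)) (ball (of_real b) e)"
      by (rule holo_compose[OF holo]) (use sub that in \<open>auto intro!: cdiff_intros\<close>)
    then show "(\<lambda>y. f (x, y, z)) holomorphic_on ball (of_real b) e" by (simp add: holo_complex_iff)
  qed (use that 1 e in auto)
  show ?thesis proof (rule holo_identity[OF holo \<open>convex U\<close>, of "ball (of_real a) d \<times> ball (of_real b) e \<times> Z"])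
    show "ball (complex_of_real a) d \<times> ball (complex_of_real b) e \<times> Z \<noteq> {}" using d e Y by auto
  qed (use Y sub 2 \<open>p \<in> U\<close> in \<open>auto intro!: open_Times\<close>)
qed

section \<open>Parametric integrals and division\<close>

text \<open>Discs of radius R/2 about points with |s| < R/2 stay inside the ball, so Cauchy's
  inequality applies there. For R at least 4 this covers the unit disc, as the Taylor remainder at s
  = 1 requires. Both bounds are linear in B, so an integrable majorant of H is also one for its
  derivative and remainder.\<close>

lemma cauchy_first_second:
  assumes H: "H holomorphic_on ball 0 R" and "R > 0" and B: "\<And>s. s \<in> ball 0 R \<Longrightarrow> cmod (H s) \<le> B"
  shows "cmod (deriv H 0) \<le> 2 * B / R"
    and "R \<ge> 4 \<Longrightarrow> cmod (H 1 - H 0 - deriv H 0) \<le> 8 * B / R\<^sup>2"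
proof -
  have C: "cmod ((deriv ^^ n) H s) \<le> fact n * B / (R / 2) ^ n" if "cmod s < R / 2" for n s proof (rule Cauchy_inequality)
    have "cball s (R / 2) \<subseteq> ball 0 R" proof
      fix x assume "x \<in> cball s (R / 2)"
      then have "cmod (x - s) \<le> R / 2" by (simp add: dist_norm norm_minus_commute)
      then show "x \<in> ball 0 R" using that norm_triangle_sub[of x s] by simp
    qed
    then have "H holomorphic_on cball s (R / 2)"
      and "\<And>x. cmod (s - x) = R / 2 \<Longrightarrow> cmod (H x) \<le> B"
      using H B by (auto intro: holomorphic_on_subset simp: subset_iff dist_norm)
    then show "H holomorphic_on ball s (R / 2)" "continuous_on (cball s (R / 2)) H"
      "\<And>x. cmod (s - x) = R / 2 \<Longrightarrow> cmod (H x) \<le> B"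
      using holomorphic_on_imp_continuous_on holomorphic_on_subset[OF _ ball_subset_cball] by blast+
  qed (use \<open>R > 0\<close> in auto)
  show "cmod (deriv H 0) \<le> 2 * B / R" using C[of 0 1] \<open>R > 0\<close> by (simp add: field_simps)
  assume "R \<ge> 4"
  have "cmod ((deriv ^^ 0) H 1 - (\<Sum>i\<le>1. (deriv ^^ i) H 0 * (1 - 0) ^ i / fact i))
      \<le> (8 * B / R\<^sup>2) * cmod (1 - 0) ^ Suc 1 / fact 1" proof (rule complex_Taylor[where S = "cball 0 1"])
    fix i x assume "x \<in> cball (0::complex) 1"
    then have "x \<in> ball 0 R" using \<open>R \<ge> 4\<close> by simp
    then show "((deriv ^^ i) H has_field_derivative (deriv ^^ Suc i) H x) (at x within cball 0 1)"
      using holomorphic_derivI[OF holomorphic_higher_deriv[OF H open_ball] open_ball]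
      by (auto intro: has_field_derivative_at_within)
  next
    fix x assume "x \<in> cball (0::complex) 1"
    then show "cmod ((deriv ^^ Suc 1) H x) \<le> 8 * B / R\<^sup>2"
      using C[of x 2] \<open>R \<ge> 4\<close> by (simp add: field_simps power2_eq_square numeral_2_eq_2)
  qed auto
  then show "cmod (H 1 - H 0 - deriv H 0) \<le> 8 * B / R\<^sup>2" by (simp add: algebra_simps)
qed

lemma norm_LINT_le:
  fixes f :: "'m \<Rightarrow> complex"
  assumes "integrable M f" "integrable M g" "\<And>x. x \<in> space M \<Longrightarrow> cmod (f x) \<le> g x"
  shows "cmod (LINT x|M. f x) \<le> (LINT x|M. g x)"
  using order_trans[OF integral_norm_bound integral_mono[OF integrable_norm[OF assms(1)] assms(2,3)]] by simp

text \<open>Differentiation under the integral with no hypothesis on the derivative of the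
  integrand: Cauchy's estimates on complex lines bound the derivative and the quadratic remainder by
  multiples of the same majorant b.\<close>

lemma holo_integral_aux:
  fixes f :: "'a::cnormed_space \<Rightarrow> 'm \<Rightarrow> complex"
  assumes "open U"
    and holo: "\<And>t. t \<in> space M \<Longrightarrow> holo (\<lambda>p. f p t) U"
    and meas: "\<And>p. p \<in> U \<Longrightarrow> f p \<in> borel_measurable M"
    and bound: "\<And>p. p \<in> U \<Longrightarrow> \<exists>r>0. \<exists>b. integrable M b \<and> ball p r \<subseteq> U \<and>
      (\<forall>q\<in>ball p r. \<forall>t\<in>space M. cmod (f q t) \<le> b t)"
    and p: "p \<in> U"
  shows "cdiff (\<lambda>p. integral\<^sup>L M (f p)) p"
    and "deriv (\<lambda>s. integral\<^sup>L M (f (p + scaleC s v))) 0 = (LINT t|M. deriv (\<lambda>s. f (p + scaleC s v) t) 0)"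
proof -
  obtain r b where r: "r > 0" "integrable M b" "ball p r \<subseteq> U"
    and b: "\<And>q t. q \<in> ball p r \<Longrightarrow> t \<in> space M \<Longrightarrow> cmod (f q t) \<le> b t" using bound[OF p] by blast
  have "\<forall>t. \<exists>D. t \<in> space M \<longrightarrow> ((\<lambda>p. f p t) has_derivative D) (at p) \<and>
      (\<forall>c v. D (scaleC c v) = c * D v)" using holo p unfolding holo_def by blast
  then obtain D where D: "\<And>t. t \<in> space M \<Longrightarrow> ((\<lambda>p. f p t) has_derivative D t) (at p)"
    and DC: "\<And>t c v. t \<in> space M \<Longrightarrow> D t (scaleC c v) = c * D t v" by metis
  have Dlin: "linear (D t)" if "t \<in> space M" for t using D[OF that] has_derivative_linear by blast
  have bnn: "b t \<ge> 0" if "t \<in> space M" for t using b[of p t] that r norm_ge_zero order_trans by (metis centre_in_ball)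
  \<comment> \<open>The line is scaled so that s = 1 is the point p + v. The slice contains the disc
    of radius r / |v|, and |v| at most r/4 makes that radius at least 4.\<close>
  define H where "H = (\<lambda>t v s. f (p + scaleC s v) t)"
  have Hd: "(H t v has_field_derivative D t v) (at 0)" if "t \<in> space M" for t v proof -
    have "((\<lambda>s. p + scaleC s v) has_derivative (\<lambda>s. scaleC s v)) (at 0)" using has_derivative_add[OF has_derivative_const
          bounded_linear_imp_has_derivative[OF bounded_linear_scaleC_left]] by simp
    from has_derivative_compose[OF this, of "\<lambda>p. f p t" "D t"] D[OF that]
    show ?thesis by (simp add: H_def has_field_derivative_def DC[OF that] fun_eq_iff mult.commute[of _ "D t v"])
  qed
  then have Hderiv: "deriv (H t v) 0 = D t v" if "t \<in> space M" for t v using that DERIV_imp_deriv by blast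
  have Hb: "H t v holomorphic_on ball 0 (r / norm v)" "\<And>s. s \<in> ball 0 (r / norm v) \<Longrightarrow> cmod (H t v s) \<le> b t"
    if t: "t \<in> space M" "v \<noteq> 0" for t v proof -
    have in_ball: "p + scaleC s v \<in> ball p r" if "s \<in> ball 0 (r / norm v)" for s
      using that \<open>v \<noteq> 0\<close> by (simp add: dist_norm norm_scaleC field_simps)
    show "\<And>s. s \<in> ball 0 (r / norm v) \<Longrightarrow> cmod (H t v s) \<le> b t" using in_ball b t by (simp add: H_def)
    have "H t v holomorphic_on {s. p + scaleC s v \<in> U}" unfolding H_def by (rule holo_slice[OF holo[OF t(1)]])
    then show "H t v holomorphic_on ball 0 (r / norm v)" using in_ball r by (auto elim!: holomorphic_on_subset)
  qed
  have D1: "cmod (D t v) \<le> 2 * b t / r * norm v" if t: "t \<in> space M" for t v proof (cases "v = 0")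
    case True then show ?thesis using linear_0[OF Dlin[OF t]] by simp
  next
    case False
    then show ?thesis using cauchy_first_second(1)[OF Hb(1)[OF t] _ Hb(2)[OF t]] r by (simp add: Hderiv[OF t] field_simps)
  qed
  have D2: "cmod (f (p + v) t - f p t - D t v) \<le> 8 * b t / r\<^sup>2 * (norm v)\<^sup>2" if t: "t \<in> space M" and v: "norm v \<le> r / 4" for t v
  proof (cases "v = 0")
    case True then show ?thesis using linear_0[OF Dlin[OF t]] by simp
  next
    case False
    then have "r / norm v \<ge> 4" using v by (simp add: field_simps)
    then have "cmod (H t v 1 - H t v 0 - deriv (H t v) 0) \<le> 8 * b t / (r / norm v)\<^sup>2"
      using False r by (intro cauchy_first_second(2)[OF Hb(1)[OF t] _ Hb(2)[OF t]]) auto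
    then have "cmod (H t v 1 - H t v 0 - D t v) \<le> 8 * b t / (r / norm v)\<^sup>2" by (simp only: Hderiv[OF t])
    then show ?thesis by (simp add: H_def power_divide field_simps)
  qed
  \<comment> \<open>The derivative is a pointwise limit of difference quotients with steps v / m k;
    starting the count at N keeps every step within r/4, where the remainder bound holds.\<close>
  have Dmeas: "(\<lambda>t. D t v) \<in> borel_measurable M" for v proof -
    obtain N where N: "N > 0" "real N * (r / 4) > norm v" using ex_less_of_nat_mult[of "r / 4" "norm v"] r
      by (metis divide_pos_pos gr0I mult_zero_left norm_not_less_zero of_nat_0 zero_less_numeral)
    define m where "m k = real (N + k)" for k
    have m: "m k > 0" "norm (v /\<^sub>R m k) \<le> r / 4" for k proof -
      show mk: "m k > 0" using N by (simp add: m_def)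
      have "norm v \<le> m k * (r / 4)" using N r by (auto simp: m_def algebra_simps intro: order_trans[OF less_imp_le])
      then show "norm (v /\<^sub>R m k) \<le> r / 4" using mk by (simp add: field_simps)
    qed
    show ?thesis proof (rule borel_measurable_LIMSEQ_metric)
      fix k
      have "p + v /\<^sub>R m k \<in> U" using m[of k] r by (auto simp: subset_iff dist_norm)
      then show "(\<lambda>t. of_real (m k) * (f (p + v /\<^sub>R m k) t - f p t)) \<in> borel_measurable M"
        using meas p by (intro borel_measurable_times borel_measurable_diff) auto
    next
      fix t assume t: "t \<in> space M"
      show "(\<lambda>k. of_real (m k) * (f (p + v /\<^sub>R m k) t - f p t)) \<longlonglongrightarrow> D t v" proof (rule LIM_zero_cancel, rule Lim_null_comparison)
        show "\<forall>\<^sub>F k in sequentially. cmod (of_real (m k) * (f (p + v /\<^sub>R m k) t - f p t) - D t v)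
            \<le> (8 * b t / r\<^sup>2 * (norm v)\<^sup>2) / m k" proof (intro always_eventually allI)
          fix k
          have "of_real (m k) * (f (p + v /\<^sub>R m k) t - f p t) - D t v
              = of_real (m k) * (f (p + v /\<^sub>R m k) t - f p t - D t (v /\<^sub>R m k))"
            using m(1)[of k] linear_scale[OF Dlin[OF t], of "inverse (m k)" v] by (simp add: algebra_simps scaleR_conv_of_real)
          then have "cmod (of_real (m k) * (f (p + v /\<^sub>R m k) t - f p t) - D t v)
              \<le> m k * (8 * b t / r\<^sup>2 * (norm (v /\<^sub>R m k))\<^sup>2)" using mult_left_mono[OF D2[OF t m(2)[of k]], of "m k"] m(1)[of k]
            by (simp only: norm_mult) simp
          also have "\<dots> = (8 * b t / r\<^sup>2 * (norm v)\<^sup>2) / m k"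
            using m(1)[of k] by (simp add: power_mult_distrib power_divide field_simps power2_eq_square)
          finally show "cmod (of_real (m k) * (f (p + v /\<^sub>R m k) t - f p t) - D t v) \<le> (8 * b t / r\<^sup>2 * (norm v)\<^sup>2) / m k" .
        qed
        have "filterlim m at_top sequentially" unfolding m_def by (rule filterlim_compose[OF filterlim_real_sequentially])
            (simp add: filterlim_sequentially_Suc filterlim_add_const_nat_at_top add.commute)
        then show "(\<lambda>k. (8 * b t / r\<^sup>2 * (norm v)\<^sup>2) / m k) \<longlonglongrightarrow> 0" by (intro real_tendsto_divide_at_top[OF tendsto_const])
      qed
    qed
  qed
  have Dint: "integrable M (\<lambda>t. D t v)" for v proof (rule Bochner_Integration.integrable_bound[OF _ Dmeas])
    show "integrable M (\<lambda>t. 2 * b t / r * norm v)" using r(2) by simp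
    show "AE t in M. norm (D t v) \<le> norm (2 * b t / r * norm v)"
      by (intro AE_I2) (metis D1 abs_ge_self order_trans real_norm_def)
  qed
  have fint: "integrable M (f q)" if "q \<in> ball p r" for q proof (rule Bochner_Integration.integrable_bound[OF r(2)])
    show "f q \<in> borel_measurable M" using that r meas by auto
    show "AE t in M. norm (f q t) \<le> norm (b t)" using b[OF that] order_trans[OF _ abs_ge_self] by (intro AE_I2) auto
  qed
  define E where "E v = (LINT t|M. D t v)" for v
  have Elin: "linear E" proof
    show "E (v + w) = E v + E w" for v w unfolding E_def Bochner_Integration.integral_add[OF Dint Dint, symmetric]
      by (rule Bochner_Integration.integral_cong) (simp_all add: linear_add[OF Dlin])
    show "E (c *\<^sub>R v) = c *\<^sub>R E v" for c v unfolding E_def integral_scaleR_right[symmetric]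
      by (rule Bochner_Integration.integral_cong) (simp_all add: linear_scale[OF Dlin])
  qed
  have Ebnd: "cmod (E v) \<le> (2 / r * (LINT t|M. b t)) * norm v" for v proof -
    have "cmod (E v) \<le> (LINT t|M. 2 / r * norm v * b t)" unfolding E_def by (rule norm_LINT_le)
        (use r(2) Dint D1 in \<open>auto simp: field_simps\<close>)
    also have "\<dots> = 2 / r * norm v * (LINT t|M. b t)" by (rule integral_mult_right_zero)
    finally show ?thesis by (simp add: algebra_simps)
  qed
  have EC: "E (scaleC c v) = c * E v" for c v proof -
    have "E (scaleC c v) = (LINT t|M. c * D t v)" unfolding E_def by (rule Bochner_Integration.integral_cong) (simp_all add: DC)
    then show ?thesis by (simp add: E_def)
  qed
  have Eder: "((\<lambda>q. integral\<^sup>L M (f q)) has_derivative E) (at p)" unfolding has_derivative_at proof (intro conjI)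
    show "bounded_linear E" using Elin Ebnd by (intro bounded_linear_intro[where K = "2 / r * (LINT t|M. b t)"])
        (auto simp: linear_add linear_scale mult.commute)
    define K where "K = 8 / r\<^sup>2 * (LINT t|M. b t)"
    show "(\<lambda>v. cmod (integral\<^sup>L M (f (p + v)) - integral\<^sup>L M (f p) - E v) / norm v) \<midarrow>0\<rightarrow> 0" proof (rule Lim_null_comparison)
      show "(\<lambda>v. K * norm v) \<midarrow>0\<rightarrow> 0" by (intro tendsto_mult_right_zero tendsto_norm_zero tendsto_ident_at)
      have "eventually (\<lambda>v::'a. v \<noteq> 0 \<and> norm v < r / 4) (at 0)"
        using r unfolding eventually_at by (intro exI[of _ "r / 4"]) (auto simp: dist_norm)
      then show "\<forall>\<^sub>F v in at 0. norm (cmod (integral\<^sup>L M (f (p + v)) - integral\<^sup>L M (f p) - E v) / norm v) \<le> K * norm v"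
      proof eventually_elim
        case (elim v)
        then have v: "p + v \<in> ball p r" "p \<in> ball p r" using r by (auto simp: dist_norm)
        have "integral\<^sup>L M (f (p + v)) - integral\<^sup>L M (f p) - E v = (LINT t|M. f (p + v) t - f p t - D t v)"
          unfolding E_def using fint v Dint by simp
        then have "cmod (integral\<^sup>L M (f (p + v)) - integral\<^sup>L M (f p) - E v)
            = cmod (LINT t|M. f (p + v) t - f p t - D t v)" by simp
        also have "\<dots> \<le> (LINT t|M. 8 / r\<^sup>2 * (norm v)\<^sup>2 * b t)" proof (rule norm_LINT_le)
          show "integrable M (\<lambda>t. f (p + v) t - f p t - D t v)" using fint v Dint by simp
          show "integrable M (\<lambda>t. 8 / r\<^sup>2 * (norm v)\<^sup>2 * b t)" using r(2) by simp
          fix t assume "t \<in> space M"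
          from D2[OF this, of v] elim
          show "cmod (f (p + v) t - f p t - D t v) \<le> 8 / r\<^sup>2 * (norm v)\<^sup>2 * b t"
            by (simp only: times_divide_eq_left mult.assoc mult.commute[of "b t"]) simp
        qed
        also have "\<dots> = 8 / r\<^sup>2 * (norm v)\<^sup>2 * (LINT t|M. b t)" by (rule integral_mult_right_zero)
        finally have "cmod (integral\<^sup>L M (f (p + v)) - integral\<^sup>L M (f p) - E v) \<le> K * (norm v)\<^sup>2"
          by (simp add: K_def algebra_simps)
        then show ?case using elim by (simp add: field_simps power2_eq_square)
      qed
    qed
  qed
  then show "cdiff (\<lambda>q. integral\<^sup>L M (f q)) p" unfolding cdiff_def scaleC_complex_def using EC by blast
  have "((\<lambda>s. p + scaleC s v) has_derivative (\<lambda>s. scaleC s v)) (at 0)" using has_derivative_add[OF has_derivative_const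
        bounded_linear_imp_has_derivative[OF bounded_linear_scaleC_left]] by simp
  from has_derivative_compose[OF this, of "\<lambda>q. integral\<^sup>L M (f q)" E] Eder
  have "((\<lambda>s. integral\<^sup>L M (f (p + scaleC s v))) has_field_derivative E v) (at 0)"
    by (simp add: has_field_derivative_def EC fun_eq_iff mult.commute[of _ "E v"])
  then have "deriv (\<lambda>s. integral\<^sup>L M (f (p + scaleC s v))) 0 = E v" by (rule DERIV_imp_deriv)
  also have "E v = (LINT t|M. deriv (\<lambda>s. f (p + scaleC s v) t) 0)" unfolding E_def
    by (rule Bochner_Integration.integral_cong) (simp_all add: Hderiv[unfolded H_def])
  finally show "deriv (\<lambda>s. integral\<^sup>L M (f (p + scaleC s v))) 0 = (LINT t|M. deriv (\<lambda>s. f (p + scaleC s v) t) 0)" .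
qed

lemma holo_integral:
  fixes f :: "'a::cnormed_space \<Rightarrow> 'm \<Rightarrow> complex"
  assumes "open U"
    and "\<And>t. t \<in> space M \<Longrightarrow> holo (\<lambda>p. f p t) U"
    and "\<And>p. p \<in> U \<Longrightarrow> f p \<in> borel_measurable M"
    and "\<And>p. p \<in> U \<Longrightarrow> \<exists>r>0. \<exists>b. integrable M b \<and> ball p r \<subseteq> U \<and>
      (\<forall>q\<in>ball p r. \<forall>t\<in>space M. cmod (f q t) \<le> b t)"
  shows "holo (\<lambda>p. integral\<^sup>L M (f p)) U" by (rule holoI[OF assms(1) holo_integral_aux(1)[OF assms]])

text \<open>The quotient h / l extends over the zero set of l because on each line in direction e it
  has a removable singularity. By the mean value property the extension is an average of h / l over
  a circle on which l does not vanish, and this integral is holomorphic in the centre.\<close>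

lemma holo_divide_out:
  fixes h :: "'a::cnormed_space \<Rightarrow> complex"
  assumes h: "holo h W" and l: "\<And>p. cdiff l p"
    and shift: "\<And>p s. l (p + scaleC s e) = l p + s"
    and zero: "\<And>p. p \<in> W \<Longrightarrow> l p = 0 \<Longrightarrow> h p = 0"
  shows "\<exists>h1. holo h1 W \<and> (\<forall>p\<in>W. h p = l p * h1 p)"
proof -
  define h1 where "h1 p = (if l p \<noteq> 0 then h p / l p else deriv (\<lambda>s. h (p + scaleC s e)) 0)" for p
  have "open W" using h by (rule holo_open)
  have holo_l: "holo l W" using l \<open>open W\<close> by (intro holoI)
  have "e \<noteq> 0" using shift[of 0 1] by auto
  have "cdiff h1 p1" if p1: "p1 \<in> W" for p1 proof (cases "l p1 = 0")
    case False
    show ?thesis proof (rule cdiff_cong_open)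
      show "cdiff (\<lambda>p. h p / l p) p1" using False by (intro cdiff_divide holoD[OF h] l p1)
      show "open {p \<in> W. l p \<noteq> 0}" by (rule open_nonzero[OF holo_l])
    qed (use p1 False in \<open>auto simp: h1_def\<close>)
  next
    case True
    obtain R0 where R0: "R0 > 0" "ball p1 R0 \<subseteq> W" using openE[OF \<open>open W\<close> p1] by auto
    have "isCont h p1" using holoD[OF h p1] by (rule cdiff_isCont)
    then obtain R1 where R1: "R1 > 0" "\<And>q. dist q p1 < R1 \<Longrightarrow> dist (h q) (h p1) < 1"
      unfolding continuous_at_eps_delta by (metis zero_less_one)
    define R where "R = min R0 R1"
    have R: "R > 0" "ball p1 R \<subseteq> W" and hb: "\<And>q. q \<in> ball p1 R \<Longrightarrow> cmod (h q) \<le> cmod (h p1) + 1" proof -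
      show "R > 0" "ball p1 R \<subseteq> W" using R0 R1 by (auto simp: R_def)
      fix q assume "q \<in> ball p1 R"
      then have "dist (h q) (h p1) < 1" by (intro R1) (simp add: R_def dist_commute)
      then show "cmod (h q) \<le> cmod (h p1) + 1" using norm_triangle_sub[of "h q" "h p1"] by (simp add: dist_norm)
    qed
    \<comment> \<open>Points q + s e with |s| < 2 r remain in the ball, while |l q| < r/2 keeps the
      zero s = - l q well inside the circle of radius r. On the circle the denominator has modulus
      at least r/2.\<close>
    define r where "r = R / (4 * norm e)"
    have r: "r > 0" "2 * r * norm e = R / 2" using R \<open>e \<noteq> 0\<close> by (auto simp: r_def)
    have isl: "isCont l p1" using l by (rule cdiff_isCont)
    obtain d where d: "d > 0" "\<And>q. dist q p1 < d \<Longrightarrow> cmod (l q) < r / 2"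
      using isl[unfolded continuous_at_eps_delta, rule_format, of "r / 2"] r True by (auto simp: dist_norm)
    define N where "N = ball p1 (min d (R / 2))"
    have N: "open N" "p1 \<in> N" and lN: "\<And>q. q \<in> N \<Longrightarrow> cmod (l q) < r / 2" using d R by (auto simp: N_def dist_commute)
    have line: "q + scaleC s e \<in> ball p1 R" if "q \<in> N" "cmod s < 2 * r" for q s proof -
      have "norm (scaleC s e) < R / 2" using that r \<open>e \<noteq> 0\<close> by (simp add: norm_scaleC flip: r(2))
      moreover have "dist p1 (q + scaleC s e) \<le> dist p1 q + norm (scaleC s e)"
        using dist_triangle[of p1 "q + scaleC s e" q] by (simp add: dist_norm)
      ultimately show ?thesis using that by (simp add: N_def)
    qed
    define c where "c x = circlepath 0 r x" for x
    have c: "cmod (c x) = r" "c x \<noteq> 0" for x using r by (auto simp: c_def circlepath norm_mult)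
    have cc: "continuous_on X c" for X unfolding c_def circlepath by (intro continuous_intros)
    define f where "f q x = indicator {0..1} x *\<^sub>R (h (q + scaleC (c x) e) / (l q + c x))" for q x
    have lc: "cmod (l q + c x) \<ge> r / 2" if "q \<in> N" for q x
      using norm_triangle_ineq4[of "l q + c x" "l q"] lN[OF that] c(1)[of x] by simp
    have lc0: "l q + c x \<noteq> 0" if "q \<in> N" for q x using lc[OF that, of x] r by auto
    have cont: "continuous_on {0..1} (\<lambda>x. h (q + scaleC (c x) e) / (l q + c x))" if q: "q \<in> N" for q
    proof (intro continuous_intros cc)
      have "continuous_on {0..1} (\<lambda>x. q + scaleC (c x) e)"
        by (intro continuous_intros bounded_linear.continuous_on[OF bounded_linear_scaleC_left] cc)
      moreover have "(\<lambda>x. q + scaleC (c x) e) ` {0..1} \<subseteq> W" using line[OF q] c r R by auto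
      ultimately show "continuous_on {0..1} (\<lambda>x. h (q + scaleC (c x) e))"
        by (rule continuous_on_compose2[OF holo_continuous_on[OF h]])
    qed (use lc0 q in auto)
    have sint: "set_integrable lborel {0..1} (\<lambda>x. h (q + scaleC (c x) e) / (l q + c x))" if "q \<in> N" for q
      by (rule borel_integrable_atLeastAtMost'[OF cont[OF that]])
    have "holo (\<lambda>q. integral\<^sup>L lborel (f q)) N" proof (rule holo_integral[OF N(1)])
      show "holo (\<lambda>q. f q x) N" for x proof (rule holoI[OF N(1)])
        fix q assume q: "q \<in> N"
        have "cdiff (\<lambda>q. h (q + scaleC (c x) e)) q" by (rule cdiff_compose[where g = h], intro cdiff_intros, rule holoD[OF h])
            (use line[OF q] c r R in auto)
        then show "cdiff (\<lambda>q. f q x) q" unfolding f_def scaleR_conv_of_real using lc0[OF q] by (intro cdiff_intros l) auto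
      qed
    next
      fix q assume q: "q \<in> N"
      show "f q \<in> borel_measurable lborel"
        using sint[OF q] unfolding f_def set_integrable_def by (rule borel_measurable_integrable)
      obtain r' where r': "r' > 0" "ball q r' \<subseteq> N" using openE[OF N(1) q] by auto
      define b where "b x = indicator {0..1} x *\<^sub>R ((cmod (h p1) + 1) / (r / 2))" for x :: real
      have "integrable lborel b" unfolding b_def
        using borel_integrable_atLeastAtMost'[of 0 1 "\<lambda>_::real. (cmod (h p1) + 1) / (r / 2)"] by (simp add: set_integrable_def)
      moreover have "cmod (f q x) \<le> b x" if "q \<in> N" for q x proof -
        have "cmod (h (q + scaleC (c x) e) / (l q + c x)) \<le> (cmod (h p1) + 1) / (r / 2)" unfolding norm_divide
          by (intro frac_le hb line that lc) (use r c in auto)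
        then show ?thesis by (simp add: f_def b_def indicator_def)
      qed
      ultimately show "\<exists>r>0. \<exists>b. integrable lborel b \<and> ball q r \<subseteq> N \<and>
          (\<forall>q\<in>ball q r. \<forall>t\<in>space lborel. cmod (f q t) \<le> b t)" using r' by blast
    qed
    then have "cdiff (\<lambda>q. integral\<^sup>L lborel (f q)) p1" using N(2) by (rule holoD)
    moreover have "integral\<^sup>L lborel (f q) = h1 q" if q: "q \<in> N" for q proof -
      define F where "F s = h (q + scaleC s e)" for s
      define s0 where "s0 = - l q"
      \<comment> \<open>The quotient on the slice through q with its singularity at
        \<open>s0\<close> filled in. Since F vanishes at \<open>s0\<close>, this is h / l off that
        point, and its value at 0 is \<open>h1 q\<close> in both cases of the definition of
        \<open>h1\<close>.\<close>
      define G where "G = (\<lambda>s. if s = s0 then deriv F s0 else (F s - F s0) / (s - s0))"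
      have s0: "s0 \<in> ball 0 (2 * r)" using lN[OF q] r by (simp add: s0_def)
      have "F holomorphic_on ball 0 (2 * r)" unfolding F_def using line[OF q] R
        by (intro holomorphic_on_subset[OF holo_slice[OF h]]) auto
      then have G: "G holomorphic_on ball 0 (2 * r)"
        unfolding G_def using s0 by (intro pole_lemma) (simp_all add: interior_open)
      have "F s0 = 0" unfolding F_def using line[OF q, of s0] s0 R shift[of q s0] by (intro zero) (auto simp: s0_def)
      then have GF: "G s = h (q + scaleC s e) / (l q + s)" if "s \<noteq> s0" for s
        using that by (simp add: G_def F_def s0_def algebra_simps)
      have G0: "G 0 = h1 q" using \<open>F s0 = 0\<close> by (auto simp: G_def h1_def F_def[abs_def] s0_def)
      have "((\<lambda>u. G u / (u - 0)) has_contour_integral (2 * cpi * \<i> * G 0)) (circlepath 0 r)"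
        using r by (intro Cauchy_integral_circlepath_simple holomorphic_on_subset[OF G]) auto
      then have "((\<lambda>x. G (c x) / c x * (2 * cpi * \<i> * c x)) has_integral
          (2 * cpi * \<i> * G 0)) {0..1}" unfolding has_contour_integral_def c_def by (rule has_integral_eq[rotated])
          (subst vector_derivative_circlepath01, simp, simp, simp add: circlepath)
      moreover have "G (c x) / c x * (2 * cpi * \<i> * c x) = 2 * cpi * \<i> * G (c x)" for x using c(2)[of x] by simp
      ultimately have "((\<lambda>x. 2 * cpi * \<i> * G (c x)) has_integral (2 * cpi * \<i> * G 0)) {0..1}" by simp
      from has_integral_mult_right[OF this, of "inverse (2 * cpi * \<i>)"]
      have "((\<lambda>x. inverse (2 * cpi * \<i>) * (2 * cpi * \<i> * G (c x))) has_integral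
          inverse (2 * cpi * \<i>) * (2 * cpi * \<i> * G 0)) {0..1}" .
      moreover have inv: "inverse (2 * cpi * \<i>) * (2 * cpi * \<i> * z) = z" for z :: complex by (simp add: field_simps)
      ultimately have "((\<lambda>x. G (c x)) has_integral G 0) {0..1}" by (simp only: inv)
      then have *: "((\<lambda>x. h (q + scaleC (c x) e) / (l q + c x)) has_integral G 0) {0..1}" proof (rule has_integral_eq[rotated])
        fix x :: real
        have "c x \<noteq> s0" using lc0[OF q, of x] by (auto simp: s0_def)
        then show "G (c x) = h (q + scaleC (c x) e) / (l q + c x)" by (rule GF)
      qed
      have "integral\<^sup>L lborel (f q) = integral {0..1} (\<lambda>x. h (q + scaleC (c x) e) / (l q + c x))"
        using set_borel_integral_eq_integral(2)[OF sint[OF q]] by (simp add: set_lebesgue_integral_def f_def[abs_def])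
      then show ?thesis using * G0 by (simp add: integral_unique)
    qed
    ultimately show ?thesis using N cdiff_cong_open by blast
  qed
  then have "holo h1 W" using \<open>open W\<close> by (intro holoI)
  moreover have "h p = l p * h1 p" if "p \<in> W" for p using zero[OF that] by (simp add: h1_def)
  ultimately show ?thesis by blast
qed

section \<open>Meromorphic functions\<close>

text \<open>A \<open>mero_quotient\<close> with one exceptional function k for the whole of W
  instead of one near each point; locally the two notions agree.\<close>

definition mero_rep ::
    "('a::complex_space \<Rightarrow> complex) \<Rightarrow> ('a \<Rightarrow> complex) \<Rightarrow> ('a \<Rightarrow> complex) \<Rightarrow> ('a \<Rightarrow> complex) \<Rightarrow> 'a set \<Rightarrow> bool"
  where "mero_rep f g h k W \<longleftrightarrow>
     holo g W \<and> holo_nz h W \<and> holo_nz k W \<and> (\<forall>z\<in>W. k z \<noteq> 0 \<longrightarrow> f z = g z / h z)"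

lemma mero_repD:
  assumes "mero_rep f g h k W"
  shows "holo g W" "holo_nz h W" "holo_nz k W" "\<And>z. z \<in> W \<Longrightarrow> k z \<noteq> 0 \<Longrightarrow> f z = g z / h z"
  using assms by (simp_all add: mero_rep_def)

lemma mero_rep_subset:
  assumes "mero_rep f g h k W" "open V" "V \<subseteq> W"
  shows "mero_rep f g h k V"
proof -
  from mero_repD[OF assms(1)] show ?thesis unfolding mero_rep_def using assms(3)
    by (intro conjI holo_subset[OF _ assms(2,3)] holo_nz_subset[OF _ assms(2,3)]) auto
qed

lemma mero_rep_open: "mero_rep f g h k W \<Longrightarrow> open W"
  unfolding mero_rep_def using holo_open[of g W] by blast

lemma mero_quotient_rep:
  assumes "mero_quotient f g h U" "p \<in> U"
  shows "\<exists>V k. p \<in> V \<and> V \<subseteq> U \<and> mero_rep f g h k V"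
proof -
  have gh: "holo g U" "holo_nz h U" and eq: "mero_eq f (\<lambda>z. g z / h z) U" using assms(1) by (simp_all add: mero_quotient_def)
  obtain V k where V: "p \<in> V" "holo_nz k V" "\<forall>z\<in>V. k z \<noteq> 0 \<longrightarrow> f z = g z / h z" using eq assms(2) unfolding mero_eq_def by blast
  have o: "open (U \<inter> V)" using holo_open[OF gh(1)] holo_nz_open[OF V(2)] by (rule open_Int)
  have "mero_rep f g h k (U \<inter> V)" unfolding mero_rep_def
    using V(3) holo_subset[OF gh(1) o] holo_nz_subset[OF gh(2) o] holo_nz_subset[OF V(2) o] by simp
  then show ?thesis using V(1) assms(2) by (intro exI[of _ "U \<inter> V"] exI[of _ k]) simp
qed

lemma mero_rep_quotient: "mero_rep f g h k W \<Longrightarrow> mero_quotient f g h W"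
  unfolding mero_rep_def mero_quotient_def mero_eq_def by blast

lemma mero_repE:
  fixes p :: "'a::cnormed_space"
  assumes "mero f A" "p \<in> A" "open V" "p \<in> V"
  obtains r g h k where "r > 0" "ball p r \<subseteq> V" "mero_rep f g h k (ball p r)"
proof -
  obtain U g h where U: "p \<in> U" "mero_quotient f g h U" using assms(1,2) unfolding mero_def by blast
  obtain W k where W: "p \<in> W" "mero_rep f g h k W" using mero_quotient_rep[OF U(2,1)] by blast
  have "open (W \<inter> V)" using mero_rep_open[OF W(2)] assms(3) by (rule open_Int)
  then obtain r where r: "r > 0" "ball p r \<subseteq> W \<inter> V" using openE[of "W \<inter> V" p] W(1) assms(4) by auto
  show thesis by (rule that[of r g h k]) (use r mero_rep_subset[OF W(2)] in auto)
qed

lemma mero_if_rep: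
  assumes "\<And>p. p \<in> A \<Longrightarrow> \<exists>W g h k. p \<in> W \<and> mero_rep f g h k W"
  shows "mero f A" unfolding mero_def
proof
  fix p assume "p \<in> A"
  then obtain W g h k where W: "p \<in> W" "mero_rep f g h k W" using assms by blast
  from W(1) mero_rep_quotient[OF W(2)] show "\<exists>U g h. p \<in> U \<and> mero_quotient f g h U" by blast
qed

text \<open>In cross-multiplied form the equality has no exceptional points: it holds where all four
  denominators and exceptional functions are nonzero, and these points are dense.\<close>

lemma mero_rep_unique:
  assumes "mero_rep f g h k W" "mero_rep f g' h' k' W" "z \<in> W"
  shows "g z * h' z = g' z * h z"
proof -
  note a = mero_repD[OF assms(1)] and b = mero_repD[OF assms(2)]
  have "g z * h' z - g' z * h z = 0" proof (rule holo_nz_zero[where g = "\<lambda>z. g z * h' z - g' z * h z"])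
    show "holo_nz (\<lambda>z. (h z * k z) * (h' z * k' z)) W" by (intro holo_nz_mult a b)
    show "holo (\<lambda>z. g z * h' z - g' z * h z) W"
      by (intro holo_diff holo_mult a(1) b(1) holo_nz_holo[OF a(2)] holo_nz_holo[OF b(2)])
    fix p assume "p \<in> W" "h p * k p * (h' p * k' p) \<noteq> 0"
    then show "g p * h' p - g' p * h p = 0" using a(4)[of p] b(4)[of p] by (simp add: field_simps)
  qed (rule assms(3))
  then show ?thesis by simp
qed

text \<open>The invertible meromorphic functions. Every factor of S except \<Psi> is of this kind,
  so dividing by them is harmless.\<close>

definition mero_nz :: "('a::complex_space \<Rightarrow> complex) \<Rightarrow> 'a set \<Rightarrow> bool" where
  "mero_nz f A \<longleftrightarrow> (\<forall>p\<in>A. \<exists>W g h k. p \<in> W \<and> mero_rep f g h k W \<and> holo_nz g W)"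

lemma mero_nz_mero: "mero_nz f A \<Longrightarrow> mero f A"
  unfolding mero_nz_def by (intro mero_if_rep) blast

lemma mero_rep_mult:
  assumes "mero_rep f g h k W" "mero_rep f' g' h' k' W"
  shows "mero_rep (\<lambda>z. f z * f' z) (\<lambda>z. g z * g' z) (\<lambda>z. h z * h' z) (\<lambda>z. k z * k' z) W"
proof -
  note a = mero_repD[OF assms(1)] and b = mero_repD[OF assms(2)]
  show ?thesis unfolding mero_rep_def using a(4) b(4) by (intro conjI holo_mult holo_nz_mult a b) simp
qed

lemma mero_mult:
  assumes "mero f A" "mero f' A"
  shows "mero (\<lambda>z. f z * f' z) (A::'a::cnormed_space set)"
proof (rule mero_if_rep)
  fix p assume p: "p \<in> A"
  obtain r g h k where 1: "r > 0" "mero_rep f g h k (ball p r)" by (rule mero_repE[OF assms(1) p, of UNIV]) auto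
  obtain r' g' h' k' where 2: "r' > 0" "ball p r' \<subseteq> ball p r" "mero_rep f' g' h' k' (ball p r')"
    by (rule mero_repE[OF assms(2) p, of "ball p r"]) (use 1 in auto)
  have "mero_rep f g h k (ball p r')" by (rule mero_rep_subset[OF 1(2)]) (use 2 in auto)
  from mero_rep_mult[OF this 2(3)]
  show "\<exists>W g h k. p \<in> W \<and> mero_rep (\<lambda>z. f z * f' z) g h k W" using 2(1) by (meson centre_in_ball)
qed

lemma mero_nzE:
  fixes p :: "'a::cnormed_space"
  assumes "mero_nz f A" "p \<in> A"
  obtains W g h k where "p \<in> W" "mero_rep f g h k W" "holo_nz g W" using assms unfolding mero_nz_def by blast

lemma mero_nz_mult:
  assumes "mero_nz f A" "mero_nz f' A"
  shows "mero_nz (\<lambda>z. f z * f' z) (A::'a::cnormed_space set)" unfolding mero_nz_def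
proof
  fix p assume p: "p \<in> A"
  obtain W g h k where 1: "p \<in> W" "mero_rep f g h k W" "holo_nz g W" by (rule mero_nzE[OF assms(1) p])
  obtain W' g' h' k' where 2: "p \<in> W'" "mero_rep f' g' h' k' W'" "holo_nz g' W'" by (rule mero_nzE[OF assms(2) p])
  have o: "open (W \<inter> W')" using mero_rep_open[OF 1(2)] mero_rep_open[OF 2(2)] by (rule open_Int)
  have "mero_rep f g h k (W \<inter> W')" "mero_rep f' g' h' k' (W \<inter> W')"
    using mero_rep_subset[OF 1(2) o] mero_rep_subset[OF 2(2) o] by auto
  from mero_rep_mult[OF this]
  have "mero_rep (\<lambda>z. f z * f' z) (\<lambda>z. g z * g' z) (\<lambda>z. h z * h' z) (\<lambda>z. k z * k' z) (W \<inter> W')" .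
  moreover have "holo_nz (\<lambda>z. g z * g' z) (W \<inter> W')"
    using holo_nz_subset[OF 1(3) o] holo_nz_subset[OF 2(3) o] by (intro holo_nz_mult) auto
  ultimately show "\<exists>W g h k. p \<in> W \<and> mero_rep (\<lambda>z. f z * f' z) g h k W \<and> holo_nz g W" using 1(1) 2(1) by (intro exI conjI) auto
qed

lemma mero_nz_inverse:
  assumes "mero_nz f A"
  shows "mero_nz (\<lambda>z. inverse (f z)) (A::'a::cnormed_space set)" unfolding mero_nz_def
proof
  fix p assume p: "p \<in> A"
  obtain W g h k where 1: "p \<in> W" "mero_rep f g h k W" "holo_nz g W" by (rule mero_nzE[OF assms p])
  have "holo_nz h W" "holo_nz k W" "\<forall>z\<in>W. k z \<noteq> 0 \<longrightarrow> f z = g z / h z" using 1(2) by (simp_all add: mero_rep_def)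
  then have "mero_rep (\<lambda>z. inverse (f z)) h g k W" "holo_nz h W" using 1(3) by (simp_all add: mero_rep_def holo_nz_holo)
  then show "\<exists>W g h k. p \<in> W \<and> mero_rep (\<lambda>z. inverse (f z)) g h k W \<and> holo_nz g W" using 1(1) by blast
qed

lemma mero_nz_divide:
  assumes "mero_nz f A" "mero_nz f' A"
  shows "mero_nz (\<lambda>z. f z / f' z) (A::'a::cnormed_space set)"
  using mero_nz_mult[OF assms(1) mero_nz_inverse[OF assms(2)]] by (simp add: divide_inverse)

lemma holo_nz_const1: "open U \<Longrightarrow> holo_nz (\<lambda>_. 1) U"
  by (intro holo_nz_nonzero holoI cdiff_const) simp_all

lemma mero_rep_holo:
  assumes "holo g W" "\<And>z. z \<in> W \<Longrightarrow> f z = g z"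
  shows "mero_rep f g (\<lambda>_. 1) (\<lambda>_. 1) W" unfolding mero_rep_def using assms holo_nz_const1[OF holo_open[OF assms(1)]] by simp

lemma open_vimage_cdiff:
  fixes \<alpha> :: "'a::complex_space \<Rightarrow> 'b::complex_space"
  assumes "\<And>p. cdiff \<alpha> p" "open W"
  shows "open (\<alpha> -` W)" by (intro open_vimage[OF assms(2)] continuous_at_imp_continuous_on ballI cdiff_isCont assms(1))

context
  fixes \<alpha> :: "'a::cnormed_space \<Rightarrow> 'b::{cnormed_space, euclidean_space}"
  assumes \<alpha>: "\<And>p. cdiff \<alpha> p" "linear \<alpha>" "surj \<alpha>"
begin

text \<open>A surjective linear map between these spaces is open, so an open set on which the
  composite vanished would have an open image on which k vanishes.\<close>

lemma holo_nz_compose: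
  assumes k: "holo_nz k W"
  shows "holo_nz (\<lambda>p. k (\<alpha> p)) (\<alpha> -` W)" unfolding holo_nz_iff
proof (intro conjI allI impI; (elim conjE)?)
  show "holo (\<lambda>p. k (\<alpha> p)) (\<alpha> -` W)"
    by (intro holo_compose[OF holo_nz_holo[OF k]] open_vimage_cdiff \<alpha>(1) holo_nz_open[OF k]) auto
  fix V assume V: "open V" "V \<subseteq> \<alpha> -` W" "V \<noteq> {}"
  have "open (\<alpha> ` V)" using V \<alpha> by (intro open_surjective_linear_image)
  then have "\<exists>q\<in>\<alpha> ` V. k q \<noteq> 0" using V by (intro holo_nzD[OF k]) auto
  then show "\<exists>p\<in>V. k (\<alpha> p) \<noteq> 0" by auto
qed

lemma mero_rep_compose:
  assumes r: "mero_rep f g h k W"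
  shows "mero_rep (\<lambda>p. f (\<alpha> p)) (\<lambda>p. g (\<alpha> p)) (\<lambda>p. h (\<alpha> p)) (\<lambda>p. k (\<alpha> p)) (\<alpha> -` W)"
proof -
  note a = mero_repD[OF r]
  show ?thesis unfolding mero_rep_def using a(4) holo_nz_compose[OF a(2)] holo_nz_compose[OF a(3)]
    by (intro conjI holo_compose[OF a(1)] open_vimage_cdiff \<alpha>(1) holo_open[OF a(1)]) auto
qed

lemma mero_compose:
  assumes f: "mero f B" and "\<alpha> ` A \<subseteq> B"
  shows "mero (\<lambda>p. f (\<alpha> p)) A"
proof (rule mero_if_rep)
  fix p assume "p \<in> A"
  then have "\<alpha> p \<in> B" using assms(2) by auto
  then obtain r g h k where 1: "r > 0" "mero_rep f g h k (ball (\<alpha> p) r)" by (rule mero_repE[OF f, of "\<alpha> p" UNIV]) auto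
  from mero_rep_compose[OF 1(2)] 1(1)
  show "\<exists>W g h k. p \<in> W \<and> mero_rep (\<lambda>p. f (\<alpha> p)) g h k W" by (intro exI conjI) auto
qed

lemma mero_nz_compose:
  assumes f: "mero_nz f B" and "\<alpha> ` A \<subseteq> B"
  shows "mero_nz (\<lambda>p. f (\<alpha> p)) A" unfolding mero_nz_def
proof
  fix p assume "p \<in> A"
  then have "\<alpha> p \<in> B" using assms(2) by auto
  then obtain W g h k where 1: "\<alpha> p \<in> W" "mero_rep f g h k W" "holo_nz g W" by (rule mero_nzE[OF f])
  from mero_rep_compose[OF 1(2)] holo_nz_compose[OF 1(3)] 1(1)
  show "\<exists>W g h k. p \<in> W \<and> mero_rep (\<lambda>p. f (\<alpha> p)) g h k W \<and> holo_nz g W" by (intro exI conjI) auto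
qed

end

text \<open>Near the given real point the uniqueness principle for real coordinates yields g = S h;
  local agreement then spreads through overlapping balls of the connected set V, by the identity
  theorem in each ball.\<close>

lemma mero_eq_holo:
  fixes F :: "complex \<times> complex \<times> 'b::cnormed_space \<Rightarrow> complex"
  assumes F: "mero F V" and V: "convex V" and S: "holo S V"
    and X: "open X" "X \<subseteq> V" "(of_real a, of_real b, c) \<in> X"
    and eq: "\<And>(x::real) (y::real) z. (of_real x, of_real y, z) \<in> X \<Longrightarrow>
                F (of_real x, of_real y, z) = S (of_real x, of_real y, z)"
  shows "mero_quotient F S (\<lambda>_. 1) V"
proof -
  have oV: "open V" using S by (rule holo_open)
  define P where "P p \<longleftrightarrow> (\<exists>U k. p \<in> U \<and> U \<subseteq> V \<and> holo_nz k U \<and> (\<forall>z\<in>U. k z \<noteq> 0 \<longrightarrow> F z = S z))" for p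
  have good: "P q" if rep: "mero_rep F g h k (ball p r)" "ball p r \<subseteq> V" "q \<in> ball p r"
      and gS: "\<And>z. z \<in> ball p r \<Longrightarrow> g z = S z * h z" for g h k p q r proof -
    note a = mero_repD(2-)[OF rep(1)]
    have "F z = S z" if "z \<in> ball p r" "h z * k z \<noteq> 0" for z using that a(3)[of z] gS[of z] by simp
    then show ?thesis unfolding P_def using rep holo_nz_mult[OF a(1,2)] by blast
  qed
  define p0 where "p0 = (complex_of_real a, complex_of_real b, c)"
  have "P p0" proof -
    have "p0 \<in> V" using X by (auto simp: p0_def)
    then obtain r g h k where r: "r > 0" "ball p0 r \<subseteq> X" "mero_rep F g h k (ball p0 r)"
      by (rule mero_repE[OF F _ X(1)]) (use X in \<open>auto simp: p0_def\<close>)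
    have sub: "ball p0 r \<subseteq> V" using r X by auto
    note a = mero_repD[OF r(3)]
    have hg: "holo (\<lambda>z. g z - S z * h z) (ball p0 r)"
      by (intro holo_diff holo_mult a(1) holo_nz_holo[OF a(2)] holo_subset[OF S open_ball sub])
    \<comment> \<open>The factor h k makes the equation trivial at those real points where the local
      representation says nothing about F. It is cancelled again once the equation holds on the
      whole ball.\<close>
    have 0: "(g z - S z * h z) * (h z * k z) = 0" if "z \<in> ball p0 r" for z
    proof (rule holo_totally_real[where U = "ball p0 r" and a = a and b = b and c = c])
      show "holo (\<lambda>z. (g z - S z * h z) * (h z * k z)) (ball p0 r)"
        by (intro holo_mult hg holo_nz_holo[OF a(2)] holo_nz_holo[OF a(3)])
      show "(complex_of_real a, complex_of_real b, c) \<in> ball p0 r" using r by (simp add: p0_def)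
      fix x y :: real and z assume z: "(complex_of_real x, complex_of_real y, z) \<in> ball p0 r"
      let ?z = "(complex_of_real x, complex_of_real y, z)"
      have "F ?z = S ?z" using z r by (intro eq) auto
      then show "(g ?z - S ?z * h ?z) * (h ?z * k ?z) = 0" using a(4)[OF z] by (cases "h ?z = 0 \<or> k ?z = 0") auto
    qed (use that in auto)
    have "g z = S z * h z" if "z \<in> ball p0 r" for z proof -
      have "g z - S z * h z = 0" by (rule holo_nz_zero[where g = "\<lambda>z. g z - S z * h z", OF holo_nz_mult[OF a(2,3)] hg _ that])
          (use 0 in auto)
      then show ?thesis by simp
    qed
    then show ?thesis using r sub by (intro good[of g h k p0 r]) auto
  qed
  have "P q" if q: "q \<in> V" for q proof (rule connected_induction_simple[OF convex_connected[OF V],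
        where P = P and a = p0 and b = q])
    fix p assume p: "p \<in> V"
    obtain r g h k where r: "r > 0" "ball p r \<subseteq> V" "mero_rep F g h k (ball p r)" by (rule mero_repE[OF F p oV p])
    note a = mero_repD[OF r(3)]
    have hg: "holo (\<lambda>z. g z - S z * h z) (ball p r)"
      by (intro holo_diff holo_mult a(1) holo_nz_holo[OF a(2)] holo_subset[OF S open_ball r(2)])
    have step: "P y" if x: "x \<in> ball p r" "P x" and y: "y \<in> ball p r" for x y proof -
      obtain U k' where U: "x \<in> U" "holo_nz k' U" "\<And>z. z \<in> U \<Longrightarrow> k' z \<noteq> 0 \<Longrightarrow> F z = S z" using x(2) unfolding P_def by blast
      define B where "B = U \<inter> ball p r"
      have B: "open B" "x \<in> B" "B \<subseteq> U" "B \<subseteq> ball p r" using holo_nz_open[OF U(2)] U(1) x(1) by (auto simp: B_def)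
      have "g z - S z * h z = 0" if "z \<in> B" for z
      proof (rule holo_nz_zero[where g = "\<lambda>z. g z - S z * h z" and U = B and k = "\<lambda>z. k z * h z * k' z"])
        show "holo_nz (\<lambda>z. k z * h z * k' z) B"
          by (intro holo_nz_mult holo_nz_subset[OF a(2)] holo_nz_subset[OF a(3)] holo_nz_subset[OF U(2)] B)
        show "holo (\<lambda>z. g z - S z * h z) B" by (rule holo_subset[OF hg B(1,4)])
        fix z assume z: "z \<in> B" "k z * h z * k' z \<noteq> 0"
        then have "F z = g z / h z" "F z = S z" using a(4)[of z] U(3)[of z] B by auto
        then show "g z - S z * h z = 0" using z(2) by auto
      qed (rule that)
      then have "g z - S z * h z = 0" if "z \<in> ball p r" for z
        using holo_identity[OF hg convex_ball B(1,4) _ _ that] B(2) by blast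
      then show ?thesis by (intro good[OF r(3,2) y]) simp
    qed
    show "\<exists>T. openin (top_of_set V) T \<and> p \<in> T \<and> (\<forall>x\<in>T. \<forall>y\<in>T. P x \<longrightarrow> P y)" proof (intro exI[of _ "ball p r"] conjI ballI impI)
      show "openin (top_of_set V) (ball p r)" using r(2) oV by (simp add: open_subset)
      show "p \<in> ball p r" using r(1) by simp
      fix x y assume "x \<in> ball p r" "y \<in> ball p r" "P x"
      then show "P y" by (intro step[of x y])
    qed
  qed (use q X \<open>P p0\<close> in \<open>auto simp: p0_def\<close>)
  have "mero_eq F (\<lambda>z. S z / 1) V" unfolding mero_eq_def proof
    fix p assume "p \<in> V"
    then obtain U k where "p \<in> U" "holo_nz k U" "\<forall>z\<in>U. k z \<noteq> 0 \<longrightarrow> F z = S z"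
      using \<open>\<And>q. q \<in> V \<Longrightarrow> P q\<close>[of p] unfolding P_def by auto
    then show "\<exists>U k. p \<in> U \<and> holo_nz k U \<and> (\<forall>z\<in>U. k z \<noteq> 0 \<longrightarrow> F z = S z / 1)" by (intro exI[of _ U] exI[of _ k]) simp
  qed
  then show ?thesis unfolding mero_quotient_def using S holo_nz_const1[OF oV] by simp
qed

section \<open>Restriction to a hyperplane\<close>

text \<open>The hyperplane l = 0 written as a graph: \<phi> parametrises it, \<pi> projects along
  the transversal direction e, and l is normalised to have slope 1 along e, so that s itself
  measures the distance from the hyperplane on a transversal line.\<close>

locale graph_hyperplane =
  fixes \<phi> :: "'a::cnormed_space \<Rightarrow> 'b::cnormed_space"
    and \<pi> :: "'b \<Rightarrow> 'a" and l :: "'b \<Rightarrow> complex" and e :: 'b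
  assumes cdiff_phi: "cdiff \<phi> u" and linear_phi: "linear \<phi>"
    and isCont_pi: "isCont \<pi> z" and cdiff_l: "cdiff l z"
    and pi_phi: "\<pi> (\<phi> u) = u" and l_phi: "l (\<phi> u) = 0"
    and decomp: "\<phi> (\<pi> z) + scaleC (l z) e = z"
    and l_shift: "l (z + scaleC s e) = l z + s"
begin

lemma holo_nz_l: "open W \<Longrightarrow> holo_nz l W"
  unfolding holo_nz_iff
proof (intro conjI allI impI; (elim conjE)?)
  assume "open W"
  then show "holo l W" by (intro holoI cdiff_l)
next
  fix V :: "'b set" assume "open V" "V \<noteq> {}"
  then obtain p where p: "p \<in> V" by blast
  show "\<exists>p\<in>V. l p \<noteq> 0" proof (cases "l p = 0")
    case True
    have "open {s. p + scaleC s e \<in> V}" using \<open>open V\<close> by (rule open_slice)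
    moreover have "0 \<in> {s. p + scaleC s e \<in> V}" using p by simp
    ultimately obtain d where d: "d > 0" "ball 0 d \<subseteq> {s. p + scaleC s e \<in> V}" by (rule openE)
    have "complex_of_real (d / 2) \<in> ball 0 d" using d(1) by simp
    with d have "p + scaleC (of_real (d / 2)) e \<in> V" by blast
    moreover have "l (p + scaleC (of_real (d / 2)) e) \<noteq> 0" using d(1) True by (simp add: l_shift)
    ultimately show ?thesis by blast
  qed (use p in blast)
qed

text \<open>As long as numerator and denominator both vanish on the hyperplane, l can be divided out
  of both. The process stops because each division lowers the order of the denominator's zero on one
  fixed transversal line, and that order is finite.\<close>

lemma mero_rep_reduce:
  assumes "mero_rep F g h k (ball (\<phi> a) r)" "r > 0"
  shows "\<exists>g' h' k'. mero_rep F g' h' k' (ball (\<phi> a) r) \<and>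
    (\<exists>u. \<phi> u \<in> ball (\<phi> a) r \<and> (g' (\<phi> u) \<noteq> 0 \<or> h' (\<phi> u) \<noteq> 0))"
proof -
  define W where "W = ball (\<phi> a) r"
  have W: "open W" "convex W" "\<phi> a \<in> W" using assms(2) by (auto simp: W_def)
  have rep: "mero_rep F g h k W" using assms(1) by (simp add: W_def)
  have h: "holo_nz h W" using rep by (simp add: mero_rep_def)
  \<comment> \<open>The point has to satisfy two conditions: the denominator is nonzero there, and
    its foot on the hyperplane still lies in W. The transversal through the foot then carries a
    denominator that is not identically zero.\<close>
  obtain z1 where z1: "z1 \<in> W" "h z1 \<noteq> 0" "\<phi> (\<pi> z1) \<in> W" proof -
    have "isCont (\<lambda>z. \<phi> (\<pi> z)) z" for z by (rule isCont_o2[OF isCont_pi cdiff_isCont[OF cdiff_phi]])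
    then have "open ((\<lambda>z. \<phi> (\<pi> z)) -` W)" by (intro open_vimage[OF W(1)] continuous_at_imp_continuous_on) auto
    then have "open (W \<inter> (\<lambda>z. \<phi> (\<pi> z)) -` W)" using W(1) by (intro open_Int)
    moreover have "\<phi> a \<in> W \<inter> (\<lambda>z. \<phi> (\<pi> z)) -` W" using W(3) by (simp add: pi_phi)
    ultimately have "\<exists>z\<in>W \<inter> (\<lambda>z. \<phi> (\<pi> z)) -` W. h z \<noteq> 0" by (intro holo_nzD[OF h]) auto
    then show thesis using that by blast
  qed
  define u1 where "u1 = \<pi> z1"
  define S where "S = {s. \<phi> u1 + scaleC s e \<in> W}"
  have S: "open S" "convex S" "0 \<in> S" "l z1 \<in> S"
    unfolding S_def using open_slice[OF W(1)] convex_slice[OF W(2)] z1 decomp[of z1] by (simp_all add: u1_def)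
  \<comment> \<open>Here m is the order of vanishing of h' at s = 0 on the transversal through
    \<phi> u1; it is the induction variable.\<close>
  define Q where "Q m h' \<longleftrightarrow> (\<exists>d>0. ball 0 d \<subseteq> S \<and> (\<exists>G. G holomorphic_on ball 0 d \<and> G 0 \<noteq> 0 \<and>
      (\<forall>s\<in>ball 0 d - {0}. h' (\<phi> u1 + scaleC s e) = G s * s ^ m)))" for m and h' :: "'b \<Rightarrow> complex"
  have "\<exists>m. Q m h" proof -
    let ?H = "\<lambda>s. h (\<phi> u1 + scaleC s e)"
    have "?H holomorphic_on S" unfolding S_def by (rule holo_slice[OF holo_nz_holo[OF h]])
    moreover have "\<exists>s\<in>S. ?H s \<noteq> 0" using S(4) z1 decomp[of z1] by (intro bexI[of _ "l z1"]) (simp_all add: u1_def)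
    ultimately obtain d where d: "d > 0" "cball 0 d \<subseteq> S" "zor_poly ?H 0 holomorphic_on cball 0 d"
      "\<forall>w\<in>cball 0 d. ?H w = zor_poly ?H 0 w * (w - 0) ^ nat (zorder ?H 0) \<and> zor_poly ?H 0 w \<noteq> 0"
      using zorder_exist_zero[of ?H S 0] S convex_connected by blast
    then have "Q (nat (zorder ?H 0)) h" unfolding Q_def by (intro exI[of _ d] conjI exI[of _ "zor_poly ?H 0"])
        (auto elim: holomorphic_on_subset simp: subset_iff)
    then show ?thesis by blast
  qed
  then obtain m where "Q m h" by blast
  then show ?thesis using rep proof (induction m arbitrary: g h k)
    case (0 g h k)
    then obtain d G where d: "d > 0" "ball 0 d \<subseteq> S" "G holomorphic_on ball 0 d" "G 0 \<noteq> 0"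
      "\<And>s. s \<in> ball 0 d \<Longrightarrow> s \<noteq> 0 \<Longrightarrow> h (\<phi> u1 + scaleC s e) = G s" unfolding Q_def by auto
    have h: "holo h W" using 0(2) by (simp add: mero_rep_def holo_nz_holo)
    have "(\<lambda>s. h (\<phi> u1 + scaleC s e)) holomorphic_on S" unfolding S_def by (rule holo_slice[OF h])
    then have "isCont (\<lambda>s. h (\<phi> u1 + scaleC s e)) 0"
      using S by (metis continuous_on_eq_continuous_at holomorphic_on_imp_continuous_on)
    then have 1: "(\<lambda>s. h (\<phi> u1 + scaleC s e)) \<midarrow>0\<rightarrow> h (\<phi> u1)" by (simp add: isCont_def)
    have "isCont G 0" using d(1,3) by (metis centre_in_ball continuous_on_eq_continuous_at
          holomorphic_on_imp_continuous_on open_ball)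
    then have 2: "G \<midarrow>0\<rightarrow> G 0" by (simp add: isCont_def)
    have "\<forall>\<^sub>F s in at 0. h (\<phi> u1 + scaleC s e) = G s"
      unfolding eventually_at using d(1,5) by (intro exI[of _ d]) (auto simp: dist_norm)
    then have "G \<midarrow>0\<rightarrow> h (\<phi> u1)" using 1 by (rule Lim_transform_eventually[rotated])
    then have "h (\<phi> u1) = G 0" using 2 by (rule LIM_unique)
    then have "h (\<phi> u1) \<noteq> 0" using d(4) by simp
    moreover have "\<phi> u1 \<in> W" using z1 by (simp add: u1_def)
    ultimately show ?case using 0(2) unfolding W_def by blast
  next
    case (Suc m g h k)
    show ?case proof (cases "\<exists>u. \<phi> u \<in> W \<and> (g (\<phi> u) \<noteq> 0 \<or> h (\<phi> u) \<noteq> 0)")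
      case True
      then show ?thesis using Suc.prems(2) unfolding W_def by blast
    next
      case False
      note a = mero_repD[OF Suc.prems(2)]
      have zero: "g z = 0" "h z = 0" if "z \<in> W" "l z = 0" for z proof -
        have "\<phi> (\<pi> z) = z" using decomp[of z] that(2) by simp
        then show "g z = 0" "h z = 0" using False that(1) by metis+
      qed
      obtain g1 where g1: "holo g1 W" "\<And>z. z \<in> W \<Longrightarrow> g z = l z * g1 z"
        using holo_divide_out[OF a(1) cdiff_l l_shift zero(1)] by blast
      obtain h1 where h1: "holo h1 W" "\<And>z. z \<in> W \<Longrightarrow> h z = l z * h1 z"
        using holo_divide_out[OF holo_nz_holo[OF a(2)] cdiff_l l_shift zero(2)] by blast
      have "holo_nz h1 W" unfolding holo_nz_iff proof (intro conjI allI impI h1(1); elim conjE)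
        fix V assume V: "open V" "V \<subseteq> W" "V \<noteq> {}"
        then obtain p where "p \<in> V" "h p \<noteq> 0" using holo_nzD[OF a(2)] by blast
        then show "\<exists>p\<in>V. h1 p \<noteq> 0" using h1(2)[of p] V by auto
      qed
      \<comment> \<open>The exceptional function gains the factor l: on the hyperplane the old
        quotient was 0 / 0 and gives no information about the new one.\<close>
      then have "mero_rep F g1 h1 (\<lambda>z. k z * l z) W"
        unfolding mero_rep_def using g1 h1 holo_nz_mult[OF a(3) holo_nz_l[OF W(1)]] a(4) by auto
      moreover have "Q m h1" proof -
        obtain d G where d: "d > 0" "ball 0 d \<subseteq> S" "G holomorphic_on ball 0 d" "G 0 \<noteq> 0"
          "\<And>s. s \<in> ball 0 d \<Longrightarrow> s \<noteq> 0 \<Longrightarrow> h (\<phi> u1 + scaleC s e) = G s * s ^ Suc m" using Suc.prems(1) unfolding Q_def by auto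
        have "h1 (\<phi> u1 + scaleC s e) = G s * s ^ m" if "s \<in> ball 0 d" "s \<noteq> 0" for s proof -
          have "\<phi> u1 + scaleC s e \<in> W" using that d(2) by (auto simp: S_def)
          then have "h (\<phi> u1 + scaleC s e) = l (\<phi> u1 + scaleC s e) * h1 (\<phi> u1 + scaleC s e)" by (rule h1(2))
          then have "G s * s ^ Suc m = s * h1 (\<phi> u1 + scaleC s e)" unfolding d(5)[OF that] l_shift l_phi by simp
          moreover have "G s * s ^ Suc m = s * (G s * s ^ m)" by (simp add: mult.left_commute)
          ultimately have "s * h1 (\<phi> u1 + scaleC s e) = s * (G s * s ^ m)" by argo
          then show ?thesis using mult_left_cancel[OF that(2)] by metis
        qed
        then show ?thesis unfolding Q_def using d by blast
      qed
      ultimately show ?thesis by (rule Suc.IH[rotated])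
    qed
  qed
qed

text \<open>The points where the pullback is correct are spread over the connected set A. Around
  each point a reduced representation is chosen; if the pullback is correct somewhere in its
  neighbourhood U, it is correct through this representation on all of U.\<close>

lemma mero_pullback_eq_propagate:
  assumes F: "mero F B" and f: "mero f A" and A: "open A" "convex A" "\<phi> ` A \<subseteq> B"
    and "open B"
    and p0: "p0 \<in> A" "mero_quotient F g0 h0 W0" "p0 \<in> U0" "\<phi> ` U0 \<subseteq> W0"
      "mero_quotient f (g0 \<circ> \<phi>) (h0 \<circ> \<phi>) U0"
  shows "mero_pullback_eq F \<phi> f A"
proof -
  define P where "P p \<longleftrightarrow> (\<exists>W g h U. mero_quotient F g h W \<and> p \<in> U \<and> \<phi> ` U \<subseteq> W \<and>
        mero_quotient f (g \<circ> \<phi>) (h \<circ> \<phi>) U)" for p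
  have "P q" if q: "q \<in> A" for q proof (rule connected_induction_simple[OF convex_connected[OF A(2)],
        where P = P and a = p0 and b = q])
    fix a assume a: "a \<in> A"
    obtain rf gf hf kf where rf: "rf > 0" "ball a rf \<subseteq> A" "mero_rep f gf hf kf (ball a rf)" by (rule mero_repE[OF f a A(1) a])
    note ff = mero_repD[OF rf(3)]
    have "open (\<pi> -` ball a rf)" by (intro open_vimage continuous_at_imp_continuous_on) (auto intro: isCont_pi)
    moreover have "\<phi> a \<in> \<pi> -` ball a rf" using rf by (simp add: pi_phi)
    moreover have "\<phi> a \<in> B" using a A(3) by auto
    ultimately obtain r g1 h1 k1 where r: "r > 0" "ball (\<phi> a) r \<subseteq> \<pi> -` ball a rf"
      "mero_rep F g1 h1 k1 (ball (\<phi> a) r)" using mero_repE[OF F, of "\<phi> a" "\<pi> -` ball a rf"] by metis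
    obtain g h k u where ghk: "mero_rep F g h k (ball (\<phi> a) r)"
      and u: "\<phi> u \<in> ball (\<phi> a) r" "g (\<phi> u) \<noteq> 0 \<or> h (\<phi> u) \<noteq> 0" using mero_rep_reduce[OF r(3,1)] by blast
    define W where "W = ball (\<phi> a) r"
    note FF = mero_repD[OF ghk, folded W_def]
    define U where "U = \<phi> -` W"
    have U: "open U" "convex U" "a \<in> U" unfolding U_def using r(1) by (auto simp: W_def linear_phi
          intro!: open_vimage_cdiff cdiff_phi convex_linear_vimage)
    have Usub: "U \<subseteq> ball a rf" proof
      fix v assume "v \<in> U"
      then have "\<pi> (\<phi> v) \<in> ball a rf" using r(2) by (auto simp: U_def W_def)
      then show "v \<in> ball a rf" by (simp add: pi_phi)
    qed
    have hol: "holo (\<lambda>v. j (\<phi> v)) U" if "holo j W" for j using U by (intro holo_compose[OF that] cdiff_phi) (auto simp: U_def)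
    have step: "P y" if x: "x \<in> U" "P x" and y: "y \<in> U" for x y proof -
      obtain W' g' h' U' where q: "mero_quotient F g' h' W'" "x \<in> U'" "\<phi> ` U' \<subseteq> W'"
        "mero_quotient f (g' \<circ> \<phi>) (h' \<circ> \<phi>) U'" using x(2) unfolding P_def by blast
      have "\<phi> x \<in> W'" using q by auto
      then obtain V' k' where V': "\<phi> x \<in> V'" "V' \<subseteq> W'" "mero_rep F g' h' k' V'" using mero_quotient_rep[OF q(1)] by blast
      obtain V'' k'' where V'': "x \<in> V''" "V'' \<subseteq> U'" "mero_rep f (g' \<circ> \<phi>) (h' \<circ> \<phi>) k'' V''"
        using mero_quotient_rep[OF q(4,2)] by blast
      have oVV: "open (V' \<inter> W)" using mero_rep_open[OF V'(3)] by (auto simp: W_def)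
      have gh: "g z * h' z = g' z * h z" if "z \<in> V' \<inter> W" for z
        by (rule mero_rep_unique[OF mero_rep_subset[OF ghk oVV] mero_rep_subset[OF V'(3) oVV] that]) (auto simp: W_def)
      define V where "V = V'' \<inter> U \<inter> \<phi> -` V'"
      have V: "open V" "x \<in> V" "V \<subseteq> U" "V \<subseteq> V''" "\<And>v. v \<in> V \<Longrightarrow> \<phi> v \<in> V' \<inter> W"
        using mero_rep_open[OF V''(3)] U(1) open_vimage_cdiff[OF cdiff_phi mero_rep_open[OF V'(3)]]
          x(1) V''(1) V'(1) by (auto simp: V_def U_def)
      have h'nz: "holo_nz (h' \<circ> \<phi>) V" "holo_nz k'' V"
        and fV: "\<And>v. v \<in> V \<Longrightarrow> k'' v \<noteq> 0 \<Longrightarrow> f v = g' (\<phi> v) / h' (\<phi> v)"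
        using mero_rep_subset[OF V''(3) V(1,4)] by (simp_all add: mero_rep_def)
      \<comment> \<open>If h vanished on the hyperplane near a, comparison with the known
        representation g'/h' would force g to vanish there too, first on V and then on U. This
        contradicts the choice of a reduced pair.\<close>
      have h_nz: "holo_nz (\<lambda>v. h (\<phi> v)) U" proof (rule ccontr)
        assume "\<not> ?thesis"
        then have 0: "h (\<phi> v) = 0" if "v \<in> U" for v using holo_nz_convex[OF hol[OF holo_nz_holo[OF FF(2)]] U(2) that] by blast
        have "g (\<phi> v) = 0" if "v \<in> V" for v
        proof (rule holo_nz_zero[where g = "\<lambda>v. g (\<phi> v)", OF h'nz(1) holo_subset[OF hol[OF FF(1)] V(1,3)] _ that])
          fix v assume v: "v \<in> V" "(h' \<circ> \<phi>) v \<noteq> 0"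
          then have "v \<in> U" using V(3) by blast
          then show "g (\<phi> v) = 0" using gh[OF V(5)[OF v(1)]] 0[of v] v by simp
        qed
        then have "g (\<phi> v) = 0" if "v \<in> U" for v using holo_identity[OF hol[OF FF(1)] U(2) V(1,3) _ _ that] V(2) by blast
        with 0 u show False by (auto simp: U_def W_def)
      qed
      have eq: "gf v * h (\<phi> v) - g (\<phi> v) * hf v = 0" if "v \<in> U" for v proof -
        let ?d = "\<lambda>v. gf v * h (\<phi> v) - g (\<phi> v) * hf v"
        have hd: "holo ?d U" by (intro holo_diff holo_mult hol FF(1) holo_nz_holo[OF FF(2)]
              holo_subset[OF ff(1) U(1) Usub] holo_subset[OF holo_nz_holo[OF ff(2)] U(1) Usub])
        have Vsub: "V \<subseteq> ball a rf" using V(3) Usub by blast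
        have "?d v = 0" if "v \<in> V" for v proof (rule holo_nz_zero[where g = ?d, OF _ holo_subset[OF hd V(1,3)] _ that])
          show "holo_nz (\<lambda>v. hf v * kf v * ((h' \<circ> \<phi>) v * k'' v)) V"
            by (intro holo_nz_mult h'nz holo_nz_subset[OF ff(2) V(1) Vsub]
                holo_nz_subset[OF ff(3) V(1) Vsub])
          fix v assume v: "v \<in> V" "hf v * kf v * ((h' \<circ> \<phi>) v * k'' v) \<noteq> 0"
          then have 1: "gf v / hf v = g' (\<phi> v) / h' (\<phi> v)" "hf v \<noteq> 0" "h' (\<phi> v) \<noteq> 0" using fV[of v] ff(4)[of v] Vsub by auto
          have 2: "g (\<phi> v) * h' (\<phi> v) = g' (\<phi> v) * h (\<phi> v)" by (rule gh[OF V(5)[OF v(1)]])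
          have "h' (\<phi> v) * ?d v = (gf v * h' (\<phi> v)) * h (\<phi> v) - (g (\<phi> v) * h' (\<phi> v)) * hf v" by (simp add: algebra_simps)
          also have "gf v * h' (\<phi> v) = g' (\<phi> v) * hf v" using 1 by (simp add: field_simps)
          finally have "h' (\<phi> v) * ?d v = 0" unfolding 2 by simp
          then show "?d v = 0" using 1(3) by simp
        qed
        then show ?thesis using holo_identity[OF hd U(2) V(1,3) _ _ that] V(2) by blast
      qed
      have "mero_rep f (\<lambda>v. g (\<phi> v)) (\<lambda>v. h (\<phi> v)) (\<lambda>v. hf v * kf v * h (\<phi> v)) U" unfolding mero_rep_def
      proof (intro conjI ballI impI hol FF(1) h_nz holo_nz_mult
          holo_nz_subset[OF ff(2) U(1) Usub] holo_nz_subset[OF ff(3) U(1) Usub])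
        fix v assume v: "v \<in> U" "hf v * kf v * h (\<phi> v) \<noteq> 0"
        then have "f v = gf v / hf v" using ff(4)[of v] Usub by auto
        then show "f v = g (\<phi> v) / h (\<phi> v)" using eq[OF v(1)] v(2) by (simp add: frac_eq_eq)
      qed
      from mero_rep_quotient[OF this] mero_rep_quotient[OF ghk] y
      show "P y" unfolding P_def comp_def by (intro exI[of _ "ball (\<phi> a) r"] exI[of _ g] exI[of _ h] exI[of _ U])
          (auto simp: U_def W_def)
    qed
    have "U \<subseteq> A" using Usub rf(2) by simp
    show "\<exists>T. openin (top_of_set A) T \<and> a \<in> T \<and> (\<forall>x\<in>T. \<forall>y\<in>T. P x \<longrightarrow> P y)" proof (intro exI[of _ U] conjI ballI impI U(3))
      show "openin (top_of_set A) U" using U(1) A(1) \<open>U \<subseteq> A\<close> by (simp add: open_subset)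
      fix x y assume "x \<in> U" "y \<in> U" "P x"
      then show "P y" by (intro step[of x y])
    qed
  next
    show "P p0" unfolding P_def by (intro exI conjI) (rule p0)+
  qed (use p0 q in auto)
  then show ?thesis unfolding mero_pullback_eq_def P_def by simp
qed

end

section \<open>Estimates for the integral kernels\<close>

lemma norm_sinh_ge:
  assumes "Re z \<ge> 0"
  shows "cmod (sinh z) \<ge> sinh (Re z)"
proof -
  have "2 * cmod (sinh z) = cmod (exp z - exp (- z))" by (simp add: sinh_field_def norm_divide)
  also have "\<dots> \<ge> exp (Re z) - exp (- Re z)" using norm_triangle_ineq2[of "exp z" "exp (- z)"] by simp
  also have "exp (Re z) - exp (- Re z) = 2 * sinh (Re z)" by (simp add: sinh_field_def)
  finally show ?thesis by simp
qed

lemma norm_sin_le_exp: "cmod (sin z) \<le> exp \<bar>Im z\<bar>"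
proof -
  have "2 * cmod (sin z) = cmod (exp (\<i> * z) - exp (- (\<i> * z)))" by (simp add: sin_exp_eq norm_divide norm_mult)
  also have "\<dots> \<le> exp (- Im z) + exp (Im z)" by (rule order_trans[OF norm_triangle_ineq4]) simp
  also have "\<dots> \<le> exp \<bar>Im z\<bar> + exp \<bar>Im z\<bar>" by (intro add_mono) auto
  finally show ?thesis by simp
qed

lemma norm_cos_le_exp: "cmod (cos z) \<le> exp \<bar>Im z\<bar>"
  using norm_sin_le_exp[of "cpi / 2 - z"] unfolding cos_sin_eq by simp

lemma sinh_ge_self: "(x::real) \<ge> 0 \<Longrightarrow> sinh x \<ge> x"
  using real_le_x_sinh[of x] by (simp add: sinh_field_def exp_minus)

lemma norm_sin_minus: "cmod (sin z - z) \<le> exp (cmod z) * cmod z ^ 3"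
proof -
  have "{..2::nat} = {0, 1, 2}" by auto
  then have "cmod (sin z - z) \<le> exp \<bar>Im z\<bar> * cmod z ^ 3 / 2"
    using Taylor_sin[of z 2] by (simp add: sin_coeff_def numeral_3_eq_3)
  also have "\<dots> \<le> exp (cmod z) * cmod z ^ 3" proof -
    have "exp \<bar>Im z\<bar> * cmod z ^ 3 \<le> exp (cmod z) * cmod z ^ 3" using abs_Im_le_cmod[of z] by (intro mult_right_mono) auto
    moreover have "exp \<bar>Im z\<bar> * cmod z ^ 3 \<ge> 0" by simp
    ultimately show ?thesis by linarith
  qed
  finally show ?thesis .
qed

lemma norm_sinh_minus: "cmod (sinh z - z) \<le> exp (cmod z) * cmod z ^ 3"
proof -
  have "sinh z - z = - \<i> * (sin (\<i> * z) - \<i> * z)" by (simp add: sinh_conv_sin algebra_simps)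
  then show ?thesis using norm_sin_minus[of "\<i> * z"] by (simp add: norm_mult)
qed

lemma norm_cos_minus: "cmod (cos z - 1) \<le> exp (cmod z) * (cmod z)\<^sup>2"
proof -
  have "{..1::nat} = {0, 1}" by auto
  then have "cmod (cos z - 1) \<le> exp \<bar>Im z\<bar> * (cmod z)\<^sup>2" using Taylor_cos[of z 1] by (simp add: cos_coeff_def numeral_2_eq_2)
  also have "\<dots> \<le> exp (cmod z) * (cmod z)\<^sup>2" using abs_Im_le_cmod[of z] by (intro mult_right_mono) auto
  finally show ?thesis .
qed

text \<open>This form is bounded as y tends to 0, with limit 1/w, so that singularities at 0 become
  differences of bounded quantities.\<close>

definition sinh_ratio :: "complex \<Rightarrow> real \<Rightarrow> complex" where
  "sinh_ratio w y = of_real y / sinh (w * of_real y)"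

lemma sinh_nonzero:
  assumes "Re w > 0" "y > 0"
  shows "sinh (w * of_real y) \<noteq> 0"
proof -
  have "0 < Re w * y" using assms by simp
  also have "\<dots> \<le> cmod (sinh (w * of_real y))" using norm_sinh_ge[of "w * of_real y"] sinh_ge_self[of "Re w * y"] assms by simp
  finally show ?thesis by auto
qed

definition sinh_bound where
  "sinh_bound a R C \<longleftrightarrow> C > 0 \<and> (\<forall>w y. a \<le> Re w \<and> cmod w \<le> R \<and> y > 0 \<longrightarrow>
     cmod (sinh_ratio w y) \<le> C \<and> (y \<le> 1 \<longrightarrow> cmod (sinh_ratio w y - 1 / w) \<le> C * y\<^sup>2) \<and>
     (y \<ge> 1 \<longrightarrow> cmod (sinh_ratio w y) \<le> C * y * exp (- Re w * y)))"

lemma sinh_boundD: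
  assumes "sinh_bound a R C"
  shows "C > 0" and "a \<le> Re w \<Longrightarrow> cmod w \<le> R \<Longrightarrow> y > 0 \<Longrightarrow>
     cmod (sinh_ratio w y) \<le> C \<and> (y \<le> 1 \<longrightarrow> cmod (sinh_ratio w y - 1 / w) \<le> C * y\<^sup>2) \<and>
     (y \<ge> 1 \<longrightarrow> cmod (sinh_ratio w y) \<le> C * y * exp (- Re w * y))" using assms unfolding sinh_bound_def by blast+

lemma sinh_ratio_bounds:
  assumes "a > 0"
  shows "\<exists>C. sinh_bound a R C"
proof -
  define c where "c = 1 - exp (- 2 * a)"
  have c: "c > 0" using assms by (simp add: c_def)
  define C where "C = 1 / a + exp \<bar>R\<bar> * \<bar>R\<bar> ^ 3 / a\<^sup>2 + 2 / c"
  have C1: "1 / a \<le> C" "exp \<bar>R\<bar> * \<bar>R\<bar> ^ 3 / a\<^sup>2 \<le> C" "2 / c \<le> C" "C > 0"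
    using assms c by (simp_all add: C_def add_nonneg_nonneg add_pos_nonneg)
  have "cmod (sinh_ratio w y) \<le> C \<and> (y \<le> 1 \<longrightarrow> cmod (sinh_ratio w y - 1 / w) \<le> C * y\<^sup>2) \<and>
     (y \<ge> 1 \<longrightarrow> cmod (sinh_ratio w y) \<le> C * y * exp (- Re w * y))" if w: "a \<le> Re w" "cmod w \<le> R" "y > 0" for w y
  proof (intro conjI impI)
    have s0: "Re w * y \<ge> 0" using w assms by simp
    have s1: "cmod (sinh (w * of_real y)) \<ge> sinh (Re w * y)" using norm_sinh_ge[of "w * of_real y"] s0 by simp
    have s2: "cmod (sinh (w * of_real y)) \<ge> a * y" using s1 sinh_ge_self[OF s0] mult_right_mono[OF w(1), of y] w(3) by linarith
    have ay: "a * y > 0" using assms w by simp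
    have "cmod (sinh_ratio w y) \<le> y / (a * y)" unfolding sinh_ratio_def norm_divide using s2 ay w(3) by (intro frac_le) auto
    then show "cmod (sinh_ratio w y) \<le> C" using C1(1) w(3) by simp
    { assume "y \<le> 1"
      have wn: "w \<noteq> 0" "cmod w \<ge> a" using w(1) assms complex_Re_le_cmod[of w] by auto
      have sn: "sinh (w * of_real y) \<noteq> 0" using s2 ay by auto
      have "sinh_ratio w y - 1 / w = - (sinh (w * of_real y) - w * of_real y) / (w * sinh (w * of_real y))"
        using wn sn by (simp add: sinh_ratio_def field_simps)
      then have "cmod (sinh_ratio w y - 1 / w)
          = cmod (sinh (w * of_real y) - w * of_real y) / (cmod w * cmod (sinh (w * of_real y)))"
        by (simp add: norm_divide norm_mult norm_minus_commute)
      also have "\<dots> \<le> (exp \<bar>R\<bar> * (\<bar>R\<bar> * y) ^ 3) / (a * (a * y))" proof (rule frac_le)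
        have 1: "cmod (w * of_real y) \<le> \<bar>R\<bar> * y" "\<bar>R\<bar> * y \<le> \<bar>R\<bar>"
          using w \<open>y \<le> 1\<close> mult_left_mono[of y 1 "\<bar>R\<bar>"] by (auto simp: norm_mult intro!: mult_right_mono)
        have "exp (cmod (w * of_real y)) * cmod (w * of_real y) ^ 3 \<le> exp \<bar>R\<bar> * (\<bar>R\<bar> * y) ^ 3"
          using 1 by (intro mult_mono power_mono) auto
        then show "cmod (sinh (w * of_real y) - w * of_real y) \<le> exp \<bar>R\<bar> * (\<bar>R\<bar> * y) ^ 3"
          using norm_sinh_minus order_trans by blast
        show "a * (a * y) \<le> cmod w * cmod (sinh (w * of_real y))" using wn(2) s2 assms w(3) by (intro mult_mono) auto
      qed (use assms ay w in auto)
      also have "\<dots> = exp \<bar>R\<bar> * \<bar>R\<bar> ^ 3 / a\<^sup>2 * y\<^sup>2" using w(3) assms by (simp add: field_simps power3_eq_cube power2_eq_square)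
      also have "\<dots> \<le> C * y\<^sup>2" using C1(2) by (intro mult_right_mono) auto
      finally show "cmod (sinh_ratio w y - 1 / w) \<le> C * y\<^sup>2" . }
    { assume y: "y \<ge> 1"
      have "exp t * exp (- 2 * t) = exp (- t)" for t :: real by (simp flip: exp_add)
      then have "2 * sinh (Re w * y) = exp (Re w * y) * (1 - exp (- 2 * (Re w * y)))"
        by (simp only: sinh_field_def right_diff_distrib) simp
      also have "\<dots> \<ge> exp (Re w * y) * c" proof -
        have "a \<le> Re w * y" using mult_mono[of a "Re w" 1 y] w(1) y assms by simp
        then show ?thesis unfolding c_def by (intro mult_left_mono) auto
      qed
      finally have "exp (Re w * y) * (c / 2) \<le> cmod (sinh (w * of_real y))" using s1 by simp
      then have "cmod (sinh_ratio w y) \<le> y / (exp (Re w * y) * (c / 2))"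
        unfolding sinh_ratio_def norm_divide using c w(3) by (intro frac_le) auto
      also have "\<dots> = 2 / c * y * exp (- Re w * y)" using c by (simp add: field_simps exp_minus)
      also have "\<dots> \<le> C * y * exp (- Re w * y)" using C1(3) w(3) by (intro mult_right_mono) auto
      finally show "cmod (sinh_ratio w y) \<le> C * y * exp (- Re w * y)" . }
  qed
  then show ?thesis unfolding sinh_bound_def using C1(4) by blast
qed

lemma sin_cos_bounds:
  "\<exists>C>0. \<forall>z y. cmod z \<le> R \<and> 0 < y \<and> y \<le> 1 \<longrightarrow>
     cmod (sin (2 * of_real y * z) / of_real y - 2 * z) \<le> C * y\<^sup>2 \<and>
     cmod (sin (2 * of_real y * z) / of_real y) \<le> C \<and>
     cmod (cos (2 * of_real y * z) - 1) \<le> C * y\<^sup>2 \<and> cmod (cos (2 * of_real y * z)) \<le> C"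
proof -
  define r where "r = 2 * \<bar>R\<bar>"
  define C1 where "C1 = exp r * r ^ 3"
  define C2 where "C2 = exp r * r\<^sup>2"
  define C where "C = C1 + C2 + r + 1"
  have r: "r \<ge> 0" by (simp add: r_def)
  then have nn: "C1 \<ge> 0" "C2 \<ge> 0" by (simp_all add: C1_def C2_def)
  have "cmod (sin (2 * of_real y * z) / of_real y - 2 * z) \<le> C * y\<^sup>2 \<and>
     cmod (sin (2 * of_real y * z) / of_real y) \<le> C \<and>
     cmod (cos (2 * of_real y * z) - 1) \<le> C * y\<^sup>2 \<and> cmod (cos (2 * of_real y * z)) \<le> C"
    if z: "cmod z \<le> R" and y: "0 < y" "y \<le> 1" for z y proof -
    define t where "t = 2 * of_real y * z"
    have y2: "y\<^sup>2 \<le> 1" "y\<^sup>2 > 0" using y by (simp_all add: power_le_one)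
    have t: "cmod t \<le> r * y" "cmod t \<le> r" proof -
      show 1: "cmod t \<le> r * y" using z y by (simp add: t_def r_def norm_mult mult_ac)
      have "r * y \<le> r" using r y by (simp add: mult_left_le)
      with 1 show "cmod t \<le> r" by linarith
    qed
    have "cmod (sin t / of_real y - 2 * z) = cmod (sin t - t) / y" proof -
      have "sin t / of_real y - 2 * z = (sin t - t) / of_real y" using y by (simp add: t_def field_simps)
      then show ?thesis using y by (simp add: norm_divide)
    qed
    also have "\<dots> \<le> exp r * (r * y) ^ 3 / y" proof (rule divide_right_mono)
      have "exp (cmod t) * cmod t ^ 3 \<le> exp r * (r * y) ^ 3" using t by (intro mult_mono power_mono) auto
      then show "cmod (sin t - t) \<le> exp r * (r * y) ^ 3" using norm_sin_minus order_trans by blast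
    qed (use y in simp)
    also have "\<dots> = C1 * y\<^sup>2" using y by (simp add: C1_def field_simps power3_eq_cube power2_eq_square)
    finally have 1: "cmod (sin t / of_real y - 2 * z) \<le> C1 * y\<^sup>2" .
    have "exp (cmod t) * (cmod t)\<^sup>2 \<le> exp r * (r * y)\<^sup>2" using t by (intro mult_mono power_mono) auto
    also have "\<dots> = C2 * y\<^sup>2" by (simp add: C2_def power_mult_distrib)
    finally have 2: "cmod (cos t - 1) \<le> C2 * y\<^sup>2" using norm_cos_minus order_trans by blast
    have C1y: "C1 * y\<^sup>2 \<le> C1" "C2 * y\<^sup>2 \<le> C2" using nn y2 by (simp_all add: mult_left_le)
    have "cmod (sin t / of_real y) \<le> cmod (sin t / of_real y - 2 * z) + cmod (2 * z)"
      using norm_triangle_ineq[of "sin t / of_real y - 2 * z" "2 * z"] by simp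
    then have 3: "cmod (sin t / of_real y) \<le> C1 + r" using 1 C1y z by (simp add: r_def norm_mult)
    have "cmod (cos t) \<le> cmod (cos t - 1) + 1" using norm_triangle_ineq[of "cos t - 1" 1] by simp
    then have 4: "cmod (cos t) \<le> C2 + 1" using 2 C1y by linarith
    have "C1 * y\<^sup>2 \<le> C * y\<^sup>2" "C2 * y\<^sup>2 \<le> C * y\<^sup>2" using nn r by (auto intro!: mult_right_mono simp: C_def)
    then show ?thesis using 1 2 3 4 nn r by (simp add: C_def t_def)
  qed
  moreover have "C > 0" using nn r by (simp add: C_def)
  ultimately show ?thesis by blast
qed

lemma norm_triple_diff:
  fixes A B C :: complex
  shows "cmod (A * B * C - a * b * c)
    \<le> cmod (A - a) * cmod B * cmod C + cmod a * cmod (B - b) * cmod C + cmod a * cmod b * cmod (C - c)"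
proof -
  have "A * B * C - a * b * c = (A - a) * B * C + a * (B - b) * C + a * b * (C - c)" by (simp add: algebra_simps)
  then show ?thesis by (metis (no_types, lifting) norm_mult norm_triangle_ineq norm_triangle_mono order_refl)
qed

lemma exp_decay_le: "0 < d \<Longrightarrow> 0 < y \<Longrightarrow> exp (- d * y) \<le> 1 / (d * (y::real))"
proof -
  assume "0 < d" "0 < y"
  then have "d * y \<le> exp (d * y)" "d * y > 0" using exp_ge_add_one_self[of "d * y"] by (linarith, simp)
  then show ?thesis by (simp add: exp_minus field_simps)
qed

lemma bound_inverse_square:
  fixes f :: "real \<Rightarrow> complex"
  assumes "C \<ge> 0" "y > 0" "y \<le> 1 \<Longrightarrow> cmod (f y) \<le> C" "y \<ge> 1 \<Longrightarrow> cmod (f y) \<le> C / y\<^sup>2"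
  shows "cmod (f y) \<le> 2 * C / (1 + y\<^sup>2)"
proof (cases "y \<le> 1")
  case True
  then have "1 + y\<^sup>2 \<le> 2" using assms(2) by (simp add: power_le_one)
  then have "C * (1 + y\<^sup>2) \<le> C * 2" using assms(1) by (rule mult_left_mono)
  then have "C \<le> 2 * C / (1 + y\<^sup>2)" by (simp add: field_simps add_pos_nonneg)
  with assms(3)[OF True] show ?thesis by simp
next
  case False
  then have y: "y \<ge> 1" by simp
  have "C / y\<^sup>2 \<le> C / ((1 + y\<^sup>2) / 2)" using assms(1) one_le_power[OF y, of 2]
    by (intro divide_left_mono mult_pos_pos) (auto intro: add_pos_nonneg)
  then show ?thesis using assms(4)[OF y] by (simp add: field_simps)
qed

definition G_kernel where
  "G_kernel (w1::complex) w2 z y =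
     (sin (2 * of_real y * z) / (2 * sinh (w1 * of_real y) * sinh (w2 * of_real y))
          - z / (w1 * w2 * of_real y)) / of_real y"

text \<open>The integrand of a representation of log (2 cosh (\<pi> z / w)); see
  \<open>exp_log_cosh\<close>.\<close>

definition lc_kernel where
  "lc_kernel (w::complex) z y = (1 / (w * of_real y) - cos (2 * of_real y * z) / sinh (w * of_real y)) / of_real y"

text \<open>What remains of the kernel of log G(m+u) - log G(m-u) after a multiple of
  \<open>lc_kernel\<close> is taken out. Its integral stays bounded as m moves along a horizontal
  line, so all growth is in the logarithm of cosh.\<close>

definition ratio_kernel where
  "ratio_kernel (w1::complex) w2 u m y = cos (2 * of_real y * m) *
     (sin (2 * of_real y * u) / sinh (w1 * of_real y) - 2 * u / w1) / (of_real y * sinh (w2 * of_real y))"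

text \<open>Each kernel is a difference of products of bounded factors, divided by the square of y.
  Near 0 the factors differ from their limits by terms quadratic in y, which compensates the
  denominator.\<close>

lemma kernel_eqs:
  assumes "Re w1 > 0" "Re w2 > 0" "y > 0"
  shows "G_kernel w1 w2 z y =
      ((sin (2 * of_real y * z) / of_real y) * sinh_ratio w1 y * sinh_ratio w2 y
        - (2 * z) * (1 / w1) * (1 / w2)) / (2 * of_real y ^ 2)"
    and "lc_kernel w1 z y = (1 * 1 * (1 / w1) - 1 * cos (2 * of_real y * z) * sinh_ratio w1 y) / of_real y ^ 2"
    and "ratio_kernel w1 w2 u m y = cos (2 * of_real y * m) *
      (1 * (sin (2 * of_real y * u) / of_real y) * sinh_ratio w1 y - 1 * (2 * u) * (1 / w1)) *
      sinh_ratio w2 y / of_real y ^ 2" using sinh_nonzero[OF assms(1,3)] sinh_nonzero[OF assms(2,3)] assms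
  by (auto simp: G_kernel_def lc_kernel_def ratio_kernel_def sinh_ratio_def field_simps
      power2_eq_square)

lemma exp_collect:
  fixes y :: real
  assumes "y \<noteq> 0"
  shows "(exp A / y) * (c * y * exp B) * (c * y * exp D) = c\<^sup>2 * y * exp (A + B + D)"
  using assms by (simp add: exp_add power2_eq_square)

text \<open>For large y the growth exp (2 y |Im z|) of the sine loses against the two hyperbolic
  sines with margin d; for small y the kernel is a difference of triple products. The bound is
  uniform so that it can serve as a local majorant in all variables.\<close>

lemma G_kernel_bound:
  assumes "a > 0" "d > 0"
  shows "\<exists>C. \<forall>w1 w2 z y. a \<le> Re w1 \<and> a \<le> Re w2 \<and> cmod w1 \<le> R \<and> cmod w2 \<le> R \<and> cmod z \<le> R \<and>
     2 * \<bar>Im z\<bar> + d \<le> Re w1 + Re w2 \<and> y > 0 \<longrightarrow> cmod (G_kernel w1 w2 z y) \<le> C / (1 + y\<^sup>2)"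
proof -
  obtain C1 where "sinh_bound a R C1" using sinh_ratio_bounds[OF assms(1), of R] by blast
  note C1 = sinh_boundD(1)[OF this] and B = sinh_boundD(2)[OF this]
  obtain C2 where C2: "C2 > 0" and SC: "\<And>z y. cmod z \<le> R \<Longrightarrow> 0 < y \<Longrightarrow> y \<le> 1 \<Longrightarrow>
     cmod (sin (2 * of_real y * z) / of_real y - 2 * z) \<le> C2 * y\<^sup>2 \<and>
     cmod (sin (2 * of_real y * z) / of_real y) \<le> C2" using sin_cos_bounds[of R] by blast
  define K1 where "K1 = C2 * C1 * C1 + 2 * \<bar>R\<bar> * C1 * C1 + 2 * \<bar>R\<bar> * (1 / a) * C1"
  define K2 where "K2 = C1\<^sup>2 / d + 2 * \<bar>R\<bar> * (1 / a) * (1 / a)"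
  define K where "K = K1 + K2"
  have nn: "K1 \<ge> 0" "K2 \<ge> 0"
    unfolding K1_def K2_def using C1 C2 assms by (auto intro!: add_nonneg_nonneg mult_nonneg_nonneg divide_nonneg_nonneg)
  have "cmod (G_kernel w1 w2 z y) \<le> 2 * K / (1 + y\<^sup>2)" if h: "a \<le> Re w1" "a \<le> Re w2" "cmod w1 \<le> R" "cmod w2 \<le> R" "cmod z \<le> R"
     "2 * \<bar>Im z\<bar> + d \<le> Re w1 + Re w2" "y > 0" for w1 w2 z y proof (rule bound_inverse_square)
    let ?A = "sin (2 * of_real y * z) / of_real y"
    let ?B = "sinh_ratio w1 y" and ?C = "sinh_ratio w2 y"
    let ?X = "?A * ?B * ?C - (2 * z) * (1 / w1) * (1 / w2)"
    have Gn: "cmod (G_kernel w1 w2 z y) = cmod ?X / (2 * y\<^sup>2)"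
      using kernel_eqs(1)[of w1 w2 y z] h assms by (simp add: norm_divide norm_mult norm_power)
    have wi: "cmod (1 / w1) \<le> 1 / a" "cmod (1 / w2) \<le> 1 / a" using h assms complex_Re_le_cmod[of w1] complex_Re_le_cmod[of w2]
      by (auto simp: norm_divide intro!: divide_left_mono mult_pos_pos)
    have zn: "cmod (2 * z) \<le> 2 * \<bar>R\<bar>" using h by (simp add: norm_mult)
    have y2: "y\<^sup>2 > 0" using h by simp
    { assume y1: "y \<le> 1"
      have "cmod ?X \<le> (C2 * y\<^sup>2) * C1 * C1 + (2 * \<bar>R\<bar>) * (C1 * y\<^sup>2) * C1 + (2 * \<bar>R\<bar>) * (1 / a) * (C1 * y\<^sup>2)"
        using SC[of z y] B[of w1 y] B[of w2 y] h y1 wi zn C1 C2 assms y2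
        by (intro order_trans[OF norm_triple_diff] add_mono mult_mono) auto
      also have "\<dots> = K1 * y\<^sup>2" by (simp add: K1_def algebra_simps)
      also have "\<dots> \<le> (2 * K) * y\<^sup>2" using nn by (intro mult_right_mono) (simp_all add: K_def)
      finally show "cmod (G_kernel w1 w2 z y) \<le> K" unfolding Gn using y2 by (simp add: pos_divide_le_eq mult_ac) }
    { assume y1: "y \<ge> 1"
      have "cmod ?A \<le> exp (2 * y * \<bar>Im z\<bar>) / y" using norm_sin_le_exp[of "2 * of_real y * z"] h
        by (auto simp: norm_divide abs_mult intro!: divide_right_mono)
      then have "cmod (?A * ?B * ?C) \<le> (exp (2 * y * \<bar>Im z\<bar>) / y) * (C1 * y * exp (- Re w1 * y)) * (C1 * y * exp (- Re w2 * y))"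
        unfolding norm_mult using B[of w1 y] B[of w2 y] h y1 C1 by (intro mult_mono) auto
      also have "\<dots> = C1\<^sup>2 * y * exp (- (Re w1 + Re w2 - 2 * \<bar>Im z\<bar>) * y)"
        using h by (subst exp_collect) (simp_all add: algebra_simps)
      also have "\<dots> \<le> C1\<^sup>2 * y * exp (- d * y)"
        using h C1 by (intro mult_left_mono iffD2[OF exp_le_cancel_iff] mult_right_mono) auto
      also have "\<dots> \<le> C1\<^sup>2 * y * (1 / (d * y))" using exp_decay_le[OF assms(2) h(7)] C1 h by (intro mult_left_mono) auto
      also have "\<dots> = C1\<^sup>2 / d" using h by simp
      finally have 1: "cmod (?A * ?B * ?C) \<le> C1\<^sup>2 / d" .
      have "cmod ((2 * z) * (1 / w1) * (1 / w2)) \<le> (2 * \<bar>R\<bar>) * (1 / a) * (1 / a)"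
        unfolding norm_mult[of _ "1 / w2"] norm_mult[of _ "1 / w1"] using wi zn assms by (intro mult_mono) auto
      with 1 have "cmod ?X \<le> K2"
        unfolding K2_def using norm_triangle_ineq4[of "?A * ?B * ?C" "(2 * z) * (1 / w1) * (1 / w2)"] by linarith
      also have "\<dots> \<le> 2 * K" using nn by (simp add: K_def)
      finally show "cmod (G_kernel w1 w2 z y) \<le> K / y\<^sup>2" unfolding Gn using y2 by (simp add: divide_simps) }
    show "K \<ge> 0" unfolding K_def using nn by linarith
  qed (use h in auto)
  then show ?thesis by blast
qed

lemma lc_kernel_bound:
  assumes "a > 0" "d > 0"
  shows "\<exists>C. \<forall>w z y. a \<le> Re w \<and> cmod w \<le> R \<and> cmod z \<le> R \<and>
     2 * \<bar>Im z\<bar> + d \<le> Re w \<and> y > 0 \<longrightarrow> cmod (lc_kernel w z y) \<le> C / (1 + y\<^sup>2)"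
proof -
  obtain C1 where "sinh_bound a R C1" using sinh_ratio_bounds[OF assms(1), of R] by blast
  note C1 = sinh_boundD(1)[OF this] and B = sinh_boundD(2)[OF this]
  obtain C2 where C2: "C2 > 0" and SC: "\<And>z y. cmod z \<le> R \<Longrightarrow> 0 < y \<Longrightarrow> y \<le> 1 \<Longrightarrow>
     cmod (cos (2 * of_real y * z) - 1) \<le> C2 * y\<^sup>2" using sin_cos_bounds[of R] by blast
  define K1 where "K1 = C2 * C1 + C1"
  define K2 where "K2 = 1 / a + C1 / d"
  define K where "K = K1 + K2"
  have nn: "K1 \<ge> 0" "K2 \<ge> 0" using C1 C2 assms by (simp_all add: K1_def K2_def)
  have "cmod (lc_kernel w z y) \<le> 2 * K / (1 + y\<^sup>2)"
    if h: "a \<le> Re w" "cmod w \<le> R" "cmod z \<le> R" "2 * \<bar>Im z\<bar> + d \<le> Re w" "y > 0" for w z y proof (rule bound_inverse_square)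
    let ?A = "cos (2 * of_real y * z)" and ?B = "sinh_ratio w y"
    let ?X = "1 * 1 * (1 / w) - 1 * ?A * ?B"
    have Gn: "cmod (lc_kernel w z y) = cmod ?X / y\<^sup>2"
      using kernel_eqs(2)[of w w y z] h assms by (simp add: norm_divide norm_mult norm_power)
    have wi: "cmod (1 / w) \<le> 1 / a" using h assms complex_Re_le_cmod[of w]
      by (auto simp: norm_divide intro!: divide_left_mono mult_pos_pos)
    have y2: "y\<^sup>2 > 0" using h by simp
    { assume y1: "y \<le> 1"
      have "cmod ?X = cmod (1 * ?A * ?B - 1 * 1 * (1 / w))" by (rule norm_minus_commute)
      also have "\<dots> \<le> cmod (1 - 1 :: complex) * cmod ?A * cmod ?B + cmod (1::complex) * (C2 * y\<^sup>2) * C1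
          + cmod (1::complex) * cmod (1::complex) * (C1 * y\<^sup>2)" using SC[of z y] B[of w y] h y1 C1 C2 y2
        by (intro order_trans[OF norm_triple_diff] add_mono mult_mono) auto
      also have "\<dots> = K1 * y\<^sup>2" by (simp add: K1_def algebra_simps)
      also have "\<dots> \<le> K * y\<^sup>2" using nn by (intro mult_right_mono) (simp_all add: K_def)
      finally show "cmod (lc_kernel w z y) \<le> K" unfolding Gn using y2 by (simp add: pos_divide_le_eq) }
    { assume y1: "y \<ge> 1"
      have "cmod ?A \<le> exp (2 * y * \<bar>Im z\<bar>)" using norm_cos_le_exp[of "2 * of_real y * z"] h by (auto simp: abs_mult)
      then have "cmod (1 * ?A * ?B) \<le> exp (2 * y * \<bar>Im z\<bar>) * (C1 * y * exp (- Re w * y))"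
        unfolding norm_mult using B[of w y] h y1 C1 by (simp add: mult_mono)
      also have "\<dots> = C1 * y * exp (- (Re w - 2 * \<bar>Im z\<bar>) * y)"
        by (simp add: left_diff_distrib exp_add exp_diff exp_minus mult_ac field_simps)
      also have "\<dots> \<le> C1 * y * exp (- d * y)"
        using h C1 by (intro mult_left_mono iffD2[OF exp_le_cancel_iff] mult_right_mono) auto
      also have "\<dots> \<le> C1 * y * (1 / (d * y))" using exp_decay_le[OF assms(2) h(5)] C1 h by (intro mult_left_mono) auto
      also have "\<dots> = C1 / d" using h by simp
      finally have "cmod (1 * ?A * ?B) \<le> C1 / d" .
      then have "cmod ?X \<le> K2" unfolding K2_def using wi norm_triangle_ineq4[of "1 * 1 * (1 / w)" "1 * ?A * ?B"] by simp
      also have "\<dots> \<le> K" using nn(1) unfolding K_def by linarith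
      finally show "cmod (lc_kernel w z y) \<le> K / y\<^sup>2" unfolding Gn using y2 by (simp add: divide_right_mono) }
    show "K \<ge> 0" unfolding K_def using nn by linarith
  qed (use h in auto)
  then show ?thesis by blast
qed

text \<open>The kernel has two competing terms, the product with the sine and the subtracted linear
  term, and each needs its own decay condition; hence two hypotheses with margin d. The real part of
  m does not enter, which makes the bound uniform along horizontal lines.\<close>

lemma ratio_kernel_bound:
  assumes "a > 0" "d > 0"
  shows "\<exists>C. \<forall>w1 w2 u m y. a \<le> Re w1 \<and> a \<le> Re w2 \<and> cmod w1 \<le> R \<and> cmod w2 \<le> R \<and> cmod u \<le> R \<and>
     2 * \<bar>Im m\<bar> + 2 * \<bar>Im u\<bar> + d \<le> Re w1 + Re w2 \<and> 2 * \<bar>Im m\<bar> + d \<le> Re w2 \<and> y > 0 \<longrightarrow>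
     cmod (ratio_kernel w1 w2 u m y) \<le> C / (1 + y\<^sup>2)"
proof -
  obtain C1 where "sinh_bound a R C1" using sinh_ratio_bounds[OF assms(1), of R] by blast
  note C1 = sinh_boundD(1)[OF this] and B = sinh_boundD(2)[OF this]
  obtain C2 where C2: "C2 > 0" and SC: "\<And>z y. cmod z \<le> R \<Longrightarrow> 0 < y \<Longrightarrow> y \<le> 1 \<Longrightarrow>
     cmod (sin (2 * of_real y * z) / of_real y - 2 * z) \<le> C2 * y\<^sup>2" using sin_cos_bounds[of R] by blast
  define K1 where "K1 = exp \<bar>R\<bar> * (C2 * C1 + 2 * \<bar>R\<bar> * C1) * C1"
  define K2 where "K2 = C1\<^sup>2 / d + 2 * \<bar>R\<bar> * (1 / a) * C1 / d"
  define K where "K = K1 + K2"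
  have nn: "K1 \<ge> 0" "K2 \<ge> 0"
    unfolding K1_def K2_def using C1 C2 assms by (auto intro!: add_nonneg_nonneg mult_nonneg_nonneg divide_nonneg_nonneg)
  have "cmod (ratio_kernel w1 w2 u m y) \<le> 2 * K / (1 + y\<^sup>2)"
    if h: "a \<le> Re w1" "a \<le> Re w2" "cmod w1 \<le> R" "cmod w2 \<le> R" "cmod u \<le> R"
     "2 * \<bar>Im m\<bar> + 2 * \<bar>Im u\<bar> + d \<le> Re w1 + Re w2" "2 * \<bar>Im m\<bar> + d \<le> Re w2" "y > 0" for w1 w2 u m y
  proof (rule bound_inverse_square)
    let ?M = "cos (2 * of_real y * m)" and ?A = "sin (2 * of_real y * u) / of_real y"
    let ?B = "sinh_ratio w1 y" and ?C = "sinh_ratio w2 y"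
    let ?X = "1 * ?A * ?B - 1 * (2 * u) * (1 / w1)"
    have Gn: "cmod (ratio_kernel w1 w2 u m y) = cmod ?M * cmod ?X * cmod ?C / y\<^sup>2"
      using kernel_eqs(3)[of w1 w2 y u m] h assms by (simp add: norm_divide norm_mult norm_power)
    have wi: "cmod (1 / w1) \<le> 1 / a" using h assms complex_Re_le_cmod[of w1]
      by (auto simp: norm_divide intro!: divide_left_mono mult_pos_pos)
    have un: "cmod (2 * u) \<le> 2 * \<bar>R\<bar>" using h by (simp add: norm_mult)
    have y2: "y\<^sup>2 > 0" using h by simp
    have M: "cmod ?M \<le> exp (2 * y * \<bar>Im m\<bar>)" using norm_cos_le_exp[of "2 * of_real y * m"] h by (auto simp: abs_mult)
    { assume y1: "y \<le> 1"
      have "2 * y * \<bar>Im m\<bar> \<le> 1 * (2 * \<bar>Im m\<bar>)" using y1 mult_right_mono[of y 1 "2 * \<bar>Im m\<bar>"] by simp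
      also have "\<dots> \<le> \<bar>R\<bar>" using h assms complex_Re_le_cmod[of w2] by linarith
      finally have M': "cmod ?M \<le> exp \<bar>R\<bar>" using M order_trans by (metis exp_le_cancel_iff)
      have "cmod ?X \<le> cmod (1 - 1 :: complex) * cmod ?A * cmod ?B + cmod (1::complex) * (C2 * y\<^sup>2) * C1
          + cmod (1::complex) * (2 * \<bar>R\<bar>) * (C1 * y\<^sup>2)" using SC[of u y] B[of w1 y] h y1 C1 C2 y2 un
        by (intro order_trans[OF norm_triple_diff] add_mono mult_mono) auto
      then have X: "cmod ?X \<le> (C2 * C1 + 2 * \<bar>R\<bar> * C1) * y\<^sup>2" by (simp add: algebra_simps)
      have "cmod ?M * cmod ?X * cmod ?C \<le> exp \<bar>R\<bar> * ((C2 * C1 + 2 * \<bar>R\<bar> * C1) * y\<^sup>2) * C1"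
        using M' X B[of w2 y] h C1 C2 by (intro mult_mono) auto
      also have "\<dots> = K1 * y\<^sup>2" by (simp add: K1_def mult_ac)
      also have "\<dots> \<le> K * y\<^sup>2" unfolding K_def using nn(2) by (intro mult_right_mono) auto
      finally show "cmod (ratio_kernel w1 w2 u m y) \<le> K" unfolding Gn using y2 by (simp add: pos_divide_le_eq) }
    { assume y1: "y \<ge> 1"
      have A: "cmod ?A \<le> exp (2 * y * \<bar>Im u\<bar>) / y" using norm_sin_le_exp[of "2 * of_real y * u"] h
        by (auto simp: norm_divide abs_mult intro!: divide_right_mono)
      have "cmod ?X \<le> (exp (2 * y * \<bar>Im u\<bar>) / y) * (C1 * y * exp (- Re w1 * y)) + 2 * \<bar>R\<bar> * (1 / a)" proof -
        have "cmod ?X \<le> cmod ?A * cmod ?B + cmod (2 * u) * cmod (1 / w1)"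
          using norm_triangle_ineq4[of "1 * ?A * ?B" "1 * (2 * u) * (1 / w1)"] by (simp only: norm_mult mult_1 norm_one)
        also have "\<dots> \<le> (exp (2 * y * \<bar>Im u\<bar>) / y) * (C1 * y * exp (- Re w1 * y)) + 2 * \<bar>R\<bar> * (1 / a)"
          using A B[of w1 y] h y1 C1 un wi by (intro add_mono mult_mono) auto
        finally show ?thesis .
      qed
      then have "cmod ?M * cmod ?X * cmod ?C \<le> exp (2 * y * \<bar>Im m\<bar>) *
          ((exp (2 * y * \<bar>Im u\<bar>) / y) * (C1 * y * exp (- Re w1 * y)) + 2 * \<bar>R\<bar> * (1 / a)) *
          (C1 * y * exp (- Re w2 * y))" using M B[of w2 y] h y1 C1 assms by (intro mult_mono add_nonneg_nonneg) auto
      also have "\<dots> = C1\<^sup>2 * y * exp (- (Re w1 + Re w2 - 2 * \<bar>Im m\<bar> - 2 * \<bar>Im u\<bar>) * y)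
          + 2 * \<bar>R\<bar> * (1 / a) * C1 * y * exp (- (Re w2 - 2 * \<bar>Im m\<bar>) * y)" proof -
        have y0: "y \<noteq> 0" using h by simp
        have "exp (2 * y * \<bar>Im m\<bar>) * ((exp (2 * y * \<bar>Im u\<bar>) / y) * (C1 * y * exp (- Re w1 * y)) + 2 * \<bar>R\<bar> * (1 / a)) *
            (C1 * y * exp (- Re w2 * y))
          = (exp (2 * y * \<bar>Im m\<bar> + 2 * y * \<bar>Im u\<bar>) / y) * (C1 * y * exp (- Re w1 * y)) * (C1 * y * exp (- Re w2 * y))
            + 2 * \<bar>R\<bar> * (1 / a) * C1 * y * exp (2 * y * \<bar>Im m\<bar> + - Re w2 * y)" unfolding exp_add by (simp add: algebra_simps)
        then show ?thesis unfolding exp_collect[OF y0] by (simp add: algebra_simps)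
      qed
      also have "\<dots> \<le> C1\<^sup>2 * y * exp (- d * y) + 2 * \<bar>R\<bar> * (1 / a) * C1 * y * exp (- d * y)"
        using h C1 assms by (intro add_mono mult_left_mono iffD2[OF exp_le_cancel_iff] mult_right_mono) auto
      also have "\<dots> \<le> C1\<^sup>2 * y * (1 / (d * y)) + 2 * \<bar>R\<bar> * (1 / a) * C1 * y * (1 / (d * y))"
        using exp_decay_le[OF assms(2) h(8)] C1 h assms by (intro add_mono mult_left_mono) auto
      also have "\<dots> = K2" unfolding K2_def using h by simp
      also have "\<dots> \<le> K" using nn(1) unfolding K_def by linarith
      finally show "cmod (ratio_kernel w1 w2 u m y) \<le> K / y\<^sup>2" unfolding Gn using y2 by (simp add: divide_right_mono) }
    show "K \<ge> 0" unfolding K_def using nn by linarith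
  qed (use h in auto)
  then show ?thesis by blast
qed

section \<open>Kernel integrals\<close>

lemma integrable_inverse_quad: "integrable lborel (\<lambda>x::real. C / (1 + x\<^sup>2))"
proof -
  have "set_integrable lborel (einterval (-\<infinity>) \<infinity>) (\<lambda>x::real. 1 / (1 + x\<^sup>2))"
  proof (rule interval_integral_FTC_nonneg(1)[where F = arctan])
    show "((arctan \<circ> real_of_ereal) \<longlongrightarrow> - (pi / 2)) (at_right (- \<infinity>))" by (simp add: ereal_tendsto_simps tendsto_arctan_at_bot)
    show "((arctan \<circ> real_of_ereal) \<longlongrightarrow> pi / 2) (at_left \<infinity>)" by (simp add: ereal_tendsto_simps tendsto_arctan_at_top)
    show "(arctan has_real_derivative 1 / (1 + x\<^sup>2)) (at x)" for x by (auto intro!: derivative_eq_intros simp: field_simps)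
    show "isCont (\<lambda>x. 1 / (1 + x\<^sup>2)) x" for x :: real by (intro continuous_intros) (auto simp: add_nonneg_eq_0_iff)
  qed auto
  then have "integrable lborel (\<lambda>x::real. 1 / (1 + x\<^sup>2))" by (simp add: set_integrable_def)
  from integrable_mult_right[OF this, of C] show ?thesis by simp
qed

lemma set_integrable_Ioi:
  fixes f :: "real \<Rightarrow> complex"
  assumes "continuous_on {0<..} f" "\<And>y. y > 0 \<Longrightarrow> cmod (f y) \<le> C / (1 + y\<^sup>2)"
  shows "set_integrable lborel {0<..} f" unfolding set_integrable_def
proof (rule Bochner_Integration.integrable_bound[OF integrable_inverse_quad[of C]])
  show "(\<lambda>x. indicat_real {0<..} x *\<^sub>R f x) \<in> borel_measurable lborel"
    using borel_measurable_continuous_on_indicator[OF _ assms(1)] by simp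
  have "C \<ge> 0" using order_trans[OF norm_ge_zero assms(2)[of 1]] by simp
  then show "AE x in lborel. norm (indicat_real {0<..} x *\<^sub>R f x) \<le> norm (C / (1 + x\<^sup>2))"
    using assms(2) by (intro AE_I2) (auto simp: indicator_def abs_of_nonneg add_nonneg_nonneg)
qed

lemma holo_Ioi_integral:
  fixes f :: "'a::cnormed_space \<Rightarrow> real \<Rightarrow> complex"
  assumes U: "open U"
    and f: "\<And>y p. y > 0 \<Longrightarrow> p \<in> U \<Longrightarrow> cdiff (\<lambda>p. f p y) p"
    and cont: "\<And>p. p \<in> U \<Longrightarrow> continuous_on {0<..} (f p)"
    and bound: "\<And>p. p \<in> U \<Longrightarrow> \<exists>N C. open N \<and> p \<in> N \<and> N \<subseteq> U \<and>
      (\<forall>q\<in>N. \<forall>y>0. cmod (f q y) \<le> C / (1 + y\<^sup>2))"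
    and p: "p \<in> U"
  shows "cdiff (\<lambda>p. LBINT y:{0<..}. f p y) p"
    and "deriv (\<lambda>s. LBINT y:{0<..}. f (p + scaleC s v) y) 0 = (LBINT y:{0<..}. deriv (\<lambda>s. f (p + scaleC s v) y) 0)"
proof -
  define g where "g = (\<lambda>p y. indicat_real {0<..} y *\<^sub>R f p y)"
  have 1: "holo (\<lambda>p. g p y) U" for y proof (rule holoI[OF U])
    fix p assume "p \<in> U"
    then show "cdiff (\<lambda>p. g p y) p" using f by (cases "y > 0") (auto simp: g_def cdiff_const)
  qed
  have 2: "g p \<in> borel_measurable lborel" if "p \<in> U" for p
    using borel_measurable_continuous_on_indicator[OF _ cont[OF that]] by (simp add: g_def)
  have 3: "\<exists>r>0. \<exists>b. integrable lborel b \<and> ball p r \<subseteq> U \<and>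
      (\<forall>q\<in>ball p r. \<forall>t\<in>space lborel. cmod (g q t) \<le> b t)" if p: "p \<in> U" for p proof -
    obtain N C where N: "open N" "p \<in> N" "N \<subseteq> U"
      and C: "\<And>q y. q \<in> N \<Longrightarrow> y > 0 \<Longrightarrow> cmod (f q y) \<le> C / (1 + y\<^sup>2)" using bound[OF p] by blast
    obtain r where r: "r > 0" "ball p r \<subseteq> N" using openE[OF N(1,2)] by auto
    have "C \<ge> 0" using order_trans[OF norm_ge_zero C[OF N(2), of 1]] by simp
    have "cmod (g q t) \<le> C / (1 + t\<^sup>2)" if "q \<in> ball p r" for q t
      using C[of q t] that r \<open>C \<ge> 0\<close> by (auto simp: g_def indicator_def add_nonneg_nonneg)
    then show ?thesis using r N integrable_inverse_quad[of C] by (intro exI[of _ r] conjI exI[of _ "\<lambda>x. C / (1 + x\<^sup>2)"]) auto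
  qed
  have eq: "(LBINT y:{0<..}. f p y) = integral\<^sup>L lborel (g p)" for p by (simp add: set_lebesgue_integral_def g_def)
  show "cdiff (\<lambda>p. LBINT y:{0<..}. f p y) p" unfolding eq by (rule holo_integral_aux(1)[OF U 1 2 3 p])
  have "deriv (\<lambda>s. LBINT y:{0<..}. f (p + scaleC s v) y) 0 = (LINT y|lborel. deriv (\<lambda>s. g (p + scaleC s v) y) 0)"
    unfolding eq by (rule holo_integral_aux(2)[OF U 1 2 3 p])
  also have "\<dots> = (LBINT y:{0<..}. deriv (\<lambda>s. f (p + scaleC s v) y) 0)" unfolding set_lebesgue_integral_def
    by (intro Bochner_Integration.integral_cong) (auto simp: g_def indicator_def)
  finally show "deriv (\<lambda>s. LBINT y:{0<..}. f (p + scaleC s v) y) 0 = (LBINT y:{0<..}. deriv (\<lambda>s. f (p + scaleC s v) y) 0)" .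
qed

lemma continuous_on_sinh_cosh [continuous_intros]:
  fixes f :: "'a::topological_space \<Rightarrow> complex"
  assumes "continuous_on A f"
  shows "continuous_on A (\<lambda>x. sinh (f x))" "continuous_on A (\<lambda>x. cosh (f x))"
  unfolding sinh_field_def cosh_field_def by (intro continuous_intros assms; simp)+

lemma continuous_on_kernels:
  assumes "Re w1 > 0" "Re w2 > 0"
  shows "continuous_on {0<..} (G_kernel w1 w2 z)" "continuous_on {0<..} (lc_kernel w1 z)"
    "continuous_on {0<..} (ratio_kernel w1 w2 u m)" unfolding G_kernel_def lc_kernel_def ratio_kernel_def
  using sinh_nonzero[OF assms(1)] sinh_nonzero[OF assms(2)] assms by (intro continuous_intros; auto)+

lemma G_strip_kernel: "G_strip w1 w2 z = exp (\<i> * (LBINT y:{0<..}. G_kernel w1 w2 z y))"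
  by (simp add: G_strip_def G_kernel_def)

lemma G_kernel_local_bound:
  assumes "Re w1 > 0" "Re w2 > 0" "2 * \<bar>Im z\<bar> < Re w1 + Re w2"
  shows "\<exists>N C. open N \<and> (w1, w2, z) \<in> N \<and>
    N \<subseteq> {(w1, w2, z). Re w1 > 0 \<and> Re w2 > 0 \<and> 2 * \<bar>Im z\<bar> < Re w1 + Re w2} \<and>
    (\<forall>(w1, w2, z)\<in>N. \<forall>y>0. cmod (G_kernel w1 w2 z y) \<le> C / (1 + y\<^sup>2))"
proof -
  define a where "a = min (Re w1) (Re w2) / 2"
  define d where "d = (Re w1 + Re w2 - 2 * \<bar>Im z\<bar>) / 2"
  define R where "R = cmod w1 + cmod w2 + cmod z + 1"
  have ad: "a > 0" "d > 0" using assms by (auto simp: a_def d_def)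
  define N where "N = {p. a < Re (fst p) \<and> a < Re (fst (snd p)) \<and> cmod (fst p) < R \<and>
    cmod (fst (snd p)) < R \<and> cmod (snd (snd p)) < R \<and>
    2 * \<bar>Im (snd (snd p))\<bar> + d < Re (fst p) + Re (fst (snd p))}"
  obtain C where C: "\<And>w1 w2 z y. a \<le> Re w1 \<and> a \<le> Re w2 \<and> cmod w1 \<le> R \<and> cmod w2 \<le> R \<and> cmod z \<le> R \<and>
     2 * \<bar>Im z\<bar> + d \<le> Re w1 + Re w2 \<and> y > 0 \<Longrightarrow> cmod (G_kernel w1 w2 z y) \<le> C / (1 + y\<^sup>2)"
    using G_kernel_bound[OF ad, of R] by blast
  have "open N" unfolding N_def by (intro open_Collects continuous_intros)
  moreover have "(w1, w2, z) \<in> N" using assms by (auto simp: N_def a_def d_def R_def min_def field_simps add_pos_nonneg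
        intro: add_nonneg_pos)
  moreover have "N \<subseteq> {(w1, w2, z). Re w1 > 0 \<and> Re w2 > 0 \<and> 2 * \<bar>Im z\<bar> < Re w1 + Re w2}" using ad by (auto simp: N_def)
  moreover have "\<forall>(w1, w2, z)\<in>N. \<forall>y>0. cmod (G_kernel w1 w2 z y) \<le> C / (1 + y\<^sup>2)" by (auto simp: N_def intro!: C)
  ultimately show ?thesis by blast
qed

lemma open_G_domain:
  "open {(w1, w2, z). Re w1 > 0 \<and> Re w2 > 0 \<and> 2 * \<bar>Im z\<bar> < Re w1 + Re w2}"
  unfolding case_prod_unfold by (intro open_Collects continuous_intros)

lemma cdiff_G_strip [cdiff_intros]:
  fixes f g h :: "'a::cnormed_space \<Rightarrow> complex"
  assumes "cdiff f p" "cdiff g p" "cdiff h p"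
    and "Re (f p) > 0" "Re (g p) > 0" "2 * \<bar>Im (h p)\<bar> < Re (f p) + Re (g p)"
  shows "cdiff (\<lambda>x. G_strip (f x) (g x) (h x)) p"
proof -
  let ?U = "{(w1, w2, z). Re w1 > 0 \<and> Re w2 > 0 \<and> 2 * \<bar>Im z\<bar> < Re w1 + Re w2}"
  let ?f = "\<lambda>q y. G_kernel (fst q) (fst (snd q)) (snd (snd q)) y"
  have "cdiff (\<lambda>q. LBINT y:{0<..}. ?f q y) (f p, g p, h p)" proof (rule holo_Ioi_integral(1)[OF open_G_domain])
    fix q assume q: "q \<in> ?U"
    show "continuous_on {0<..} (?f q)" using q by (intro continuous_on_kernels) auto
    show "\<exists>N C. open N \<and> q \<in> N \<and> N \<subseteq> ?U \<and> (\<forall>q\<in>N. \<forall>y>0. cmod (?f q y) \<le> C / (1 + y\<^sup>2))"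
      using G_kernel_local_bound[of "fst q" "fst (snd q)" "snd (snd q)"] q by (simp add: case_prod_unfold)
    fix y :: real assume "y > 0"
    then show "cdiff (\<lambda>q. ?f q y) q" unfolding G_kernel_def using q sinh_nonzero[of "fst q" y] sinh_nonzero[of "fst (snd q)" y]
      by (intro cdiff_intros) auto
  qed (use assms in auto)
  then have "cdiff (\<lambda>x. (\<lambda>q. LBINT y:{0<..}. ?f q y) (f x, g x, h x)) p"
    by (intro cdiff_compose[where g = "\<lambda>q. LBINT y:{0<..}. ?f q y" and f = "\<lambda>x. (f x, g x, h x)"]
        cdiff_Pair assms)
  then show ?thesis unfolding G_strip_kernel by (intro cdiff_intros) simp
qed

lemma G_strip_nonzero [simp]: "G_strip w1 w2 z \<noteq> 0"
  by (simp add: G_strip_kernel)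

lemma G_kernel_minus: "G_kernel w1 w2 (- z) y = - G_kernel w1 w2 z y"
  by (simp add: G_kernel_def diff_divide_distrib)

lemma G_strip_minus: "G_strip w1 w2 (- z) = inverse (G_strip w1 w2 z)"
  unfolding G_strip_kernel G_kernel_minus by (simp add: set_lebesgue_integral_def exp_minus)

lemma G_strip_commute: "G_strip w1 w2 z = G_strip w2 w1 z"
  by (simp add: G_strip_def mult_ac)

definition log_cosh :: "complex \<Rightarrow> complex \<Rightarrow> complex" where
  "log_cosh w z = (LBINT y:{0<..}. lc_kernel w z y)"

lemma open_lc_domain: "open {(w, z). Re w > 0 \<and> 2 * \<bar>Im z\<bar> < Re w}"
  unfolding case_prod_unfold by (intro open_Collects continuous_intros)

lemma log_cosh_aux:
  assumes "Re w > 0" "2 * \<bar>Im z\<bar> < Re w"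
  shows "cdiff (\<lambda>q. log_cosh (fst q) (snd q)) (w, z)"
    and "deriv (log_cosh w) z = (LBINT y:{0<..}. 2 * sin (2 * of_real y * z) / sinh (w * of_real y))"
proof -
  let ?U = "{(w, z). Re w > 0 \<and> 2 * \<bar>Im z\<bar> < Re w}"
  let ?f = "\<lambda>q y. lc_kernel (fst q) (snd q) y"
  have a: "cdiff (\<lambda>q. ?f q y) q" if "y > 0" "q \<in> ?U" for y q unfolding lc_kernel_def using that sinh_nonzero[of "fst q" y]
    by (intro cdiff_intros) auto
  have b: "continuous_on {0<..} (?f q)" if "q \<in> ?U" for q using that by (intro continuous_on_kernels(2)[of _ 1]) auto
  have c: "\<exists>N C. open N \<and> q \<in> N \<and> N \<subseteq> ?U \<and> (\<forall>q\<in>N. \<forall>y>0. cmod (?f q y) \<le> C / (1 + y\<^sup>2))" if q: "q \<in> ?U" for q proof -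
    obtain w z where qq: "q = (w, z)" by force
    define a where "a = Re w / 2"
    define d where "d = (Re w - 2 * \<bar>Im z\<bar>) / 2"
    define R where "R = cmod w + cmod z + 1"
    have ad: "a > 0" "d > 0" using q qq by (auto simp: a_def d_def)
    define N where "N = {p. a < Re (fst p) \<and> cmod (fst p) < R \<and> cmod (snd p) < R \<and>
      2 * \<bar>Im (snd p)\<bar> + d < Re (fst p)}"
    obtain C where C: "\<And>w z y. a \<le> Re w \<and> cmod w \<le> R \<and> cmod z \<le> R \<and>
       2 * \<bar>Im z\<bar> + d \<le> Re w \<and> y > 0 \<Longrightarrow> cmod (lc_kernel w z y) \<le> C / (1 + y\<^sup>2)" using lc_kernel_bound[OF ad, of R] by blast
    have "open N" unfolding N_def by (intro open_Collects continuous_intros)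
    moreover have "q \<in> N" using q qq by (auto simp: N_def a_def d_def R_def field_simps add_pos_nonneg intro: add_nonneg_pos)
    moreover have "N \<subseteq> ?U" using ad by (auto simp: N_def)
    moreover have "\<forall>q\<in>N. \<forall>y>0. cmod (?f q y) \<le> C / (1 + y\<^sup>2)" by (auto simp: N_def intro!: C)
    ultimately show ?thesis by blast
  qed
  have mem: "(w, z) \<in> ?U" using assms by simp
  show "cdiff (\<lambda>q. log_cosh (fst q) (snd q)) (w, z)"
    unfolding log_cosh_def by (rule holo_Ioi_integral(1)[OF open_lc_domain a b c mem])
  have "deriv (\<lambda>s. log_cosh w (z + s)) 0 = (LBINT y:{0<..}. deriv (\<lambda>s. lc_kernel w (z + s) y) 0)"
    using holo_Ioi_integral(2)[OF open_lc_domain a b c mem, of "(0, 1)"]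
    by (simp add: log_cosh_def scaleC_prod_def scaleC_complex_def)
  also have "deriv (\<lambda>s. log_cosh w (z + s)) 0 = deriv (log_cosh w) z"
    using deriv_shift_0[of "log_cosh w" z] by (simp add: o_def)
  also have "(LBINT y:{0<..}. deriv (\<lambda>s. lc_kernel w (z + s) y) 0)
      = (LBINT y:{0<..}. 2 * sin (2 * of_real y * z) / sinh (w * of_real y))" proof (rule set_lebesgue_integral_cong)
    show "\<forall>y. y \<in> {0<..} \<longrightarrow> deriv (\<lambda>s. lc_kernel w (z + s) y) 0 = 2 * sin (2 * of_real y * z) / sinh (w * of_real y)"
    proof (intro allI impI DERIV_imp_deriv)
      fix y :: real assume "y \<in> {0<..}"
      then show "((\<lambda>s. lc_kernel w (z + s) y) has_field_derivative
          2 * sin (2 * of_real y * z) / sinh (w * of_real y)) (at 0)"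
        unfolding lc_kernel_def using sinh_nonzero[OF assms(1), of y] by (auto intro!: derivative_eq_intros simp: field_simps)
    qed
  qed simp
  finally show "deriv (log_cosh w) z = (LBINT y:{0<..}. 2 * sin (2 * of_real y * z) / sinh (w * of_real y))" .
qed

lemma cdiff_log_cosh [cdiff_intros]:
  fixes f h :: "'a::cnormed_space \<Rightarrow> complex"
  assumes "cdiff f p" "cdiff h p" and "Re (f p) > 0" "2 * \<bar>Im (h p)\<bar> < Re (f p)"
  shows "cdiff (\<lambda>x. log_cosh (f x) (h x)) p"
proof -
  have "cdiff (\<lambda>x. (\<lambda>q. log_cosh (fst q) (snd q)) (f x, h x)) p"
    by (intro cdiff_compose[where g = "\<lambda>q. log_cosh (fst q) (snd q)" and f = "\<lambda>x. (f x, h x)"]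
        cdiff_Pair assms log_cosh_aux(1))
  then show ?thesis by simp
qed

lemma lc_kernel_integrable:
  assumes "Re w > 0" "2 * \<bar>Im z\<bar> < Re w"
  shows "set_integrable lborel {0<..} (lc_kernel w z)"
proof -
  obtain C where C: "\<And>w' z' y. Re w \<le> Re w' \<and> cmod w' \<le> max (cmod w) (cmod z) \<and>
      cmod z' \<le> max (cmod w) (cmod z) \<and> 2 * \<bar>Im z'\<bar> + (Re w - 2 * \<bar>Im z\<bar>) \<le> Re w' \<and> y > 0 \<Longrightarrow>
      cmod (lc_kernel w' z' y) \<le> C / (1 + y\<^sup>2)"
    using lc_kernel_bound[of "Re w" "Re w - 2 * \<bar>Im z\<bar>" "max (cmod w) (cmod z)"] assms by auto
  show ?thesis by (rule set_integrable_Ioi[OF continuous_on_kernels(2)[OF assms(1,1)], of _ C]) (intro C, simp)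
qed

lemma G_kernel_integrable:
  assumes "Re w1 > 0" "Re w2 > 0" "2 * \<bar>Im z\<bar> < Re w1 + Re w2"
  shows "set_integrable lborel {0<..} (G_kernel w1 w2 z)"
proof -
  obtain N C where "(w1, w2, z) \<in> N"
    and "\<forall>(w1, w2, z)\<in>N. \<forall>y>0. cmod (G_kernel w1 w2 z y) \<le> C / (1 + y\<^sup>2)" using G_kernel_local_bound[OF assms] by auto
  then have "cmod (G_kernel w1 w2 z y) \<le> C / (1 + y\<^sup>2)" if "y > 0" for y using that by auto
  then show ?thesis by (rule set_integrable_Ioi[OF continuous_on_kernels(1)[OF assms(1,2)]])
qed

section \<open>The integral for \<open>log (2 cosh)\<close>\<close>

text \<open>The logarithmic derivative of the reflection formula for Gamma at 1/2 + i t.\<close>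

lemma Digamma_reflection_half:
  fixes t :: real
  defines "s \<equiv> 1 / 2 + \<i> * of_real t"
  shows "Digamma s - Digamma (1 - s) = \<i> * of_real (pi * tanh (pi * t))"
proof -
  have s: "s \<notin> \<int>\<^sub>\<le>\<^sub>0" "1 - s \<notin> \<int>\<^sub>\<le>\<^sub>0" proof -
    have "real_of_int n * 2 \<noteq> 1" for n proof
      assume "real_of_int n * 2 = 1"
      then have "real_of_int (n * 2) = real_of_int 1" by simp
      then have "n * 2 = 1" by (simp only: of_int_eq_iff)
      then show False by presburger
    qed
    then show "s \<notin> \<int>\<^sub>\<le>\<^sub>0" "1 - s \<notin> \<int>\<^sub>\<le>\<^sub>0" by (auto simp: s_def nonpos_Ints_def complex_eq_iff)
  qed
  have sn: "sin (cpi * s) = of_real (cosh (pi * t))"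
    and cn: "cos (cpi * s) = - \<i> * of_real (sinh (pi * t))" proof -
    have e: "cpi * s = of_real (pi / 2) + \<i> * of_real (pi * t)" by (simp add: s_def algebra_simps)
    have ch: "cos (\<i> * of_real r) = of_real (cosh r)" "sin (\<i> * of_real r) = \<i> * of_real (sinh r)" for r
      by (simp_all add: cos_exp_eq sin_exp_eq cosh_field_def sinh_field_def exp_of_real right_diff_distrib
          flip: mult.assoc of_real_minus)
    show "sin (cpi * s) = of_real (cosh (pi * t))" unfolding e sin_add ch sin_of_real cos_of_real by simp
    show "cos (cpi * s) = - \<i> * of_real (sinh (pi * t))" unfolding e cos_add ch sin_of_real cos_of_real by simp
  qed
  have nz: "sin (cpi * s) \<noteq> 0" unfolding sn by (simp add: cosh_real_pos less_imp_neq[symmetric])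
  have 1: "((\<lambda>z. Gamma z * Gamma (1 - z)) has_field_derivative
      Gamma s * Gamma (1 - s) * (Digamma s - Digamma (1 - s))) (at s)"
    using s by (auto intro!: derivative_eq_intros simp: algebra_simps)
  have 2: "((\<lambda>z. cpi / sin (cpi * z)) has_field_derivative
      - (cpi * (cos (cpi * s) * cpi)) / (sin (cpi * s) * sin (cpi * s))) (at s)"
    using nz by (auto intro!: derivative_eq_intros simp: field_simps)
  have "Gamma s * Gamma (1 - s) * (Digamma s - Digamma (1 - s))
      = - (cpi * (cos (cpi * s) * cpi)) / (sin (cpi * s) * sin (cpi * s))"
    by (rule DERIV_unique[OF 1]) (use 2 in \<open>simp only: Gamma_reflection_complex\<close>)
  then have "cpi / sin (cpi * s) * (Digamma s - Digamma (1 - s))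
      = - (cpi * (cos (cpi * s) * cpi)) / (sin (cpi * s) * sin (cpi * s))" by (simp only: Gamma_reflection_complex)
  note * = this
  have aux: "D = - (a * C / S)" if "a / S * D = - (a * (C * a)) / (S * S)" "a \<noteq> 0" "S \<noteq> 0" for a S C D :: complex proof -
    have "D = (a / S * D) * (S / a)" using that(2,3) by simp
    also have "\<dots> = - (a * C / S)" unfolding that(1) using that(2,3) by (simp add: field_simps)
    finally show ?thesis .
  qed
  have "Digamma s - Digamma (1 - s) = - (cpi * cos (cpi * s) / sin (cpi * s))" by (rule aux[OF * _ nz]) simp
  also have "\<dots> = \<i> * of_real (pi * tanh (pi * t))" unfolding sn cn by (simp add: tanh_def)
  finally show ?thesis .
qed

text \<open>The partial fraction expansion of tanh, obtained by subtracting the Digamma series at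
  the two conjugate points s and 1 - s.\<close>

lemma tanh_sums:
  fixes t :: real
  shows "(\<lambda>k. 2 * t / ((real k + 1 / 2)\<^sup>2 + t\<^sup>2)) sums (pi * tanh (pi * t))"
proof -
  define s where "s = 1 / 2 + \<i> * of_real t"
  have s: "s \<noteq> 0" "1 - s \<noteq> 0" by (auto simp: s_def complex_eq_iff)
  have S: "(\<lambda>n. inverse (of_nat (Suc n)) - inverse (z + of_nat n)) sums (Digamma z + euler_mascheroni)"
    if "z \<noteq> 0" for z :: complex using summable_sums[OF summable_Digamma[OF that]] by (simp add: Digamma_def)
  have "(\<lambda>n. inverse (1 - s + of_nat n) - inverse (s + of_nat n)) sums (Digamma s - Digamma (1 - s))"
    using sums_diff[OF S[OF s(1)] S[OF s(2)]] by (simp add: algebra_simps)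
  also have "(\<lambda>n. inverse (1 - s + of_nat n) - inverse (s + of_nat n)) = (\<lambda>n. \<i> * of_real (2 * t / ((real n + 1 / 2)\<^sup>2 + t\<^sup>2)))"
  proof
    fix n
    have nz: "1 - s + of_nat n \<noteq> 0" "s + of_nat n \<noteq> 0" by (auto simp: s_def complex_eq_iff)
    have pr: "(1 - s + of_nat n) * (s + of_nat n) = of_real ((real n + 1 / 2)\<^sup>2 + t\<^sup>2)"
      by (simp add: s_def complex_eq_iff power2_eq_square field_simps)
    have "inverse (1 - s + of_nat n) - inverse (s + of_nat n)
        = ((s + of_nat n) - (1 - s + of_nat n)) / ((1 - s + of_nat n) * (s + of_nat n))" using nz by (simp add: field_simps)
    also have "\<dots> = \<i> * of_real (2 * t / ((real n + 1 / 2)\<^sup>2 + t\<^sup>2))" unfolding pr by (simp add: s_def)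
    finally show "inverse (1 - s + of_nat n) - inverse (s + of_nat n) = \<i> * of_real (2 * t / ((real n + 1 / 2)\<^sup>2 + t\<^sup>2))" .
  qed
  finally have "(\<lambda>n. \<i> * of_real (2 * t / ((real n + 1 / 2)\<^sup>2 + t\<^sup>2))) sums (\<i> * of_real (pi * tanh (pi * t)))"
    unfolding s_def Digamma_reflection_half .
  from sums_mult[OF this, of "- \<i>"]
  have "(\<lambda>n. complex_of_real (2 * t / ((real n + 1 / 2)\<^sup>2 + t\<^sup>2))) sums of_real (pi * tanh (pi * t))" by (simp flip: mult.assoc)
  then show ?thesis by (simp only: sums_of_real_iff)
qed

lemma exp_le_inverse_quad:
  assumes "a > 0" "y \<ge> (0::real)"
  shows "exp (- a * y) \<le> (1 + 2 / a\<^sup>2) / (1 + y\<^sup>2)"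
proof -
  have "1 + (a * y)\<^sup>2 / 2 \<le> exp (a * y)"
    using exp_lower_Taylor_quadratic[of "a * y"] assms by (auto intro: order_trans[rotated])
  moreover have "1 + y\<^sup>2 \<le> (1 + 2 / a\<^sup>2) * (1 + (a * y)\<^sup>2 / 2)"
    using assms by (simp add: field_simps power_mult_distrib add_nonneg_nonneg)
  moreover have "(1 + 2 / a\<^sup>2) * (1 + (a * y)\<^sup>2 / 2) \<le> (1 + 2 / a\<^sup>2) * exp (a * y)"
    using calculation(1) by (intro mult_left_mono) (simp_all add: add_nonneg_nonneg)
  ultimately have "1 + y\<^sup>2 \<le> (1 + 2 / a\<^sup>2) * exp (a * y)" by linarith
  then show ?thesis by (simp add: exp_minus field_simps add_pos_nonneg)
qed

lemma exp_integral_Ioi: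
  assumes "Re c > 0"
  shows "set_integrable lborel {0<..} (\<lambda>y. exp (- (c * complex_of_real y)))"
    and "(LBINT y:{0<..}. exp (- (c * complex_of_real y))) = 1 / c"
proof -
  let ?e = "\<lambda>y. exp (- (c * complex_of_real y))"
  have c0: "c \<noteq> 0" using assms by auto
  show int: "set_integrable lborel {0<..} ?e" proof (rule set_integrable_Ioi)
    show "continuous_on {0<..} ?e" by (intro continuous_intros)
    show "cmod (?e y) \<le> (1 + 2 / (Re c)\<^sup>2) / (1 + y\<^sup>2)" if "y > 0" for y using exp_le_inverse_quad[OF assms, of y] that by simp
  qed
  define F where "F y = - ?e y / c" for y
  have F: "(F has_vector_derivative ?e y) (at y)" for y proof -
    have "((\<lambda>z. - exp (- (c * z)) / c) has_field_derivative exp (- (c * of_real y))) (at (of_real y))"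
      using c0 by (auto intro!: derivative_eq_intros)
    from has_vector_derivative_real_field[OF this] show ?thesis by (simp add: F_def[abs_def])
  qed
  have "(LBINT y=0..\<infinity>. ?e y) = 0 - F 0" proof (rule interval_integral_FTC_integrable)
    show "(F has_vector_derivative ?e y) (at y)" for y by (rule F)
    show "isCont ?e y" for y by (intro continuous_intros)
    show "set_integrable lborel (einterval 0 \<infinity>) ?e" using int by (simp add: zero_ereal_def)
    have "isCont F 0" using F has_vector_derivative_continuous by blast
    then have "(F \<longlongrightarrow> F 0) (at_right 0)" by (simp add: isCont_def filterlim_at_split)
    then show "((F \<circ> real_of_ereal) \<longlongrightarrow> F 0) (at_right 0)" by (simp add: zero_ereal_def ereal_tendsto_simps)
    have "(F \<longlongrightarrow> 0) at_top" proof (rule Lim_null_comparison)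
      show "\<forall>\<^sub>F y in at_top. norm (F y) \<le> exp (- (Re c * y)) / cmod c"
        by (intro always_eventually) (simp add: F_def norm_divide)
      have "filterlim (\<lambda>y. Re c * y) at_top at_top"
        using assms by (intro filterlim_tendsto_pos_mult_at_top[OF tendsto_const] filterlim_ident)
      then have "((\<lambda>y. exp (- (Re c * y))) \<longlongrightarrow> 0) at_top"
        by (intro filterlim_compose[OF exp_at_bot]) (simp add: filterlim_uminus_at_bot)
      then show "((\<lambda>y. exp (- (Re c * y)) / cmod c) \<longlongrightarrow> 0) at_top"
        using tendsto_divide[OF _ tendsto_const, of _ 0 at_top "cmod c"] c0 by fastforce
    qed
    then show "((F \<circ> real_of_ereal) \<longlongrightarrow> 0) (at_left \<infinity>)" by (simp add: ereal_tendsto_simps)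
  qed simp
  then show "(LBINT y:{0<..}. ?e y) = 1 / c" using interval_integral_to_infinity_eq[of lborel 0 "?e"]
    by (simp add: F_def zero_ereal_def)
qed

lemma sinh_geometric:
  assumes "t > 0"
  shows "(\<lambda>k. 2 * exp (- ((2 * real k + 1) * t))) sums (1 / sinh t)"
proof -
  have "(\<lambda>k. exp (- 2 * t) ^ k) sums (1 / (1 - exp (- 2 * t)))" using assms by (intro geometric_sums) simp
  from sums_mult[OF this, of "2 * exp (- t)"]
  have "(\<lambda>k. 2 * exp (- t) * exp (- 2 * t) ^ k) sums (2 * exp (- t) * (1 / (1 - exp (- 2 * t))))" .
  also have "(\<lambda>k. 2 * exp (- t) * exp (- 2 * t) ^ k) = (\<lambda>k. 2 * exp (- ((2 * real k + 1) * t)))"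
    by (simp add: fun_eq_iff algebra_simps flip: exp_add exp_of_nat_mult)
  also have "2 * exp (- t) * (1 / (1 - exp (- 2 * t))) = 1 / sinh t" proof -
    have "exp (- t) * exp t = 1" "exp (- 2 * t) = exp (- t) * exp (- t)" by (simp_all flip: exp_add)
    moreover have "1 - exp (- t) * exp (- t) \<noteq> 0" using assms by (simp flip: exp_add)
    moreover have "exp t - exp (- t) \<noteq> 0" using assms by simp
    ultimately show ?thesis by (simp add: sinh_field_def frac_eq_eq) (simp add: algebra_simps)
  qed
  finally show ?thesis .
qed

text \<open>Expanding 1/sinh in a geometric series and integrating termwise gives rational terms,
  which are exactly the partial fractions of tanh. The integral is the z-derivative of
  \<open>log_cosh\<close>.\<close>

lemma sin_sinh_integral:
  fixes w z :: real
  assumes w: "w > 0"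
  shows "(LBINT y:{0<..}. 2 * sin (2 * of_real y * complex_of_real z) / sinh (of_real w * of_real y))
    = of_real (pi / w * tanh (pi * z / w))"
proof -
  define a where "a k = (2 * real k + 1) * w" for k
  have a: "a k > 0" for k using w by (simp add: a_def add_nonneg_pos)
  define g where "g k y = 4 * sin (2 * of_real y * complex_of_real z) * exp (- (of_real (a k) * complex_of_real y))" for k y
  define f where "f = (\<lambda>k y. indicat_real {0<..} y *\<^sub>R g k y)"
  have g_eq: "g k y = - 2 * \<i> * (exp (- ((of_real (a k) - 2 * \<i> * of_real z) * of_real y))
      - exp (- ((of_real (a k) + 2 * \<i> * of_real z) * of_real y)))" for k y proof -
    have i: "4 * (D / (2 * \<i>)) = - 2 * \<i> * D" for D :: complex by (simp add: complex_eq_iff)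
    have "4 * ((A - B) / (2 * \<i>)) * C = - 2 * \<i> * (A * C - B * C)" for A B C :: complex unfolding i by (simp add: algebra_simps)
    note h = this
    show ?thesis unfolding g_def sin_exp_eq h exp_add[symmetric] by (simp add: algebra_simps)
  qed
  have re: "Re (of_real (a k) - 2 * \<i> * of_real z) > 0" "Re (of_real (a k) + 2 * \<i> * of_real z) > 0" for k
    using a[of k] by simp_all
  note E1 = exp_integral_Ioi[OF re(1)] and E2 = exp_integral_Ioi[OF re(2)]
  have gint: "set_integrable lborel {0<..} (g k)" for k
    unfolding g_eq[abs_def] using E1(1)[of k] E2(1)[of k] by (intro set_integrable_mult_right set_integral_diff(1)) auto
  have fint: "integrable lborel (f k)" for k using gint[of k] by (simp add: f_def set_integrable_def)
  have gval: "(LBINT y:{0<..}. g k y) = of_real (8 * z / ((a k)\<^sup>2 + 4 * z\<^sup>2))" for k proof -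
    have "(LBINT y:{0<..}. g k y) = - 2 * \<i> * (1 / (of_real (a k) - 2 * \<i> * of_real z) - 1 / (of_real (a k) + 2 * \<i> * of_real z))"
      unfolding g_eq set_integral_mult_right set_integral_diff(2)[OF E1(1) E2(1)] E1(2) E2(2) ..
    also have "\<dots> = - 2 * \<i> * (4 * \<i> * of_real z) / ((of_real (a k) - 2 * \<i> * of_real z) * (of_real (a k) + 2 * \<i> * of_real z))"
      using re[of k] by (subst diff_frac_eq) (auto simp: complex_eq_iff)
    also have "(of_real (a k) - 2 * \<i> * of_real z) * (of_real (a k) + 2 * \<i> * of_real z) = of_real ((a k)\<^sup>2 + 4 * z\<^sup>2)"
      by (simp add: complex_eq_iff power2_eq_square)
    finally show ?thesis by simp
  qed
  \<comment> \<open>Half of the exponential absorbs the factor y that comes from |sin t| being at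
    most |t|. This yields integrals of order 1 / (a k) squared, which are summable; the bound
    without the factor y would give only 1 / a k.\<close>
  have norm_bound: "cmod (g k y) \<le> 16 * \<bar>z\<bar> / a k * exp (- (a k / 2 * y))" if "y > 0" for k y proof -
    have "cmod (g k y) = 4 * \<bar>sin (2 * y * z)\<bar> * exp (- (a k * y))" proof -
      have "sin (2 * of_real y * complex_of_real z) = of_real (sin (2 * y * z))" by (simp add: sin_of_real[symmetric])
      then show ?thesis by (simp add: g_def norm_mult)
    qed
    also have "\<dots> \<le> 4 * (2 * y * \<bar>z\<bar>) * exp (- (a k * y))"
      using abs_sin_x_le_abs_x[of "2 * y * z"] that by (intro mult_right_mono mult_left_mono) (auto simp: abs_mult)
    also have "exp (- (a k * y)) = exp (- (a k / 2 * y)) * exp (- (a k / 2) * y)" by (simp flip: exp_add)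
    also have "4 * (2 * y * \<bar>z\<bar>) * (exp (- (a k / 2 * y)) * exp (- (a k / 2) * y))
        \<le> 4 * (2 * y * \<bar>z\<bar>) * (exp (- (a k / 2 * y)) * (1 / (a k / 2 * y)))"
      using exp_decay_le[of "a k / 2" y] a[of k] that by (intro mult_left_mono) auto
    also have "\<dots> = 16 * \<bar>z\<bar> / a k * exp (- (a k / 2 * y))" using that a[of k] by (simp add: field_simps)
    finally show ?thesis .
  qed
  have norm_int: "(LINT y|lborel. norm (f k y)) \<le> 32 * \<bar>z\<bar> / (a k)\<^sup>2" for k proof -
    have r2: "Re (complex_of_real (a k / 2)) > 0" using a[of k] by simp
    have e: "exp (- (complex_of_real (a k / 2) * of_real y)) = of_real (exp (- (a k / 2 * y)))" for y
      by (simp flip: exp_of_real)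
    have i1: "integrable lborel (\<lambda>y. indicat_real {0<..} y *\<^sub>R exp (- (a k / 2 * y)))"
      using integrable_Re[OF exp_integral_Ioi(1)[OF r2, unfolded set_integrable_def e]] by simp
    have i2: "(LINT y|lborel. indicat_real {0<..} y *\<^sub>R exp (- (a k / 2 * y))) = 2 / a k" proof -
      have "of_real (LINT y|lborel. indicat_real {0<..} y *\<^sub>R exp (- (a k / 2 * y)))
          = (LINT y|lborel. complex_of_real (indicat_real {0<..} y *\<^sub>R exp (- (a k / 2 * y))))"
        by (simp only: integral_complex_of_real)
      also have "\<dots> = (LBINT y:{0<..}. exp (- (complex_of_real (a k / 2) * of_real y)))"
        unfolding set_lebesgue_integral_def e by (simp add: scaleR_conv_of_real)
      also have "\<dots> = of_real (2 / a k)" unfolding exp_integral_Ioi(2)[OF r2] by simp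
      finally show ?thesis by (simp only: of_real_eq_iff)
    qed
    have "(LINT y|lborel. norm (f k y)) \<le> (LINT y|lborel. 16 * \<bar>z\<bar> / a k * (indicat_real {0<..} y *\<^sub>R exp (- (a k / 2 * y))))"
    proof (rule integral_mono)
      show "integrable lborel (\<lambda>y. norm (f k y))" using fint by (rule integrable_norm)
      show "integrable lborel (\<lambda>y. 16 * \<bar>z\<bar> / a k * (indicat_real {0<..} y *\<^sub>R exp (- (a k / 2 * y))))"
        using i1 by (rule integrable_mult_right)
      show "norm (f k y) \<le> 16 * \<bar>z\<bar> / a k * (indicat_real {0<..} y *\<^sub>R exp (- (a k / 2 * y)))" for y
        using norm_bound[of y k] by (simp add: f_def indicator_def)
    qed
    also have "\<dots> = 16 * \<bar>z\<bar> / a k * (2 / a k)" unfolding integral_mult_right_zero i2 ..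
    finally show ?thesis by (simp add: power2_eq_square)
  qed
  have fval: "integral\<^sup>L lborel (f k) = of_real (8 * z / ((a k)\<^sup>2 + 4 * z\<^sup>2))" for k
    using gval[of k] by (simp add: f_def set_lebesgue_integral_def)
  have sm: "summable (\<lambda>k. LINT y|lborel. norm (f k y))" proof (rule summable_comparison_test)
    show "summable (\<lambda>k. 32 * \<bar>z\<bar> / w\<^sup>2 * inverse (real (Suc k) ^ 2))"
      by (intro summable_mult summable_Suc_iff[of "\<lambda>n. inverse (real n ^ 2)", THEN iffD2])
        (rule inverse_power_summable, simp)
    have "(LINT y|lborel. norm (f k y)) \<le> 32 * \<bar>z\<bar> / w\<^sup>2 * inverse (real (Suc k) ^ 2)" for k proof -
      have "32 * \<bar>z\<bar> / (a k)\<^sup>2 \<le> 32 * \<bar>z\<bar> / (real (Suc k) * w)\<^sup>2"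
        using w by (intro divide_left_mono power_mono mult_pos_pos zero_less_power) (auto simp: a_def add_nonneg_pos)
      also have "\<dots> = 32 * \<bar>z\<bar> / w\<^sup>2 * inverse (real (Suc k) ^ 2)" by (simp only: power_mult_distrib) (simp add: field_simps)
      finally show ?thesis using norm_int[of k] by linarith
    qed
    then show "\<exists>N. \<forall>k\<ge>N. norm (LINT y|lborel. norm (f k y)) \<le> 32 * \<bar>z\<bar> / w\<^sup>2 * inverse (real (Suc k) ^ 2)"
      by (auto simp: integral_nonneg)
  qed
  have g_sums: "(\<lambda>k. g k y) sums (2 * sin (2 * of_real y * complex_of_real z) / sinh (of_real w * of_real y))"
    and g_norm: "summable (\<lambda>k. cmod (g k y))" if y: "y > 0" for y proof -
    have s: "(\<lambda>k. 2 * exp (- ((2 * real k + 1) * (w * y)))) sums (1 / sinh (w * y))" using w y by (intro sinh_geometric) simp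
    have ge: "g k y = 2 * sin (2 * of_real y * complex_of_real z) * of_real (2 * exp (- ((2 * real k + 1) * (w * y))))" for k
      by (simp add: g_def a_def mult.assoc flip: exp_of_real)
    have "complex_of_real (1 / sinh (w * y)) = 1 / sinh (of_real w * of_real y)" by (simp add: sinh_field_def flip: exp_of_real)
    then show "(\<lambda>k. g k y) sums (2 * sin (2 * of_real y * complex_of_real z) / sinh (of_real w * of_real y))"
      unfolding ge using sums_mult[OF sums_of_real[OF s, where 'a = complex],
          of "2 * sin (2 * of_real y * complex_of_real z)"] by simp
    have "summable (\<lambda>k. cmod (2 * sin (2 * of_real y * complex_of_real z)) * (2 * exp (- ((2 * real k + 1) * (w * y)))))"
      using sums_summable[OF s] by (rule summable_mult)
    then show "summable (\<lambda>k. cmod (g k y))" unfolding ge norm_mult by simp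
  qed
  have "(\<lambda>k. integral\<^sup>L lborel (f k)) sums (LINT y|lborel. (\<Sum>k. f k y))" proof (rule sums_integral[OF fint _ sm])
    show "AE y in lborel. summable (\<lambda>k. norm (f k y))" using g_norm by (intro AE_I2) (auto simp: f_def indicator_def)
  qed
  also have "(LINT y|lborel. (\<Sum>k. f k y))
      = (LBINT y:{0<..}. 2 * sin (2 * of_real y * complex_of_real z) / sinh (of_real w * of_real y))"
    unfolding set_lebesgue_integral_def
    using sums_unique[OF g_sums] by (intro Bochner_Integration.integral_cong) (auto simp: f_def indicator_def)
  finally have 1: "(\<lambda>k. complex_of_real (8 * z / ((a k)\<^sup>2 + 4 * z\<^sup>2))) sums
      (LBINT y:{0<..}. 2 * sin (2 * of_real y * complex_of_real z) / sinh (of_real w * of_real y))" unfolding fval .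
  have "(\<lambda>k. 1 / w * (2 * (z / w) / ((real k + 1 / 2)\<^sup>2 + (z / w)\<^sup>2))) sums (1 / w * (pi * tanh (pi * (z / w))))"
    by (intro sums_mult tanh_sums)
  also have "(\<lambda>k. 1 / w * (2 * (z / w) / ((real k + 1 / 2)\<^sup>2 + (z / w)\<^sup>2))) = (\<lambda>k. 8 * z / ((a k)\<^sup>2 + 4 * z\<^sup>2))" proof
    fix k
    have p: "(real k + 1 / 2)\<^sup>2 + (z / w)\<^sup>2 = ((a k)\<^sup>2 + 4 * z\<^sup>2) / (4 * w\<^sup>2)"
      using w by (simp add: a_def field_simps power2_eq_square)
    have "(a k)\<^sup>2 + 4 * z\<^sup>2 > 0" using a[of k] by (simp add: add_pos_nonneg)
    then show "1 / w * (2 * (z / w) / ((real k + 1 / 2)\<^sup>2 + (z / w)\<^sup>2)) = 8 * z / ((a k)\<^sup>2 + 4 * z\<^sup>2)"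
      unfolding p using w by (simp add: field_simps power2_eq_square)
  qed
  finally have "(\<lambda>k. complex_of_real (8 * z / ((a k)\<^sup>2 + 4 * z\<^sup>2))) sums of_real (1 / w * (pi * tanh (pi * (z / w))))"
    by (simp only: sums_of_real_iff)
  with 1 show ?thesis using sums_unique2 by fastforce
qed

lemma log_cosh_deriv_real:
  fixes w z :: real
  assumes "w > 0"
  shows "(log_cosh (of_real w) has_field_derivative of_real (pi / w * tanh (pi * z / w))) (at (of_real z))"
proof -
  have "cdiff (log_cosh (of_real w)) (complex_of_real z)"
    using cdiff_log_cosh[OF cdiff_const cdiff_ident, of "of_real w" "complex_of_real z"] assms by simp
  then have "(log_cosh (of_real w) has_field_derivative deriv (log_cosh (of_real w)) (of_real z)) (at (of_real z))"
    by (simp add: cdiff_complex_iff DERIV_deriv_iff_field_differentiable)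
  then show ?thesis using log_cosh_aux(2)[of "of_real w" "of_real z"] sin_sinh_integral[OF assms, of z] assms by simp
qed

lemma exp_log_cosh_real:
  fixes w z :: real
  assumes "w > 0"
  shows "exp (log_cosh (of_real w) (of_real z)) = exp (log_cosh (of_real w) 0) * of_real (cosh (pi * z / w))"
proof -
  define f where "f z = log_cosh (of_real w) (complex_of_real z) - of_real (ln (cosh (pi * z / w)))" for z
  have "(f has_vector_derivative 0) (at z)" for z proof -
    have 1: "((\<lambda>z. log_cosh (of_real w) (complex_of_real z)) has_vector_derivative
        of_real (pi / w * tanh (pi * z / w))) (at z)"
      by (rule has_vector_derivative_real_field[OF log_cosh_deriv_real[OF assms]])
    have "((\<lambda>z. ln (cosh (pi * z / w))) has_real_derivative (pi / w * tanh (pi * z / w))) (at z)"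
      using assms by (auto intro!: derivative_eq_intros simp: tanh_def cosh_real_pos field_simps)
    then have 2: "((\<lambda>z. complex_of_real (ln (cosh (pi * z / w)))) has_vector_derivative
        of_real (pi / w * tanh (pi * z / w))) (at z)" by (rule has_vector_derivative_of_real)
    show ?thesis unfolding f_def[abs_def] using has_vector_derivative_diff[OF 1 2] by simp
  qed
  then obtain c where c: "\<And>z. f z = c" using has_vector_derivative_zero_constant[of UNIV f] by auto
  have "f z = f 0" by (simp add: c)
  then have "log_cosh (of_real w) (of_real z) = log_cosh (of_real w) 0 + of_real (ln (cosh (pi * z / w)))"
    by (simp add: f_def algebra_simps)
  then show ?thesis by (simp add: exp_add exp_of_real cosh_real_pos)
qed

text \<open>At z = 0 the kernel is homogeneous, so the substitution y to y/2 rescales w without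
  changing the integral.\<close>

lemma log_cosh_halve:
  fixes w :: complex
  shows "log_cosh (w / 2) 0 = log_cosh w 0"
proof -
  have "log_cosh w 0 = (LINT y|lborel. indicat_real {0<..} y *\<^sub>R lc_kernel w 0 y)"
    by (simp add: log_cosh_def set_lebesgue_integral_def)
  also have "\<dots> = \<bar>1 / 2\<bar> *\<^sub>R (LINT y|lborel. indicat_real {0<..} (0 + 1 / 2 * y) *\<^sub>R lc_kernel w 0 (0 + 1 / 2 * y))"
    by (rule lborel_integral_real_affine) simp
  also have "\<dots> = (LINT y|lborel. (1 / 2) *\<^sub>R (indicat_real {0<..} (1 / 2 * y) *\<^sub>R lc_kernel w 0 (1 / 2 * y)))"
    by (subst integral_scaleR_right) simp
  also have "\<dots> = (LINT y|lborel. indicat_real {0<..} y *\<^sub>R lc_kernel (w / 2) 0 y)" by (intro Bochner_Integration.integral_cong)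
      (auto simp: indicator_def lc_kernel_def scaleR_conv_of_real field_simps)
  also have "\<dots> = log_cosh (w / 2) 0" by (simp add: log_cosh_def set_lebesgue_integral_def)
  finally show ?thesis by simp
qed

text \<open>The duplication formula for sinh, applied under the integral. Together with
  \<open>log_cosh_halve\<close> it ties the value at 0 to the values at plus and minus i w /
  4.\<close>

lemma log_cosh_duplicate:
  assumes "Re w > 0" "Im w = 0"
  shows "log_cosh w (\<i> * w / 4) + log_cosh w (- (\<i> * w / 4)) = log_cosh (w / 2) 0"
proof -
  have int: "set_integrable lborel {0<..} (lc_kernel w (\<i> * w / 4))"
    "set_integrable lborel {0<..} (lc_kernel w (- (\<i> * w / 4)))" using assms by (auto intro!: lc_kernel_integrable)
  have "log_cosh w (\<i> * w / 4) + log_cosh w (- (\<i> * w / 4))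
      = (LBINT y:{0<..}. lc_kernel w (\<i> * w / 4) y + lc_kernel w (- (\<i> * w / 4)) y)"
    unfolding log_cosh_def using set_integral_add(2)[OF int] by simp
  also have "\<dots> = log_cosh (w / 2) 0" unfolding log_cosh_def proof (rule set_lebesgue_integral_cong)
    show "\<forall>y. y \<in> {0<..} \<longrightarrow> lc_kernel w (\<i> * w / 4) y + lc_kernel w (- (\<i> * w / 4)) y = lc_kernel (w / 2) 0 y"
    proof (intro allI impI)
      fix y :: real assume y: "y \<in> {0<..}"
      define t where "t = w * of_real y / 2"
      have s: "sinh t \<noteq> 0" "sinh (2 * t) \<noteq> 0"
        using sinh_nonzero[of "w / 2" y] sinh_nonzero[of w y] assms y by (simp_all add: t_def)
      have c: "cos (2 * of_real y * (\<i> * w / 4)) = cosh t" "cos (2 * of_real y * (- (\<i> * w / 4))) = cosh t"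
        by (simp_all add: t_def cosh_conv_cos mult_ac)
      have d: "sinh (2 * t) = 2 * sinh t * cosh t" using sinh_add[of t t] by (simp add: mult_ac)
      have "cosh t \<noteq> 0" using s d by auto
      then have h: "cosh t / sinh (2 * t) + cosh t / sinh (2 * t) = 1 / sinh t"
        unfolding d using s(1) by (simp add: field_simps)
      have "lc_kernel w (\<i> * w / 4) y + lc_kernel w (- (\<i> * w / 4)) y
          = (2 / (w * of_real y) - (cosh t / sinh (2 * t) + cosh t / sinh (2 * t))) / of_real y"
        unfolding lc_kernel_def c by (simp add: t_def add_divide_distrib diff_divide_distrib mult_ac)
      also have "\<dots> = lc_kernel (w / 2) 0 y" unfolding h by (simp add: lc_kernel_def t_def mult_ac)
      finally show "lc_kernel w (\<i> * w / 4) y + lc_kernel w (- (\<i> * w / 4)) y = lc_kernel (w / 2) 0 y" .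
    qed
  qed simp
  finally show ?thesis .
qed

lemma log_cosh_field_differentiable:
  assumes "Re w > 0" "2 * \<bar>Im z\<bar> < Re w"
  shows "log_cosh w field_differentiable (at z)"
  using cdiff_log_cosh[OF cdiff_const cdiff_ident, of w z] assms by (simp add: cdiff_complex_iff)

text \<open>The derivative determines \<open>log_cosh\<close> only up to a constant. The two scaling
  relations turn into E = E E cos (\<pi>/4) cos (\<pi>/4) for its exponential E, and this forces E =
  2.\<close>

lemma exp_log_cosh_zero_real:
  fixes w :: real
  assumes "w > 0"
  shows "exp (log_cosh (of_real w) 0) = 2"
proof -
  define E where "E = exp (log_cosh (of_real w) 0)"
  have "exp (log_cosh (of_real w) z) - E * cosh (cpi * z / of_real w) = 0" if "z \<in> ball (of_real 0) (w / 2)" for z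
  proof (rule real_points_zero[OF _ _ _ that, where F = "\<lambda>z. exp (log_cosh (of_real w) z) - E * cosh (cpi * z / of_real w)"])
    have "(\<lambda>z. log_cosh (of_real w) z) holomorphic_on ball 0 (w / 2)"
    proof (rule holomorphic_on_subset[where s = "{z. 2 * \<bar>Im z\<bar> < w}"])
      show "(\<lambda>z. log_cosh (of_real w) z) holomorphic_on {z. 2 * \<bar>Im z\<bar> < w}" unfolding holomorphic_on_def using assms
        by (auto intro: field_differentiable_at_within[OF log_cosh_field_differentiable])
      show "ball 0 (w / 2) \<subseteq> {z. 2 * \<bar>Im z\<bar> < w}" proof
        fix z :: complex assume "z \<in> ball 0 (w / 2)"
        then show "z \<in> {z. 2 * \<bar>Im z\<bar> < w}" using abs_Im_le_cmod[of z] by simp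
      qed
    qed
    then show "(\<lambda>z. exp (log_cosh (of_real w) z) - E * cosh (cpi * z / of_real w))
        holomorphic_on ball (of_real 0) (w / 2)" unfolding cosh_field_def using assms by (intro holomorphic_intros) auto
    fix r :: real
    have "cosh (cpi * complex_of_real r / of_real w) = of_real (cosh (pi * r / w))"
      by (simp add: cosh_field_def flip: exp_of_real)
    then show "exp (log_cosh (of_real w) (of_real r)) - E * cosh (cpi * of_real r / of_real w) = 0"
      using exp_log_cosh_real[OF assms, of r] by (simp add: E_def)
  qed (use assms in simp)
  then have *: "exp (log_cosh (of_real w) z) = E * cosh (cpi * z / of_real w)" if "cmod z < w / 2" for z using that by simp
  have "cmod (\<i> * of_real w / 4) < w / 2" "cmod (- (\<i> * of_real w / 4)) < w / 2"
    using assms by (simp_all add: norm_mult norm_divide)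
  note 1 = this[THEN *]
  have c: "cosh (cpi * (\<i> * of_real w / 4) / of_real w) = cos (complex_of_real (pi / 4))" proof -
    have "\<i> * (cpi * (\<i> * of_real w / 4) / of_real w) = - complex_of_real (pi / 4)" using assms by (simp add: complex_eq_iff)
    then show ?thesis unfolding cosh_conv_cos by (simp only: cos_minus)
  qed
  have c': "cosh (cpi * (- (\<i> * of_real w / 4)) / of_real w) = cos (complex_of_real (pi / 4))" using c by simp
  have "E = exp (log_cosh (of_real w / 2) 0)" unfolding log_cosh_halve E_def ..
  also have "\<dots> = exp (log_cosh (of_real w) (\<i> * of_real w / 4)) * exp (log_cosh (of_real w) (- (\<i> * of_real w / 4)))"
    using log_cosh_duplicate[of "of_real w"] assms by (simp flip: exp_add)
  also have "\<dots> = (E * of_real (cos (pi / 4))) * (E * of_real (cos (pi / 4)))" unfolding 1 c c' cos_of_real ..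
  also have "\<dots> = E * E * of_real (cos (pi / 4) * cos (pi / 4))" by simp
  also have "cos (pi / 4) * cos (pi / 4) = 1 / 2" by (simp add: cos_45 power2_eq_square[symmetric] power_divide)
  finally have "E * E = E * 2" by simp
  moreover have "E \<noteq> 0" by (simp add: E_def)
  ultimately show ?thesis by (simp add: E_def)
qed

lemma convex_linear_less:
  fixes f g :: "'a::real_vector \<Rightarrow> real"
  assumes "linear f" "linear g"
  shows "convex {p. f p < g p}"
proof -
  have "linear (\<lambda>p. f p - g p)" using assms by (rule linear_compose_sub)
  then have "convex ((\<lambda>p. f p - g p) -` {..<0})" by (rule convex_linear_vimage) simp
  then show ?thesis by (simp add: vimage_def)
qed

lemma convex_Collect_conj: "convex {p. P p} \<Longrightarrow> convex {p. Q p} \<Longrightarrow> convex {p. P p \<and> Q p}"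
  using convex_Int[of "{p. P p}" "{p. Q p}"] by (simp add: Collect_conj_eq)

text \<open>Both sides are holomorphic in (w, z) jointly, so the case of real w and z
  suffices.\<close>

lemma exp_log_cosh:
  assumes "Re w > 0" "2 * \<bar>Im z\<bar> < Re w"
  shows "exp (log_cosh w z) = 2 * cosh (cpi * z / w)"
proof -
  \<comment> \<open>The third coordinate is a dummy: the uniqueness principle is stated for two
    distinguished coordinates and a remainder.\<close>
  define U where "U = {p :: complex \<times> complex \<times> complex.
    0 < Re (fst p) \<and> 2 * Im (fst (snd p)) < Re (fst p) \<and> - 2 * Im (fst (snd p)) < Re (fst p)}"
  have "exp (log_cosh (fst p) (fst (snd p))) - 2 * cosh (cpi * fst (snd p) / fst p) = 0" if "p \<in> U" for p
  proof (rule holo_totally_real[of "\<lambda>p. exp (log_cosh (fst p) (fst (snd p))) - 2 * cosh (cpi * fst (snd p) / fst p)" U 1 0 0])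
    show "holo (\<lambda>p. exp (log_cosh (fst p) (fst (snd p))) - 2 * cosh (cpi * fst (snd p) / fst p)) U" proof (rule holoI)
      show "open U" unfolding U_def by (intro open_Collects continuous_intros)
      show "cdiff (\<lambda>p. exp (log_cosh (fst p) (fst (snd p))) - 2 * cosh (cpi * fst (snd p) / fst p)) p" if "p \<in> U" for p
        using that by (intro cdiff_intros) (auto simp: U_def)
    qed
    show "convex U" unfolding U_def by (intro convex_Collect_conj convex_linear_less linearI) (auto simp: algebra_simps)
    fix x y :: real and t :: complex
    assume "(complex_of_real x, complex_of_real y, t) \<in> U"
    then have x: "x > 0" by (simp add: U_def)
    have "cosh (cpi * complex_of_real y / of_real x) = of_real (cosh (pi * y / x))"
      by (simp add: cosh_field_def flip: exp_of_real)
    then show "exp (log_cosh (fst (complex_of_real x, complex_of_real y, t)) (fst (snd (complex_of_real x, complex_of_real y, t)))) -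
        2 * cosh (cpi * fst (snd (complex_of_real x, complex_of_real y, t)) / fst (complex_of_real x, complex_of_real y, t)) = 0"
      using exp_log_cosh_real[OF x, of y] exp_log_cosh_zero_real[OF x] by simp
  qed (use that in \<open>auto simp: U_def\<close>)
  moreover have "(w, z, 0) \<in> U" using assms by (auto simp: U_def)
  ultimately show ?thesis by fastforce
qed

section \<open>Quotients of hyperbolic gamma functions\<close>

lemma ratio_kernel_integrable:
  assumes "Re w1 > 0" "Re w2 > 0" "2 * \<bar>Im m\<bar> + 2 * \<bar>Im u\<bar> < Re w1 + Re w2" "2 * \<bar>Im m\<bar> < Re w2"
  shows "set_integrable lborel {0<..} (ratio_kernel w1 w2 u m)"
proof -
  define R where "R = cmod w1 + cmod w2 + cmod u"
  define a where "a = min (Re w1) (Re w2)"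
  define d where "d = min (Re w1 + Re w2 - 2 * \<bar>Im m\<bar> - 2 * \<bar>Im u\<bar>) (Re w2 - 2 * \<bar>Im m\<bar>)"
  have ad: "a > 0" "d > 0" using assms by (auto simp: a_def d_def)
  obtain C where C: "\<And>v1 v2 u m y. a \<le> Re v1 \<and> a \<le> Re v2 \<and> cmod v1 \<le> R \<and> cmod v2 \<le> R \<and> cmod u \<le> R \<and>
     2 * \<bar>Im m\<bar> + 2 * \<bar>Im u\<bar> + d \<le> Re v1 + Re v2 \<and> 2 * \<bar>Im m\<bar> + d \<le> Re v2 \<and> y > 0 \<Longrightarrow>
     cmod (ratio_kernel v1 v2 u m y) \<le> C / (1 + y\<^sup>2)" using ratio_kernel_bound[OF ad, of R] by blast
  show ?thesis by (rule set_integrable_Ioi[OF continuous_on_kernels(3)[OF assms(1,2)], of _ _ C], rule C)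
      (auto simp: a_def d_def R_def min_def)
qed

text \<open>The sum-to-product formula for sin (m+u) - sin (m-u), applied under the integral. It is
  the source both of the difference equation, with u half a period, and of the growth estimate for
  quotients.\<close>

lemma G_strip_ratio:
  assumes "Re w1 > 0" "Re w2 > 0" "2 * \<bar>Im m\<bar> + 2 * \<bar>Im u\<bar> < Re w1 + Re w2" "2 * \<bar>Im m\<bar> < Re w2"
  shows "G_strip w1 w2 (m + u) = G_strip w1 w2 (m - u) *
    exp (\<i> * (LBINT y:{0<..}. ratio_kernel w1 w2 u m y) - 2 * \<i> * u / w1 * log_cosh w2 m)"
proof -
  have nz: "w1 \<noteq> 0" "w2 \<noteq> 0" using assms by auto
  have "2 * \<bar>Im (m + u)\<bar> < Re w1 + Re w2" "2 * \<bar>Im (m - u)\<bar> < Re w1 + Re w2"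
    using assms abs_triangle_ineq[of "Im m" "Im u"] abs_triangle_ineq4[of "Im m" "Im u"] by simp_all
  note i1 = G_kernel_integrable[OF assms(1,2) this(1)] and i2 = G_kernel_integrable[OF assms(1,2) this(2)]
  note i3 = ratio_kernel_integrable[OF assms] and i4 = lc_kernel_integrable[OF assms(2,4)]
  have "(LBINT y:{0<..}. G_kernel w1 w2 (m + u) y)
      = (LBINT y:{0<..}. G_kernel w1 w2 (m - u) y + (ratio_kernel w1 w2 u m y - 2 * u / w1 * lc_kernel w2 m y))"
  proof (rule set_lebesgue_integral_cong)
    show "\<forall>y. y \<in> {0<..} \<longrightarrow> G_kernel w1 w2 (m + u) y
        = G_kernel w1 w2 (m - u) y + (ratio_kernel w1 w2 u m y - 2 * u / w1 * lc_kernel w2 m y)" proof (intro allI impI)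
      fix y :: real assume "y \<in> {0<..}"
      then have y: "y > 0" by simp
      define s1 where "s1 = sinh (w1 * of_real y)"
      define s2 where "s2 = sinh (w2 * of_real y)"
      have s: "s1 \<noteq> 0" "s2 \<noteq> 0" using sinh_nonzero assms y by (auto simp: s1_def s2_def)
      have sc: "sin (2 * of_real y * (m + u)) = sin (2 * of_real y * (m - u)) + 2 * cos (2 * of_real y * m) * sin (2 * of_real y * u)"
        by (simp add: distrib_left right_diff_distrib sin_add sin_diff)
      show "G_kernel w1 w2 (m + u) y = G_kernel w1 w2 (m - u) y + (ratio_kernel w1 w2 u m y - 2 * u / w1 * lc_kernel w2 m y)"
        unfolding G_kernel_def ratio_kernel_def lc_kernel_def sc s1_def[symmetric] s2_def[symmetric]
        using s nz y by (simp add: field_simps)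
    qed
  qed simp
  also have "\<dots> = (LBINT y:{0<..}. G_kernel w1 w2 (m - u) y) +
      ((LBINT y:{0<..}. ratio_kernel w1 w2 u m y) - 2 * u / w1 * log_cosh w2 m)"
    unfolding log_cosh_def set_integral_mult_right[symmetric]
    by (subst set_integral_add(2)[OF i2 set_integral_diff(1)[OF i3 set_integrable_mult_right[OF i4]]],
        subst set_integral_diff(2)[OF i3 set_integrable_mult_right[OF i4]]) (rule refl)
  finally have e: "(LBINT y:{0<..}. G_kernel w1 w2 (m + u) y) =
      (LBINT y:{0<..}. G_kernel w1 w2 (m - u) y) +
      ((LBINT y:{0<..}. ratio_kernel w1 w2 u m y) - 2 * u / w1 * log_cosh w2 m)" .
  show ?thesis unfolding G_strip_kernel e exp_add[symmetric] by (simp add: algebra_simps)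
qed

text \<open>For u = i w1 / 2 the sine in \<open>ratio_kernel\<close> becomes i sinh (w1 y) and the
  kernel vanishes identically; only the logarithm of cosh is left.\<close>

lemma G_strip_difference:
  assumes "Re w1 > 0" "Re w2 > 0" "2 * \<bar>Im z\<bar> < Re w2"
  shows "G_strip w1 w2 (z + \<i> * w1 / 2) = 2 * cosh (cpi * z / w2) * G_strip w1 w2 (z - \<i> * w1 / 2)"
proof -
  have nz: "w1 \<noteq> 0" using assms by auto
  have "ratio_kernel w1 w2 (\<i> * w1 / 2) z y = 0" if "y > 0" for y proof -
    have "sin (2 * of_real y * (\<i> * w1 / 2)) = \<i> * sinh (w1 * of_real y)" by (simp add: sinh_conv_sin mult_ac)
    then show ?thesis using sinh_nonzero[OF assms(1) that] nz by (simp add: ratio_kernel_def)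
  qed
  then have "(LBINT y:{0<..}. ratio_kernel w1 w2 (\<i> * w1 / 2) z y) = (LINT y::real|lborel. 0)"
    unfolding set_lebesgue_integral_def by (intro Bochner_Integration.integral_cong) (auto simp: indicator_def)
  then have "G_strip w1 w2 (z + \<i> * w1 / 2) = G_strip w1 w2 (z - \<i> * w1 / 2) *
      exp (\<i> * 0 - 2 * \<i> * (\<i> * w1 / 2) / w1 * log_cosh w2 z)" using G_strip_ratio[of w1 w2 z "\<i> * w1 / 2"] assms by simp
  also have "\<i> * 0 - 2 * \<i> * (\<i> * w1 / 2) / w1 * log_cosh w2 z = log_cosh w2 z" using nz by simp
  finally show ?thesis using exp_log_cosh[OF assms(2,3)] by (simp add: mult_ac)
qed

section \<open>The meromorphic continuation of the hyperbolic gamma function\<close>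

text \<open>The factor that G acquires from k steps of the difference equation in the first period,
  starting at y.\<close>

definition cosh_shift :: "complex \<Rightarrow> complex \<Rightarrow> complex \<Rightarrow> nat \<Rightarrow> complex" where
  "cosh_shift w1 w2 y k = (\<Prod>j<k. 2 * cosh (cpi * (y + \<i> * (of_nat j + 1 / 2) * w1) / w2))"

lemma cosh_shift_0 [simp]: "cosh_shift w1 w2 y 0 = 1"
  by (simp add: cosh_shift_def)

lemma cosh_shift_Suc:
  "cosh_shift w1 w2 y (Suc k) = cosh_shift w1 w2 y k * (2 * cosh (cpi * (y + \<i> * (of_nat k + 1 / 2) * w1) / w2))"
  by (simp add: cosh_shift_def)

lemma cosh_shift_add:
  "cosh_shift w1 w2 y (m + n) = cosh_shift w1 w2 y m * cosh_shift w1 w2 (y + \<i> * of_nat m * w1) n"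
proof (induction n)
  case (Suc n)
  have e: "y + \<i> * (of_nat (m + n) + 1 / 2) * w1 = (y + \<i> * of_nat m * w1) + \<i> * (of_nat n + 1 / 2) * w1"
    by (simp add: algebra_simps)
  show ?case unfolding add_Suc_right cosh_shift_Suc Suc e by simp
qed simp

lemma cdiff_cosh_shift [cdiff_intros]:
  assumes "cdiff f p" "cdiff g p" "cdiff h p" "g p \<noteq> 0"
  shows "cdiff (\<lambda>x. cosh_shift (f x) (g x) (h x) k) p" unfolding cosh_shift_def by (intro cdiff_intros assms)

lemma G_strip_shift:
  assumes w: "Re w1 > 0" "Re w2 > 0" and "2 * \<bar>Im y\<bar> < Re w1 + Re w2"
    and "2 * \<bar>Im (y + \<i> * of_nat k * w1)\<bar> < Re w1 + Re w2"
  shows "G_strip w1 w2 (y + \<i> * of_nat k * w1) = G_strip w1 w2 y * cosh_shift w1 w2 y k" using assms(3,4)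
proof (induction k)
  case (Suc k)
  define R where "R = real k * Re w1"
  have r: "0 \<le> R" using w by (simp add: R_def)
  have im: "Im (y + \<i> * of_nat k * w1) = Im y + R"
    "Im (y + \<i> * of_nat (Suc k) * w1) = Im y + R + Re w1" by (simp_all add: R_def algebra_simps)
  have 1: "2 * \<bar>Im (y + \<i> * of_nat k * w1)\<bar> < Re w1 + Re w2" using Suc.prems r w unfolding im by (smt (verit))
  define z where "z = y + \<i> * (of_nat k + 1 / 2) * w1"
  have "2 * Im z = 2 * Im y + 2 * R + Re w1" by (simp add: z_def R_def algebra_simps)
  then have z: "2 * \<bar>Im z\<bar> < Re w2" using Suc.prems r w unfolding im by (smt (verit))
  have zz: "z + \<i> * w1 / 2 = y + \<i> * of_nat (Suc k) * w1" "z - \<i> * w1 / 2 = y + \<i> * of_nat k * w1"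
    by (simp_all add: z_def algebra_simps)
  show ?case using G_strip_difference[OF w z] Suc.IH[OF Suc.prems(1) 1] unfolding zz by (simp add: cosh_shift_Suc z_def)
qed simp

text \<open>The argument is moved down into the strip by the nearest integer number of first
  periods. The strip is higher than one period, and \<open>G_shift_unique\<close> shows that any
  other admissible number gives the same value. No division occurs, so the result has no
  poles.\<close>

definition G_up :: "complex \<Rightarrow> complex \<Rightarrow> complex \<Rightarrow> complex" where
  "G_up w1 w2 z = (let k = nat (round (Im z / Re w1)); y = z - \<i> * of_nat k * w1
     in G_strip w1 w2 y * cosh_shift w1 w2 y k)"

text \<open>Below the strip the reflection G(-z) = 1/G(z) is used, so poles occur only as zeros of
  \<open>G_up\<close>. There the convention inverse 0 = 0 agrees with the prescribed value 0 at
  poles.\<close>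

definition G_cont :: "complex \<Rightarrow> complex \<Rightarrow> complex \<Rightarrow> complex" where
  "G_cont w1 w2 z = (if Im z \<ge> 0 then G_up w1 w2 z else inverse (G_up w1 w2 (- z)))"

context
  fixes w1 w2 :: complex
  assumes w: "Re w1 > 0" "Re w2 > 0"
begin

lemma G_shift_unique:
  assumes "2 * \<bar>Im (z - \<i> * of_nat k * w1)\<bar> < Re w1 + Re w2"
    and "2 * \<bar>Im (z - \<i> * of_nat k' * w1)\<bar> < Re w1 + Re w2"
  shows "G_strip w1 w2 (z - \<i> * of_nat k * w1) * cosh_shift w1 w2 (z - \<i> * of_nat k * w1) k
       = G_strip w1 w2 (z - \<i> * of_nat k' * w1) * cosh_shift w1 w2 (z - \<i> * of_nat k' * w1) k'" using assms
proof (induction k k' rule: linorder_wlog)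
  case (le k k')
  obtain d where k': "k' = d + k" using le(1) by (metis le_add_diff_inverse2)
  define y where "y = z - \<i> * of_nat k' * w1"
  have y: "z - \<i> * of_nat k * w1 = y + \<i> * of_nat d * w1" by (simp add: y_def k' algebra_simps)
  have "G_strip w1 w2 (y + \<i> * of_nat d * w1) = G_strip w1 w2 y * cosh_shift w1 w2 y d"
    using le(2,3) unfolding y y_def[symmetric] by (intro G_strip_shift w)
  then show ?case unfolding y y_def[symmetric] unfolding k' cosh_shift_add by simp
next
  case (sym k k')
  from sym(1)[OF sym(3,2)] show ?case by simp
qed

lemma G_up_eq:
  assumes "- (Re w1 + Re w2) < 2 * Im z" "2 * \<bar>Im (z - \<i> * of_nat k * w1)\<bar> < Re w1 + Re w2"
  shows "G_up w1 w2 z = G_strip w1 w2 (z - \<i> * of_nat k * w1) * cosh_shift w1 w2 (z - \<i> * of_nat k * w1) k"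
proof -
  define n where "n = nat (round (Im z / Re w1))"
  have "2 * \<bar>Im (z - \<i> * of_nat n * w1)\<bar> < Re w1 + Re w2" proof (cases "round (Im z / Re w1) \<ge> 0")
    case True
    have "\<bar>of_int (round (Im z / Re w1)) - Im z / Re w1\<bar> \<le> 1 / 2" by (rule of_int_round_abs_le)
    then have "\<bar>of_int (round (Im z / Re w1)) - Im z / Re w1\<bar> * Re w1 \<le> 1 / 2 * Re w1" using w by (intro mult_right_mono) auto
    also have "\<bar>of_int (round (Im z / Re w1)) - Im z / Re w1\<bar> * Re w1
        = \<bar>(of_int (round (Im z / Re w1)) - Im z / Re w1) * Re w1\<bar>" using w by (simp add: abs_mult)
    also have "(of_int (round (Im z / Re w1)) - Im z / Re w1) * Re w1 = real n * Re w1 - Im z"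
      using w True by (simp add: n_def algebra_simps)
    finally show ?thesis using w by (simp add: abs_minus_commute)
  next
    case False
    then have n: "n = 0" by (simp add: n_def)
    have "Im z / Re w1 < 0" proof (rule ccontr)
      assume "\<not> ?thesis"
      then have "round (Im z / Re w1) \<ge> round (0::real)" by (intro round_mono) simp
      with False show False by simp
    qed
    then have "Im z < 0" using w by (simp add: divide_less_0_iff)
    then show ?thesis using assms(1) n by simp
  qed
  then show ?thesis unfolding G_up_def Let_def n_def[symmetric] using assms(2) by (rule G_shift_unique)
qed

lemma G_up_exists:
  assumes "- (Re w1 + Re w2) < 2 * Im z"
  shows "\<exists>k. 2 * \<bar>Im (z - \<i> * of_nat k * w1)\<bar> < Re w1 + Re w2"
proof (cases "2 * Im z < Re w1 + Re w2")
  case True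
  then show ?thesis using assms by (intro exI[of _ 0]) (auto simp: abs_less_iff)
next
  case False
  define k where "k = nat \<lceil>Im z / Re w1\<rceil>"
  have p: "Im z / Re w1 > 0" using False w by simp
  then have "real k = of_int \<lceil>Im z / Re w1\<rceil>" by (simp add: k_def)
  then have k: "Im z / Re w1 \<le> real k" "real k < Im z / Re w1 + 1" by linarith+
  have 1: "Im z \<le> real k * Re w1" "real k * Re w1 < Im z + Re w1" using k w by (simp_all add: field_simps)
  show ?thesis proof (cases "2 * (real k * Re w1 - Im z) < Re w1 + Re w2")
    case True
    then show ?thesis using 1 by (intro exI[of _ k]) (simp add: abs_less_iff)
  next
    case False
    have "k \<noteq> 0" using k p by (intro notI) simp
    then have "real (k - 1) = real k - 1" by (simp add: of_nat_diff)
    then show ?thesis using 1 False w by (intro exI[of _ "k - 1"]) (simp add: abs_less_iff algebra_simps)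
  qed
qed

lemma G_up_strip: "2 * \<bar>Im z\<bar> < Re w1 + Re w2 \<Longrightarrow> G_up w1 w2 z = G_strip w1 w2 z"
  using G_up_eq[of z 0] by (simp add: abs_less_iff)

lemma G_cont_upper:
  assumes "- (Re w1 + Re w2) < 2 * Im z"
  shows "G_cont w1 w2 z = G_up w1 w2 z"
proof (cases "Im z \<ge> 0")
  case False
  then have "2 * \<bar>Im z\<bar> < Re w1 + Re w2" "2 * \<bar>Im (- z)\<bar> < Re w1 + Re w2" using assms by auto
  then show ?thesis using False by (simp add: G_cont_def G_up_strip G_strip_minus)
qed (simp add: G_cont_def)

lemma G_cont_lower:
  assumes "2 * Im z < Re w1 + Re w2"
  shows "G_cont w1 w2 z = inverse (G_up w1 w2 (- z))"
proof (cases "Im z \<ge> 0")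
  case True
  then have "2 * \<bar>Im z\<bar> < Re w1 + Re w2" "2 * \<bar>Im (- z)\<bar> < Re w1 + Re w2" using assms by auto
  then show ?thesis using True by (simp add: G_cont_def G_up_strip G_strip_minus)
qed (simp add: G_cont_def)

lemma G_cont_strip: "2 * \<bar>Im z\<bar> < Re w1 + Re w2 \<Longrightarrow> G_cont w1 w2 z = G_strip w1 w2 z"
  using G_cont_upper[of z] G_up_strip[of z] by (simp add: abs_less_iff)

lemma G_up_difference1:
  assumes "- Re w2 < 2 * Im z"
  shows "G_up w1 w2 (z + \<i> * w1 / 2) = 2 * cosh (cpi * z / w2) * G_up w1 w2 (z - \<i> * w1 / 2)"
proof -
  have h: "- (Re w1 + Re w2) < 2 * Im (z - \<i> * w1 / 2)" "- (Re w1 + Re w2) < 2 * Im (z + \<i> * w1 / 2)" using assms w by simp_all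
  obtain k where k: "2 * \<bar>Im (z - \<i> * w1 / 2 - \<i> * of_nat k * w1)\<bar> < Re w1 + Re w2" using G_up_exists[OF h(1)] by blast
  define y where "y = z - \<i> * w1 / 2 - \<i> * of_nat k * w1"
  have y: "z + \<i> * w1 / 2 - \<i> * of_nat (Suc k) * w1 = y" by (simp add: y_def algebra_simps)
  have z: "y + \<i> * (of_nat k + 1 / 2) * w1 = z" by (simp add: y_def algebra_simps)
  have "G_up w1 w2 (z - \<i> * w1 / 2) = G_strip w1 w2 y * cosh_shift w1 w2 y k" using G_up_eq[OF h(1) k] by (simp add: y_def)
  moreover have "G_up w1 w2 (z + \<i> * w1 / 2) = G_strip w1 w2 y * cosh_shift w1 w2 y (Suc k)"
    using G_up_eq[OF h(2), of "Suc k"] k unfolding y y_def[symmetric] by simp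
  ultimately show ?thesis by (simp add: cosh_shift_Suc z)
qed

end

lemma cdiff_G_up [cdiff_intros]:
  fixes f g h :: "'a::cnormed_space \<Rightarrow> complex"
  assumes "cdiff f p" "cdiff g p" "cdiff h p"
    and "Re (f p) > 0" "Re (g p) > 0" "- (Re (f p) + Re (g p)) < 2 * Im (h p)"
  shows "cdiff (\<lambda>x. G_up (f x) (g x) (h x)) p"
proof -
  obtain k where k: "2 * \<bar>Im (h p - \<i> * of_nat k * f p)\<bar> < Re (f p) + Re (g p)" using G_up_exists[OF assms(4-6)] by blast
  define U where "U = {q :: complex \<times> complex \<times> complex. 0 < Re (fst q) \<and> 0 < Re (fst (snd q)) \<and>
    - (Re (fst q) + Re (fst (snd q))) < 2 * Im (snd (snd q)) \<and>
    2 * \<bar>Im (snd (snd q) - \<i> * of_nat k * fst q)\<bar> < Re (fst q) + Re (fst (snd q))}"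
  let ?F = "\<lambda>q. G_strip (fst q) (fst (snd q)) (snd (snd q) - \<i> * of_nat k * fst q) *
    cosh_shift (fst q) (fst (snd q)) (snd (snd q) - \<i> * of_nat k * fst q) k"
  have "cdiff (\<lambda>q. G_up (fst q) (fst (snd q)) (snd (snd q))) (f p, g p, h p)" proof (rule cdiff_cong_open[where f = ?F])
    show "open U" unfolding U_def by (intro open_Collects continuous_intros)
    show "(f p, g p, h p) \<in> U" using assms k by (simp add: U_def)
    show "?F q = G_up (fst q) (fst (snd q)) (snd (snd q))" if "q \<in> U" for q
      using that by (intro G_up_eq[symmetric]) (auto simp: U_def)
    show "cdiff ?F (f p, g p, h p)" using assms k by (intro cdiff_intros) auto
  qed
  then have "cdiff (\<lambda>x. (\<lambda>q. G_up (fst q) (fst (snd q)) (snd (snd q))) (f x, g x, h x)) p"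
    by (intro cdiff_compose[where g = "\<lambda>q. G_up (fst q) (fst (snd q)) (snd (snd q))" and f = "\<lambda>x. (f x, g x, h x)"]
        cdiff_Pair assms)
  then show ?thesis by simp
qed

section \<open>Uniqueness of the meromorphic continuation\<close>

lemma nicely_meromorphic_on_cong_open:
  assumes "f nicely_meromorphic_on A" "open A" "\<And>z. z \<in> A \<Longrightarrow> f z = g z"
  shows "g nicely_meromorphic_on A"
proof -
  have ev: "eventually (\<lambda>w. f w = g w) (at z)" if "z \<in> A" for z
    using eventually_at_in_open'[OF assms(2) that] assms(3) by (rule eventually_mono)
  have "f meromorphic_on A \<longleftrightarrow> g meromorphic_on A" by (rule meromorphic_on_cong) (use ev in auto)
  moreover have "(is_pole g z \<and> g z = 0) \<or> g \<midarrow>z\<rightarrow> g z" if z: "z \<in> A" for z proof -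
    have "is_pole f z \<longleftrightarrow> is_pole g z" by (rule is_pole_cong[OF ev[OF z] refl])
    moreover have "(f \<midarrow>z\<rightarrow> g z) \<longleftrightarrow> (g \<midarrow>z\<rightarrow> g z)" by (rule tendsto_cong[OF ev[OF z]])
    ultimately show ?thesis using assms(1,3) z unfolding nicely_meromorphic_on_def by metis
  qed
  ultimately show ?thesis using assms(1) unfolding nicely_meromorphic_on_def by blast
qed

lemma nicely_meromorphic_on_Un:
  "f nicely_meromorphic_on A \<Longrightarrow> f nicely_meromorphic_on B \<Longrightarrow> f nicely_meromorphic_on (A \<union> B)"
  unfolding nicely_meromorphic_on_def using meromorphic_on_Un by blast

text \<open>The difference is identically zero off a sparse set. At the remaining points both
  functions have the same limit, or both have a pole and hence the value 0.\<close>

lemma nicely_meromorphic_unique: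
  assumes f: "f nicely_meromorphic_on UNIV" and g: "g nicely_meromorphic_on UNIV"
    and S: "open S" "S \<noteq> {}" "\<And>z. z \<in> S \<Longrightarrow> f z = g z"
  shows "f z = g z"
proof -
  have "(\<lambda>z. f z - g z) meromorphic_on UNIV" using f g by (intro meromorphic_intros) (auto simp: nicely_meromorphic_on_def)
  from meromorphic_imp_constant_or_avoid[OF this open_UNIV connected_UNIV, of 0]
  have "eventually (\<lambda>z. f z - g z = 0) (cosparse UNIV) \<or> eventually (\<lambda>z. f z - g z \<noteq> 0) (cosparse UNIV)" by simp
  then have ev: "eventually (\<lambda>z. f z = g z) (at z)" for z proof
    assume "eventually (\<lambda>z. f z - g z \<noteq> 0) (cosparse UNIV)"
    moreover obtain s where s: "s \<in> S" using S by blast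
    ultimately have "eventually (\<lambda>z. f z - g z \<noteq> 0) (at s)" by (simp add: eventually_cosparse_open_eq)
    moreover have "eventually (\<lambda>z. z \<in> S) (at s)" by (rule eventually_at_in_open'[OF S(1) s])
    ultimately have "eventually (\<lambda>z. False) (at s)" by eventually_elim (use S(3) in auto)
    then show ?thesis by simp
  qed (simp add: eventually_cosparse_open_eq)
  have p: "is_pole f z \<longleftrightarrow> is_pole g z" by (rule is_pole_cong[OF ev refl])
  have ex: "\<not> h \<midarrow>z\<rightarrow> c" if "is_pole h z" for h :: "complex \<Rightarrow> complex" and c
    using that not_tendsto_and_filterlim_at_infinity[of "at z" h c] unfolding is_pole_def by auto
  show ?thesis proof (cases "is_pole f z")
    case True
    then show ?thesis using f g p ex unfolding nicely_meromorphic_on_def by (metis UNIV_I)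
  next
    case False
    then have "f \<midarrow>z\<rightarrow> f z" "g \<midarrow>z\<rightarrow> g z" using f g p unfolding nicely_meromorphic_on_def by blast+
    moreover have "(g \<midarrow>z\<rightarrow> f z) \<longleftrightarrow> (f \<midarrow>z\<rightarrow> f z)" by (rule tendsto_cong[OF eventually_mono[OF ev]]) simp
    ultimately show ?thesis using LIM_unique by blast
  qed
qed

context
  fixes w1 w2 :: complex
  assumes w: "Re w1 > 0" "Re w2 > 0"
begin

definition up_half :: "real \<Rightarrow> complex set" where "up_half r = {z. - r < 2 * Im z}"

lemma up_half: "open (up_half r)" "convex (up_half r)"
proof -
  show "open (up_half r)" unfolding up_half_def by (intro open_Collect_less continuous_intros)
  have "up_half r = {z. Im z > - r / 2}" by (auto simp: up_half_def)
  then show "convex (up_half r)" using convex_halfspace_Im_gt[of "- r / 2"] by simp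
qed

lemma holomorphic_G_up: "G_up w1 w2 holomorphic_on up_half (Re w1 + Re w2)"
proof -
  have "holo (\<lambda>z. G_up w1 w2 z) (up_half (Re w1 + Re w2))"
    by (intro holoI up_half cdiff_intros) (use w in \<open>auto simp: up_half_def\<close>)
  then show ?thesis by (simp add: holo_complex_iff)
qed

text \<open>\<open>G_up\<close> is built from shifts by the first period only. Inside the strip G is
  symmetric in the periods, which gives the second equation there; the identity theorem carries it
  upwards.\<close>

lemma G_up_difference2:
  assumes "- Re w1 < 2 * Im z"
  shows "G_up w1 w2 (z + \<i> * w2 / 2) = 2 * cosh (cpi * z / w1) * G_up w1 w2 (z - \<i> * w2 / 2)"
proof (rule analytic_continuation_open[where f = "\<lambda>z. G_up w1 w2 (z + \<i> * w2 / 2)"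
      and g = "\<lambda>z. 2 * cosh (cpi * z / w1) * G_up w1 w2 (z - \<i> * w2 / 2)"
      and s = "{z. 2 * \<bar>Im z\<bar> < Re w1}" and s' = "up_half (Re w1)"])
  show "open {z. 2 * \<bar>Im z\<bar> < Re w1}" by (intro open_Collect_less continuous_intros)
  show "{z. 2 * \<bar>Im z\<bar> < Re w1} \<noteq> {}" using w by (auto intro!: exI[of _ 0])
  show "connected (up_half (Re w1))" by (intro convex_connected up_half)
  have "holo (\<lambda>z. G_up w1 w2 (z + \<i> * w2 / 2)) (up_half (Re w1))"
    by (intro holoI up_half cdiff_intros) (use w in \<open>auto simp: up_half_def\<close>)
  then show "(\<lambda>z. G_up w1 w2 (z + \<i> * w2 / 2)) holomorphic_on up_half (Re w1)" by (simp add: holo_complex_iff)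
  have "w1 \<noteq> 0" using w by auto
  then have "holo (\<lambda>z. 2 * cosh (cpi * z / w1) * G_up w1 w2 (z - \<i> * w2 / 2)) (up_half (Re w1))"
    by (intro holoI up_half cdiff_intros) (use w in \<open>auto simp: up_half_def\<close>)
  then show "(\<lambda>z. 2 * cosh (cpi * z / w1) * G_up w1 w2 (z - \<i> * w2 / 2)) holomorphic_on up_half (Re w1)"
    by (simp add: holo_complex_iff)
  fix z assume z: "z \<in> {z. 2 * \<bar>Im z\<bar> < Re w1}"
  then have "2 * \<bar>Im (z + \<i> * w2 / 2)\<bar> < Re w1 + Re w2" "2 * \<bar>Im (z - \<i> * w2 / 2)\<bar> < Re w1 + Re w2"
    using w abs_triangle_ineq[of "Im z" "Re w2 / 2"] abs_triangle_ineq4[of "Im z" "Re w2 / 2"] by simp_all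
  then show "G_up w1 w2 (z + \<i> * w2 / 2) = 2 * cosh (cpi * z / w1) * G_up w1 w2 (z - \<i> * w2 / 2)"
    using G_strip_difference[OF w(2,1), of z] z by (simp add: G_up_strip[OF w] G_strip_commute[of w1])
qed (use assms up_half in \<open>auto simp: up_half_def\<close>)

lemma G_cont_nicely_meromorphic: "G_cont w1 w2 nicely_meromorphic_on UNIV"
proof -
  let ?H = "up_half (Re w1 + Re w2)"
  have "G_up w1 w2 nicely_meromorphic_on ?H" using holomorphic_G_up up_half
    by (intro analytic_on_imp_nicely_meromorphic_on) (simp add: analytic_on_open)
  then have 1: "G_cont w1 w2 nicely_meromorphic_on ?H" by (rule nicely_meromorphic_on_cong_open[OF _ up_half(1)])
      (simp add: G_cont_upper[OF w] up_half_def)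
  have o: "open (uminus -` ?H)" by (intro open_vimage up_half continuous_intros)
  have "(\<lambda>z. G_up w1 w2 (- z)) holomorphic_on uminus -` ?H" proof -
    have "holo (\<lambda>z. G_up w1 w2 (- z)) (uminus -` ?H)" by (intro holoI o cdiff_intros) (use w in \<open>auto simp: up_half_def\<close>)
    then show ?thesis by (simp add: holo_complex_iff)
  qed
  then have "(\<lambda>z. inverse (G_up w1 w2 (- z))) nicely_meromorphic_on uminus -` ?H"
    using o by (intro nicely_meromorphic_on_inverse analytic_on_imp_nicely_meromorphic_on) (simp add: analytic_on_open)
  then have 2: "G_cont w1 w2 nicely_meromorphic_on uminus -` ?H"
    by (rule nicely_meromorphic_on_cong_open[OF _ o]) (simp add: G_cont_lower[OF w] up_half_def)
  have "?H \<union> uminus -` ?H = UNIV" using w by (auto simp: up_half_def)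
  then show ?thesis using nicely_meromorphic_on_Un[OF 1 2] by simp
qed

text \<open>A zero of \<open>G_up\<close> is isolated, so its reciprocal really tends to infinity.
  Hence at a point that is not a pole the division defining the lower half is genuine.\<close>

lemma G_cont_pole:
  assumes "2 * Im z < Re w1 + Re w2" "G_up w1 w2 (- z) = 0"
  shows "is_pole (G_cont w1 w2) z"
proof -
  let ?H = "up_half (Re w1 + Re w2)"
  have mz: "- z \<in> ?H" using assms by (simp add: up_half_def)
  have "0 \<in> ?H" "G_up w1 w2 0 \<noteq> 0" using w by (simp_all add: up_half_def G_up_strip[OF w])
  then obtain r where r: "r > 0" "ball (- z) r \<subseteq> ?H"
    "\<And>v. v \<in> ball (- z) r - {- z} \<Longrightarrow> G_up w1 w2 v \<noteq> 0"
    using isolated_zeros[OF holomorphic_G_up up_half(1) convex_connected[OF up_half(2)] mz assms(2)] by metis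
  have dd: "- v \<in> ball (- z) r" if "dist v z < r" for v using that by (simp add: dist_norm norm_minus_commute)
  have "isCont (G_up w1 w2) (- z)"
    using holomorphic_G_up mz up_half(1) by (metis continuous_on_eq_continuous_at holomorphic_on_imp_continuous_on)
  then have "isCont (\<lambda>v. G_up w1 w2 (- v)) z" by (rule isCont_o2[where f = uminus and g = "G_up w1 w2", rotated]) simp
  then have "(\<lambda>v. G_up w1 w2 (- v)) \<midarrow>z\<rightarrow> 0" using assms(2) by (simp add: isCont_def)
  moreover have "\<forall>\<^sub>F v in at z. G_up w1 w2 (- v) \<noteq> 0" unfolding eventually_at using r dd by (intro exI[of _ r]) auto
  ultimately have "filterlim (\<lambda>v. G_up w1 w2 (- v)) (at 0) (at z)" by (simp add: filterlim_at)
  then have "filterlim (\<lambda>v. inverse (G_up w1 w2 (- v))) at_infinity (at z)"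
    by (rule filterlim_compose[OF filterlim_inverse_at_infinity])
  then have p: "is_pole (\<lambda>v. inverse (G_up w1 w2 (- v))) z" by (simp add: is_pole_def)
  have "\<forall>\<^sub>F v in at z. inverse (G_up w1 w2 (- v)) = G_cont w1 w2 v" unfolding eventually_at
  proof (intro exI[of _ r] conjI ballI impI)
    fix v assume "v \<noteq> z \<and> dist v z < r"
    then have "- v \<in> ?H" using dd r(2) by blast
    then show "inverse (G_up w1 w2 (- v)) = G_cont w1 w2 v" by (simp add: up_half_def G_cont_lower[OF w])
  qed (rule r(1))
  from is_pole_cong[OF this refl] p show ?thesis by simp
qed

text \<open>Below the strip the equation is the reciprocal of the reflected one, and a reciprocal of
  0 is excluded because z - i v / 2 is not a pole. The roles of the periods are left open so that
  one argument serves both equations.\<close>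

lemma G_cont_difference_aux:
  assumes v: "Re v > 0" and vv: "Re v < Re w1 + Re w2" "u \<noteq> 0"
    and up: "\<And>z. Re v - (Re w1 + Re w2) < 2 * Im z \<Longrightarrow>
       G_up w1 w2 (z + \<i> * v / 2) = 2 * cosh (cpi * z / u) * G_up w1 w2 (z - \<i> * v / 2)"
    and np: "\<not> is_pole (G_cont w1 w2) (z - \<i> * v / 2)"
  shows "G_cont w1 w2 (z + \<i> * v / 2) = 2 * cosh (cpi * z / u) * G_cont w1 w2 (z - \<i> * v / 2)"
proof (cases "Re v - (Re w1 + Re w2) < 2 * Im z")
  case True
  then have "- (Re w1 + Re w2) < 2 * Im (z + \<i> * v / 2)" "- (Re w1 + Re w2) < 2 * Im (z - \<i> * v / 2)" using v by simp_all
  then show ?thesis using up[OF True] by (simp add: G_cont_upper[OF w])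
next
  case False
  then have l: "2 * Im (z + \<i> * v / 2) < Re w1 + Re w2" "2 * Im (z - \<i> * v / 2) < Re w1 + Re w2"
    and mz: "Re v - (Re w1 + Re w2) < 2 * Im (- z)" using v vv by simp_all
  have a: "- (z + \<i> * v / 2) = - z - \<i> * v / 2" "- (z - \<i> * v / 2) = - z + \<i> * v / 2" by simp_all
  have "G_up w1 w2 (- z + \<i> * v / 2) \<noteq> 0" using G_cont_pole[OF l(2)] np unfolding a by blast
  moreover have "G_up w1 w2 (- z + \<i> * v / 2) = 2 * cosh (cpi * z / u) * G_up w1 w2 (- z - \<i> * v / 2)" using up[OF mz] by simp
  ultimately show ?thesis unfolding G_cont_lower[OF w l(1)] G_cont_lower[OF w l(2)] a by (simp add: field_simps)
qed

text \<open>The values in the strip alone already determine the function; the difference equations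
  are needed only for existence.\<close>

lemma G_eq_G_cont: "G w1 w2 = G_cont w1 w2"
  unfolding G_def
proof (rule the_equality, intro conjI allI impI; (elim conjE)?)
  show "G_cont w1 w2 nicely_meromorphic_on UNIV" by (rule G_cont_nicely_meromorphic)
  show "G_cont w1 w2 z = G_strip w1 w2 z" if "\<bar>Im z\<bar> < Re ((w1 + w2) / 2)" for z using that by (intro G_cont_strip[OF w]) simp
  have nz: "w1 \<noteq> 0" "w2 \<noteq> 0" using w by auto
  show "G_cont w1 w2 (z + \<i> * w1 / 2) = 2 * cosh (cpi * z / w2) * G_cont w1 w2 (z - \<i> * w1 / 2)"
    if "\<not> is_pole (G_cont w1 w2) (z - \<i> * w1 / 2)" for z
    using that by (intro G_cont_difference_aux G_up_difference1[OF w] w nz) (use w in auto)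
  show "G_cont w1 w2 (z + \<i> * w2 / 2) = 2 * cosh (cpi * z / w1) * G_cont w1 w2 (z - \<i> * w2 / 2)"
    if "\<not> is_pole (G_cont w1 w2) (z - \<i> * w2 / 2)" for z
    using that by (intro G_cont_difference_aux G_up_difference2 w nz) (use w in auto)
next
  fix f
  assume f: "f nicely_meromorphic_on UNIV"
    "\<forall>z. \<bar>Im z\<bar> < Re ((w1 + w2) / 2) \<longrightarrow> f z = G_strip w1 w2 z"
  show "f = G_cont w1 w2" proof
    fix z
    show "f z = G_cont w1 w2 z"
    proof (rule nicely_meromorphic_unique[where f = f and g = "G_cont w1 w2" and z = z and S = "{z. 2 * \<bar>Im z\<bar> < Re w1 + Re w2}"])
      show "open {z. 2 * \<bar>Im z\<bar> < Re w1 + Re w2}" by (intro open_Collect_less continuous_intros)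
      show "{z. 2 * \<bar>Im z\<bar> < Re w1 + Re w2} \<noteq> {}" using w by (auto intro!: exI[of _ 0])
      show "f z = G_cont w1 w2 z" if "z \<in> {z. 2 * \<bar>Im z\<bar> < Re w1 + Re w2}" for z using f that by (simp add: G_cont_strip[OF w])
    qed (use f G_cont_nicely_meromorphic in auto)
  qed
qed

lemma G_up_nonzero_open:
  assumes "open V" "V \<subseteq> up_half (Re w1 + Re w2)" "V \<noteq> {}"
  shows "\<exists>z\<in>V. G_up w1 w2 z \<noteq> 0"
proof (rule ccontr)
  assume n: "\<not> ?thesis"
  have "G_up w1 w2 0 = 0" proof (rule analytic_continuation_open[where f = "G_up w1 w2" and g = "\<lambda>_. 0" and s = V
        and s' = "up_half (Re w1 + Re w2)"])
    show "connected (up_half (Re w1 + Re w2))" by (rule convex_connected[OF up_half(2)])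
    show "G_up w1 w2 z = 0" if "z \<in> V" for z using n that by simp
    show "0 \<in> up_half (Re w1 + Re w2)" using w by (simp add: up_half_def)
  qed (use assms up_half(1) holomorphic_G_up in simp_all)
  then show False using w by (simp add: G_up_strip[OF w])
qed

end

lemma G_eq_G_strip:
  "Re w1 > 0 \<Longrightarrow> Re w2 > 0 \<Longrightarrow> 2 * \<bar>Im z\<bar> < Re w1 + Re w2 \<Longrightarrow> G w1 w2 z = G_strip w1 w2 z" by (simp add: G_eq_G_cont G_cont_strip)

lemma holo_nz_G_up:
  "holo_nz (\<lambda>p. G_up (fst p) (fst (snd p)) (snd (snd p)))
     {p. Re (fst p) > 0 \<and> Re (fst (snd p)) > 0 \<and> - (Re (fst p) + Re (fst (snd p))) < 2 * Im (snd (snd p))}"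
  (is "holo_nz ?f ?U") unfolding holo_nz_iff
proof (intro conjI allI impI; (elim conjE)?)
  have "open ?U" by (intro open_Collects continuous_intros)
  then show "holo ?f ?U" by (intro holoI cdiff_intros) auto
  fix V :: "(complex \<times> complex \<times> complex) set"
  assume V: "open V" "V \<subseteq> ?U" "V \<noteq> {}"
  then obtain a b c where abc: "(a, b, c) \<in> V" by force
  define V' where "V' = {z. (a, b, z) \<in> V}"
  have "open ((\<lambda>z. (a, b, z)) -` V)" by (intro open_vimage V(1) continuous_intros)
  then have o: "open V'" by (simp add: V'_def vimage_def)
  have ab: "Re a > 0" "Re b > 0" using V abc by auto
  have "V' \<subseteq> up_half (Re a + Re b)" using V by (auto simp: V'_def up_half_def)
  then have "\<exists>z\<in>V'. G_up a b z \<noteq> 0" using abc by (intro G_up_nonzero_open ab o) (auto simp: V'_def)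
  then obtain z where "(a, b, z) \<in> V" "G_up a b z \<noteq> 0" by (auto simp: V'_def)
  then show "\<exists>p\<in>V. ?f p \<noteq> 0" by (intro bexI[of _ "(a, b, z)"]) auto
qed

text \<open>Two charts cover all arguments: above, G is the holomorphic function
  \<open>G_up\<close>; below, it is the reciprocal of a reflected copy.\<close>

lemma mero_nz_G:
  "mero_nz (\<lambda>p. G (fst p) (fst (snd p)) (snd (snd p))) {p. Re (fst p) > 0 \<and> Re (fst (snd p)) > 0}" unfolding mero_nz_def
proof
  let ?f = "\<lambda>p :: complex \<times> complex \<times> complex. G_up (fst p) (fst (snd p)) (snd (snd p))"
  let ?g = "\<lambda>p :: complex \<times> complex \<times> complex. G_up (fst p) (fst (snd p)) (- snd (snd p))"
  let ?U = "{p :: complex \<times> complex \<times> complex. Re (fst p) > 0 \<and> Re (fst (snd p)) > 0 \<and>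
    - (Re (fst p) + Re (fst (snd p))) < 2 * Im (snd (snd p))}"
  define \<alpha> where "\<alpha> = (\<lambda>p :: complex \<times> complex \<times> complex. (fst p, fst (snd p), - snd (snd p)))"
  have \<alpha>: "cdiff \<alpha> p" "linear \<alpha>" "surj \<alpha>" for p proof -
    show "cdiff \<alpha> p" unfolding \<alpha>_def by (intro cdiff_intros)
    show "linear \<alpha>" unfolding \<alpha>_def by (rule linearI) (auto simp: algebra_simps)
    have "\<alpha> (\<alpha> p) = p" for p by (simp add: \<alpha>_def)
    then show "surj \<alpha>" by (metis surjI)
  qed
  fix p :: "complex \<times> complex \<times> complex"
  assume p: "p \<in> {p. Re (fst p) > 0 \<and> Re (fst (snd p)) > 0}"
  show "\<exists>W g h k. p \<in> W \<and> mero_rep (\<lambda>p. G (fst p) (fst (snd p)) (snd (snd p))) g h k W \<and> holo_nz g W" proof (cases "p \<in> ?U")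
    case True
    have "mero_rep (\<lambda>p. G (fst p) (fst (snd p)) (snd (snd p))) ?f (\<lambda>_. 1) (\<lambda>_. 1) ?U"
      by (rule mero_rep_holo[OF holo_nz_holo[OF holo_nz_G_up]]) (simp add: G_eq_G_cont G_cont_upper)
    with True holo_nz_G_up show ?thesis by (intro exI[of _ ?U] exI[of _ ?f] exI[of _ "\<lambda>_. 1"] conjI)
  next
    case False
    have U: "\<alpha> -` ?U = {p. Re (fst p) > 0 \<and> Re (fst (snd p)) > 0 \<and> 2 * Im (snd (snd p)) < Re (fst p) + Re (fst (snd p))}"
      by (auto simp: \<alpha>_def)
    have GL: "G (fst p) (fst (snd p)) (snd (snd p)) = 1 / ?g p" if "p \<in> \<alpha> -` ?U" for p
      using that unfolding U by (simp add: G_eq_G_cont G_cont_lower inverse_eq_divide)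
    have "holo_nz ?g (\<alpha> -` ?U)" using holo_nz_compose[OF \<alpha> holo_nz_G_up] by (simp add: \<alpha>_def)
    moreover have o: "open (\<alpha> -` ?U)" using calculation by (rule holo_nz_open)
    ultimately have "mero_rep (\<lambda>p. G (fst p) (fst (snd p)) (snd (snd p))) (\<lambda>_. 1) ?g (\<lambda>_. 1) (\<alpha> -` ?U)" unfolding mero_rep_def
      by (intro conjI holo_nz_const1 holo_nz_holo[OF holo_nz_const1] ballI impI GL)
    moreover have "p \<in> \<alpha> -` ?U" using p False unfolding U by auto
    ultimately show ?thesis using holo_nz_const1[OF o] by (intro exI[of _ "\<alpha> -` ?U"] exI[of _ "\<lambda>_. 1"] exI[of _ ?g] conjI)
  qed
qed

section \<open>Growth of quotients of hyperbolic gamma functions\<close>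

lemma norm_LBINT_Ioi_le:
  fixes f :: "real \<Rightarrow> complex"
  assumes "set_integrable lborel {0<..} f" "\<And>y. y > 0 \<Longrightarrow> cmod (f y) \<le> C / (1 + y\<^sup>2)"
  shows "cmod (LBINT y:{0<..}. f y) \<le> (LINT x|lborel. C / (1 + (x::real)\<^sup>2))" unfolding set_lebesgue_integral_def
proof (rule norm_LINT_le)
  show "integrable lborel (\<lambda>x. indicat_real {0<..} x *\<^sub>R f x)" using assms(1) by (simp add: set_integrable_def)
  have "C \<ge> 0" using order_trans[OF norm_ge_zero assms(2)[of 1]] by simp
  then show "cmod (indicat_real {0<..} x *\<^sub>R f x) \<le> C / (1 + x\<^sup>2)" for x
    using assms(2)[of x] by (auto simp: indicator_def add_nonneg_nonneg)
qed (rule integrable_inverse_quad)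

text \<open>Logarithms of 1 are at least 2 \<pi> apart, so a continuous path among them cannot move.
  This controls the branch in the asymptotics of \<open>log_cosh\<close>.\<close>

lemma exp_eq_one_continuous_const:
  fixes h :: "real \<Rightarrow> complex"
  assumes cont: "continuous_on {0..1} h" and e: "\<And>s. s \<in> {0..1} \<Longrightarrow> exp (h s) = 1"
  shows "h 1 = h 0"
proof -
  have "h constant_on {0..1}" proof (rule continuous_discrete_range_constant[OF _ cont])
    fix x :: real assume x: "x \<in> {0..1}"
    have "2 * pi \<le> cmod (h y - h x)" if y: "y \<in> {0..1}" "h y \<noteq> h x" for y proof -
      have "exp (h y - h x) = 1" using e[OF x] e[OF y(1)] by (simp add: exp_diff)
      then obtain n :: int where n: "Re (h y - h x) = 0" "Im (h y - h x) = of_int (2 * n) * pi" unfolding exp_eq_1 by blast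
      have "n \<noteq> 0" using n y(2) by (auto simp: complex_eq_iff)
      then have "\<bar>real_of_int n\<bar> \<ge> 1" by linarith
      then have "2 * pi * 1 \<le> 2 * pi * \<bar>real_of_int n\<bar>" by (intro mult_left_mono) auto
      also have "\<dots> = \<bar>Im (h y - h x)\<bar>" unfolding n by (simp add: abs_mult)
      also have "\<dots> \<le> cmod (h y - h x)" by (rule abs_Im_le_cmod)
      finally show ?thesis by simp
    qed
    then show "\<exists>e>0. \<forall>y. y \<in> {0..1} \<and> h y \<noteq> h x \<longrightarrow> e \<le> norm (h y - h x)" by (intro exI[of _ "2 * pi"]) auto
  qed simp
  then obtain c where "\<And>s. s \<in> {0..1} \<Longrightarrow> h s = c" unfolding constant_on_def by blast
  then show ?thesis by simp
qed

text \<open>Either |Im (z/w)| is at most 1/4 and the exponential has nonnegative real part, or the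
  hypotheses force Re (z/w) to be at least 1/8 and the exponential has modulus at most exp
  (-\<pi>/4), which is at most 1/2. In both cases the sum stays away from 0.\<close>

lemma one_plus_exp_bounds:
  assumes w: "Re w > 0" "\<bar>Im w\<bar> \<le> Re w" and z: "8 * \<bar>Im z\<bar> \<le> Re w" "Re (z / w) \<ge> 0"
  shows "1 / 2 \<le> cmod (1 + exp (- (2 * cpi * z / w)))"
    and "cmod (1 + exp (- (2 * cpi * z / w))) \<le> 2"
    and "1 + exp (- (2 * cpi * z / w)) \<notin> \<real>\<^sub>\<le>\<^sub>0"
proof -
  define \<xi> where "\<xi> = exp (- (2 * cpi * z / w))"
  define \<alpha> where "\<alpha> = Re (z / w)"
  define \<beta> where "\<beta> = Im (z / w)"
  have zw: "z / w = Complex \<alpha> \<beta>" by (simp add: \<alpha>_def \<beta>_def)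
  have w0: "w \<noteq> 0" using w by auto
  have x: "- (2 * cpi * z / w) = Complex (- 2 * pi * \<alpha>) (- 2 * pi * \<beta>)" proof -
    have "- (2 * cpi * z / w) = of_real (- 2 * pi) * (z / w)" by simp
    then show ?thesis unfolding zw by (simp add: complex_eq_iff)
  qed
  have n: "cmod \<xi> = exp (- 2 * pi * \<alpha>)" unfolding \<xi>_def x by simp
  have n1: "cmod \<xi> \<le> 1" unfolding n using z(2) by (simp add: \<alpha>_def)
  have lower: "1 / 2 \<le> cmod (1 + \<xi>)" proof (cases "\<bar>\<beta>\<bar> \<le> 1 / 4")
    case True
    then have "cos (2 * pi * \<beta>) \<ge> 0" proof (intro cos_ge_zero)
      have "\<bar>2 * pi * \<beta>\<bar> = 2 * pi * \<bar>\<beta>\<bar>" by (simp add: abs_mult)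
      also have "\<dots> \<le> 2 * pi * (1 / 4)" using True by (intro mult_left_mono) auto
      also have "\<dots> = pi / 2" by simp
      finally show "- (pi / 2) \<le> 2 * pi * \<beta>" "2 * pi * \<beta> \<le> pi / 2" by linarith+
    qed
    then have "Re \<xi> \<ge> 0" unfolding \<xi>_def x by (simp add: Re_exp)
    then have "1 \<le> Re (1 + \<xi>)" by simp
    also have "\<dots> \<le> cmod (1 + \<xi>)" by (rule complex_Re_le_cmod)
    finally show ?thesis by simp
  next
    case False
    have "z = w * Complex \<alpha> \<beta>" using zw w0 by (simp add: field_simps)
    then have "Im z = Re w * \<beta> + Im w * \<alpha>" by simp
    then have "\<bar>Re w * \<beta>\<bar> \<le> \<bar>Im z\<bar> + \<bar>Im w * \<alpha>\<bar>" by linarith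
    then have "Re w * \<bar>\<beta>\<bar> \<le> \<bar>Im z\<bar> + \<bar>Im w\<bar> * \<alpha>" using w(1) z(2) by (simp add: abs_mult \<alpha>_def)
    also have "\<bar>Im w\<bar> * \<alpha> \<le> Re w * \<alpha>" using w z(2) by (intro mult_right_mono) (auto simp: \<alpha>_def)
    finally have "Re w * \<bar>\<beta>\<bar> \<le> Re w / 8 + Re w * \<alpha>" using z(1) by simp
    then have "Re w * \<bar>\<beta>\<bar> \<le> Re w * (1 / 8 + \<alpha>)" by (simp add: distrib_left)
    then have "\<bar>\<beta>\<bar> \<le> 1 / 8 + \<alpha>" using w(1) by simp
    then have a: "\<alpha> \<ge> 1 / 8" using False by simp
    have p3: "3 / 4 \<le> pi / 4" using pi_ge_two pi_gt3 by simp
    have "2 \<le> 1 + 3 / 4 + (3 / 4)\<^sup>2 / (2::real)" by (simp add: power2_eq_square)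
    also have "\<dots> \<le> exp (3 / 4)" by (rule exp_lower_Taylor_quadratic) simp
    also have "\<dots> \<le> exp (pi / 4)" using p3 by simp
    also have "\<dots> \<le> exp (2 * pi * \<alpha>)" proof -
      have "2 * pi * (1 / 8) \<le> 2 * pi * \<alpha>" using a by (intro mult_left_mono) auto
      then show ?thesis by simp
    qed
    finally have "exp (- 2 * pi * \<alpha>) \<le> 1 / 2" by (simp add: exp_minus field_simps)
    then have "cmod \<xi> \<le> 1 / 2" unfolding n .
    then show ?thesis using norm_triangle_ineq4[of "1 + \<xi>" \<xi>] by simp
  qed
  then show "1 / 2 \<le> cmod (1 + exp (- (2 * cpi * z / w)))" by (simp add: \<xi>_def)
  show "cmod (1 + exp (- (2 * cpi * z / w))) \<le> 2"
    unfolding \<xi>_def[symmetric] using norm_triangle_ineq[of 1 \<xi>] n1 norm_one[where ?'a = complex] by linarith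
  show "1 + exp (- (2 * cpi * z / w)) \<notin> \<real>\<^sub>\<le>\<^sub>0" proof
    assume "1 + exp (- (2 * cpi * z / w)) \<in> \<real>\<^sub>\<le>\<^sub>0"
    then have r: "Re (1 + \<xi>) \<le> 0" "Im (1 + \<xi>) = 0" by (auto simp: \<xi>_def complex_nonpos_Reals_iff)
    then have "Re \<xi> \<le> - 1" "Im \<xi> = 0" by simp_all
    moreover have "- Re \<xi> \<le> 1" using n1 abs_Re_le_cmod[of \<xi>] by simp
    ultimately have "1 + \<xi> = 0" by (simp add: complex_eq_iff)
    with lower show False by simp
  qed
qed

lemma norm_Ln_le:
  assumes "1 / 2 \<le> cmod v" "cmod v \<le> 2"
  shows "cmod (Ln v) \<le> ln 2 + pi"
proof -
  have v: "v \<noteq> 0" using assms by auto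
  have "ln (cmod v) \<le> ln 2" using assms by (subst ln_le_cancel_iff) auto
  moreover have "ln (1 / 2) \<le> ln (cmod v)" using assms by (subst ln_le_cancel_iff) auto
  moreover have "ln (1 / 2) = - ln (2::real)" by (simp add: ln_div)
  ultimately have "\<bar>Re (Ln v)\<bar> \<le> ln 2" unfolding Re_Ln[OF v] by (intro abs_leI) auto
  moreover have "\<bar>Im (Ln v)\<bar> \<le> pi" using Im_Ln_le_pi[OF v] mpi_less_Im_Ln[OF v] by simp
  ultimately show ?thesis using cmod_le[of "Ln v"] by linarith
qed

lemma log_cosh_minus: "log_cosh w (- z) = log_cosh w z"
  by (simp add: log_cosh_def lc_kernel_def)

text \<open>From 2 cosh t = exp t (1 + exp (-2 t)) one gets \<open>log_cosh\<close> up to a multiple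
  of 2 \<pi> i. Following the segment from 0 to z fixes this multiple, so the error bound does not
  depend on the length of the segment.\<close>

lemma log_cosh_asymp_aux:
  assumes w: "Re w > 0" "\<bar>Im w\<bar> \<le> Re w" and z: "8 * \<bar>Im z\<bar> \<le> Re w" "Re (z / w) \<ge> 0"
  shows "cmod (log_cosh w z - cpi * z / w) \<le> cmod (log_cosh w 0) + 2 * (ln 2 + pi)"
proof -
  define h where "h s = log_cosh w (of_real s * z) - cpi * (of_real s * z) / w
      - Ln (1 + exp (- (2 * cpi * (of_real s * z) / w)))" for s
  have sz: "8 * \<bar>Im (of_real s * z)\<bar> \<le> Re w" "Re (of_real s * z / w) \<ge> 0" "2 * \<bar>Im (of_real s * z)\<bar> < Re w"
    if "s \<in> {0..1}" for s proof -
    have "\<bar>Im (of_real s * z)\<bar> \<le> \<bar>Im z\<bar>" using that by (simp add: abs_mult mult_left_le_one_le)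
    then show "8 * \<bar>Im (of_real s * z)\<bar> \<le> Re w" "2 * \<bar>Im (of_real s * z)\<bar> < Re w" using z(1) w(1) by linarith+
    have "of_real s * z / w = of_real s * (z / w)" by simp
    then show "Re (of_real s * z / w) \<ge> 0" using that z(2) by (simp del: times_divide_eq_right Re_divide_of_real add: mult_nonneg_nonneg)
  qed
  note E = one_plus_exp_bounds[OF w sz(1,2)]
  have "h 1 = h 0" proof (rule exp_eq_one_continuous_const)
    have 1: "continuous_on {0..1} (\<lambda>s. log_cosh w (of_real s * z))"
    proof (rule continuous_on_compose2[where g = "log_cosh w" and t = "{z. 2 * \<bar>Im z\<bar> < Re w}"])
      show "continuous_on {z. 2 * \<bar>Im z\<bar> < Re w} (log_cosh w)" by (rule continuous_at_imp_continuous_on)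
          (auto intro!: field_differentiable_imp_continuous_at log_cosh_field_differentiable w)
    qed (use sz(3) in \<open>auto intro!: continuous_intros\<close>)
    have w0: "w \<noteq> 0" using w by auto
    have 2: "continuous_on {0..1} (\<lambda>s. 1 + exp (- (2 * cpi * (of_real s * z) / w)))" using w0 by (intro continuous_intros) auto
    show "continuous_on {0..1} h" unfolding h_def[abs_def] using w0 E(3) by (intro continuous_intros 1 2) auto
    fix s :: real assume s: "s \<in> {0..1}"
    have "1 + exp (- (2 * cpi * (of_real s * z) / w)) \<noteq> 0" using E(1)[OF s s] by fastforce
    then have "exp (h s) = 2 * cosh (cpi * (of_real s * z) / w) / exp (cpi * (of_real s * z) / w)
        / (1 + exp (- (2 * cpi * (of_real s * z) / w)))"
      unfolding h_def using exp_log_cosh[OF w(1) sz(3)[OF s]] by (simp add: exp_diff)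
    also have "2 * cosh (cpi * (of_real s * z) / w)
        = exp (cpi * (of_real s * z) / w) * (1 + exp (- (2 * cpi * (of_real s * z) / w)))" proof -
      have "exp t * (1 + exp (- (2 * t))) = 2 * cosh t" for t :: complex
        by (simp add: cosh_field_def distrib_left flip: exp_add)
      from this[of "cpi * (of_real s * z) / w"] show ?thesis by (simp add: mult.assoc)
    qed
    finally show "exp (h s) = 1" using \<open>1 + exp (- (2 * cpi * (of_real s * z) / w)) \<noteq> 0\<close> by simp
  qed
  then have "log_cosh w z - cpi * z / w = log_cosh w 0 - Ln 2 + Ln (1 + exp (- (2 * cpi * z / w)))"
    by (simp add: h_def algebra_simps)
  also have "cmod \<dots> \<le> cmod (log_cosh w 0) + cmod (Ln 2) + cmod (Ln (1 + exp (- (2 * cpi * z / w))))"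
    by (meson norm_triangle_ineq4 norm_triangle_mono order_refl)
  also have "\<dots> \<le> cmod (log_cosh w 0) + (ln 2 + pi) + (ln 2 + pi)"
    using one_plus_exp_bounds(1,2)[OF w z] by (intro add_mono norm_Ln_le) auto
  finally show ?thesis by simp
qed

lemma log_cosh_asymp:
  assumes "a > 0"
  shows "\<exists>C. \<forall>w c t. a \<le> Re w \<and> cmod w \<le> R \<and> \<bar>Im w\<bar> \<le> Re w \<and> cmod c \<le> R \<and> 8 * \<bar>Im c\<bar> \<le> Re w \<longrightarrow>
     cmod (log_cosh w (of_real t + c) - of_real (pi * \<bar>t\<bar>) / w) \<le> C"
proof -
  obtain C1 where C1: "\<And>w z y. a \<le> Re w \<and> cmod w \<le> R \<and> cmod z \<le> R \<and>
     2 * \<bar>Im z\<bar> + a \<le> Re w \<and> y > 0 \<Longrightarrow> cmod (lc_kernel w z y) \<le> C1 / (1 + y\<^sup>2)"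
    using lc_kernel_bound[OF assms assms, of R] by blast
  define I where "I = (LINT x|lborel. C1 / (1 + (x::real)\<^sup>2))"
  define K where "K = I + 2 * (ln 2 + pi)"
  define C where "C = K + pi * \<bar>R\<bar> / a + 2 * pi * (\<bar>R\<bar> ^ 3 / a\<^sup>2) / a"
  have "cmod (log_cosh w (of_real t + c) - of_real (pi * \<bar>t\<bar>) / w) \<le> C"
    if h: "a \<le> Re w" "cmod w \<le> R" "\<bar>Im w\<bar> \<le> Re w" "cmod c \<le> R" "8 * \<bar>Im c\<bar> \<le> Re w" for w c t proof -
    define m where "m = of_real t + c"
    have w: "Re w > 0" "w \<noteq> 0" "cmod w \<ge> a" using h assms complex_Re_le_cmod[of w] by auto
    have R0: "R > 0" using w(3) assms h(2) by linarith
    have "cmod (log_cosh w 0) \<le> I" unfolding log_cosh_def I_def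
      by (rule norm_LBINT_Ioi_le[OF lc_kernel_integrable C1]) (use w h R0 in auto)
    then have A: "cmod (log_cosh w z - cpi * z / w) \<le> K" if "8 * \<bar>Im z\<bar> \<le> Re w" "Re (z / w) \<ge> 0" for z
      using log_cosh_asymp_aux[OF w(1) h(3) that] by (simp add: K_def)
    have cw: "cmod (c / w) \<le> R / a" unfolding norm_divide using h w assms R0 by (intro frac_le) auto
    \<comment> \<open>The sign of \<open>Re (m / w)\<close> can differ from that of \<open>t\<close> only for bounded \<open>t\<close>.\<close>
    have B: "cmod (cpi * (of_real eps * m) / w - of_real (pi * \<bar>t\<bar>) / w) \<le> pi * \<bar>R\<bar> / a + 2 * pi * (\<bar>R\<bar> ^ 3 / a\<^sup>2) / a"
      if eps: "eps = 1 \<or> eps = -1" "eps * Re (m / w) \<ge> 0" for eps :: real proof -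
      have "\<bar>eps * t - \<bar>t\<bar>\<bar> \<le> 2 * (R ^ 3 / a\<^sup>2)" proof (cases "eps * t \<ge> 0")
        case True
        then have "eps * t = \<bar>t\<bar>" using eps(1) by auto
        then show ?thesis using R0 by simp
      next
        case False
        have r: "Re (of_real t / w) = t * (Re w / (cmod w)\<^sup>2)" by (simp add: Re_divide cmod_power2)
        have "eps * Re (m / w) = eps * t * (Re w / (cmod w)\<^sup>2) + eps * Re (c / w)"
          unfolding m_def add_divide_distrib plus_complex.sel r by (simp add: algebra_simps)
        then have "\<bar>t\<bar> * (Re w / (cmod w)\<^sup>2) \<le> eps * Re (c / w)" using eps False by (cases "eps = 1") (auto simp: abs_if)
        also have "\<dots> \<le> \<bar>Re (c / w)\<bar>" using eps(1) by auto
        also have "\<dots> \<le> R / a" using abs_Re_le_cmod[of "c / w"] cw by linarith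
        finally have "\<bar>t\<bar> * (Re w / (cmod w)\<^sup>2) \<le> R / a" .
        moreover have "a / R\<^sup>2 \<le> Re w / (cmod w)\<^sup>2" using h w assms R0 by (intro frac_le power_mono) auto
        ultimately have "\<bar>t\<bar> * (a / R\<^sup>2) \<le> R / a" by (meson abs_ge_zero mult_left_mono order_trans)
        then have "\<bar>t\<bar> \<le> R ^ 3 / a\<^sup>2" using R0 assms by (simp add: field_simps power2_eq_square power3_eq_cube)
        then show ?thesis using eps(1) by auto
      qed
      moreover have e1: "\<bar>eps\<bar> = 1" using eps(1) by auto
      moreover have "cpi * (of_real eps * m) / w - of_real (pi * \<bar>t\<bar>) / w
          = cpi * of_real eps * (c / w) + of_real (pi * (eps * t - \<bar>t\<bar>)) / w"
        by (simp add: m_def algebra_simps add_divide_distrib diff_divide_distrib)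
      then have "cmod (cpi * (of_real eps * m) / w - of_real (pi * \<bar>t\<bar>) / w)
          \<le> pi * cmod (c / w) + pi * \<bar>eps * t - \<bar>t\<bar>\<bar> / cmod w"
        using norm_triangle_ineq[of "cpi * of_real eps * (c / w)" "of_real (pi * (eps * t - \<bar>t\<bar>)) / w"]
        by (simp only: norm_mult norm_divide norm_of_real abs_mult e1 mult_1_right abs_of_pos[OF pi_gt_zero])
      moreover have "pi * cmod (c / w) \<le> pi * (R / a)" using cw by (intro mult_left_mono) auto
      moreover have "pi * \<bar>eps * t - \<bar>t\<bar>\<bar> / cmod w \<le> pi * (2 * (R ^ 3 / a\<^sup>2)) / a"
        using calculation(1) w assms R0 by (intro frac_le mult_left_mono) auto
      ultimately show ?thesis using R0 by (simp add: mult_ac)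
    qed
    have C: "cmod (log_cosh w m - of_real (pi * \<bar>t\<bar>) / w) \<le> C" proof -
      obtain eps :: real where eps: "eps = 1 \<or> eps = -1" "eps * Re (m / w) \<ge> 0" proof (cases "Re (m / w) \<ge> 0")
        case True then show ?thesis using that[of 1] by simp
      next
        case False then show ?thesis using that[of "-1"] by simp
      qed
      have L: "log_cosh w (of_real eps * m) = log_cosh w m" using eps(1) by (auto simp: log_cosh_minus)
      have "Re (of_real eps * m / w) \<ge> 0" using eps by auto
      moreover have "8 * \<bar>Im (of_real eps * m)\<bar> \<le> Re w" using eps(1) h(5) by (auto simp: m_def)
      ultimately have "cmod (log_cosh w m - cpi * (of_real eps * m) / w) \<le> K" using A[of "of_real eps * m"] by (simp add: L)
      with B[OF eps] show ?thesis using norm_triangle_ineq[of "log_cosh w m - cpi * (of_real eps * m) / w"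
            "cpi * (of_real eps * m) / w - of_real (pi * \<bar>t\<bar>) / w"] by (simp add: C_def)
    qed
    then show ?thesis by (simp add: m_def)
  qed
  then show ?thesis by blast
qed

text \<open>A single G has a quadratic exponent on a horizontal line; in a quotient it cancels and
  leaves exponential growth with a rate linear in \<alpha> - \<beta>. The formula
  \<open>G_strip_ratio\<close> is used with m the midpoint of the two arguments, and the condition
  on Im \<alpha> + Im \<beta> keeps m where the asymptotics of \<open>log_cosh\<close> hold.\<close>

lemma G_strip_quotient_bound:
  assumes "a > 0" "d > 0"
  shows "\<exists>K>0. \<forall>w1 w2 \<alpha> \<beta> t. a \<le> Re w1 \<and> a \<le> Re w2 \<and> cmod w1 \<le> R \<and> cmod w2 \<le> R \<and>
     cmod \<alpha> \<le> R \<and> cmod \<beta> \<le> R \<and> \<bar>Im w2\<bar> \<le> Re w2 \<and> 4 * \<bar>Im \<alpha> + Im \<beta>\<bar> \<le> Re w2 \<and>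
     2 * \<bar>Im \<alpha>\<bar> + d \<le> Re w1 + Re w2 \<and> 2 * \<bar>Im \<beta>\<bar> + d \<le> Re w1 + Re w2 \<longrightarrow>
     cmod (G_strip w1 w2 (of_real t + \<alpha>) / G_strip w1 w2 (of_real t + \<beta>))
       \<le> K * exp (\<bar>t\<bar> * Re (- (cpi * \<i> * (\<alpha> - \<beta>) / (w1 * w2))))"
proof -
  define d' where "d' = min d (a / 2)"
  have d': "d' > 0" "d' \<le> d" "2 * d' \<le> a" using assms by (auto simp: d'_def)
  obtain C1 where C1: "\<And>w1 w2 u m y. a \<le> Re w1 \<and> a \<le> Re w2 \<and> cmod w1 \<le> R \<and> cmod w2 \<le> R \<and> cmod u \<le> R \<and>
     2 * \<bar>Im m\<bar> + 2 * \<bar>Im u\<bar> + d' \<le> Re w1 + Re w2 \<and> 2 * \<bar>Im m\<bar> + d' \<le> Re w2 \<and> y > 0 \<Longrightarrow>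
     cmod (ratio_kernel w1 w2 u m y) \<le> C1 / (1 + y\<^sup>2)" using ratio_kernel_bound[OF assms(1) d'(1), of R] by blast
  obtain C2 where C2: "\<And>w c t. a \<le> Re w \<and> cmod w \<le> R \<and> \<bar>Im w\<bar> \<le> Re w \<and> cmod c \<le> R \<and> 8 * \<bar>Im c\<bar> \<le> Re w \<Longrightarrow>
     cmod (log_cosh w (of_real t + c) - of_real (pi * \<bar>t\<bar>) / w) \<le> C2" using log_cosh_asymp[OF assms(1), of R] by blast
  define I where "I = (LINT x|lborel. C1 / (1 + (x::real)\<^sup>2))"
  define K where "K = exp (I + 2 * \<bar>R\<bar> / a * \<bar>C2\<bar>)"
  have main: "cmod (G_strip w1 w2 (of_real t + \<alpha>) / G_strip w1 w2 (of_real t + \<beta>))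
       \<le> K * exp (\<bar>t\<bar> * Re (- (cpi * \<i> * (\<alpha> - \<beta>) / (w1 * w2))))"
    if h: "a \<le> Re w1" "a \<le> Re w2" "cmod w1 \<le> R" "cmod w2 \<le> R" "cmod \<alpha> \<le> R" "cmod \<beta> \<le> R"
      "\<bar>Im w2\<bar> \<le> Re w2" "4 * \<bar>Im \<alpha> + Im \<beta>\<bar> \<le> Re w2"
      "2 * \<bar>Im \<alpha>\<bar> + d \<le> Re w1 + Re w2" "2 * \<bar>Im \<beta>\<bar> + d \<le> Re w1 + Re w2" for w1 w2 \<alpha> \<beta> t proof -
    define m where "m = of_real t + (\<alpha> + \<beta>) / 2"
    define u where "u = (\<alpha> - \<beta>) / 2"
    have mu: "m + u = of_real t + \<alpha>" "m - u = of_real t + \<beta>" by (simp_all add: m_def u_def field_simps)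
    have imm: "2 * Im m = Im \<alpha> + Im \<beta>" "2 * Im u = Im \<alpha> - Im \<beta>" by (simp_all add: m_def u_def)
    have s: "2 * \<bar>Im m\<bar> + 2 * \<bar>Im u\<bar> + d' \<le> Re w1 + Re w2" "2 * \<bar>Im m\<bar> + d' \<le> Re w2" using h imm d' by (smt (verit))+
    have w: "Re w1 > 0" "Re w2 > 0" "w1 \<noteq> 0" "w2 \<noteq> 0" "cmod w1 \<ge> a" using h assms complex_Re_le_cmod[of w1] by auto
    have un: "cmod u \<le> R" "cmod ((\<alpha> + \<beta>) / 2) \<le> R"
      using norm_triangle_ineq4[of \<alpha> \<beta>] norm_triangle_ineq[of \<alpha> \<beta>] h by (simp_all add: u_def norm_divide)
    have st: "2 * \<bar>Im m\<bar> + 2 * \<bar>Im u\<bar> < Re w1 + Re w2" "2 * \<bar>Im m\<bar> < Re w2" using s d' by linarith+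
    define J where "J = (LBINT y:{0<..}. ratio_kernel w1 w2 u m y)"
    have J: "cmod J \<le> I" unfolding J_def I_def
      by (rule norm_LBINT_Ioi_le[OF ratio_kernel_integrable[OF w(1,2) st] C1]) (use h s un in auto)
    define L where "L = log_cosh w2 m"
    define \<delta> where "\<delta> = L - of_real (pi * \<bar>t\<bar>) / w2"
    have "8 * \<bar>Im ((\<alpha> + \<beta>) / 2)\<bar> \<le> Re w2" using h(8) by simp
    then have \<delta>: "cmod \<delta> \<le> C2" using C2[of w2 "(\<alpha> + \<beta>) / 2" t] h un unfolding \<delta>_def L_def m_def by simp
    have "G_strip w1 w2 (of_real t + \<alpha>) / G_strip w1 w2 (of_real t + \<beta>) = exp (\<i> * J - 2 * \<i> * u / w1 * L)"
      using G_strip_ratio[OF w(1,2) st] unfolding mu J_def L_def by simp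
    then have n: "cmod (G_strip w1 w2 (of_real t + \<alpha>) / G_strip w1 w2 (of_real t + \<beta>))
        = exp (Re (\<i> * J - 2 * \<i> * u / w1 * L))" by simp
    have "\<i> * J - 2 * \<i> * u / w1 * L = \<i> * J - 2 * \<i> * u / w1 * \<delta> + of_real \<bar>t\<bar> * (- (cpi * \<i> * (\<alpha> - \<beta>) / (w1 * w2)))"
      unfolding \<delta>_def u_def using w by (simp add: field_simps)
    moreover have rm: "Re (of_real s * x) = s * Re x" for s x by simp
    ultimately have "Re (\<i> * J - 2 * \<i> * u / w1 * L) = Re (\<i> * J) - Re (2 * \<i> * u / w1 * \<delta>) +
        \<bar>t\<bar> * Re (- (cpi * \<i> * (\<alpha> - \<beta>) / (w1 * w2)))" by (simp only: plus_complex.sel minus_complex.sel rm)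
    moreover have "Re (\<i> * J) \<le> I" using complex_Re_le_cmod[of "\<i> * J"] J by (simp add: norm_mult)
    moreover have "- Re (2 * \<i> * u / w1 * \<delta>) \<le> 2 * \<bar>R\<bar> / a * \<bar>C2\<bar>" proof -
      have "- Re (2 * \<i> * u / w1 * \<delta>) \<le> cmod (2 * \<i> * u / w1 * \<delta>)" using abs_Re_le_cmod[of "2 * \<i> * u / w1 * \<delta>"] by linarith
      also have "\<dots> = (2 * cmod u / cmod w1) * cmod \<delta>" by (simp add: norm_mult norm_divide)
      also have "\<dots> \<le> (2 * \<bar>R\<bar> / a) * \<bar>C2\<bar>" using un \<delta> w assms by (intro mult_mono frac_le) auto
      finally show ?thesis .
    qed
    ultimately have "Re (\<i> * J - 2 * \<i> * u / w1 * L) \<le> (I + 2 * \<bar>R\<bar> / a * \<bar>C2\<bar>) + \<bar>t\<bar> * Re (- (cpi * \<i> * (\<alpha> - \<beta>) / (w1 * w2)))"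
      by linarith
    then show ?thesis unfolding n K_def exp_add[symmetric] by simp
  qed
  have "K > 0" by (simp add: K_def)
  then show ?thesis using main by (intro exI[of _ K] conjI allI impI) simp_all
qed

section \<open>Shifting the contour across finitely many poles\<close>

lemma bounded_inverse_quad:
  fixes h :: "real \<Rightarrow> complex"
  assumes cont: "continuous_on UNIV h" and b: "\<And>t. \<bar>t\<bar> \<ge> X \<Longrightarrow> cmod (h t) \<le> C / (1 + t\<^sup>2)"
  shows "\<exists>C'. \<forall>t. cmod (h t) \<le> C' / (1 + t\<^sup>2)"
proof -
  have "compact ((\<lambda>t. of_real (1 + t\<^sup>2) * h t) ` {-X..X})"
    by (intro compact_continuous_image continuous_intros continuous_on_subset[OF cont]) auto
  then obtain B where B: "\<And>t. t \<in> {-X..X} \<Longrightarrow> cmod (of_real (1 + t\<^sup>2) * h t) \<le> B"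
    using compact_imp_bounded bounded_iff by (metis (no_types, lifting) image_eqI)
  have "cmod (h t) \<le> max B C / (1 + t\<^sup>2)" for t proof (cases "\<bar>t\<bar> \<ge> X")
    case True
    have "C / (1 + t\<^sup>2) \<le> max B C / (1 + t\<^sup>2)" by (intro divide_right_mono) auto
    then show ?thesis using b[OF True] by linarith
  next
    case False
    have p: "1 + t\<^sup>2 > 0" by (simp add: add_pos_nonneg)
    have "cmod (of_real (1 + t\<^sup>2) * h t) \<le> B" by (rule B) (use False in auto)
    then have "(1 + t\<^sup>2) * cmod (h t) \<le> B" unfolding norm_mult norm_of_real using p by simp
    then show ?thesis using p by (simp add: pos_le_divide_eq mult.commute max.coboundedI1)
  qed
  then show ?thesis by blast
qed

lemma integrable_of_inverse_quad:
  fixes h :: "real \<Rightarrow> complex"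
  assumes "continuous_on UNIV h" "\<And>t. cmod (h t) \<le> C / (1 + t\<^sup>2)"
  shows "integrable lborel h"
proof (rule Bochner_Integration.integrable_bound[OF integrable_inverse_quad[of C]])
  show "h \<in> borel_measurable lborel" using assms(1) by (auto intro: borel_measurable_continuous_onI)
  show "AE x in lborel. cmod (h x) \<le> norm (C / (1 + x\<^sup>2))"
    unfolding real_norm_def by (intro AE_I2 order_trans[OF assms(2) abs_ge_self])
qed

lemma has_contour_integral_linepath_same_Im_iff:
  assumes "a < b"
  shows "(f has_contour_integral I) (linepath (Complex a c) (Complex b c)) \<longleftrightarrow>
    ((\<lambda>x. f (of_real x + \<i> * of_real c)) has_integral I) {a..b}"
proof -
  have "(f has_contour_integral I) (linepath (Complex a c) (Complex b c)) \<longleftrightarrow>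
      ((\<lambda>x. f (linepath (Complex a c) (Complex b c) x) * (Complex b c - Complex a c)) has_integral I) {0..1}"
    by (subst has_contour_integral_linepath) simp_all
  also have "\<dots> \<longleftrightarrow> ((\<lambda>x. f (of_real (a + (b - a) * x) + \<i> * of_real c) * of_real (b - a)) has_integral I) {0..1}" using assms
    by (intro has_integral_cong arg_cong2[of _ _ _ _ "(*)"] arg_cong[of _ _ f])
       (auto simp: linepath_def complex_eq_iff algebra_simps)
  also have "{0..1} = (\<lambda>x. x / (b - a)) ` {0..b-a}" using assms by simp
  also have "((\<lambda>x. f (of_real (a + (b - a) * x) + \<i> * of_real c) * of_real (b - a)) has_integral I) \<dots> \<longleftrightarrow>
             ((\<lambda>x. f (of_real (a + x) + \<i> * of_real c) * of_real (b - a)) has_integral ((b-a) *\<^sub>R I)) {0..b-a}"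
    by (subst has_integral_stretch_real_iff) (use assms in simp_all)
  also have "\<dots> \<longleftrightarrow> ((\<lambda>x. of_real (b-a) * f (of_real x + \<i> * of_real c)) has_integral (b-a) *\<^sub>R I) {a..b}"
    by (subst has_integral_shift_real_ivl_iff[where c = "-a"]) (simp_all add: scaleR_conv_of_real mult_ac)
  also have "\<dots> \<longleftrightarrow> ((\<lambda>x. f (of_real x + \<i> * of_real c)) has_integral I) {a..b}"
    by (subst has_integral_mult_right_iff) (use assms in \<open>auto simp: scaleR_conv_of_real\<close>)
  finally show ?thesis .
qed

lemma contour_integral_linepath_tendsto:
  assumes cont: "continuous_on UNIV (\<lambda>t. f (of_real t + \<i> * of_real c))"
    and b: "\<And>t. cmod (f (of_real t + \<i> * of_real c)) \<le> C / (1 + t\<^sup>2)"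
  shows "((\<lambda>R. contour_integral (linepath (Complex (-R) c) (Complex R c)) f) \<longlongrightarrow>
    (LINT t|lborel. f (of_real t + \<i> * of_real c))) at_top"
proof -
  define h where "h t = f (of_real t + \<i> * of_real c)" for t :: real
  have h: "integrable lborel h" unfolding h_def by (rule integrable_of_inverse_quad[OF cont b])
  have "((\<lambda>R. LINT t|lborel. indicat_real {-R..R} t *\<^sub>R h t) \<longlongrightarrow> (LINT t|lborel. h t)) at_top"
  proof (rule integral_dominated_convergence_at_top[where w = "\<lambda>t. C / (1 + t\<^sup>2)"])
    show "h \<in> borel_measurable lborel" "(\<lambda>x. indicat_real {- t..t} x *\<^sub>R h x) \<in> borel_measurable lborel" for t
      using borel_measurable_integrable[OF h] by measurable
    show "AE x in lborel. ((\<lambda>i. indicat_real {- i..i} x *\<^sub>R h x) \<longlongrightarrow> h x) at_top" proof (intro AE_I2 tendsto_eventually)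
      fix x :: real
      show "\<forall>\<^sub>F i in at_top. indicat_real {- i..i} x *\<^sub>R h x = h x"
        using eventually_ge_at_top[of "\<bar>x\<bar>"] by eventually_elim (auto simp: indicator_def)
    qed
    have "0 \<le> C / (1 + t\<^sup>2)" for t using order_trans[OF norm_ge_zero b] .
    then show "\<forall>\<^sub>F i in at_top. AE x in lborel. cmod (indicat_real {- i..i} x *\<^sub>R h x) \<le> C / (1 + x\<^sup>2)"
      using b by (intro always_eventually allI AE_I2) (auto simp: indicator_def h_def)
  qed (rule integrable_inverse_quad)
  moreover have "\<forall>\<^sub>F R in at_top. (LINT t|lborel. indicat_real {-R..R} t *\<^sub>R h t)
      = contour_integral (linepath (Complex (-R) c) (Complex R c)) f" using eventually_gt_at_top[of 0] proof eventually_elim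
    case (elim R)
    have s: "set_integrable lborel {-R..R} h"
      by (rule set_integrable_subset[of _ UNIV]) (use h in \<open>auto simp: set_integrable_def\<close>)
    have "(h has_integral (LBINT t:{-R..R}. h t)) {-R..R}"
      using set_borel_integral_eq_integral[OF s] by (simp add: has_integral_integrable_integral)
    then have "(f has_contour_integral (LBINT t:{-R..R}. h t)) (linepath (Complex (-R) c) (Complex R c))"
      using elim by (subst has_contour_integral_linepath_same_Im_iff) (auto simp: h_def[abs_def])
    then show ?case by (simp add: contour_integral_unique set_lebesgue_integral_def)
  qed
  ultimately show ?thesis unfolding h_def by (rule Lim_transform_eventually)
qed

text \<open>The residue theorem on growing rectangles. The decay is assumed only for |t| at least X,
  since the poles lie between the lines; beyond X it makes the vertical sides vanish in the
  limit.\<close>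

lemma line_integral_shift:
  assumes S: "open S" "connected S" "\<And>z. c \<le> Im z \<Longrightarrow> Im z \<le> d \<Longrightarrow> z \<in> S" and "c < d"
    and P: "finite P" "\<And>p. p \<in> P \<Longrightarrow> c < Im p \<and> Im p < d"
    and f: "f holomorphic_on S - P"
    and b: "\<And>t y. \<bar>t\<bar> \<ge> X \<Longrightarrow> c \<le> y \<Longrightarrow> y \<le> d \<Longrightarrow> cmod (f (of_real t + \<i> * of_real y)) \<le> C / (1 + t\<^sup>2)"
  shows "(LINT t|lborel. f (of_real t + \<i> * of_real c)) - (LINT t|lborel. f (of_real t + \<i> * of_real d))
    = 2 * pi * \<i> * (\<Sum>p\<in>P. residue f p)"
proof -
  have cf: "continuous_on (S - P) f" using f by (rule holomorphic_on_imp_continuous_on)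
  define H where "H y R = contour_integral (linepath (Complex (-R) y) (Complex R y)) f" for y R
  define V where "V R = contour_integral (linepath (Complex R c) (Complex R d)) f" for R
  have H: "(H y \<longlongrightarrow> (LINT t|lborel. f (of_real t + \<i> * of_real y))) at_top" if y: "y = c \<or> y = d" for y proof -
    have y': "c \<le> y" "y \<le> d" using y \<open>c < d\<close> by auto
    have cont: "continuous_on UNIV (\<lambda>t. f (of_real t + \<i> * of_real y))" proof (rule continuous_on_compose2[OF cf])
      show "(\<lambda>t. of_real t + \<i> * of_real y) ` UNIV \<subseteq> S - P" using y y' S(3) P(2) by fastforce
    qed (intro continuous_intros)
    obtain C' where "\<And>t. cmod (f (of_real t + \<i> * of_real y)) \<le> C' / (1 + t\<^sup>2)"
      using bounded_inverse_quad[OF cont b] y' by blast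
    then show ?thesis unfolding H_def[abs_def] by (rule contour_integral_linepath_tendsto[OF cont])
  qed
  \<comment> \<open>Past this abscissa the bound holds and no pole remains, so the vertical sides
    avoid P and the rectangle encloses all of P.\<close>
  define X' where "X' = Max (insert (max X 1) ((\<lambda>p. \<bar>Re p\<bar> + 1) ` P))"
  have X': "X \<le> X'" "0 < X'" "\<And>p. p \<in> P \<Longrightarrow> \<bar>Re p\<bar> < X'" proof -
    have "max X 1 \<le> X'" unfolding X'_def using P(1) by (intro Max_ge) auto
    then show "X \<le> X'" "0 < X'" by auto
    fix p assume "p \<in> P"
    then have "\<bar>Re p\<bar> + 1 \<le> X'" unfolding X'_def using P(1) by (intro Max_ge) auto
    then show "\<bar>Re p\<bar> < X'" by simp
  qed
  have seg: "closed_segment (Complex R c) (Complex R d) \<subseteq> S - P" if "\<bar>R\<bar> \<ge> X'" for R proof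
    fix z assume "z \<in> closed_segment (Complex R c) (Complex R d)"
    then have z: "Re z = R" "c \<le> Im z" "Im z \<le> d"
      using \<open>c < d\<close> by (auto simp: closed_segment_same_Re closed_segment_eq_real_ivl)
    then show "z \<in> S - P" using S(3) X'(3) that by fastforce
  qed
  have Vb: "cmod (V R) \<le> C / (1 + R\<^sup>2) * (d - c)" if R: "\<bar>R\<bar> \<ge> X'" for R proof -
    have "cmod (V R) \<le> C / (1 + R\<^sup>2) * cmod (Complex R d - Complex R c)" unfolding V_def
    proof (rule contour_integral_bound_linepath)
      show "f contour_integrable_on linepath (Complex R c) (Complex R d)"
        by (rule contour_integrable_continuous_linepath[OF continuous_on_subset[OF cf seg[OF R]]])
      show "0 \<le> C / (1 + R\<^sup>2)" using order_trans[OF norm_ge_zero b[of R c]] R X'(1) \<open>c < d\<close> by simp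
      fix z assume "z \<in> closed_segment (Complex R c) (Complex R d)"
      then have z: "Re z = R" "c \<le> Im z" "Im z \<le> d"
        using \<open>c < d\<close> by (auto simp: closed_segment_same_Re closed_segment_eq_real_ivl)
      have "z = of_real R + \<i> * of_real (Im z)" using z(1) by (simp add: complex_eq_iff)
      then show "cmod (f z) \<le> C / (1 + R\<^sup>2)" using b[of R "Im z"] R X'(1) z by simp
    qed
    also have "Complex R d - Complex R c = \<i> * of_real (d - c)" by (simp add: complex_eq_iff)
    also have "cmod \<dots> = d - c" using \<open>c < d\<close> by (simp only: norm_mult norm_of_real norm_ii) simp
    finally show ?thesis .
  qed
  have lim0: "((\<lambda>R::real. C / (1 + R\<^sup>2) * (d - c)) \<longlongrightarrow> 0) at_top" by real_asymp
  have V0: "(V \<longlongrightarrow> 0) at_top" proof (rule Lim_null_comparison[OF _ lim0])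
    show "\<forall>\<^sub>F R in at_top. cmod (V R) \<le> C / (1 + R\<^sup>2) * (d - c)"
      using eventually_ge_at_top[of X'] by eventually_elim (use Vb in simp)
  qed
  have V0': "((\<lambda>R. V (- R)) \<longlongrightarrow> 0) at_top" proof (rule Lim_null_comparison[OF _ lim0])
    show "\<forall>\<^sub>F R in at_top. cmod (V (- R)) \<le> C / (1 + R\<^sup>2) * (d - c)"
      using eventually_ge_at_top[of X'] by eventually_elim (use Vb[of "- _"] in auto)
  qed
  have rect: "\<forall>\<^sub>F R in at_top. H c R + V R - H d R - V (- R) = 2 * pi * \<i> * (\<Sum>p\<in>P. residue f p)"
    using eventually_ge_at_top[of X'] proof eventually_elim
    case (elim R)
    define a1 where "a1 = Complex (-R) c"
    define a3 where "a3 = Complex R d"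
    have R: "R > 0" using elim X' by linarith
    have le: "Re a1 \<le> Re a3" "Im a1 \<le> Im a3" using R \<open>c < d\<close> by (auto simp: a1_def a3_def)
    have im: "path_image (rectpath a1 a3) \<subseteq> S - P" proof
      fix z assume z: "z \<in> path_image (rectpath a1 a3)"
      then have "z \<in> cbox a1 a3" "z \<notin> box a1 a3" using path_image_rectpath_cbox_minus_box[OF le] by auto
      moreover have "P \<subseteq> box a1 a3" using X'(3) P(2) elim by (fastforce simp: in_box_complex_iff a1_def a3_def)
      ultimately show "z \<in> S - P" using S(3) by (auto simp: in_cbox_complex_iff a1_def a3_def)
    qed
    have "contour_integral (rectpath a1 a3) f = 2 * pi * \<i> * (\<Sum>p\<in>P. winding_number (rectpath a1 a3) p * residue f p)"
    proof (rule Residue_theorem[OF S(1,2) P(1) f])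
      show "\<forall>z. z \<notin> S \<longrightarrow> winding_number (rectpath a1 a3) z = 0"
        using S(3) by (intro allI impI winding_number_rectpath_outside[OF le]) (auto simp: in_cbox_complex_iff a1_def a3_def)
    qed (use im in auto)
    also have "(\<Sum>p\<in>P. winding_number (rectpath a1 a3) p * residue f p) = (\<Sum>p\<in>P. residue f p)" proof (rule sum.cong[OF refl])
      fix p assume "p \<in> P"
      then have "p \<in> box a1 a3" using X'(3)[of p] P(2)[of p] elim by (auto simp: in_box_complex_iff a1_def a3_def)
      then show "winding_number (rectpath a1 a3) p * residue f p = residue f p" by (simp add: winding_number_rectpath)
    qed
    also have "contour_integral (rectpath a1 a3) f = H c R + V R - H d R - V (- R)" proof -
      define a2 where "a2 = Complex R c"
      define a4 where "a4 = Complex (-R) d"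
      have "path_image (rectpath a1 a3) = closed_segment a1 a2 \<union> closed_segment a2 a3 \<union> closed_segment a3 a4 \<union> closed_segment a4 a1"
        by (simp add: rectpath_def Let_def path_image_join Un_assoc a2_def a4_def a1_def a3_def)
      with im have "f contour_integrable_on linepath a1 a2" "f contour_integrable_on linepath a2 a3"
        "f contour_integrable_on linepath a3 a4" "f contour_integrable_on linepath a4 a1"
        by (auto intro!: contour_integrable_continuous_linepath continuous_on_subset[OF cf])
      then have "contour_integral (rectpath a1 a3) f = contour_integral (linepath a1 a2) f + contour_integral (linepath a2 a3) f +
          contour_integral (linepath a3 a4) f + contour_integral (linepath a4 a1) f"
        by (simp add: rectpath_def Let_def a1_def a2_def a3_def a4_def)
      moreover have "contour_integral (linepath a3 a4) f = - contour_integral (linepath a4 a3) f"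
        "contour_integral (linepath a4 a1) f = - contour_integral (linepath a1 a4) f"
        using contour_integral_reversepath[of "linepath a4 a3" f] contour_integral_reversepath[of "linepath a1 a4" f]
        by simp_all
      ultimately show ?thesis by (simp add: H_def V_def a1_def a2_def a3_def a4_def)
    qed
    finally show ?case .
  qed
  have "((\<lambda>R. H c R + V R - H d R - V (- R)) \<longlongrightarrow>
      (LINT t|lborel. f (of_real t + \<i> * of_real c)) + 0 - (LINT t|lborel. f (of_real t + \<i> * of_real d)) - 0) at_top"
    by (intro tendsto_intros H V0 V0') auto
  then have "((\<lambda>R::real. 2 * pi * \<i> * (\<Sum>p\<in>P. residue f p)) \<longlongrightarrow>
      (LINT t|lborel. f (of_real t + \<i> * of_real c)) + 0 - (LINT t|lborel. f (of_real t + \<i> * of_real d)) - 0) at_top"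
    using tendsto_cong[OF rect] by blast
  then show ?thesis by (simp add: tendsto_const_iff)
qed

section \<open>Bounds for the integrand\<close>

lemma sin_ge_linear:
  assumes "0 \<le> b" "b \<le> pi / 2"
  shows "2 * b / pi \<le> sin b"
proof -
  have "convex_on {0..pi} (\<lambda>x. - sin x)" by (rule f''_ge0_imp_convex[where f' = "\<lambda>x. - cos x" and f'' = sin])
      (auto intro!: derivative_eq_intros sin_ge_zero)
  then have "- sin ((1 - 2 * b / pi) *\<^sub>R 0 + (2 * b / pi) *\<^sub>R (pi / 2))
      \<le> (1 - 2 * b / pi) * (- sin 0) + (2 * b / pi) * (- sin (pi / 2))"
    using assms by (intro convex_onD) (auto simp: field_simps)
  then show ?thesis by simp
qed

text \<open>The square of |sinh (a + i b)| is the sum of the squares of sinh a and sin b; the first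
  is bounded below by a, the second by Jordan's inequality.\<close>

lemma norm_sinh_ge_half:
  assumes "\<bar>Im u\<bar> \<le> pi / 2"
  shows "cmod u / 2 \<le> cmod (sinh u)"
proof -
  define a where "a = Re u"
  define b where "b = Im u"
  have "sinh u = Complex (sinh a * cos b) (cosh a * sin b)"
    by (simp add: complex_eq_iff a_def b_def sinh_field_def cosh_field_def Re_exp Im_exp algebra_simps)
  then have "(cmod (sinh u))\<^sup>2 = (sinh a * cos b)\<^sup>2 + (cosh a * sin b)\<^sup>2" by (simp add: cmod_power2)
  also have "\<dots> = (sinh a)\<^sup>2 * ((cos b)\<^sup>2 + (sin b)\<^sup>2) + (sin b)\<^sup>2"
    by (simp add: power_mult_distrib cosh_square_eq distrib_left distrib_right del: sin_cos_squared_add2)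
  also have "\<dots> = (sinh a)\<^sup>2 + (sin b)\<^sup>2" by simp
  finally have e: "(cmod (sinh u))\<^sup>2 = (sinh a)\<^sup>2 + (sin b)\<^sup>2" .
  have "\<bar>a\<bar> \<le> \<bar>sinh a\<bar>" using sinh_ge_self[of "\<bar>a\<bar>"] by (cases "a \<ge> 0") auto
  then have 1: "\<bar>a\<bar>\<^sup>2 \<le> \<bar>sinh a\<bar>\<^sup>2" by (intro power_mono) auto
  have "2 * \<bar>b\<bar> / pi \<le> sin \<bar>b\<bar>" using assms by (intro sin_ge_linear) (auto simp: b_def)
  moreover have "\<bar>b\<bar> / 2 \<le> 2 * \<bar>b\<bar> / pi" using mult_right_mono[of pi 4 "\<bar>b\<bar>"] pi_less_4 by (simp add: field_simps)
  moreover have "\<bar>sin b\<bar> = \<bar>sin \<bar>b\<bar>\<bar>" by (auto simp: abs_if)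
  ultimately have "\<bar>b\<bar> / 2 \<le> \<bar>sin b\<bar>" by linarith
  then have 2: "(\<bar>b\<bar> / 2)\<^sup>2 \<le> \<bar>sin b\<bar>\<^sup>2" by (intro power_mono) auto
  have 3: "a\<^sup>2 \<le> 4 * (sinh a)\<^sup>2" using 1 zero_le_power2[of "sinh a"] unfolding power2_abs by linarith
  have 4: "b\<^sup>2 \<le> 4 * (sin b)\<^sup>2" using 2 by (simp add: power_divide)
  have "(cmod u / 2)\<^sup>2 = (a\<^sup>2 + b\<^sup>2) / 4" by (simp add: power_divide cmod_power2 a_def b_def)
  also have "\<dots> \<le> (cmod (sinh u))\<^sup>2" using 3 4 unfolding e by simp
  finally show ?thesis by (rule power2_le_imp_le) simp
qed

text \<open>A lower bound independent of t for complex periods. With small |Im v| the linear bound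
  for sinh applies; otherwise the condition on w2 makes the real part of v at least 1/4 in modulus.
  The perturbation by s w1 is at most 1/8 in v and cannot spoil this.\<close>

lemma norm_sinh_line_ge:
  fixes t s :: real
  assumes w: "Re w1 > 0" "Re w2 > 0" "\<bar>Im w2\<bar> \<le> Re w2" "8 * (s * cmod w1) \<le> Re w2" and s: "s \<ge> 1 / 2"
  shows "Re w1 / (2 * cmod w2) \<le> cmod (sinh (cpi * (of_real t - \<i> * of_real s * w1) / w2))"
proof -
  define v where "v = (of_real t - \<i> * of_real s * w1) / w2"
  define u where "u = cpi * v"
  have u: "cpi * (of_real t - \<i> * of_real s * w1) / w2 = u" by (simp add: u_def v_def)
  have w2: "cmod w2 > 0" "Re w2 \<le> cmod w2" using w complex_Re_le_cmod[of w2] by auto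
  have w1: "Re w1 \<le> cmod w1" by (rule complex_Re_le_cmod)
  show ?thesis proof (cases "\<bar>Im v\<bar> \<le> 1 / 2")
    case True
    have "Im u = pi * Im v" by (simp add: u_def)
    then have "\<bar>Im u\<bar> = pi * \<bar>Im v\<bar>" by (simp add: abs_mult)
    also have "\<dots> \<le> pi * (1 / 2)" using True by (intro mult_left_mono) auto
    finally have "cmod u / 2 \<le> cmod (sinh u)" by (intro norm_sinh_ge_half) simp
    moreover have "1 * cmod v \<le> pi / 2 * cmod v" using pi_ge_two by (intro mult_right_mono) auto
    then have "cmod v \<le> cmod u / 2" by (simp add: u_def norm_mult)
    moreover have "Re w1 / 2 \<le> cmod (of_real t - \<i> * of_real s * w1)" proof -
      have "1 / 2 * Re w1 \<le> s * Re w1" using s w(1) by (intro mult_right_mono) auto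
      also have "\<dots> = \<bar>Im (of_real t - \<i> * of_real s * w1)\<bar>" using s w(1) by simp
      also have "\<dots> \<le> cmod (of_real t - \<i> * of_real s * w1)" by (rule abs_Im_le_cmod)
      finally show ?thesis by simp
    qed
    then have "Re w1 / 2 / cmod w2 \<le> cmod v" unfolding v_def norm_divide by (intro divide_right_mono) auto
    ultimately show ?thesis unfolding u by simp
  next
    case False
    define e where "e = \<i> * of_real s * w1 / w2"
    have "cmod e = s * cmod w1 / cmod w2" using s by (simp add: e_def norm_mult norm_divide)
    also have "\<dots> \<le> 1 / 8" using w w2 by (simp add: field_simps)
    finally have e: "\<bar>Re e\<bar> \<le> 1 / 8" "\<bar>Im e\<bar> \<le> 1 / 8" using abs_Re_le_cmod[of e] abs_Im_le_cmod[of e] by linarith+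
    define q where "q = (Re w2)\<^sup>2 + (Im w2)\<^sup>2"
    have q: "q > 0" using w(2) by (simp add: q_def add_pos_nonneg)
    have "Re (of_real t / w2) = t * Re w2 / q" "Im (of_real t / w2) = - (t * Im w2 / q)"
      by (simp_all add: Re_divide Im_divide q_def)
    then have "\<bar>Im (of_real t / w2)\<bar> \<le> \<bar>Re (of_real t / w2)\<bar>"
      using w q by (simp add: abs_mult abs_divide divide_right_mono mult_left_mono)
    moreover have "v = of_real t / w2 - e" by (simp add: v_def e_def diff_divide_distrib)
    then have "Re v = Re (of_real t / w2) - Re e" "Im v = Im (of_real t / w2) - Im e" by simp_all
    ultimately have "\<bar>Re v\<bar> \<ge> 1 / 4" using False e by linarith
    then have "2 * (1 / 4) \<le> pi * \<bar>Re v\<bar>" using pi_ge_two by (intro mult_mono) auto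
    moreover have "\<bar>Re u\<bar> = pi * \<bar>Re v\<bar>" by (simp add: u_def abs_mult)
    ultimately have "\<bar>Re u\<bar> \<ge> 1 / 2" by simp
    have "\<bar>Re u\<bar> \<le> cmod (sinh u)" proof (cases "Re u \<ge> 0")
      case True
      then show ?thesis using norm_sinh_ge[of u] sinh_ge_self[of "Re u"] by simp
    next
      case False
      then show ?thesis using norm_sinh_ge[of "- u"] sinh_ge_self[of "- Re u"] by simp
    qed
    moreover have "Re w1 / (2 * cmod w2) \<le> 1 / 2" proof -
      have "1 / 2 * cmod w1 \<le> s * cmod w1" using s by (intro mult_right_mono) auto
      then have "Re w1 \<le> cmod w2" using w(4) w1 w2 by linarith
      then show ?thesis using w2 by (simp add: field_simps)
    qed
    ultimately show ?thesis unfolding u using \<open>\<bar>Re u\<bar> \<ge> 1 / 2\<close> by linarith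
  qed
qed

lemma cosh_diff_half_pi: "cosh (z - \<i> * cpi / 2) = - \<i> * sinh z"
proof -
  have c: "cosh (\<i> * cpi / 2) = (0::complex)" "sinh (\<i> * cpi / 2) = \<i>"
    by (simp_all add: cosh_field_def sinh_field_def exp_eq_polar cis.ctr complex_eq_iff)
  show ?thesis by (simp add: cosh_diff c)
qed

text \<open>Moving the argument by half the second period turns cosh into sinh, so the zeros of the
  product can be read off at the poles being crossed.\<close>

lemma cosh_shift_sinh:
  assumes "w2 \<noteq> 0"
  shows "cosh_shift w1 w2 (u - \<i> * w2 / 2) N = (\<Prod>j<N. - 2 * \<i> * sinh (cpi * (u + \<i> * (of_nat j + 1 / 2) * w1) / w2))"
  unfolding cosh_shift_def
proof (rule prod.cong[OF refl])
  fix j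
  have "cpi * (u - \<i> * w2 / 2 + \<i> * (of_nat j + 1 / 2) * w1) / w2 = cpi * (u + \<i> * (of_nat j + 1 / 2) * w1) / w2 - \<i> * cpi / 2"
    using assms by (simp add: field_simps)
  then show "2 * cosh (cpi * (u - \<i> * w2 / 2 + \<i> * (of_nat j + 1 / 2) * w1) / w2)
      = - 2 * \<i> * sinh (cpi * (u + \<i> * (of_nat j + 1 / 2) * w1) / w2)" by (simp only: cosh_diff_half_pi) simp
qed

lemma norm_cosh_shift_line_ge:
  fixes t :: real
  assumes w: "Re w1 > 0" "Re w2 > 0" "\<bar>Im w2\<bar> \<le> Re w2" "8 * (real N * cmod w1) \<le> Re w2"
  shows "(Re w1 / cmod w2) ^ N \<le> cmod (cosh_shift w1 w2 (of_real t - \<i> * w2 / 2 - \<i> * of_nat N * w1) N)"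
proof -
  have e: "of_real t - \<i> * w2 / 2 - \<i> * of_nat N * w1 = (of_real t - \<i> * of_nat N * w1) - \<i> * w2 / 2" by simp
  have "cmod (cosh_shift w1 w2 (of_real t - \<i> * w2 / 2 - \<i> * of_nat N * w1) N)
      = (\<Prod>j<N. 2 * cmod (sinh (cpi * ((of_real t - \<i> * of_nat N * w1) + \<i> * (of_nat j + 1 / 2) * w1) / w2)))"
    unfolding e using w(2) by (subst cosh_shift_sinh) (auto simp: prod_norm[symmetric] norm_mult)
  also have "\<dots> \<ge> (\<Prod>j<N. Re w1 / cmod w2)" proof (rule prod_mono, intro conjI)
    fix j assume "j \<in> {..<N}"
    then have j: "real j + 1 \<le> real N" by auto
    define s where "s = real N - (real j + 1 / 2)"
    have s: "1 / 2 \<le> s" "s \<le> real N" using j by (auto simp: s_def)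
    have "s * cmod w1 \<le> real N * cmod w1" using s by (intro mult_right_mono) auto
    then have "8 * (s * cmod w1) \<le> Re w2" using w(4) by linarith
    from norm_sinh_line_ge[OF w(1-3) this s(1), of t]
    have "Re w1 / cmod w2 \<le> 2 * cmod (sinh (cpi * (of_real t - \<i> * of_real s * w1) / w2))" by simp
    also have "of_real t - \<i> * of_real s * w1 = (of_real t - \<i> * of_nat N * w1) + \<i> * (of_nat j + 1 / 2) * w1"
      by (simp add: s_def algebra_simps)
    finally show "Re w1 / cmod w2
      \<le> 2 * cmod (sinh (cpi * ((of_real t - \<i> * of_nat N * w1) + \<i> * (of_nat j + 1 / 2) * w1) / w2))" .
    show "0 \<le> Re w1 / cmod w2" using w by simp
  qed
  finally show ?thesis by simp
qed

lemma norm_cosh_ge: "\<bar>Re z\<bar> \<le> cmod (cosh z)"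
proof -
  have "\<bar>Re (z + \<i> * cpi / 2)\<bar> \<le> cmod (sinh (z + \<i> * cpi / 2))" for z proof (cases "Re (z + \<i> * cpi / 2) \<ge> 0")
    case True
    then show ?thesis using norm_sinh_ge[of "z + \<i> * cpi / 2"] sinh_ge_self[of "Re z"] by simp
  next
    case False
    then show ?thesis using norm_sinh_ge[of "- (z + \<i> * cpi / 2)"] sinh_ge_self[of "- Re z"]
      by (simp only: sinh_minus norm_minus_cancel) simp
  qed
  from this[of z] cosh_diff_half_pi[of "z + \<i> * cpi / 2"] show ?thesis by (simp add: norm_mult)
qed

text \<open>A cruder bound than on the shifted line, for real periods and away from the imaginary
  axis. It is valid at every height between the two contours, as the vertical sides of the
  rectangles require.\<close>

lemma norm_cosh_shift_real_ge:
  fixes r1 r2 :: real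
  assumes "r2 > 0" "\<bar>Re y\<bar> \<ge> 1"
  shows "(2 * pi / r2) ^ N \<le> cmod (cosh_shift (of_real r1) (of_real r2) y N)"
proof -
  have "cmod (cosh_shift (of_real r1) (of_real r2) y N)
      = (\<Prod>j<N. 2 * cmod (cosh (cpi * (y + \<i> * (of_nat j + 1 / 2) * of_real r1) / of_real r2)))"
    by (simp add: cosh_shift_def prod_norm[symmetric] norm_mult)
  also have "\<dots> \<ge> (\<Prod>j<N. 2 * pi / r2)" proof (rule prod_mono, intro conjI)
    fix j
    have "cpi * (y + \<i> * (of_nat j + 1 / 2) * of_real r1) / of_real r2
        = of_real (pi / r2) * (y + \<i> * of_real ((real j + 1 / 2) * r1))" by simp
    then have "Re (cpi * (y + \<i> * (of_nat j + 1 / 2) * of_real r1) / of_real r2) = pi / r2 * Re y"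
      by (simp del: of_real_mult of_real_divide)
    moreover have "pi / r2 * 1 \<le> \<bar>pi / r2 * Re y\<bar>" unfolding abs_mult using assms by (intro mult_mono) auto
    ultimately show "2 * pi / r2 \<le> 2 * cmod (cosh (cpi * (y + \<i> * (of_nat j + 1 / 2) * of_real r1) / of_real r2))"
      using norm_cosh_ge[of "cpi * (y + \<i> * (of_nat j + 1 / 2) * of_real r1) / of_real r2"] by simp
    show "0 \<le> 2 * pi / r2" using assms by simp
  qed
  finally show ?thesis by simp
qed

text \<open>Six of the eight factors of the integrand. The other two are those responsible for the
  pinch: the numerator with +\<sigma>, whose poles are crossed, and the denominator with
  +\<upsilon>.\<close>

definition psi_regular where
  "psi_regular w1 w2 \<rho> \<sigma> \<tau> \<upsilon> x l z =
    G_strip w1 w2 (z + x + l / 2 - \<i> * w1 / 4 - \<i> * w2 / 4 + \<i> * \<tau>) *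
    G_strip w1 w2 (z + x + l / 2 - \<i> * w1 / 4 - \<i> * w2 / 4 - \<i> * \<tau>) *
    G_strip w1 w2 (z - l / 2 - \<i> * w1 / 4 - \<i> * w2 / 4 - \<i> * \<sigma>) /
    (G_strip w1 w2 (z + x - l / 2 + \<i> * w1 / 4 + \<i> * w2 / 4 + \<i> * \<rho>) *
     G_strip w1 w2 (z + x - l / 2 + \<i> * w1 / 4 + \<i> * w2 / 4 - \<i> * \<rho>) *
     G_strip w1 w2 (z + l / 2 + \<i> * w1 / 4 + \<i> * w2 / 4 - \<i> * \<upsilon>))"

definition psi_quot where
  "psi_quot N w1 w2 \<rho> \<sigma> \<tau> \<upsilon> x l z = psi_regular w1 w2 \<rho> \<sigma> \<tau> \<upsilon> x l z *
    G_strip w1 w2 (z - l / 2 - \<i> * w1 / 4 - \<i> * w2 / 4 + \<i> * \<sigma> + \<i> * of_nat N * w1) /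
    G_strip w1 w2 (z + l / 2 + \<i> * w1 / 4 + \<i> * w2 / 4 + \<i> * \<upsilon>)"

text \<open>
  The integrand of \<open>\<psi>\<close>, with the only factor that has poles below the real line written through
  the difference equation, so that these poles become zeros of \<^const>\<open>cosh_shift\<close>.
\<close>

definition psi_shifted where
  "psi_shifted N w1 w2 \<rho> \<sigma> \<tau> \<upsilon> x l z = psi_quot N w1 w2 \<rho> \<sigma> \<tau> \<upsilon> x l z /
    cosh_shift w1 w2 (z - l / 2 - \<i> * w1 / 4 - \<i> * w2 / 4 + \<i> * \<sigma>) N"

text \<open>
  Real and imaginary parts of the parameters for which all gamma functions in \<^const>\<open>psi_quot\<close>
  are evaluated in the strip, on the horizontal line at height \<open>y\<close>.
\<close>

definition strip_ok where
  "strip_ok m d (r1::real) r2 \<rho> \<sigma> \<tau> \<upsilon> x l y \<longleftrightarrow>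
    2 * \<bar>y + x + l / 2 - r1 / 4 - r2 / 4 + \<tau>\<bar> + d \<le> r1 + r2 \<and>
    2 * \<bar>y + x + l / 2 - r1 / 4 - r2 / 4 - \<tau>\<bar> + d \<le> r1 + r2 \<and>
    2 * \<bar>y - l / 2 - r1 / 4 - r2 / 4 - \<sigma>\<bar> + d \<le> r1 + r2 \<and>
    2 * \<bar>y - l / 2 - r1 / 4 - r2 / 4 + \<sigma> + m\<bar> + d \<le> r1 + r2 \<and>
    2 * \<bar>y + x - l / 2 + r1 / 4 + r2 / 4 + \<rho>\<bar> + d \<le> r1 + r2 \<and>
    2 * \<bar>y + x - l / 2 + r1 / 4 + r2 / 4 - \<rho>\<bar> + d \<le> r1 + r2 \<and>
    2 * \<bar>y + l / 2 + r1 / 4 + r2 / 4 - \<upsilon>\<bar> + d \<le> r1 + r2 \<and>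
    2 * \<bar>y + l / 2 + r1 / 4 + r2 / 4 + \<upsilon>\<bar> + d \<le> r1 + r2"

text \<open>The hypothesis on Im \<alpha> + Im \<beta> of \<open>G_strip_quotient_bound\<close> for
  the four pairs of a numerator and a denominator, in which the terms with \<lambda> and with the
  periods cancel.\<close>

definition pairs_ok where
  "pairs_ok m (r2::real) \<rho> \<sigma> \<tau> \<upsilon> x y \<longleftrightarrow>
    4 * \<bar>2 * y + 2 * x + \<tau> + \<rho>\<bar> \<le> r2 \<and> 4 * \<bar>2 * y + 2 * x - \<tau> - \<rho>\<bar> \<le> r2 \<and>
    4 * \<bar>2 * y - \<sigma> - \<upsilon>\<bar> \<le> r2 \<and> 4 * \<bar>2 * y + \<sigma> + \<upsilon> + m\<bar> \<le> r2"

abbreviation (input) admissible where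
  "admissible N a d R w1 w2 \<rho> \<sigma> \<tau> \<upsilon> x l c \<equiv>
     a \<le> Re w1 \<and> a \<le> Re w2 \<and> cmod w1 \<le> R \<and> cmod w2 \<le> R \<and>
     cmod \<rho> \<le> R \<and> cmod \<sigma> \<le> R \<and> cmod \<tau> \<le> R \<and> cmod \<upsilon> \<le> R \<and> cmod x \<le> R \<and> cmod l \<le> R \<and> cmod c \<le> R \<and>
     \<bar>Im w2\<bar> \<le> Re w2 \<and>
     strip_ok (of_nat N * Re w1) d (Re w1) (Re w2) (Re \<rho>) (Re \<sigma>) (Re \<tau>) (Re \<upsilon>) (Im x) (Im l) (Im c) \<and>
     pairs_ok (of_nat N * Re w1) (Re w2) (Re \<rho>) (Re \<sigma>) (Re \<tau>) (Re \<upsilon>) (Im x) (Im c)"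

text \<open>Each numerator is paired with one denominator and \<open>G_strip_quotient_bound\<close>
  is applied four times.\<close>

lemma psi_quot_bound_exp:
  assumes "a > 0" "d > 0"
  shows "\<exists>K>0. \<forall>w1 w2 \<rho> \<sigma> \<tau> \<upsilon> x l c t. admissible N a d R w1 w2 \<rho> \<sigma> \<tau> \<upsilon> x l c \<longrightarrow>
     cmod (psi_quot N w1 w2 \<rho> \<sigma> \<tau> \<upsilon> x l (of_real t + c))
       \<le> K * exp (\<bar>t\<bar> * (pi * ((real N - 2) * Re (1 / w2) - 2 * Re (1 / w1))))"
proof -
  define R' where "R' = real (N + 8) * \<bar>R\<bar>"
  obtain K where K: "K > 0" and bound: "\<And>w1 w2 \<alpha> \<beta> t. a \<le> Re w1 \<and> a \<le> Re w2 \<and> cmod w1 \<le> R' \<and> cmod w2 \<le> R' \<and>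
     cmod \<alpha> \<le> R' \<and> cmod \<beta> \<le> R' \<and> \<bar>Im w2\<bar> \<le> Re w2 \<and> 4 * \<bar>Im \<alpha> + Im \<beta>\<bar> \<le> Re w2 \<and>
     2 * \<bar>Im \<alpha>\<bar> + d \<le> Re w1 + Re w2 \<and> 2 * \<bar>Im \<beta>\<bar> + d \<le> Re w1 + Re w2 \<Longrightarrow>
     cmod (G_strip w1 w2 (of_real t + \<alpha>) / G_strip w1 w2 (of_real t + \<beta>))
       \<le> K * exp (\<bar>t\<bar> * Re (- (cpi * \<i> * (\<alpha> - \<beta>) / (w1 * w2))))" using G_strip_quotient_bound[OF assms, of R'] by blast
  have main: "cmod (psi_quot N w1 w2 \<rho> \<sigma> \<tau> \<upsilon> x l (of_real t + c))
       \<le> K ^ 4 * exp (\<bar>t\<bar> * (pi * ((real N - 2) * Re (1 / w2) - 2 * Re (1 / w1))))"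
    if h: "a \<le> Re w1" "a \<le> Re w2" "cmod w1 \<le> R" "cmod w2 \<le> R"
      "cmod \<rho> \<le> R" "cmod \<sigma> \<le> R" "cmod \<tau> \<le> R" "cmod \<upsilon> \<le> R" "cmod x \<le> R" "cmod l \<le> R" "cmod c \<le> R"
      "\<bar>Im w2\<bar> \<le> Re w2"
    and st: "strip_ok (of_nat N * Re w1) d (Re w1) (Re w2) (Re \<rho>) (Re \<sigma>) (Re \<tau>) (Re \<upsilon>) (Im x) (Im l) (Im c)"
    and pr: "pairs_ok (of_nat N * Re w1) (Re w2) (Re \<rho>) (Re \<sigma>) (Re \<tau>) (Re \<upsilon>) (Im x) (Im c)" for w1 w2 \<rho> \<sigma> \<tau> \<upsilon> x l c t proof -
    have R0: "R \<ge> 0" using order_trans[OF norm_ge_zero h(3)] .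
    have w0: "w1 \<noteq> 0" "w2 \<noteq> 0" using h assms by auto
    have nadd: "cmod (u + v) \<le> A + B" if "cmod u \<le> A" "cmod v \<le> B" for u v A B using that norm_triangle_mono by blast
    have nsub: "cmod (u - v) \<le> A + B" if "cmod u \<le> A" "cmod v \<le> B" for u v A B
      using that norm_triangle_ineq4[of u v] by linarith
    have n1: "cmod (u / 2) \<le> R" "cmod (\<i> * u / 4) \<le> R" "cmod (\<i> * u) \<le> R" if "cmod u \<le> R" for u proof -
      have "cmod u \<le> R * 2" "cmod u \<le> R * 4" using that R0 by linarith+
      then show "cmod (u / 2) \<le> R" "cmod (\<i> * u / 4) \<le> R" "cmod (\<i> * u) \<le> R" using that by (simp_all add: norm_divide norm_mult)
    qed
    have n2: "cmod (\<i> * of_nat N * w1) \<le> real N * R" using h(3) by (simp add: norm_mult mult_left_mono)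
    have wR: "cmod w1 \<le> R'" "cmod w2 \<le> R'" using h(3,4) R0 mult_right_mono[of 1 "real (N + 8)" R] by (simp_all add: R'_def)
    define \<alpha>1 where "\<alpha>1 = c + x + l / 2 - \<i> * w1 / 4 - \<i> * w2 / 4 + \<i> * \<tau>"
    define \<alpha>2 where "\<alpha>2 = c + x + l / 2 - \<i> * w1 / 4 - \<i> * w2 / 4 - \<i> * \<tau>"
    define \<alpha>3 where "\<alpha>3 = c - l / 2 - \<i> * w1 / 4 - \<i> * w2 / 4 - \<i> * \<sigma>"
    define \<alpha>4 where "\<alpha>4 = c - l / 2 - \<i> * w1 / 4 - \<i> * w2 / 4 + \<i> * \<sigma> + \<i> * of_nat N * w1"
    define \<beta>1 where "\<beta>1 = c + x - l / 2 + \<i> * w1 / 4 + \<i> * w2 / 4 + \<i> * \<rho>"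
    define \<beta>2 where "\<beta>2 = c + x - l / 2 + \<i> * w1 / 4 + \<i> * w2 / 4 - \<i> * \<rho>"
    define \<beta>3 where "\<beta>3 = c + l / 2 + \<i> * w1 / 4 + \<i> * w2 / 4 - \<i> * \<upsilon>"
    define \<beta>4 where "\<beta>4 = c + l / 2 + \<i> * w1 / 4 + \<i> * w2 / 4 + \<i> * \<upsilon>"
    note ds = \<alpha>1_def \<alpha>2_def \<alpha>3_def \<alpha>4_def \<beta>1_def \<beta>2_def \<beta>3_def \<beta>4_def
    have "cmod \<alpha>1 \<le> R + R + R + R + R + R" "cmod \<alpha>2 \<le> R + R + R + R + R + R"
      "cmod \<alpha>3 \<le> R + R + R + R + R" "cmod \<alpha>4 \<le> R + R + R + R + R + real N * R"
      "cmod \<beta>1 \<le> R + R + R + R + R + R" "cmod \<beta>2 \<le> R + R + R + R + R + R"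
      "cmod \<beta>3 \<le> R + R + R + R + R" "cmod \<beta>4 \<le> R + R + R + R + R" unfolding ds by (intro nadd nsub n1 n2 h)+
    moreover have "R + R + R + R + R + R \<le> R'" "R + R + R + R + R \<le> R'" "R + R + R + R + R + real N * R \<le> R'"
      using R0 unfolding R'_def by (auto simp: algebra_simps)
    ultimately have n: "cmod \<alpha>1 \<le> R'" "cmod \<alpha>2 \<le> R'" "cmod \<alpha>3 \<le> R'" "cmod \<alpha>4 \<le> R'"
      "cmod \<beta>1 \<le> R'" "cmod \<beta>2 \<le> R'" "cmod \<beta>3 \<le> R'" "cmod \<beta>4 \<le> R'" using order_trans by blast+
    have im: "Im \<alpha>1 = Im c + Im x + Im l / 2 - Re w1 / 4 - Re w2 / 4 + Re \<tau>"
      "Im \<alpha>2 = Im c + Im x + Im l / 2 - Re w1 / 4 - Re w2 / 4 - Re \<tau>"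
      "Im \<alpha>3 = Im c - Im l / 2 - Re w1 / 4 - Re w2 / 4 - Re \<sigma>"
      "Im \<alpha>4 = Im c - Im l / 2 - Re w1 / 4 - Re w2 / 4 + Re \<sigma> + of_nat N * Re w1"
      "Im \<beta>1 = Im c + Im x - Im l / 2 + Re w1 / 4 + Re w2 / 4 + Re \<rho>"
      "Im \<beta>2 = Im c + Im x - Im l / 2 + Re w1 / 4 + Re w2 / 4 - Re \<rho>"
      "Im \<beta>3 = Im c + Im l / 2 + Re w1 / 4 + Re w2 / 4 - Re \<upsilon>"
      "Im \<beta>4 = Im c + Im l / 2 + Re w1 / 4 + Re w2 / 4 + Re \<upsilon>" by (simp_all add: ds)
    have sum: "Im \<alpha>1 + Im \<beta>1 = 2 * Im c + 2 * Im x + Re \<tau> + Re \<rho>" "Im \<alpha>2 + Im \<beta>2 = 2 * Im c + 2 * Im x - Re \<tau> - Re \<rho>"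
      "Im \<alpha>3 + Im \<beta>3 = 2 * Im c - Re \<sigma> - Re \<upsilon>" "Im \<alpha>4 + Im \<beta>4 = 2 * Im c + Re \<sigma> + Re \<upsilon> + of_nat N * Re w1"
      unfolding im by simp_all
    define E where "E \<alpha> \<beta> = Re (- (cpi * \<i> * (\<alpha> - \<beta>) / (w1 * w2)))" for \<alpha> \<beta>
    define q where "q \<alpha> \<beta> = G_strip w1 w2 (of_real t + \<alpha>) / G_strip w1 w2 (of_real t + \<beta>)" for \<alpha> \<beta>
    have b: "cmod (q \<alpha>1 \<beta>1) \<le> K * exp (\<bar>t\<bar> * E \<alpha>1 \<beta>1)" "cmod (q \<alpha>2 \<beta>2) \<le> K * exp (\<bar>t\<bar> * E \<alpha>2 \<beta>2)"
      "cmod (q \<alpha>3 \<beta>3) \<le> K * exp (\<bar>t\<bar> * E \<alpha>3 \<beta>3)" "cmod (q \<alpha>4 \<beta>4) \<le> K * exp (\<bar>t\<bar> * E \<alpha>4 \<beta>4)" unfolding q_def E_def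
      by (rule bound, use st[unfolded strip_ok_def, folded im] pr[unfolded pairs_ok_def, folded sum] h(1,2,12) n wR in blast)+
    have "psi_quot N w1 w2 \<rho> \<sigma> \<tau> \<upsilon> x l (of_real t + c) = q \<alpha>1 \<beta>1 * q \<alpha>2 \<beta>2 * q \<alpha>3 \<beta>3 * q \<alpha>4 \<beta>4"
      unfolding psi_quot_def psi_regular_def q_def ds by (simp add: algebra_simps)
    then have "cmod (psi_quot N w1 w2 \<rho> \<sigma> \<tau> \<upsilon> x l (of_real t + c))
        = cmod (q \<alpha>1 \<beta>1) * cmod (q \<alpha>2 \<beta>2) * cmod (q \<alpha>3 \<beta>3) * cmod (q \<alpha>4 \<beta>4)" by (simp add: norm_mult)
    also have "\<dots> \<le> (K * exp (\<bar>t\<bar> * E \<alpha>1 \<beta>1)) * (K * exp (\<bar>t\<bar> * E \<alpha>2 \<beta>2)) * (K * exp (\<bar>t\<bar> * E \<alpha>3 \<beta>3)) * (K * exp (\<bar>t\<bar> * E \<alpha>4 \<beta>4))"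
      using K by (intro mult_mono b mult_nonneg_nonneg) auto
    also have "\<dots> = K ^ 4 * exp (\<bar>t\<bar> * (E \<alpha>1 \<beta>1 + E \<alpha>2 \<beta>2 + E \<alpha>3 \<beta>3 + E \<alpha>4 \<beta>4))"
      by (simp add: distrib_left exp_add power4_eq_xxxx)
    also have "E \<alpha>1 \<beta>1 + E \<alpha>2 \<beta>2 + E \<alpha>3 \<beta>3 + E \<alpha>4 \<beta>4
        = Re (- (cpi * \<i> * ((\<alpha>1 - \<beta>1) + (\<alpha>2 - \<beta>2) + (\<alpha>3 - \<beta>3) + (\<alpha>4 - \<beta>4)) / (w1 * w2)))"
      unfolding E_def plus_complex.sel[symmetric] by (simp add: algebra_simps add_divide_distrib diff_divide_distrib)
    \<comment> \<open>In the sum of the four differences all of \<rho>, \<sigma>, \<tau>,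
      \<upsilon>, x and \<lambda> cancel, so the rate depends on N and the periods only.\<close>
    also have "- (cpi * \<i> * ((\<alpha>1 - \<beta>1) + (\<alpha>2 - \<beta>2) + (\<alpha>3 - \<beta>3) + (\<alpha>4 - \<beta>4)) / (w1 * w2))
        = of_real (pi * (real N - 2)) * (1 / w2) - of_real (2 * pi) * (1 / w1)" unfolding ds using w0 by (simp add: field_simps)
    also have "Re \<dots> = pi * ((real N - 2) * Re (1 / w2) - 2 * Re (1 / w1))"
      by (simp only: minus_complex.sel times_complex.sel Re_complex_of_real Im_complex_of_real) (simp add: algebra_simps)
    finally show ?thesis .
  qed
  have "K ^ 4 > 0" using K by simp
  then show ?thesis using main by (intro exI[of _ "K ^ 4"] conjI allI impI) simp_all
qed

text \<open>The N steps contribute N Re (1/w2) to the rate, which the size of the second period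
  makes at most Re (1/w1). A strictly negative rate remains, and exponential decay is weakened to
  the quadratic majorant used throughout.\<close>

lemma psi_quot_bound:
  assumes "a > 0" "d > 0" "N \<ge> 1"
  shows "\<exists>K. \<forall>w1 w2 \<rho> \<sigma> \<tau> \<upsilon> x l c t. admissible N a d R w1 w2 \<rho> \<sigma> \<tau> \<upsilon> x l c \<and>
     \<bar>Im w1\<bar> \<le> Re w1 \<and> 2 * (real N * Re w1) \<le> Re w2 \<longrightarrow>
     cmod (psi_quot N w1 w2 \<rho> \<sigma> \<tau> \<upsilon> x l (of_real t + c)) \<le> K / (1 + t\<^sup>2)"
proof -
  obtain K where K: "K > 0" and bound: "\<And>w1 w2 \<rho> \<sigma> \<tau> \<upsilon> x l c t. admissible N a d R w1 w2 \<rho> \<sigma> \<tau> \<upsilon> x l c \<Longrightarrow>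
     cmod (psi_quot N w1 w2 \<rho> \<sigma> \<tau> \<upsilon> x l (of_real t + c))
       \<le> K * exp (\<bar>t\<bar> * (pi * ((real N - 2) * Re (1 / w2) - 2 * Re (1 / w1))))"
    using psi_quot_bound_exp[OF assms(1,2), of R N] by blast
  define \<kappa> where "\<kappa> = pi / (2 * (\<bar>R\<bar> + 1))"
  have \<kappa>: "\<kappa> > 0" by (simp add: \<kappa>_def)
  have main: "cmod (psi_quot N w1 w2 \<rho> \<sigma> \<tau> \<upsilon> x l (of_real t + c)) \<le> K * (1 + 2 / \<kappa>\<^sup>2) / (1 + t\<^sup>2)"
    if h: "a \<le> Re w1" "cmod w1 \<le> R" "\<bar>Im w1\<bar> \<le> Re w1" "2 * (real N * Re w1) \<le> Re w2"
      and b: "cmod (psi_quot N w1 w2 \<rho> \<sigma> \<tau> \<upsilon> x l (of_real t + c))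
       \<le> K * exp (\<bar>t\<bar> * (pi * ((real N - 2) * Re (1 / w2) - 2 * Re (1 / w1))))" for w1 w2 \<rho> \<sigma> \<tau> \<upsilon> x l c t proof -
    have r1: "Re w1 > 0" "Re w1 \<le> R" using h assms(1) complex_Re_le_cmod[of w1] by linarith+
    have "1 * Re w1 \<le> real N * Re w1" using r1 assms(3) by (intro mult_right_mono) auto
    then have r2: "Re w2 > 0" using h(4) r1 by linarith
    have "(Im w1)\<^sup>2 \<le> (Re w1)\<^sup>2" using power_mono[OF h(3) abs_ge_zero, of 2] by simp
    then have "(Re w1)\<^sup>2 + (Im w1)\<^sup>2 \<le> 2 * (Re w1)\<^sup>2" by simp
    then have "Re w1 / (2 * (Re w1)\<^sup>2) \<le> Re w1 / ((Re w1)\<^sup>2 + (Im w1)\<^sup>2)"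
      using r1 by (intro divide_left_mono) (auto intro!: mult_pos_pos add_pos_nonneg)
    also have "\<dots> = Re (1 / w1)" by (simp add: Re_divide)
    finally have "Re w1 / (2 * (Re w1)\<^sup>2) \<le> Re (1 / w1)" .
    then have 1: "1 / (2 * Re w1) \<le> Re (1 / w1)" using r1 by (simp add: power2_eq_square)
    have "Re (1 / w2) = Re w2 / ((Re w2)\<^sup>2 + (Im w2)\<^sup>2)" by (simp add: Re_divide)
    also have "\<dots> \<le> Re w2 / (Re w2)\<^sup>2" using r2 by (intro divide_left_mono) (auto intro!: mult_pos_pos add_pos_nonneg)
    finally have "Re (1 / w2) \<le> 1 / Re w2" using r2 by (simp add: power2_eq_square)
    moreover have pos: "Re (1 / w2) \<ge> 0" using r2 by (simp add: Re_divide)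
    ultimately have "(real N - 2) * Re (1 / w2) \<le> real N * (1 / Re w2)" by (intro mult_mono) auto
    also have "\<dots> \<le> 1 / (2 * Re w1)" using h(4) r1 r2 by (simp add: field_simps)
    finally have "(real N - 2) * Re (1 / w2) - 2 * Re (1 / w1) \<le> - (1 / (2 * Re w1))" using 1 by linarith
    also have "\<dots> \<le> - (1 / (2 * (\<bar>R\<bar> + 1)))" using r1 by (simp add: frac_le)
    finally have "pi * ((real N - 2) * Re (1 / w2) - 2 * Re (1 / w1)) \<le> pi * - (1 / (2 * (\<bar>R\<bar> + 1)))"
      by (rule mult_left_mono) simp
    then have "\<bar>t\<bar> * (pi * ((real N - 2) * Re (1 / w2) - 2 * Re (1 / w1))) \<le> \<bar>t\<bar> * - \<kappa>"
      by (intro mult_left_mono) (auto simp: \<kappa>_def)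
    then have "exp (\<bar>t\<bar> * (pi * ((real N - 2) * Re (1 / w2) - 2 * Re (1 / w1)))) \<le> exp (- \<kappa> * \<bar>t\<bar>)" by (simp add: mult.commute)
    also have "\<dots> \<le> (1 + 2 / \<kappa>\<^sup>2) / (1 + \<bar>t\<bar>\<^sup>2)" by (rule exp_le_inverse_quad[OF \<kappa>]) simp
    finally have "K * exp (\<bar>t\<bar> * (pi * ((real N - 2) * Re (1 / w2) - 2 * Re (1 / w1)))) \<le> K * ((1 + 2 / \<kappa>\<^sup>2) / (1 + \<bar>t\<bar>\<^sup>2))"
      using K by (intro mult_left_mono) auto
    with b show ?thesis by simp
  qed
  show ?thesis by (intro exI[of _ "K * (1 + 2 / \<kappa>\<^sup>2)"] allI impI main bound) simp_all
qed

section \<open>The residue expansion\<close>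

text \<open>With r2 so large all gamma arguments on the new line stay in the strip, given \<sigma>
  near -r2/8 and \<upsilon> near r2/8. The window for l - \<sigma> + \<upsilon> has two tasks. The
  original contour exists only below (r1 + r2)/2, and the special value of \<lambda> is at r2/2 + (N
  - 1/2) r1 when N = n + 1; the window meets the first range and contains the second.\<close>

definition region where
  "region N r1 r2 \<rho> \<sigma> \<tau> \<upsilon> x l \<longleftrightarrow> 0 < r1 \<and> 100 * (real N * r1) < r2 \<and>
     \<bar>\<rho>\<bar> < r1 \<and> \<bar>\<tau>\<bar> < r1 \<and> \<bar>x\<bar> < r1 \<and> \<bar>\<sigma> + r2 / 8\<bar> < r1 \<and> \<bar>\<upsilon> - r2 / 8\<bar> < r1 \<and>
     r2 / 2 - r1 / 2 < l - \<sigma> + \<upsilon> \<and> l - \<sigma> + \<upsilon> < r2 / 2 + real N * r1"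

definition line_height where
  "line_height N (r1::real) r2 \<sigma> l = l / 2 + r1 / 4 - r2 / 4 - \<sigma> - real N * r1"

text \<open>The condition |Im x| < \<zeta> under which \<psi> is an integral over the real line,
  with a margin d that leaves room for an open strip around the contours.\<close>

definition start_region where
  "start_region d (r1::real) r2 \<rho> \<sigma> \<tau> \<upsilon> x l \<longleftrightarrow> 0 < d \<and> d \<le> r1 \<and>
     \<bar>x\<bar> + \<bar>\<rho>\<bar> + \<bar>l\<bar> / 2 + d \<le> r1 / 4 + r2 / 4 \<and> \<bar>x\<bar> + \<bar>\<sigma>\<bar> + \<bar>l\<bar> / 2 + d \<le> r1 / 4 + r2 / 4 \<and>
     \<bar>x\<bar> + \<bar>\<tau>\<bar> + \<bar>l\<bar> / 2 + d \<le> r1 / 4 + r2 / 4 \<and> \<bar>x\<bar> + \<bar>\<upsilon>\<bar> + \<bar>l\<bar> / 2 + d \<le> r1 / 4 + r2 / 4"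

text \<open>The product N r1 is replaced by an atom m, so that every later position check is linear
  arithmetic.\<close>

lemma region_linear:
  assumes "region N r1 r2 \<rho> \<sigma> \<tau> \<upsilon> x l" "N \<ge> 1" "m = real N * r1"
  shows "r1 \<le> m" "0 < r1" "100 * m < r2" "\<rho> < r1" "- r1 < \<rho>" "\<tau> < r1" "- r1 < \<tau>"
    "x < r1" "- r1 < x" "\<sigma> + r2 / 8 < r1" "- r1 < \<sigma> + r2 / 8" "\<upsilon> - r2 / 8 < r1" "- r1 < \<upsilon> - r2 / 8"
    "r2 / 2 - r1 / 2 < l - \<sigma> + \<upsilon>" "l - \<sigma> + \<upsilon> < r2 / 2 + m"
proof -
  have "1 * r1 \<le> real N * r1" using assms unfolding region_def by (intro mult_right_mono) auto
  note * = this assms(1)[unfolded region_def abs_less_iff] assms(3)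
  show "r1 \<le> m" "0 < r1" "100 * m < r2" "\<rho> < r1" "- r1 < \<rho>" "\<tau> < r1" "- r1 < \<tau>"
    "x < r1" "- r1 < x" "\<sigma> + r2 / 8 < r1" "- r1 < \<sigma> + r2 / 8" "\<upsilon> - r2 / 8 < r1" "- r1 < \<upsilon> - r2 / 8"
    "r2 / 2 - r1 / 2 < l - \<sigma> + \<upsilon>" "l - \<sigma> + \<upsilon> < r2 / 2 + m" using * by linarith+
qed

lemma two_abs_le:
  fixes E :: real
  shows "E + d / 2 \<le> a / 2 + b / 2 \<Longrightarrow> - E + d / 2 \<le> a / 2 + b / 2 \<Longrightarrow> 2 * \<bar>E\<bar> + d \<le> a + b"
    and "E \<le> a / 4 \<Longrightarrow> - E \<le> a / 4 \<Longrightarrow> 4 * \<bar>E\<bar> \<le> a" by (auto simp: abs_if)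

lemma region_line_ok:
  assumes "region N r1 r2 \<rho> \<sigma> \<tau> \<upsilon> x l" "N \<ge> 1" "d \<le> r1" "d / 2 \<le> r2 / 2 + real N * r1 - (l - \<sigma> + \<upsilon>)"
  shows "strip_ok (real N * r1) d r1 r2 \<rho> \<sigma> \<tau> \<upsilon> x l (line_height N r1 r2 \<sigma> l)"
    and "pairs_ok (real N * r1) r2 \<rho> \<sigma> \<tau> \<upsilon> x (line_height N r1 r2 \<sigma> l)"
proof -
  define m where m: "m = real N * r1"
  note lin = region_linear[OF assms(1,2) m]
  note h = lin assms(3) assms(4)[folded m]
  define y where "y = line_height N r1 r2 \<sigma> l"
  have y: "y = l / 2 + r1 / 4 - r2 / 4 - \<sigma> - m" by (simp add: y_def line_height_def m)
  show "strip_ok (real N * r1) d r1 r2 \<rho> \<sigma> \<tau> \<upsilon> x l (line_height N r1 r2 \<sigma> l)"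
    unfolding strip_ok_def m[symmetric] y_def[symmetric] by (intro conjI two_abs_le; use h y in linarith)
  show "pairs_ok (real N * r1) r2 \<rho> \<sigma> \<tau> \<upsilon> x (line_height N r1 r2 \<sigma> l)" unfolding pairs_ok_def m[symmetric] y_def[symmetric]
    by (intro conjI two_abs_le; use h y in linarith)
qed

lemma start_region_ok:
  assumes "region N r1 r2 \<rho> \<sigma> \<tau> \<upsilon> x l" "N \<ge> 1" "start_region d r1 r2 \<rho> \<sigma> \<tau> \<upsilon> x l"
    and y: "line_height N r1 r2 \<sigma> l - d / 4 \<le> y" "y \<le> d / 4"
  shows "strip_ok (real N * r1) (d / 2) r1 r2 \<rho> \<sigma> \<tau> \<upsilon> x l y"
    and "pairs_ok (real N * r1) r2 \<rho> \<sigma> \<tau> \<upsilon> x y"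
    and "8 * \<bar>y\<bar> \<le> r2"
proof -
  define m where m: "m = real N * r1"
  note lin = region_linear[OF assms(1,2) m]
  have s: "0 < d" "d \<le> r1"
    "\<bar>x\<bar> + \<bar>\<sigma>\<bar> + \<bar>l\<bar> / 2 + d \<le> r1 / 4 + r2 / 4" "\<bar>x\<bar> + \<bar>\<upsilon>\<bar> + \<bar>l\<bar> / 2 + d \<le> r1 / 4 + r2 / 4"
    using assms(3) unfolding start_region_def by auto
  have s': "0 < d" "d \<le> r1" "- \<sigma> + l / 2 + d \<le> r1 / 4 + r2 / 4" "\<upsilon> + l / 2 + d \<le> r1 / 4 + r2 / 4"
    using s abs_ge_zero[of x] abs_ge_minus_self[of \<sigma>] abs_ge_self[of \<upsilon>] abs_ge_self[of l] by linarith+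
  define c where "c = line_height N r1 r2 \<sigma> l"
  have c: "c = l / 2 + r1 / 4 - r2 / 4 - \<sigma> - m" by (simp add: c_def line_height_def m)
  note h = lin s' y[folded c_def] c
  show "strip_ok (real N * r1) (d / 2) r1 r2 \<rho> \<sigma> \<tau> \<upsilon> x l y" unfolding strip_ok_def m[symmetric]
    by (intro conjI two_abs_le; use h in linarith)
  show "pairs_ok (real N * r1) r2 \<rho> \<sigma> \<tau> \<upsilon> x y" unfolding pairs_ok_def m[symmetric]
    by (intro conjI two_abs_le; use h in linarith)
  have "y \<le> r2 / 8" "- y \<le> r2 / 8" using h by linarith+
  then show "8 * \<bar>y\<bar> \<le> r2" by linarith
qed

text \<open>The left side is the height of the highest pole, m = 0: in the start region all poles to
  be crossed lie below the real line.\<close>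

lemma start_region_line_negative:
  assumes "start_region d r1 r2 \<rho> \<sigma> \<tau> \<upsilon> x l" "r1 > 0"
  shows "line_height N r1 r2 \<sigma> l + (real N * r1 - r1 / 2) < 0"
proof -
  have "0 < d" "\<bar>x\<bar> + \<bar>\<sigma>\<bar> + \<bar>l\<bar> / 2 + d \<le> r1 / 4 + r2 / 4" using assms(1) unfolding start_region_def by auto
  then have "0 < d" "- \<sigma> + l / 2 + d \<le> r1 / 4 + r2 / 4"
    using abs_ge_zero[of x] abs_ge_minus_self[of \<sigma>] abs_ge_self[of l] by linarith+
  then show ?thesis using assms(2) unfolding line_height_def by linarith
qed

section \<open>Position and residues of the crossed poles\<close>

definition psi_coeff where
  "psi_coeff m w1 w2 = 1 / (\<Prod>j<m. - 2 * sin (cpi * of_nat (Suc j) * w1 / w2))"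

definition psi_pole where
  "psi_pole m w1 w2 \<sigma> l = l / 2 - \<i> * w1 / 4 - \<i> * w2 / 4 - \<i> * \<sigma> - \<i> * of_nat m * w1"

text \<open>Halfway between the poles N - 1 and N. Since the offset depends complex linearly on the
  parameters, the poles keep their position relative to the line and the integral becomes
  holomorphic in all of them.\<close>

definition psi_line where
  "psi_line N w1 w2 \<sigma> l = l / 2 + \<i> * w1 / 4 - \<i> * w2 / 4 - \<i> * \<sigma> - \<i> * of_nat N * w1"

lemma Im_psi_line: "Im (psi_line N w1 w2 \<sigma> l) = line_height N (Re w1) (Re w2) (Re \<sigma>) (Im l)"
  by (simp add: psi_line_def line_height_def)

lemma Im_psi_pole: "Im (psi_pole m w1 w2 \<sigma> l)
    = line_height N (Re w1) (Re w2) (Re \<sigma>) (Im l) + (real N * Re w1 - Re w1 / 2 - real m * Re w1)"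
  by (simp add: psi_pole_def line_height_def)

lemma cosh_shift_psi_pole:
  assumes "w2 \<noteq> 0"
  shows "cosh_shift w1 w2 (z - l / 2 - \<i> * w1 / 4 - \<i> * w2 / 4 + \<i> * \<sigma>) N
    = (\<Prod>j<N. - 2 * \<i> * sinh (cpi * (z - psi_pole j w1 w2 \<sigma> l) / w2))"
proof -
  define u where "u = z - l / 2 - \<i> * w1 / 4 + \<i> * w2 / 4 + \<i> * \<sigma>"
  have "z - l / 2 - \<i> * w1 / 4 - \<i> * w2 / 4 + \<i> * \<sigma> = u - \<i> * w2 / 2" by (simp add: u_def)
  moreover have "u + \<i> * (of_nat j + 1 / 2) * w1 = z - psi_pole j w1 w2 \<sigma> l" for j
    by (simp add: u_def psi_pole_def algebra_simps)
  ultimately show ?thesis using cosh_shift_sinh[OF assms, of w1 u N] by simp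
qed

lemma sinh_small_eq_0:
  fixes r :: real
  assumes "r > 0" "2 * \<bar>Im v\<bar> \<le> r" "sinh (cpi * v / of_real r) = 0"
  shows "v = 0"
proof -
  define u where "u = cpi * v / of_real r"
  have "Im u = pi / r * Im v" unfolding u_def by (simp add: Im_divide_of_real)
  then have "\<bar>Im u\<bar> = pi / r * \<bar>Im v\<bar>" using assms(1) by (simp add: abs_mult)
  also have "\<dots> \<le> pi / r * (r / 2)" using assms by (intro mult_left_mono) auto
  also have "\<dots> = pi / 2" using assms by simp
  finally have "cmod u / 2 \<le> cmod (sinh u)" by (rule norm_sinh_ge_half)
  then have "u = 0" using assms(3) by (simp add: u_def)
  then show ?thesis using assms(1) by (simp add: u_def)
qed

lemma sinh_tendsto:
  assumes "w \<noteq> 0"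
  shows "((\<lambda>z. (z - p) / (- 2 * \<i> * sinh (cpi * (z - p) / w))) \<longlongrightarrow> w / (- 2 * \<i> * cpi)) (at p)"
proof -
  have "((\<lambda>z. - 2 * \<i> * sinh (cpi * (z - p) / w)) has_field_derivative - 2 * \<i> * cpi / w) (at p)"
    by (auto intro!: derivative_eq_intros simp: assms)
  then have "((\<lambda>z. (- 2 * \<i> * sinh (cpi * (z - p) / w)) / (z - p)) \<longlongrightarrow> - 2 * \<i> * cpi / w) (at p)"
    unfolding has_field_derivative_iff by simp
  then have "((\<lambda>z. inverse ((- 2 * \<i> * sinh (cpi * (z - p) / w)) / (z - p))) \<longlongrightarrow> inverse (- 2 * \<i> * cpi / w)) (at p)"
    by (rule tendsto_inverse) (use assms in simp)
  then show ?thesis by (simp add: inverse_eq_divide)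
qed

text \<open>The sinh factors with j < m form the coefficient \<open>psi_coeff\<close>; those with j
  > m are cancelled by shifting the remaining gamma function down by k = N - 1 - m periods. Its
  value at the bottom, i (w1 - w2) / 2, is the same for every pole.\<close>

lemma psi_quot_at_pole:
  assumes w: "Re w1 > 0" "Re w2 > 0" "m < N" "2 * (real N * Re w1) < Re w2"
  shows "psi_quot N w1 w2 \<rho> \<sigma> \<tau> \<upsilon> x l (psi_pole m w1 w2 \<sigma> l) /
     (\<Prod>j\<in>{..<N} - {m}. - 2 * \<i> * sinh (cpi * (psi_pole m w1 w2 \<sigma> l - psi_pole j w1 w2 \<sigma> l) / w2))
    = G_strip w1 w2 (\<i> * (w1 - w2) / 2) * (psi_coeff m w1 w2 * psi_regular w1 w2 \<rho> \<sigma> \<tau> \<upsilon> x l (psi_pole m w1 w2 \<sigma> l) /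
       G_strip w1 w2 (l - \<i> * \<sigma> + \<i> * \<upsilon> - \<i> * of_nat m * w1))"
proof -
  define k where "k = N - Suc m"
  have N: "N = Suc (m + k)" using assms(3) by (simp add: k_def)
  define h where "h j = - 2 * \<i> * sinh (cpi * (psi_pole m w1 w2 \<sigma> l - psi_pole j w1 w2 \<sigma> l) / w2)" for j
  have split: "{..<N} - {m} = {..<m} \<union> (\<lambda>j. Suc (m + j)) ` {..<k}" proof -
    have "x < m \<or> x \<in> (\<lambda>j. Suc (m + j)) ` {..<k}" if "x \<noteq> m" "x < N" for x proof (cases "x < m")
      case False
      then show ?thesis using that by (intro disjI2 image_eqI[of _ _ "x - Suc m"]) (auto simp: N)
    qed simp
    then show ?thesis by (auto simp: N)
  qed
  have pr: "prod h ({..<N} - {m}) = prod h {..<m} * (\<Prod>j<k. h (Suc (m + j)))"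
    unfolding split by (subst prod.union_disjoint) (auto simp: prod.reindex inj_on_def)
  have isin: "- 2 * \<i> * sinh (- (\<i> * a)) = - 2 * sin a" for a :: complex by (simp add: sinh_field_def sin_exp_eq field_simps)
  have h1: "h j = - 2 * sin (cpi * of_nat (m - j) * w1 / w2)" if "j < m" for j proof -
    have "psi_pole m w1 w2 \<sigma> l - psi_pole j w1 w2 \<sigma> l = - (\<i> * (of_nat (m - j) * w1))"
      using that by (simp add: psi_pole_def of_nat_diff algebra_simps)
    then show ?thesis unfolding h_def isin[symmetric] by (simp add: mult_ac)
  qed
  have "prod h {..<m} = (\<Prod>j<m. h (m - Suc j))" by (rule prod.nat_diff_reindex[symmetric])
  also have "\<dots> = (\<Prod>j<m. - 2 * sin (cpi * of_nat (Suc j) * w1 / w2))" proof (rule prod.cong[OF refl])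
    fix j assume "j \<in> {..<m}"
    then show "h (m - Suc j) = - 2 * sin (cpi * of_nat (Suc j) * w1 / w2)" using h1[of "m - Suc j"] by (simp del: of_nat_Suc)
  qed
  finally have p1: "1 / prod h {..<m} = psi_coeff m w1 w2" by (simp add: psi_coeff_def)
  define g where "g = \<i> * (w1 - w2) / 2"
  have "w2 \<noteq> 0" using w by auto
  have "g = \<i> * w1 / 2 - \<i> * w2 / 2" by (simp add: g_def algebra_simps diff_divide_distrib)
  then have "cosh_shift w1 w2 g k = (\<Prod>j<k. - 2 * \<i> * sinh (cpi * (\<i> * w1 / 2 + \<i> * (of_nat j + 1 / 2) * w1) / w2))"
    using cosh_shift_sinh[OF \<open>w2 \<noteq> 0\<close>, of w1 "\<i> * w1 / 2" k] by simp
  also have "\<dots> = (\<Prod>j<k. h (Suc (m + j)))"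
    by (rule prod.cong[OF refl]) (simp add: h_def psi_pole_def algebra_simps add_divide_distrib)
  finally have p2: "(\<Prod>j<k. h (Suc (m + j))) = cosh_shift w1 w2 g k" ..
  have "real k * Re w1 \<le> real N * Re w1" using w by (intro mult_right_mono) (auto simp: N)
  moreover have "0 \<le> real k * Re w1" using w by simp
  moreover have "2 * Im (g + \<i> * of_nat k * w1) = Re w1 - Re w2 + 2 * (real k * Re w1)" "2 * Im g = Re w1 - Re w2"
    by (simp_all add: g_def)
  ultimately have e1: "G_strip w1 w2 (g + \<i> * of_nat k * w1) = G_strip w1 w2 g * cosh_shift w1 w2 g k"
    using w by (intro G_strip_shift) linarith+
  have e2: "psi_pole m w1 w2 \<sigma> l - l / 2 - \<i> * w1 / 4 - \<i> * w2 / 4 + \<i> * \<sigma> + \<i> * of_nat N * w1 = g + \<i> * of_nat k * w1"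
    by (simp add: psi_pole_def g_def N algebra_simps add_divide_distrib diff_divide_distrib)
  have e3: "psi_pole m w1 w2 \<sigma> l + l / 2 + \<i> * w1 / 4 + \<i> * w2 / 4 + \<i> * \<upsilon> = l - \<i> * \<sigma> + \<i> * \<upsilon> - \<i> * of_nat m * w1"
    by (simp add: psi_pole_def algebra_simps)
  have q: "psi_quot N w1 w2 \<rho> \<sigma> \<tau> \<upsilon> x l (psi_pole m w1 w2 \<sigma> l)
      = psi_regular w1 w2 \<rho> \<sigma> \<tau> \<upsilon> x l (psi_pole m w1 w2 \<sigma> l) * (G_strip w1 w2 g * cosh_shift w1 w2 g k) /
        G_strip w1 w2 (l - \<i> * \<sigma> + \<i> * \<upsilon> - \<i> * of_nat m * w1)" unfolding psi_quot_def e1 e2 e3 ..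
  have nz: "cosh_shift w1 w2 g k \<noteq> 0" using e1 G_strip_nonzero by (metis mult_zero_right)
  show ?thesis unfolding h_def[symmetric] pr p2 q g_def[symmetric] p1[symmetric] using nz by (simp add: mult_ac)
qed

text \<open>The pole is simple: the poles lie within half of the second period of one another, so
  only the m-th sinh factor vanishes there.\<close>

lemma psi_shifted_residue:
  fixes r1 r2 :: real
  assumes S: "open S" "psi_pole m r1 r2 \<sigma> l \<in> S" and hol: "psi_quot N r1 r2 \<rho> \<sigma> \<tau> \<upsilon> x l holomorphic_on S"
    and r: "r1 > 0" "r2 > 0" "m < N" "2 * (real N * r1) < r2"
  shows "residue (psi_shifted N r1 r2 \<rho> \<sigma> \<tau> \<upsilon> x l) (psi_pole m r1 r2 \<sigma> l)
    = of_real r2 / (- 2 * \<i> * cpi) * (G_strip r1 r2 (\<i> * (of_real r1 - of_real r2) / 2) *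
       (psi_coeff m r1 r2 * psi_regular r1 r2 \<rho> \<sigma> \<tau> \<upsilon> x l (psi_pole m r1 r2 \<sigma> l) /
       G_strip r1 r2 (l - \<i> * \<sigma> + \<i> * \<upsilon> - \<i> * of_nat m * r1)))"
proof -
  let ?q = "psi_quot N r1 r2 \<rho> \<sigma> \<tau> \<upsilon> x l"
  define p where "p = psi_pole m r1 r2 \<sigma> l"
  define f where "f = psi_shifted N r1 r2 \<rho> \<sigma> \<tau> \<upsilon> x l"
  define h where "h j z = - 2 * \<i> * sinh (cpi * (z - psi_pole j r1 r2 \<sigma> l) / of_real r2)" for j z
  define D where "D z = (\<Prod>j\<in>{..<N} - {m}. h j z)" for z
  have f: "f z = ?q z / (h m z * D z)" for z proof -
    have "cosh_shift r1 r2 (z - l / 2 - \<i> * r1 / 4 - \<i> * r2 / 4 + \<i> * \<sigma>) N = (\<Prod>j<N. h j z)"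
      unfolding h_def using r by (subst cosh_shift_psi_pole) auto
    also have "\<dots> = h m z * D z" unfolding D_def using r by (subst prod.remove[of _ m]) auto
    finally show ?thesis by (simp add: f_def psi_shifted_def)
  qed
  have hc: "isCont (h j) z" for j z unfolding h_def using r by (intro continuous_intros) auto
  have D: "isCont D p" unfolding D_def by (intro continuous_intros hc)
  have nz: "h j z \<noteq> 0" if "j \<noteq> m" "j < N" "z = p" for j z proof
    assume "h j z = 0"
    then have s: "sinh (cpi * (p - psi_pole j r1 r2 \<sigma> l) / of_real r2) = 0" by (simp add: h_def that)
    have e: "p - psi_pole j r1 r2 \<sigma> l = \<i> * of_real ((real j - real m) * r1)" by (simp add: p_def psi_pole_def algebra_simps)
    have "\<bar>(real j - real m) * r1\<bar> \<le> real N * r1" unfolding abs_mult using that r by (intro mult_mono) auto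
    moreover have "Im (p - psi_pole j r1 r2 \<sigma> l) = (real j - real m) * r1" unfolding e by simp
    ultimately have "2 * \<bar>Im (p - psi_pole j r1 r2 \<sigma> l)\<bar> \<le> r2" using r by linarith
    then have "p - psi_pole j r1 r2 \<sigma> l = 0" using s by (rule sinh_small_eq_0[OF r(2)])
    then have "(real j - real m) * r1 = 0" unfolding e by (simp del: of_real_mult of_real_diff)
    then show False using that r by simp
  qed
  have Dp: "D p \<noteq> 0" using nz by (auto simp: D_def)
  have "\<forall>\<^sub>F z in at p. D z \<noteq> 0" using D Dp by (simp add: isCont_def tendsto_imp_eventually_ne)
  moreover have "\<forall>\<^sub>F z in at p. h m z \<noteq> 0" proof -
    have "\<forall>\<^sub>F z in at p. z \<in> ball p (r2 / 2) - {p}" using r by (intro eventually_at_in_open) auto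
    then show ?thesis proof eventually_elim
      case (elim z)
      have "2 * \<bar>Im (z - p)\<bar> \<le> r2" using elim abs_Im_le_cmod[of "z - p"] by (simp add: dist_norm norm_minus_commute)
      then show ?case using elim sinh_small_eq_0[of r2 "z - p"] r by (auto simp: h_def p_def[symmetric])
    qed
  qed
  moreover have "\<forall>\<^sub>F z in at p. z \<in> S" using S by (intro eventually_at_in_open') (auto simp: p_def)
  ultimately have "\<forall>\<^sub>F z in at p. z \<in> S \<and> h m z \<noteq> 0 \<and> D z \<noteq> 0" by eventually_elim auto
  then obtain eps where eps: "eps > 0" "\<And>z. z \<in> ball p eps \<Longrightarrow> z \<noteq> p \<Longrightarrow> z \<in> S \<and> h m z \<noteq> 0 \<and> D z \<noteq> 0"
    unfolding eventually_at by (auto simp: dist_commute)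
  have "residue f p = ?q p / D p * (of_real r2 / (- 2 * \<i> * cpi))" proof (rule residue_simple')
    show "open (ball p eps)" "p \<in> ball p eps" using eps by auto
    show "f holomorphic_on ball p eps - {p}" proof -
      have "h j holomorphic_on A" for j A unfolding h_def sinh_field_def using r by (auto intro!: holomorphic_intros)
      then have "(\<lambda>z. h m z * D z) holomorphic_on ball p eps - {p}" unfolding D_def[abs_def] by (intro holomorphic_intros)
      moreover have "h m z * D z \<noteq> 0" if "z \<in> ball p eps - {p}" for z using eps(2) that by auto
      moreover have "ball p eps - {p} \<subseteq> S" using eps(2) by blast
      ultimately have "(\<lambda>z. ?q z / (h m z * D z)) holomorphic_on ball p eps - {p}"
        by (intro holomorphic_on_divide holomorphic_on_subset[OF hol]) auto
      then show ?thesis by (simp add: f[abs_def])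
    qed
    have "((\<lambda>z. ?q z / D z * ((z - p) / h m z)) \<longlongrightarrow>
        ?q p / D p * (of_real r2 / (- 2 * \<i> * cpi))) (at p)" proof (rule tendsto_mult[OF tendsto_divide])
      have "isCont (?q) p" using holomorphic_on_imp_continuous_on[OF hol] S by (simp add: continuous_on_eq_continuous_at p_def)
      then show "(?q \<longlongrightarrow> ?q p) (at p)" by (simp add: isCont_def)
      show "(D \<longlongrightarrow> D p) (at p)" using D by (simp add: isCont_def)
      show "((\<lambda>z. (z - p) / h m z) \<longlongrightarrow> of_real r2 / (- 2 * \<i> * cpi)) (at p)"
        unfolding h_def p_def using r by (intro sinh_tendsto) auto
    qed (rule Dp)
    then show "((\<lambda>z. f z * (z - p)) \<longlongrightarrow> ?q p / D p * (of_real r2 / (- 2 * \<i> * cpi))) (at p)" unfolding f by (simp add: mult_ac)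
  qed
  also have "?q p / D p = G_strip r1 r2 (\<i> * (of_real r1 - of_real r2) / 2) *
       (psi_coeff m r1 r2 * psi_regular r1 r2 \<rho> \<sigma> \<tau> \<upsilon> x l p / G_strip r1 r2 (l - \<i> * \<sigma> + \<i> * \<upsilon> - \<i> * of_nat m * r1))"
    unfolding D_def h_def p_def using r by (intro psi_quot_at_pole) auto
  finally show ?thesis unfolding f_def p_def by (simp only: mult.commute)
qed

lemma cdiff_psi_regular:
  fixes f1 f2 f3 f4 f5 f6 f7 f8 f9 :: "'a::cnormed_space \<Rightarrow> complex"
  assumes "cdiff f1 p" "cdiff f2 p" "cdiff f3 p" "cdiff f4 p" "cdiff f5 p" "cdiff f6 p" "cdiff f7 p"
      "cdiff f8 p" "cdiff f9 p" "Re (f1 p) > 0" "Re (f2 p) > 0"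
    and "2 * \<bar>Im (f9 p) + Im (f7 p) + Im (f8 p) / 2 - Re (f1 p) / 4 - Re (f2 p) / 4 + Re (f5 p)\<bar> < Re (f1 p) + Re (f2 p)"
     "2 * \<bar>Im (f9 p) + Im (f7 p) + Im (f8 p) / 2 - Re (f1 p) / 4 - Re (f2 p) / 4 - Re (f5 p)\<bar> < Re (f1 p) + Re (f2 p)"
     "2 * \<bar>Im (f9 p) - Im (f8 p) / 2 - Re (f1 p) / 4 - Re (f2 p) / 4 - Re (f4 p)\<bar> < Re (f1 p) + Re (f2 p)"
     "2 * \<bar>Im (f9 p) + Im (f7 p) - Im (f8 p) / 2 + Re (f1 p) / 4 + Re (f2 p) / 4 + Re (f3 p)\<bar> < Re (f1 p) + Re (f2 p)"
     "2 * \<bar>Im (f9 p) + Im (f7 p) - Im (f8 p) / 2 + Re (f1 p) / 4 + Re (f2 p) / 4 - Re (f3 p)\<bar> < Re (f1 p) + Re (f2 p)"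
     "2 * \<bar>Im (f9 p) + Im (f8 p) / 2 + Re (f1 p) / 4 + Re (f2 p) / 4 - Re (f6 p)\<bar> < Re (f1 p) + Re (f2 p)"
  shows "cdiff (\<lambda>p. psi_regular (f1 p) (f2 p) (f3 p) (f4 p) (f5 p) (f6 p) (f7 p) (f8 p) (f9 p)) p"
  unfolding psi_regular_def by (intro cdiff_intros assms) (use assms(12-) in simp_all)

lemma cdiff_psi_quot:
  fixes f1 f2 f3 f4 f5 f6 f7 f8 f9 :: "'a::cnormed_space \<Rightarrow> complex"
  assumes "cdiff f1 p" "cdiff f2 p" "cdiff f3 p" "cdiff f4 p" "cdiff f5 p" "cdiff f6 p" "cdiff f7 p"
      "cdiff f8 p" "cdiff f9 p" "Re (f1 p) > 0" "Re (f2 p) > 0" "d > 0"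
    and st: "strip_ok (real N * Re (f1 p)) d (Re (f1 p)) (Re (f2 p)) (Re (f3 p)) (Re (f4 p)) (Re (f5 p)) (Re (f6 p))
      (Im (f7 p)) (Im (f8 p)) (Im (f9 p))"
  shows "cdiff (\<lambda>p. psi_quot N (f1 p) (f2 p) (f3 p) (f4 p) (f5 p) (f6 p) (f7 p) (f8 p) (f9 p)) p"
proof -
  have *: "2 * \<bar>e\<bar> + d \<le> s \<Longrightarrow> 2 * \<bar>e\<bar> < s" for e s using \<open>d > 0\<close> by linarith
  note st' = st[unfolded strip_ok_def]
  show ?thesis unfolding psi_quot_def
    by (intro cdiff_intros cdiff_psi_regular assms(1-11)) (use st' in \<open>(elim conjE; simp add: *)+\<close>)
qed

text \<open>The contour is lowered from the real line to \<open>psi_line\<close>. The residue factor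
  r2 / (-2 \<pi> i) against 2 \<pi> i in the residue theorem accounts for the sign and the factor r2
  before the sum.\<close>

lemma psi_integral_shift:
  fixes r1 r2 :: real
  assumes reg: "region N r1 r2 (Re \<rho>) (Re \<sigma>) (Re \<tau>) (Re \<upsilon>) (Im x) (Im l)" and N: "N \<ge> 1"
    and start: "start_region d r1 r2 (Re \<rho>) (Re \<sigma>) (Re \<tau>) (Re \<upsilon>) (Im x) (Im l)"
  shows "psi_integral r1 r2 (\<rho>, \<sigma>, \<tau>, \<upsilon>) x l =
    (LINT t|lborel. psi_shifted N r1 r2 \<rho> \<sigma> \<tau> \<upsilon> x l (of_real t + psi_line N r1 r2 \<sigma> l)) +
    of_real r2 * G_strip r1 r2 (\<i> * (of_real r1 - of_real r2) / 2) *
      (\<Sum>m<N. psi_coeff m r1 r2 * psi_regular r1 r2 \<rho> \<sigma> \<tau> \<upsilon> x l (psi_pole m r1 r2 \<sigma> l) /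
         G_strip r1 r2 (l - \<i> * \<sigma> + \<i> * \<upsilon> - \<i> * of_nat m * r1))"
proof -
  let ?st = "strip_ok (real N * r1) (d / 2) r1 r2 (Re \<rho>) (Re \<sigma>) (Re \<tau>) (Re \<upsilon>) (Im x) (Im l)"
  let ?res = "\<lambda>m. of_real r2 / (- 2 * \<i> * cpi) * (G_strip r1 r2 (\<i> * (of_real r1 - of_real r2) / 2) *
       (psi_coeff m r1 r2 * psi_regular r1 r2 \<rho> \<sigma> \<tau> \<upsilon> x l (psi_pole m r1 r2 \<sigma> l) /
       G_strip r1 r2 (l - \<i> * \<sigma> + \<i> * \<upsilon> - \<i> * of_nat m * r1)))"
  have r: "r1 > 0" "100 * (real N * r1) < r2" using reg by (auto simp: region_def)
  have "1 * r1 \<le> real N * r1" using r N by (intro mult_right_mono) auto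
  then have r2: "r2 > 0" "r1 \<le> real N * r1" using r by linarith+
  have r3: "2 * (real N * r1) < r2" using r r2 by linarith
  have d: "d > 0" "d \<le> r1" using start by (auto simp: start_region_def)
  define c where "c = line_height N r1 r2 (Re \<sigma>) (Im l)"
  note ok = start_region_ok[OF reg N start, folded c_def]
  \<comment> \<open>A strip slightly larger than the closed one between the contours, so that
    holomorphy holds on an open set.\<close>
  define S where "S = {z. c - d / 4 < Im z \<and> Im z < d / 4}"
  define f where "f = psi_shifted N r1 r2 \<rho> \<sigma> \<tau> \<upsilon> x l"
  define q where "q = psi_quot N r1 r2 \<rho> \<sigma> \<tau> \<upsilon> x l"
  define p where "p m = psi_pole m r1 r2 \<sigma> l" for m
  define H where "H z = cosh_shift r1 r2 (z - l / 2 - \<i> * r1 / 4 - \<i> * r2 / 4 + \<i> * \<sigma>) N" for z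
  have f: "f z = q z / H z" for z by (simp add: f_def q_def H_def psi_shifted_def)
  have cneg: "c + (real N * r1 - r1 / 2) < 0" unfolding c_def by (rule start_region_line_negative[OF start r(1)])
  then have c0: "c < 0" using r r2 by linarith
  have Imp: "Im (p m) = c + (real N * r1 - r1 / 2 - real m * r1)" for m
    unfolding p_def c_def using Im_psi_pole[of m r1 r2 \<sigma> l N] by simp
  have pm: "c < Im (p m)" "Im (p m) < 0" if "m < N" for m proof -
    have "real (Suc m) * r1 \<le> real N * r1" using that r by (intro mult_right_mono) auto
    then have "real m * r1 + r1 \<le> real N * r1" by (simp add: distrib_right)
    then show "c < Im (p m)" unfolding Imp using r by linarith
    have "0 \<le> real m * r1" using r by simp
    then show "Im (p m) < 0" unfolding Imp using cneg by linarith
  qed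
  have S: "open S" "connected S" proof -
    show "open S" unfolding S_def by (intro open_Collects continuous_intros)
    have "S = {z. Im z > c - d / 4} \<inter> {z. Im z < d / 4}" by (auto simp: S_def)
    then show "connected S" by (simp only: convex_connected convex_Int convex_halfspace_Im_gt convex_halfspace_Im_lt)
  qed
  have q: "q holomorphic_on S" proof -
    have "holo q S" unfolding q_def proof (rule holoI[OF S(1)])
      fix z assume "z \<in> S"
      then have z: "?st (Im z)" by (intro ok(1)) (auto simp: S_def)
      have "cdiff (\<lambda>z. psi_quot N r1 r2 \<rho> \<sigma> \<tau> \<upsilon> x l z) z"
        by (intro cdiff_psi_quot[where d = "d / 2"] cdiff_const cdiff_ident) (use z d r(1) r2(1) in simp_all)
      then show "cdiff (psi_quot N r1 r2 \<rho> \<sigma> \<tau> \<upsilon> x l) z" by simp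
    qed
    then show ?thesis by (simp add: holo_complex_iff)
  qed
  have H: "H z = (\<Prod>j<N. - 2 * \<i> * sinh (cpi * (z - p j) / of_real r2))" for z
    unfolding H_def p_def using r2 by (intro cosh_shift_psi_pole) auto
  have H0: "H z \<noteq> 0" if z: "z \<in> S - p ` {..<N}" for z proof
    assume "H z = 0"
    then obtain j where j: "j < N" "sinh (cpi * (z - p j) / of_real r2) = 0" by (auto simp: H)
    have "8 * \<bar>Im z\<bar> \<le> r2" "8 * \<bar>Im (p j)\<bar> \<le> r2" by (rule ok(3); use z pm[OF j(1)] d in \<open>simp add: S_def\<close>)+
    then have "2 * \<bar>Im (z - p j)\<bar> \<le> r2"  unfolding minus_complex.sel by (smt (verit))
    from sinh_small_eq_0[OF r2(1) this j(2)] show False using z j(1) by auto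
  qed
  define s where "s = - l / 2 - \<i> * r1 / 4 - \<i> * r2 / 4 + \<i> * \<sigma>"
  define R where "R = \<bar>r1\<bar> + \<bar>r2\<bar> + cmod \<rho> + cmod \<sigma> + cmod \<tau> + cmod \<upsilon> + cmod x + cmod l"
  obtain K where K: "\<And>w1 w2 \<rho> \<sigma> \<tau> \<upsilon> x l c t. admissible N r1 (d / 2) R w1 w2 \<rho> \<sigma> \<tau> \<upsilon> x l c \<and>
     \<bar>Im w1\<bar> \<le> Re w1 \<and> 2 * (real N * Re w1) \<le> Re w2 \<Longrightarrow>
     cmod (psi_quot N w1 w2 \<rho> \<sigma> \<tau> \<upsilon> x l (of_real t + c)) \<le> K / (1 + t\<^sup>2)"
    using psi_quot_bound[OF r(1) half_gt_zero[OF d(1)] N, of R] by blast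
  note nn = norm_ge_zero[of \<rho>] norm_ge_zero[of \<sigma>] norm_ge_zero[of \<tau>]
      norm_ge_zero[of \<upsilon>] norm_ge_zero[of x] norm_ge_zero[of l]
  \<comment> \<open>For |t| at least 1 + |Re s| the argument of the cosh product has real part of
    modulus at least 1, so the division by the product costs only a constant.\<close>
  have bound: "cmod (f (of_real t + \<i> * of_real y)) \<le> (K / (2 * pi / r2) ^ N) / (1 + t\<^sup>2)"
    if t: "\<bar>t\<bar> \<ge> 1 + \<bar>Re s\<bar>" and y: "c \<le> y" "y \<le> 0" for t y proof -
    have st: "?st y"
      and pr: "pairs_ok (real N * r1) r2 (Re \<rho>) (Re \<sigma>) (Re \<tau>) (Re \<upsilon>) (Im x) y" and "8 * \<bar>y\<bar> \<le> r2" by (rule ok; use y d in simp)+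
    then have yR: "\<bar>y\<bar> \<le> R" unfolding R_def using nn r by linarith
    have nR: "cmod \<rho> \<le> R" "cmod \<sigma> \<le> R" "cmod \<tau> \<le> R" "cmod \<upsilon> \<le> R" "cmod x \<le> R" "cmod l \<le> R" "\<bar>r1\<bar> \<le> R" "\<bar>r2\<bar> \<le> R"
      unfolding R_def using nn r by linarith+
    have a: "r1 \<le> r2" "2 * (real N * r1) \<le> r2" using r r2 by linarith+
    have "cmod (\<i> * of_real y) \<le> R" "Im (\<i> * of_real y) = y" using yR by (simp_all add: norm_mult)
    then have 1: "cmod (q (of_real t + \<i> * of_real y)) \<le> K / (1 + t\<^sup>2)"
      unfolding q_def using st pr nR a r(1) r2(1) by (intro K) simp
    have p0: "(2 * pi / r2) ^ N > 0" using r2 by simp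
    have "1 \<le> \<bar>Re (of_real t + \<i> * of_real y + s)\<bar>" using t by simp
    from norm_cosh_shift_real_ge[OF r2(1) this, where N = N and ?r1.0 = r1]
    have 2: "(2 * pi / r2) ^ N \<le> cmod (H (of_real t + \<i> * of_real y))" by (simp add: H_def s_def algebra_simps)
    have "cmod (f (of_real t + \<i> * of_real y)) = cmod (q (of_real t + \<i> * of_real y)) / cmod (H (of_real t + \<i> * of_real y))"
      by (simp add: f norm_divide)
    also have "\<dots> \<le> (K / (1 + t\<^sup>2)) / (2 * pi / r2) ^ N" by (rule frac_le[OF order_trans[OF norm_ge_zero 1] 1 p0 2])
    finally show ?thesis by (simp add: field_simps)
  qed
  have "(LINT t|lborel. f (of_real t + \<i> * of_real c)) - (LINT t|lborel. f (of_real t + \<i> * of_real 0))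
      = 2 * pi * \<i> * (\<Sum>p\<in>p ` {..<N}. residue f p)"
  proof (rule line_integral_shift[OF S, where X = "1 + \<bar>Re s\<bar>" and C = "K / (2 * pi / r2) ^ N"])
    show "z \<in> S" if "c \<le> Im z" "Im z \<le> 0" for z using that d by (simp add: S_def)
    have "H holomorphic_on S - p ` {..<N}" unfolding H[abs_def] sinh_field_def using r2 by (auto intro!: holomorphic_intros)
    then show "f holomorphic_on S - p ` {..<N}"
      unfolding f[abs_def] using H0 by (intro holomorphic_on_divide holomorphic_on_subset[OF q]) auto
    show "cmod (f (of_real t + \<i> * of_real y)) \<le> K / (2 * pi / r2) ^ N / (1 + t\<^sup>2)"
      if "1 + \<bar>Re s\<bar> \<le> \<bar>t\<bar>" "c \<le> y" "y \<le> 0" for t y using that by (rule bound)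
  qed (use c0 pm in auto)
  also have "(\<Sum>p\<in>p ` {..<N}. residue f p) = (\<Sum>m<N. residue f (p m))" proof (rule sum.reindex_cong[OF _ refl refl])
    have "m = m'" if "p m = p m'" for m m' using arg_cong[OF that, of Im] r by (simp add: Imp)
    then show "inj_on p {..<N}" by (auto intro: inj_onI)
  qed
  also have "\<dots> = (\<Sum>m<N. ?res m)" proof (rule sum.cong[OF refl])
    fix m assume "m \<in> {..<N}"
    then have m: "m < N" by simp
    show "residue f (p m) = ?res m" unfolding f_def p_def
      by (rule psi_shifted_residue[OF S(1) _ q[unfolded q_def] r(1) r2(1) m r3])
        (use pm[OF m] d in \<open>auto simp: S_def p_def[symmetric]\<close>)
  qed
  finally have main: "(LINT t|lborel. f (of_real t)) = (LINT t|lborel. f (of_real t + \<i> * of_real c)) +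
      of_real r2 * G_strip r1 r2 (\<i> * (of_real r1 - of_real r2) / 2) *
      (\<Sum>m<N. psi_coeff m r1 r2 * psi_regular r1 r2 \<rho> \<sigma> \<tau> \<upsilon> x l (p m) /
         G_strip r1 r2 (l - \<i> * \<sigma> + \<i> * \<upsilon> - \<i> * of_nat m * r1))"
    unfolding sum_distrib_left[symmetric] by (simp add: field_simps p_def)
  \<comment> \<open>The offset also has a real part, coming from \<lambda> and \<sigma>; translation
    of the real line absorbs it.\<close>
  define L where "L = psi_line N r1 r2 \<sigma> l"
  have "L = of_real (Re L) + \<i> * of_real c" using Im_psi_line[of N r1 r2 \<sigma> l] by (simp add: L_def c_def complex_eq_iff)
  then have "f (of_real t + L) = f (of_real (Re L + 1 * t) + \<i> * of_real c)" for t
    by (metis (no_types, opaque_lifting) add.assoc add.commute mult_1 of_real_add)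
  then have shift: "(LINT t|lborel. f (of_real t + \<i> * of_real c)) = (LINT t|lborel. f (of_real t + L))"
    using lborel_integral_real_affine[of 1 "\<lambda>t. f (of_real t + \<i> * of_real c)" "Re L"] by simp
  have "psi_integral r1 r2 (\<rho>, \<sigma>, \<tau>, \<upsilon>) x l = (LINT t|lborel. f (of_real t))" unfolding psi_integral_def Let_def prod.case
  proof (rule Bochner_Integration.integral_cong[OF refl])
    fix t
    have st: "?st 0" by (rule ok; use c0 d in simp)
    have *: "2 * \<bar>e\<bar> + d / 2 \<le> a \<Longrightarrow> 2 * \<bar>e\<bar> < a" for e a using d by linarith
    have G: "G r1 r2 z = G_strip r1 r2 z" if "2 * \<bar>Im z\<bar> < r1 + r2" for z using that r(1) r2(1) by (intro G_eq_G_strip) auto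
    have 4: "e - \<i> * ((of_real r1 + of_real r2) / 2) / 2 = e - \<i> * r1 / 4 - \<i> * r2 / 4"
      "e + \<i> * ((of_real r1 + of_real r2) / 2) / 2 = e + \<i> * r1 / 4 + \<i> * r2 / 4" for e :: complex
      by (simp_all add: field_simps)
    define y where "y = of_real t - l / 2 - \<i> * r1 / 4 - \<i> * r2 / 4 + \<i> * \<sigma>"
    have y: "2 * \<bar>Im y\<bar> < r1 + r2" proof -
      have "\<bar>Im x\<bar> + \<bar>Re \<sigma>\<bar> + \<bar>Im l\<bar> / 2 + d \<le> r1 / 4 + r2 / 4" using start by (simp add: start_region_def)
      moreover have "Im y = - Im l / 2 - r1 / 4 - r2 / 4 + Re \<sigma>" by (simp add: y_def)
      ultimately have "Im y < r1 / 2 + r2 / 2" "- Im y < r1 / 2 + r2 / 2"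
        using d abs_ge_zero[of "Im x"] abs_ge_self[of "Re \<sigma>"] abs_ge_minus_self[of "Re \<sigma>"]
          abs_ge_self[of "Im l"] abs_ge_minus_self[of "Im l"] by linarith+
      then show ?thesis by (auto simp: abs_if)
    qed
    have yN: "2 * \<bar>Im (y + \<i> * of_nat N * r1)\<bar> < r1 + r2" using st[unfolded strip_ok_def] by (auto simp: y_def intro: *)
    \<comment> \<open>The single factor written through the difference equation. On the real line
      both its original and its shifted argument lie in the strip, so the two forms of the integrand
      agree.\<close>
    have Gy: "G r1 r2 y = G_strip r1 r2 (y + \<i> * of_nat N * r1) / cosh_shift r1 r2 y N" proof -
      have e: "G_strip r1 r2 (y + \<i> * of_nat N * r1) = G_strip r1 r2 y * cosh_shift r1 r2 y N"
        using r(1) r2(1) y yN by (intro G_strip_shift) auto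
      then have "cosh_shift r1 r2 y N \<noteq> 0" using G_strip_nonzero by (metis mult_zero_right)
      then show ?thesis using e by (simp add: G[OF y])
    qed
    let ?u = "of_real t + x + l / 2 - \<i> * r1 / 4 - \<i> * r2 / 4" and ?v = "of_real t + x - l / 2 + \<i> * r1 / 4 + \<i> * r2 / 4"
    let ?w = "of_real t + l / 2 + \<i> * r1 / 4 + \<i> * r2 / 4" and ?z = "of_real t - l / 2 - \<i> * r1 / 4 - \<i> * r2 / 4"
    have g: "G r1 r2 (?u + \<i> * \<tau>) = G_strip r1 r2 (?u + \<i> * \<tau>)"
      "G r1 r2 (?u - \<i> * \<tau>) = G_strip r1 r2 (?u - \<i> * \<tau>)"
      "G r1 r2 (?z - \<i> * \<sigma>) = G_strip r1 r2 (?z - \<i> * \<sigma>)"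
      "G r1 r2 (?v + \<i> * \<rho>) = G_strip r1 r2 (?v + \<i> * \<rho>)"
      "G r1 r2 (?v - \<i> * \<rho>) = G_strip r1 r2 (?v - \<i> * \<rho>)"
      "G r1 r2 (?w + \<i> * \<upsilon>) = G_strip r1 r2 (?w + \<i> * \<upsilon>)"
      "G r1 r2 (?w - \<i> * \<upsilon>) = G_strip r1 r2 (?w - \<i> * \<upsilon>)" using st[unfolded strip_ok_def] by (auto intro!: G *)
    show "pm (G r1 r2) (of_real t + x + l / 2 - \<i> * ((of_real r1 + of_real r2) / 2) / 2) (\<i> * \<tau>) *
         pm (G r1 r2) (of_real t - l / 2 - \<i> * ((of_real r1 + of_real r2) / 2) / 2) (\<i> * \<sigma>) /
         (pm (G r1 r2) (of_real t + x - l / 2 + \<i> * ((of_real r1 + of_real r2) / 2) / 2) (\<i> * \<rho>) *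
          pm (G r1 r2) (of_real t + l / 2 + \<i> * ((of_real r1 + of_real r2) / 2) / 2) (\<i> * \<upsilon>)) = f (of_real t)"
      unfolding f_def psi_shifted_def psi_quot_def psi_regular_def pm_def 4 y_def[symmetric] Gy g by (simp add: mult_ac)
  qed
  then show ?thesis unfolding main shift by (simp add: f_def L_def p_def)
qed

section \<open>Coordinates and the convex domain of parameters\<close>

type_synonym point = "complex \<times> complex \<times> quadruple \<times> complex \<times> complex"

definition w1_of :: "point \<Rightarrow> complex" where "w1_of p = fst p"
definition w2_of :: "point \<Rightarrow> complex" where "w2_of p = fst (snd p)"
text \<open>Points store \<gamma>, the variable of S, while the integrand is written in \<rho>,
  \<sigma>, \<tau>, \<upsilon>; these are recovered linearly, as in
  \<open>rho_of_gamma\<close>.\<close>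

definition rho_of :: "point \<Rightarrow> complex" where
  "rho_of p = (fst (snd (fst (snd (snd p)))) - fst (fst (snd (snd p)))) / 2"
definition sig_of :: "point \<Rightarrow> complex" where
  "sig_of p = (fst (fst (snd (snd p))) + fst (snd (fst (snd (snd p))))) / 2"
definition tau_of :: "point \<Rightarrow> complex" where
  "tau_of p = (snd (snd (snd (fst (snd (snd p))))) - fst (snd (snd (fst (snd (snd p)))))) / 2"
definition ups_of :: "point \<Rightarrow> complex" where
  "ups_of p = - (fst (snd (snd (fst (snd (snd p))))) + snd (snd (snd (fst (snd (snd p)))))) / 2"
definition x_of :: "point \<Rightarrow> complex" where "x_of p = fst (snd (snd (snd p)))"
definition l_of :: "point \<Rightarrow> complex" where "l_of p = snd (snd (snd (snd p)))"

lemmas coord_defs = w1_of_def w2_of_def rho_of_def sig_of_def tau_of_def ups_of_def x_of_def l_of_def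

abbreviation (input) "regular_at p \<equiv> psi_regular (w1_of p) (w2_of p) (rho_of p) (sig_of p) (tau_of p) (ups_of p) (x_of p) (l_of p)"
abbreviation (input) "quot_at N p \<equiv> psi_quot N (w1_of p) (w2_of p) (rho_of p) (sig_of p) (tau_of p) (ups_of p) (x_of p) (l_of p)"
abbreviation (input) "shifted_at N p \<equiv> psi_shifted N (w1_of p) (w2_of p) (rho_of p) (sig_of p) (tau_of p) (ups_of p) (x_of p) (l_of p)"
abbreviation (input) "line_at N p \<equiv> psi_line N (w1_of p) (w2_of p) (sig_of p) (l_of p)"
abbreviation (input) "pole_at m p \<equiv> psi_pole m (w1_of p) (w2_of p) (sig_of p) (l_of p)"
abbreviation (input) "region_at N p \<equiv> region N (Re (w1_of p)) (Re (w2_of p)) (Re (rho_of p)) (Re (sig_of p)) (Re (tau_of p))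
  (Re (ups_of p)) (Im (x_of p)) (Im (l_of p))"
abbreviation (input) "start_at d p \<equiv> start_region d (Re (w1_of p)) (Re (w2_of p)) (Re (rho_of p)) (Re (sig_of p)) (Re (tau_of p))
  (Re (ups_of p)) (Im (x_of p)) (Im (l_of p))"
abbreviation (input) "strip_at p \<equiv> G_strip (w1_of p) (w2_of p)"
abbreviation (input) "G_at p \<equiv> G (w1_of p) (w2_of p)"
abbreviation (input) "cosh_at p \<equiv> cosh_shift (w1_of p) (w2_of p)"
abbreviation (input) "mu_of p \<equiv> l_of p - \<i> * sig_of p + \<i> * ups_of p"

lemma cdiff_coord [cdiff_intros]:
  "cdiff w1_of p" "cdiff w2_of p" "cdiff rho_of p" "cdiff sig_of p" "cdiff tau_of p" "cdiff ups_of p"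
  "cdiff x_of p" "cdiff l_of p" unfolding coord_defs[abs_def] by (intro cdiff_intros; simp)+

lemma coord_continuous [continuous_intros]:
  "continuous_on A w1_of" "continuous_on A w2_of" "continuous_on A rho_of" "continuous_on A sig_of"
  "continuous_on A tau_of" "continuous_on A ups_of" "continuous_on A x_of" "continuous_on A l_of"
  unfolding coord_defs[abs_def] by (intro continuous_intros; simp)+

text \<open>All conditions compare real-linear functions, which makes the set open and convex. The
  bounds on the imaginary parts of the periods are those needed for the lower bounds of sinh and the
  asymptotics of \<open>log_cosh\<close>.\<close>

definition domain :: "nat \<Rightarrow> point set" where
  "domain N = {p. \<bar>Im (w1_of p)\<bar> < Re (w1_of p) \<and> \<bar>Im (w2_of p)\<bar> < Re (w2_of p) \<and>
     region_at N p}"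

lemma open_domain: "open (domain N)"
  unfolding domain_def region_def by (intro open_Collects continuous_intros) simp_all

lemma convex_domain: "convex (domain N)"
  unfolding domain_def region_def coord_defs abs_less_iff conj_assoc by (intro convex_Collect_conj convex_linear_less linearI)
    (simp_all add: algebra_simps add_divide_distrib diff_divide_distrib)

definition line_integral :: "nat \<Rightarrow> point \<Rightarrow> complex" where
  "line_integral N p = (LINT t|lborel. shifted_at N p (of_real t + line_at N p))"

lemma domainD:
  assumes "p \<in> domain N"
  shows "Re (w1_of p) > 0" "Re (w2_of p) > 0" "w2_of p \<noteq> 0" "\<bar>Im (w1_of p)\<bar> \<le> Re (w1_of p)" "\<bar>Im (w2_of p)\<bar> \<le> Re (w2_of p)"
    "8 * (real N * cmod (w1_of p)) \<le> Re (w2_of p)" "2 * (real N * Re (w1_of p)) \<le> Re (w2_of p)"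
    "region_at N p"
proof -
  show reg: "region_at N p" and im: "\<bar>Im (w1_of p)\<bar> \<le> Re (w1_of p)" "\<bar>Im (w2_of p)\<bar> \<le> Re (w2_of p)"
    using assms by (auto simp: domain_def)
  show pos: "Re (w1_of p) > 0" and "Re (w2_of p) > 0" and "w2_of p \<noteq> 0" using assms by (auto simp: domain_def region_def)
  have "cmod (w1_of p) \<le> 2 * Re (w1_of p)" using cmod_le[of "w1_of p"] im pos by linarith
  then have "real N * cmod (w1_of p) \<le> real N * (2 * Re (w1_of p))" by (intro mult_left_mono) auto
  moreover have "100 * (real N * Re (w1_of p)) < Re (w2_of p)" using reg by (simp add: region_def)
  moreover have "0 \<le> real N * Re (w1_of p)" using pos by simp
  moreover have "real N * (2 * Re (w1_of p)) = 2 * (real N * Re (w1_of p))" by simp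
  ultimately show "8 * (real N * cmod (w1_of p)) \<le> Re (w2_of p)" "2 * (real N * Re (w1_of p)) \<le> Re (w2_of p)" by linarith+
qed

text \<open>The distance in height between the shifted line and the lowest pole of the denominator
  factor with +\<upsilon>; while it is positive the shifted contour is not pinched.\<close>

definition gap :: "nat \<Rightarrow> point \<Rightarrow> real" where
  "gap N p = Re (w2_of p) / 2 + real N * Re (w1_of p) - (Im (l_of p) - Re (sig_of p) + Re (ups_of p))"

lemma gap_pos: "p \<in> domain N \<Longrightarrow> gap N p > 0"
  by (auto simp: domain_def region_def gap_def)

lemma domain_line_ok:
  assumes "p \<in> domain N" "N \<ge> 1" "d \<le> Re (w1_of p)" "d / 2 \<le> gap N p"
  shows "strip_ok (real N * Re (w1_of p)) d (Re (w1_of p)) (Re (w2_of p)) (Re (rho_of p)) (Re (sig_of p)) (Re (tau_of p))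
      (Re (ups_of p)) (Im (x_of p)) (Im (l_of p)) (Im (line_at N p))"
    and "pairs_ok (real N * Re (w1_of p)) (Re (w2_of p)) (Re (rho_of p)) (Re (sig_of p)) (Re (tau_of p))
      (Re (ups_of p)) (Im (x_of p)) (Im (line_at N p))" unfolding Im_psi_line
  using region_line_ok[OF domainD(8)[OF assms(1)] assms(2,3)] assms(4) by (auto simp: gap_def)

text \<open>On the shifted line the product depends on t and the periods only, hence its lower bound
  is uniform in \<lambda> and \<sigma>.\<close>

lemma cosh_shift_psi_line:
  "cosh_shift w1 w2 (t + psi_line N w1 w2 \<sigma> l - l / 2 - \<i> * w1 / 4 - \<i> * w2 / 4 + \<i> * \<sigma>) N
    = cosh_shift w1 w2 (t - \<i> * w2 / 2 - \<i> * of_nat N * w1) N" by (simp add: psi_line_def algebra_simps)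

lemma norm_psi_shifted_line_le:
  assumes p: "p \<in> domain N" and a: "0 < a" "a \<le> Re (w1_of p)" "cmod (w2_of p) \<le> R"
    and b: "cmod (quot_at N p (of_real t + line_at N p)) \<le> B"
  shows "cmod (shifted_at N p (of_real t + line_at N p)) \<le> B / (a / R) ^ N"
proof -
  note D = domainD[OF p]
  have "0 < cmod (w2_of p)" using D(3) by simp
  then have w2: "0 < cmod (w2_of p)" "0 < R" using a(3) by linarith+
  have "(a / R) ^ N \<le> (Re (w1_of p) / cmod (w2_of p)) ^ N" using a w2 by (intro power_mono frac_le divide_nonneg_nonneg) auto
  also have "\<dots> \<le> cmod (cosh_at p (of_real t - \<i> * w2_of p / 2 - \<i> * of_nat N * w1_of p) N)"
    by (rule norm_cosh_shift_line_ge[OF D(1,2,5,6)])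
  finally show ?thesis unfolding psi_shifted_def cosh_shift_psi_line norm_divide
    using a w2 by (intro frac_le b order_trans[OF norm_ge_zero b]) auto
qed

lemma cdiff_psi_line [cdiff_intros]:
  assumes "cdiff f p" "cdiff g p" "cdiff h p" "cdiff k p"
  shows "cdiff (\<lambda>p. psi_line N (f p) (g p) (h p) (k p)) p" unfolding psi_line_def by (intro cdiff_intros assms) simp_all

lemma cosh_shift_line_nonzero:
  assumes "p \<in> domain N"
  shows "cosh_at p (of_real t - \<i> * w2_of p / 2 - \<i> * of_nat N * w1_of p) N \<noteq> 0"
proof -
  note D = domainD[OF assms]
  have "0 < (Re (w1_of p) / cmod (w2_of p)) ^ N" using D by simp
  also have "\<dots> \<le> cmod (cosh_at p (of_real t - \<i> * w2_of p / 2 - \<i> * of_nat N * w1_of p) N)"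
    by (rule norm_cosh_shift_line_ge[OF D(1,2,5,6)])
  finally show ?thesis by auto
qed

text \<open>The decay of \<open>psi_quot\<close> and the lower bound of the cosh product are both
  locally uniform, which provides the majorant for differentiation under the integral.\<close>

lemma holo_line_integral:
  assumes N: "N \<ge> 1"
  shows "holo (line_integral N) (domain N)" unfolding line_integral_def[abs_def]
proof (rule holo_integral)
  let ?L = "\<lambda>p. line_at N p"
  let ?f = "\<lambda>p t. shifted_at N p (of_real t + ?L p)"
  have ex: "\<exists>d>0. d \<le> Re (w1_of p) \<and> d / 2 \<le> gap N p" if "p \<in> domain N" for p
    using domainD(1)[OF that] gap_pos[OF that] by (intro exI[of _ "min (Re (w1_of p)) (gap N p)"]) auto
  show "holo (\<lambda>p. ?f p t) (domain N)" for t proof (rule holoI[OF open_domain])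
    fix p assume p: "p \<in> domain N"
    note D = domainD[OF p]
    obtain d where d: "d > 0" "d \<le> Re (w1_of p)" "d / 2 \<le> gap N p" using ex[OF p] by blast
    show "cdiff (\<lambda>p. ?f p t) p" unfolding psi_shifted_def cosh_shift_psi_line
      by (intro cdiff_divide cdiff_psi_quot[where d = d] cdiff_intros D d cosh_shift_line_nonzero[OF p])
        (use domain_line_ok(1)[OF p N d(2,3)] D in simp_all)
  qed
  show "(\<lambda>t. ?f p t) \<in> borel_measurable lborel" if p: "p \<in> domain N" for p proof -
    note D = domainD[OF p]
    obtain d where d: "d > 0" "d \<le> Re (w1_of p)" "d / 2 \<le> gap N p" using ex[OF p] by blast
    define g where "g z = shifted_at N p (z + ?L p)" for z
    have "isCont (\<lambda>t. g (of_real t)) t" for t proof (rule isCont_o2[where g = g])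
      have "cdiff g (of_real t)" unfolding g_def[abs_def] psi_shifted_def cosh_shift_psi_line
        by (intro cdiff_divide cdiff_psi_quot[where d = d] cdiff_intros D d cosh_shift_line_nonzero[OF p])
          (use domain_line_ok(1)[OF p N d(2,3)] D in simp_all)
      then show "isCont g (of_real t)" by (rule cdiff_isCont)
    qed (intro continuous_intros)
    then have "continuous_on UNIV (\<lambda>t. ?f p t)" unfolding g_def by (simp add: continuous_at_imp_continuous_on)
    then show ?thesis using borel_measurable_continuous_onI by simp
  qed
  fix p assume p: "p \<in> domain N"
  note D = domainD[OF p]
  define \<Phi> where "\<Phi> q = cmod (w1_of q) + cmod (w2_of q) + cmod (rho_of q) + cmod (sig_of q) + cmod (tau_of q) +
      cmod (ups_of q) + cmod (x_of q) + cmod (l_of q) + cmod (?L q)" for q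
  define R where "R = \<Phi> p + 1"
  define a where "a = Re (w1_of p) / 2"
  define e where "e = gap N p / 2"
  define d where "d = min a e"
  have pos: "a > 0" "e > 0" "d > 0" using D(1) gap_pos[OF p] by (auto simp: a_def e_def d_def)
  have c\<Phi>: "continuous_on UNIV \<Phi>" unfolding \<Phi>_def psi_line_def by (intro continuous_intros) auto
  \<comment> \<open>Continuity of \<Phi> and of \<open>gap\<close> makes the constants R, a and e
    valid on a whole neighbourhood of p, so that one constant K serves all its points.\<close>
  have cg: "continuous_on UNIV (gap N)" unfolding gap_def[abs_def] by (intro continuous_intros) auto
  define U where "U = domain N \<inter> {q. \<Phi> q < R \<and> a < Re (w1_of q) \<and> e < gap N q}"
  have "open U" unfolding U_def using c\<Phi> cg by (intro open_Int open_domain open_Collects continuous_intros) auto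
  moreover have "p \<in> U" using p pos D(1) by (simp add: U_def R_def a_def e_def gap_pos)
  ultimately obtain r where r: "r > 0" "ball p r \<subseteq> U" using open_contains_ball by blast
  obtain K where K: "\<And>w1 w2 \<rho> \<sigma> \<tau> \<upsilon> x l c t. admissible N a d R w1 w2 \<rho> \<sigma> \<tau> \<upsilon> x l c \<and>
     \<bar>Im w1\<bar> \<le> Re w1 \<and> 2 * (real N * Re w1) \<le> Re w2 \<Longrightarrow>
     cmod (psi_quot N w1 w2 \<rho> \<sigma> \<tau> \<upsilon> x l (of_real t + c)) \<le> K / (1 + t\<^sup>2)" using psi_quot_bound[OF pos(1,3) N, of R] by blast
  have "cmod (?f q t) \<le> (K / (a / R) ^ N) / (1 + t\<^sup>2)" if q: "q \<in> ball p r" for q t proof -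
    have q': "q \<in> domain N" "\<Phi> q < R" "a < Re (w1_of q)" "e < gap N q" using q r by (auto simp: U_def)
    note Q = domainD[OF q'(1)]
    have n: "cmod (w1_of q) \<le> R" "cmod (w2_of q) \<le> R" "cmod (rho_of q) \<le> R" "cmod (sig_of q) \<le> R" "cmod (tau_of q) \<le> R"
      "cmod (ups_of q) \<le> R" "cmod (x_of q) \<le> R" "cmod (l_of q) \<le> R" "cmod (?L q) \<le> R"
      using q'(2) norm_ge_zero[of "w1_of q"] norm_ge_zero[of "w2_of q"] norm_ge_zero[of "rho_of q"] norm_ge_zero[of "sig_of q"]
        norm_ge_zero[of "tau_of q"] norm_ge_zero[of "ups_of q"] norm_ge_zero[of "x_of q"] norm_ge_zero[of "l_of q"] norm_ge_zero[of "?L q"]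
      unfolding \<Phi>_def by linarith+
    have d: "d \<le> Re (w1_of q)" "d / 2 \<le> gap N q" using q' pos by (auto simp: d_def)
    have "1 * Re (w1_of q) \<le> real N * Re (w1_of q)" using N Q(1) by (intro mult_right_mono) auto
    then have a2: "a \<le> Re (w2_of q)" "a \<le> Re (w1_of q)" using Q(1,7) q'(3) by linarith+
    have "cmod (quot_at N q (of_real t + ?L q)) \<le> K / (1 + t\<^sup>2)" by (rule K) (intro conjI a2 n Q domain_line_ok[OF q'(1) N d])
    from norm_psi_shifted_line_le[OF q'(1) pos(1) a2(2) n(2) this] show ?thesis by (simp add: mult.commute)
  qed
  then show "\<exists>r>0. \<exists>b. integrable lborel b \<and> ball p r \<subseteq> domain N \<and>
      (\<forall>q\<in>ball p r. \<forall>t\<in>space lborel. cmod (?f q t) \<le> b t)" using r integrable_inverse_quad[of "K / (a / R) ^ N"]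
    by (intro exI[of _ r] exI[of _ "\<lambda>t. (K / (a / R) ^ N) / (1 + t\<^sup>2)"] conjI) (auto simp: U_def)
qed (rule open_domain)

section \<open>A holomorphic expression for S on the parameter domain\<close>

definition S_prefactor :: "(complex \<Rightarrow> complex) \<Rightarrow> point \<Rightarrow> complex" where
  "S_prefactor g p =
    g (2 * \<i> * sig_of p + \<i> * w1_of p / 2 + \<i> * w2_of p / 2) *
    g (\<i> * sig_of p - \<i> * rho_of p - \<i> * tau_of p - \<i> * ups_of p + \<i> * w1_of p / 2 + \<i> * w2_of p / 2) *
    g (\<i> * sig_of p - \<i> * rho_of p + \<i> * tau_of p - \<i> * ups_of p + \<i> * w1_of p / 2 + \<i> * w2_of p / 2) *
    (g (x_of p - \<i> * sig_of p + \<i> * rho_of p) *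
       g (x_of p - \<i> * sig_of p - \<i> * rho_of p) /
     (g (x_of p - \<i> * tau_of p - \<i> * ups_of p) *
      g (x_of p + \<i> * tau_of p - \<i> * ups_of p))) *
    (g (l_of p - \<i> * sig_of p - \<i> * ups_of p) /
     (g (l_of p - \<i> * rho_of p - \<i> * tau_of p) *
      g (l_of p - \<i> * rho_of p + \<i> * tau_of p))) /
    csqrt (w1_of p * w2_of p)"

text \<open>The factor with argument \<open>mu_of p\<close>, the one that vanishes at the special
  \<lambda>, is separated from the harmless rest of S and kept next to \<Psi>, whose pole it has to
  cancel.\<close>

lemma S_fun_coords:
  "S_fun \<Psi> p = S_prefactor (G_at p) p * (G_at p (mu_of p) *
     \<Psi> (w1_of p, w2_of p, (rho_of p, sig_of p, tau_of p, ups_of p), x_of p, l_of p))"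
proof -
  obtain w1 w2 \<gamma>0 \<gamma>1 \<gamma>2 \<gamma>3 x l where fields: "p = (w1, w2, (\<gamma>0, \<gamma>1, \<gamma>2, \<gamma>3), x, l)" by (metis surj_pair)
  let ?\<gamma> = "(\<gamma>0, \<gamma>1, \<gamma>2, \<gamma>3)"
  have N: "N_factor w1 w2 ?\<gamma> =
    G w1 w2 (2 * \<i> * sig_of p + \<i> * w1 / 2 + \<i> * w2 / 2) *
    G w1 w2 (\<i> * sig_of p - \<i> * rho_of p - \<i> * tau_of p - \<i> * ups_of p + \<i> * w1 / 2 + \<i> * w2 / 2) *
    G w1 w2 (\<i> * sig_of p - \<i> * rho_of p + \<i> * tau_of p - \<i> * ups_of p + \<i> * w1 / 2 + \<i> * w2 / 2)"
    unfolding N_factor_def fields coord_defs prod.case fst_conv snd_conv list.map prod_list.Cons prod_list.Nil mult_1_right mult.assoc[symmetric]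
    by (intro arg_cong2[where f = "(*)"] arg_cong[where f = "G w1 w2"]) (simp_all add: field_simps)
  have D1: "Delta w1 w2 ?\<gamma> x =
     (G w1 w2 (x - \<i> * tau_of p - \<i> * ups_of p) * G w1 w2 (x + \<i> * tau_of p - \<i> * ups_of p)) /
      (G w1 w2 (x - \<i> * sig_of p + \<i> * rho_of p) * G w1 w2 (x - \<i> * sig_of p - \<i> * rho_of p))"
    unfolding Delta_def fields coord_defs prod.case fst_conv snd_conv
    by (intro arg_cong2[where f = "(*)"] arg_cong2[where f = "(/)"] arg_cong[where f = "G w1 w2"]) (simp_all add: field_simps)
  have D2: "Delta w1 w2 (dual ?\<gamma>) l =
     (G w1 w2 (l - \<i> * rho_of p - \<i> * tau_of p) * G w1 w2 (l - \<i> * rho_of p + \<i> * tau_of p)) /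
      (G w1 w2 (l - \<i> * sig_of p + \<i> * ups_of p) * G w1 w2 (l - \<i> * sig_of p - \<i> * ups_of p))"
    unfolding Delta_def dual_def fields coord_defs prod.case fst_conv snd_conv
    by (intro arg_cong2[where f = "(*)"] arg_cong2[where f = "(/)"] arg_cong[where f = "G w1 w2"]) (simp_all add: field_simps)
  have R: "rho_of_gamma ?\<gamma> = (rho_of p, sig_of p, tau_of p, ups_of p)"
    "w1_of p = w1" "w2_of p = w2" "x_of p = x" "l_of p = l" by (simp_all add: fields coord_defs rho_of_gamma_def)
  have "S_fun \<Psi> p = N_factor w1 w2 ?\<gamma> * \<Psi> (w1, w2, rho_of_gamma ?\<gamma>, x, l) /
     (csqrt (w1 * w2) * Delta w1 w2 ?\<gamma> x * Delta w1 w2 (dual ?\<gamma>) l)" by (simp add: S_fun_def fields)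
  moreover have "n * P / (c * (a / b) * (A / (m * B))) = n * (b / a) * (B / A) / c * (m * P)" for n P c a b A m B :: complex
    by (simp only: divide_inverse inverse_mult_distrib inverse_inverse_eq mult_ac)
  ultimately show ?thesis unfolding N D1 D2 R S_prefactor_def by simp
qed

text \<open>The residue sum already multiplied by G(\<open>mu_of p\<close>): the quotient of that
  factor by the gamma function in the m-th residue is a product of m cosines, regular at the special
  \<lambda>.\<close>

definition S_residues :: "nat \<Rightarrow> point \<Rightarrow> complex" where
  "S_residues N p = w2_of p * strip_at p (\<i> * (w1_of p - w2_of p) / 2) *
     (\<Sum>m<N. psi_coeff m (w1_of p) (w2_of p) *
        regular_at p
          (pole_at m p) *
        cosh_at p (mu_of p - \<i> * of_nat m * w1_of p) m)"

text \<open>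
  A holomorphic expression for \<open>S\<close> near \<open>\<lambda> = \<lambda>\<^sub>n\<close>, where \<open>N = n + 1\<close>.  The pole of
  \<open>G (\<lambda> - \<i> \<gamma>0)\<close> (dual parameter) at \<open>\<lambda>\<^sub>n\<close> sits in none of the gamma functions below.
\<close>

definition S_reduced :: "nat \<Rightarrow> point \<Rightarrow> complex" where
  "S_reduced N p = S_prefactor (strip_at p) p *
     (line_integral N p *
        (strip_at p (mu_of p - \<i> * of_nat N * w1_of p) *
         cosh_at p (mu_of p - \<i> * of_nat N * w1_of p) N) +
      S_residues N p)"

lemma two_abs_less:
  fixes E :: real
  shows "E < a / 2 + b / 2 \<Longrightarrow> - E < a / 2 + b / 2 \<Longrightarrow> 2 * \<bar>E\<bar> < a + b" by (auto simp: abs_if)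

lemmas domain_linear = region_linear[OF domainD(8)]

lemma sin_small_nonzero:
  assumes "z \<noteq> 0" "cmod z \<le> pi / 2"
  shows "sin z \<noteq> 0"
proof
  assume "sin z = 0"
  moreover have "sinh (\<i> * z) = \<i> * sin z" by (simp add: sinh_field_def sin_exp_eq field_simps)
  moreover have "\<bar>Im (\<i> * z)\<bar> \<le> pi / 2" using assms(2) abs_Re_le_cmod[of z] by simp
  ultimately have "cmod (\<i> * z) / 2 \<le> 0" using norm_sinh_ge_half[of "\<i> * z"] by simp
  then show False using assms(1) by (simp add: norm_mult)
qed

text \<open>N |w1| is small against |w2|, so the arguments stay in a disc where 0 is the only zero
  of sin. These sines are the differences of the crossed poles.\<close>

lemma domain_sin_nonzero:
  assumes p: "p \<in> domain N" and j: "0 < j" "j \<le> N"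
  shows "sin (cpi * of_nat j * w1_of p / w2_of p) \<noteq> 0"
proof (rule sin_small_nonzero)
  note D = domainD[OF p]
  have "w1_of p \<noteq> 0" using D(1) by auto
  then show "cpi * of_nat j * w1_of p / w2_of p \<noteq> 0" using D j by simp
  have "real j * cmod (w1_of p) \<le> real N * cmod (w1_of p)" using j by (intro mult_right_mono) auto
  also have "8 * \<dots> \<le> cmod (w2_of p)" using D(6) complex_Re_le_cmod[of "w2_of p"] by linarith
  finally have "real j * cmod (w1_of p) \<le> cmod (w2_of p) / 2" using norm_ge_zero[of "w2_of p"] by linarith
  then have "pi * (real j * cmod (w1_of p)) \<le> pi * (cmod (w2_of p) / 2)" by (intro mult_left_mono) auto
  then show "cmod (cpi * of_nat j * w1_of p / w2_of p) \<le> pi / 2" using D(3) by (simp add: norm_mult norm_divide field_simps)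
qed

lemma cdiff_psi_coeff:
  assumes p: "p \<in> domain N" and "m < N"
  shows "cdiff (\<lambda>p. psi_coeff m (w1_of p) (w2_of p)) p" unfolding psi_coeff_def
  using domain_sin_nonzero[OF p] domainD(3)[OF p] \<open>m < N\<close> by (intro cdiff_intros) (auto simp del: of_nat_Suc)

text \<open>Multiplying by the conjugate of w2, a negative product would give the real part of w1
  the wrong sign. The product of the periods therefore never meets the cut of the principal square
  root.\<close>

lemma mult_notin_nonpos_Reals:
  assumes "Re w1 > 0" "Re w2 > 0"
  shows "w1 * w2 \<notin> \<real>\<^sub>\<le>\<^sub>0"
proof
  assume "w1 * w2 \<in> \<real>\<^sub>\<le>\<^sub>0"
  then obtain s where s: "s \<le> 0" "w1 * w2 = of_real s" by (auto elim: nonpos_Reals_cases)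
  have "w1 * (cmod w2)\<^sup>2 = w1 * w2 * cnj w2" unfolding mult.assoc complex_norm_square[symmetric] by simp
  also have "\<dots> = of_real s * cnj w2" by (simp add: s)
  finally have "Re (w1 * (cmod w2)\<^sup>2) = Re (of_real s * cnj w2)" by simp
  then have "Re w1 * (cmod w2)\<^sup>2 = s * Re w2" by (simp flip: of_real_power)
  moreover have "s * Re w2 \<le> 0" using s assms by (simp add: mult_nonpos_nonneg)
  moreover have "w2 \<noteq> 0" using assms by auto
  then have "Re w1 * (cmod w2)\<^sup>2 > 0" using assms by simp
  ultimately show False by linarith
qed

lemma holo_S_reduced:
  assumes N: "N \<ge> 1"
  shows "holo (S_reduced N) (domain N)"
proof (rule holoI[OF open_domain])
  fix p assume p: "p \<in> domain N"
  note D = domainD[OF p]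
  define m where m: "m = real N * Re (w1_of p)"
  note h = domain_linear[OF p N m]
  have sq: "w1_of p * w2_of p \<notin> \<real>\<^sub>\<le>\<^sub>0" "csqrt (w1_of p * w2_of p) \<noteq> 0" using mult_notin_nonpos_Reals[OF D(1,2)] by auto
  have 1: "cdiff (\<lambda>p. S_prefactor (strip_at p) p) p" unfolding S_prefactor_def
    by (intro cdiff_intros D(1,2) sq two_abs_less; use h in simp)
  have "cdiff (\<lambda>p. psi_coeff k (w1_of p) (w2_of p) *
        regular_at p
          (pole_at k p) *
        cosh_at p (mu_of p - \<i> * of_nat k * w1_of p) k) p" if k: "k < N" for k proof -
    define s where "s = real k * Re (w1_of p)"
    have "real (Suc k) * Re (w1_of p) \<le> real N * Re (w1_of p)" using k D(1) by (intro mult_right_mono) auto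
    then have s: "s + Re (w1_of p) \<le> m" "0 \<le> s" using D(1) by (simp_all add: s_def m algebra_simps)
    have im: "Im (pole_at k p) = Im (l_of p) / 2 - Re (w1_of p) / 4 - Re (w2_of p) / 4 - Re (sig_of p) - s"
      by (simp add: psi_pole_def s_def)
    have c: "cdiff (\<lambda>p. pole_at k p) p" unfolding psi_pole_def by (intro cdiff_intros) simp_all
    show ?thesis
      by (intro cdiff_intros cdiff_psi_coeff[OF p k] cdiff_psi_regular c D(1,2,3) two_abs_less; unfold im; use h s in linarith)
  qed
  note T = this
  have "2 * \<bar>Im (\<i> * (w1_of p - w2_of p) / 2)\<bar> < Re (w1_of p) + Re (w2_of p)"
    by (rule two_abs_less) (use D(1,2) in \<open>simp_all add: diff_divide_distrib\<close>)
  then have "cdiff (\<lambda>p. strip_at p (\<i> * (w1_of p - w2_of p) / 2)) p" by (intro cdiff_intros D(1,2)) simp_all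
  then have 2: "cdiff (S_residues N) p" unfolding S_residues_def[abs_def]
    by (rule cdiff_mult[OF cdiff_mult[OF cdiff_coord(2)] cdiff_sum]) (simp add: T)
  have 3: "cdiff (line_integral N) p" using holoD[OF holo_line_integral[OF N] p] .
  have "Im (mu_of p - \<i> * of_nat N * w1_of p) = Im (l_of p) - Re (sig_of p) + Re (ups_of p) - m" by (simp add: m)
  then have sN: "2 * \<bar>Im (mu_of p - \<i> * of_nat N * w1_of p)\<bar> < Re (w1_of p) + Re (w2_of p)"
    using h by (intro two_abs_less) linarith+
  show "cdiff (S_reduced N) p" unfolding S_reduced_def[abs_def] by (intro cdiff_intros 1 2 3 D(1,2,3) sN)
qed

text \<open>The open part of the domain where, for real periods, the defining integral of \<psi> is
  available.\<close>

definition start_domain :: "nat \<Rightarrow> point set" where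
  "start_domain N = domain N \<inter> {p.
     \<bar>Im (x_of p)\<bar> + \<bar>Re (rho_of p)\<bar> + \<bar>Im (l_of p)\<bar> / 2 < Re (w1_of p) / 4 + Re (w2_of p) / 4 \<and>
     \<bar>Im (x_of p)\<bar> + \<bar>Re (sig_of p)\<bar> + \<bar>Im (l_of p)\<bar> / 2 < Re (w1_of p) / 4 + Re (w2_of p) / 4 \<and>
     \<bar>Im (x_of p)\<bar> + \<bar>Re (tau_of p)\<bar> + \<bar>Im (l_of p)\<bar> / 2 < Re (w1_of p) / 4 + Re (w2_of p) / 4 \<and>
     \<bar>Im (x_of p)\<bar> + \<bar>Re (ups_of p)\<bar> + \<bar>Im (l_of p)\<bar> / 2 < Re (w1_of p) / 4 + Re (w2_of p) / 4}"

lemma open_start_domain: "open (start_domain N)"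
  unfolding start_domain_def by (intro open_Int open_domain open_Collects continuous_intros; simp)

lemma start_domain_region:
  assumes "p \<in> start_domain N"
  shows "\<exists>d. start_at d p"
proof -
  define s where "s = Re (w1_of p) / 4 + Re (w2_of p) / 4"
  define f where "f v = s - (\<bar>Im (x_of p)\<bar> + \<bar>Re v\<bar> + \<bar>Im (l_of p)\<bar> / 2)" for v
  define d where "d = Min {Re (w1_of p), f (rho_of p), f (sig_of p), f (tau_of p), f (ups_of p)}"
  have "Re (w1_of p) > 0" using assms by (simp add: start_domain_def domain_def region_def)
  moreover have "f (rho_of p) > 0" "f (sig_of p) > 0" "f (tau_of p) > 0" "f (ups_of p) > 0"
    using assms by (simp_all add: start_domain_def f_def s_def)
  ultimately have "d > 0" unfolding d_def by (subst Min_gr_iff) auto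
  moreover have "d \<le> Re (w1_of p)" "d \<le> f (rho_of p)" "d \<le> f (sig_of p)" "d \<le> f (tau_of p)" "d \<le> f (ups_of p)"
    unfolding d_def by (rule Min_le; simp)+
  ultimately show ?thesis unfolding start_region_def s_def[symmetric] by (intro exI[of _ d] conjI; unfold f_def; linarith)
qed

lemma zeta_gt:
  assumes "start_region d r1 r2 (Re \<rho>) (Re \<sigma>) (Re \<tau>) (Re \<upsilon>) (Im x) (Im l)"
  shows "\<bar>Im x\<bar> < zeta r1 r2 (\<rho>, \<sigma>, \<tau>, \<upsilon>) l"
proof -
  have "Max {\<bar>Re \<rho>\<bar>, \<bar>Re \<sigma>\<bar>, \<bar>Re \<tau>\<bar>, \<bar>Re \<upsilon>\<bar>} \<le> r1 / 4 + r2 / 4 - d - \<bar>Im x\<bar> - \<bar>Im l\<bar> / 2"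
    using assms by (intro Max.boundedI) (auto simp: start_region_def)
  moreover have "d > 0" using assms by (simp add: start_region_def)
  moreover have "\<bar>Im (l / 2)\<bar> = \<bar>Im l\<bar> / 2" "(r1 + r2) / 2 / 2 = r1 / 4 + r2 / 4" by (simp_all add: abs_divide)
  ultimately show ?thesis unfolding zeta_def prod.case by linarith
qed

text \<open>Multiply the residue expansion by G(\<open>mu_of p\<close>) and remove each gamma
  function in a denominator by the difference equation. At this stage the periods must be real,
  since only there \<Psi> is given by an integral.\<close>

lemma S_fun_eq_S_reduced:
  assumes \<Psi>: "psi_extension \<Psi>" and p: "p \<in> start_domain N" and N: "N \<ge> 1"
    and w: "w1_of p = of_real r1" "w2_of p = of_real r2"
  shows "S_fun \<Psi> p = S_reduced N p"
proof -
  have dom: "p \<in> domain N" using p by (simp add: start_domain_def)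
  note D = domainD[OF dom]
  obtain d where start: "start_at d p" using start_domain_region[OF p] by blast
  have s: "0 < d" "- Re (sig_of p) + Im (l_of p) / 2 + d \<le> Re (w1_of p) / 4 + Re (w2_of p) / 4"
      "Re (ups_of p) + Im (l_of p) / 2 + d \<le> Re (w1_of p) / 4 + Re (w2_of p) / 4" using start unfolding start_region_def
    using abs_ge_zero[of "Im (x_of p)"] abs_ge_minus_self[of "Re (sig_of p)"] abs_ge_self[of "Re (ups_of p)"] abs_ge_self[of "Im (l_of p)"]
    by linarith+
  define m where m: "m = real N * Re (w1_of p)"
  note h = domain_linear[OF dom N m]
  define K where "K = w2_of p * strip_at p (\<i> * (w1_of p - w2_of p) / 2)"
  define b where "b = mu_of p"
  define t where "t k = psi_coeff k (w1_of p) (w2_of p) *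
        regular_at p
          (pole_at k p)" for k
  have b: "2 * \<bar>Im b\<bar> < Re (w1_of p) + Re (w2_of p)" by (rule two_abs_less) (use h s in \<open>simp_all add: b_def\<close>)
  \<comment> \<open>For k at most N the lowered argument is still in the strip. The case k = N
    treats the line integral, the cases k < N treat the residues.\<close>
  have Gb: "strip_at p b = strip_at p (b - \<i> * of_nat k * w1_of p) *
      cosh_at p (b - \<i> * of_nat k * w1_of p) k" if "k \<le> N" for k proof -
    have "real k * Re (w1_of p) \<le> m" unfolding m using that D(1) by (intro mult_right_mono) auto
    moreover have "0 \<le> real k * Re (w1_of p)" using D(1) by simp
    moreover have "Im (b - \<i> * of_nat k * w1_of p)
        = Im (l_of p) - Re (sig_of p) + Re (ups_of p) - real k * Re (w1_of p)" by (simp add: b_def)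
    ultimately have "2 * \<bar>Im (b - \<i> * of_nat k * w1_of p)\<bar> < Re (w1_of p) + Re (w2_of p)"
      using h s by (intro two_abs_less) linarith+
    then show ?thesis using G_strip_shift[OF D(1,2), of "b - \<i> * of_nat k * w1_of p" k] b by simp
  qed
  have "\<Psi> (w1_of p, w2_of p, (rho_of p, sig_of p, tau_of p, ups_of p), x_of p, l_of p)
      = psi_integral (w1_of p) (w2_of p) (rho_of p, sig_of p, tau_of p, ups_of p) (x_of p) (l_of p)" proof -
    have "r1 > 0" "r2 > 0" using D(1,2) w by auto
    moreover have "\<bar>Im (x_of p)\<bar> < zeta r1 r2 (rho_of p, sig_of p, tau_of p, ups_of p) (l_of p)"
      using zeta_gt[OF start] w by simp
    moreover from this have "0 < zeta r1 r2 (rho_of p, sig_of p, tau_of p, ups_of p) (l_of p)"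
      using abs_ge_zero[of "Im (x_of p)"] by linarith
    ultimately show ?thesis using \<Psi> unfolding psi_extension_def w by blast
  qed
  also have "\<dots> = line_integral N p + K * (\<Sum>k<N. t k / strip_at p (b - \<i> * of_nat k * w1_of p))" proof -
    have reg: "region N r1 r2 (Re (rho_of p)) (Re (sig_of p)) (Re (tau_of p)) (Re (ups_of p)) (Im (x_of p)) (Im (l_of p))"
      using D(8) w by simp
    have "start_region d r1 r2 (Re (rho_of p)) (Re (sig_of p)) (Re (tau_of p)) (Re (ups_of p)) (Im (x_of p)) (Im (l_of p))"
      using start w by simp
    from psi_integral_shift[OF reg N this] show ?thesis by (simp add: line_integral_def K_def t_def b_def w)
  qed
  also have "strip_at p b * \<dots> = line_integral N p *
        (strip_at p (b - \<i> * of_nat N * w1_of p) * cosh_at p (b - \<i> * of_nat N * w1_of p) N) +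
      K * (\<Sum>k<N. t k * cosh_at p (b - \<i> * of_nat k * w1_of p) k)" proof -
    have e1: "strip_at p b * (\<Sum>k<N. t k / strip_at p (b - \<i> * of_nat k * w1_of p))
        = (\<Sum>k<N. t k * cosh_at p (b - \<i> * of_nat k * w1_of p) k)" unfolding sum_distrib_left proof (rule sum.cong[OF refl])
      fix k assume "k \<in> {..<N}"
      then show "strip_at p b * (t k / strip_at p (b - \<i> * of_nat k * w1_of p))
          = t k * cosh_at p (b - \<i> * of_nat k * w1_of p) k" using Gb[of k] by simp
    qed
    have "u * (L + K * S) = L * u + K * (u * S)" for u L S by (simp add: algebra_simps)
    then show ?thesis unfolding e1 Gb[OF order_refl, symmetric] by (simp only: e1)
  qed
  finally have eq: "strip_at p b * \<Psi> (w1_of p, w2_of p, (rho_of p, sig_of p, tau_of p, ups_of p), x_of p, l_of p) =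
      line_integral N p *
        (strip_at p (b - \<i> * of_nat N * w1_of p) * cosh_at p (b - \<i> * of_nat N * w1_of p) N) +
      S_residues N p" by (simp add: S_residues_def K_def t_def b_def)
  have G: "G_at p e = strip_at p e" if "Im e < Re (w1_of p) / 2 + Re (w2_of p) / 2"
      "- Im e < Re (w1_of p) / 2 + Re (w2_of p) / 2" for e by (rule G_eq_G_strip[OF D(1,2) two_abs_less[OF that]])
  have pre: "S_prefactor (G_at p) p = S_prefactor (strip_at p) p" unfolding S_prefactor_def
    by (intro arg_cong2[where f = "(*)"] arg_cong2[where f = "(/)"] G refl; use h in simp)
  have gb: "G_at p b = strip_at p b" by (rule G_eq_G_strip[OF D(1,2) b])
  show ?thesis unfolding S_fun_coords pre S_reduced_def b_def[symmetric] gb eq ..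
qed

section \<open>The value of G at half the difference of the periods\<close>

lemma sinh_quotient_tendsto:
  assumes "w \<noteq> 0"
  shows "((\<lambda>eps::real. sinh (cpi * (\<i> * of_real eps) / w) / of_real eps) \<longlongrightarrow> \<i> * cpi / w) (at_right 0)"
proof -
  have "((\<lambda>z. sinh (cpi * (\<i> * z) / w)) has_field_derivative \<i> * cpi / w) (at 0)"
    by (auto intro!: derivative_eq_intros simp: assms)
  then have "((\<lambda>z. sinh (cpi * (\<i> * z) / w) / z) \<longlongrightarrow> \<i> * cpi / w) (at 0)" unfolding has_field_derivative_iff by simp
  moreover have "filterlim (of_real :: real \<Rightarrow> complex) (at 0) (at_right 0)" unfolding filterlim_at proof
    show "\<forall>\<^sub>F x :: real in at_right 0. complex_of_real x \<in> UNIV \<and> complex_of_real x \<noteq> 0"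
      using eventually_at_right_less[of "0::real"] by eventually_elim simp
    have "((of_real :: real \<Rightarrow> complex) \<longlongrightarrow> of_real 0) (at_right 0)" by (intro tendsto_intros)
    then show "((of_real :: real \<Rightarrow> complex) \<longlongrightarrow> 0) (at_right 0)" by simp
  qed
  ultimately show ?thesis by (rule filterlim_compose)
qed

lemma G_strip_isCont:
  assumes "Re w1 > 0" "Re w2 > 0" "2 * \<bar>Im z\<bar> < Re w1 + Re w2"
  shows "isCont (G_strip w1 w2) z"
proof -
  have "cdiff (\<lambda>z. G_strip w1 w2 z) z" by (intro cdiff_intros assms)
  then show ?thesis by (rule cdiff_isCont)
qed

lemma G_strip_half_period:
  assumes w: "Re w1 > 0" "Re w2 > 0" and eps: "0 < eps" "eps < Re w2"
  shows "G_strip w1 w2 (\<i> * (w1 - w2) / 2 + \<i> * of_real eps) =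
    G_strip w1 w2 (- (\<i> * (w1 + w2) / 2) + \<i> * of_real eps) * (- 2 * \<i> * sinh (cpi * (\<i> * of_real eps) / w2))"
proof -
  define z where "z = - (\<i> * (w1 + w2) / 2) + \<i> * of_real eps"
  have z1: "z + \<i> * of_nat 1 * w1 = \<i> * (w1 - w2) / 2 + \<i> * of_real eps" by (simp add: z_def field_simps)
  have u: "z = (\<i> * of_real eps - \<i> * w1 / 2) - \<i> * w2 / 2" by (simp add: z_def field_simps)
  have w0: "w2 \<noteq> 0" using w by auto
  have "cosh_shift w1 w2 z 1 = - 2 * \<i> * sinh (cpi * (\<i> * of_real eps) / w2)" unfolding u by (subst cosh_shift_sinh[OF w0]) simp
  moreover have "G_strip w1 w2 (z + \<i> * of_nat 1 * w1) = G_strip w1 w2 z * cosh_shift w1 w2 z 1"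
  proof (rule G_strip_shift[OF w])
    show "2 * \<bar>Im z\<bar> < Re w1 + Re w2" by (rule two_abs_less) (use w eps in \<open>simp_all add: z_def add_divide_distrib\<close>)
    show "2 * \<bar>Im (z + \<i> * of_nat 1 * w1)\<bar> < Re w1 + Re w2"
      unfolding z1 by (rule two_abs_less) (use w eps in \<open>simp_all add: diff_divide_distrib\<close>)
  qed
  ultimately show ?thesis by (simp only: z1) (simp add: z_def)
qed

text \<open>The pole of G at - i (w1 + w2) / 2 is approached by the difference equation in either
  period. Comparing the two limits relates the values at y and -y by the ratio of the periods, and
  reflection makes the value at -y the reciprocal of that at y.\<close>

lemma G_strip_half_diff_square:
  assumes w: "Re w1 > 0" "Re w2 > 0"
  shows "G_strip w1 w2 (\<i> * (w1 - w2) / 2) ^ 2 = w1 / w2"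
proof -
  define y where "y = \<i> * (w1 - w2) / 2"
  have y': "\<i> * (w2 - w1) / 2 = - y" by (simp add: y_def field_simps)
  have w0: "w1 \<noteq> 0" "w2 \<noteq> 0" using w by auto
  have y: "2 * \<bar>Im y\<bar> < Re w1 + Re w2" by (rule two_abs_less) (use w in \<open>simp_all add: y_def diff_divide_distrib\<close>)
  have lim: "((\<lambda>eps::real. G_strip w1 w2 (v + \<i> * of_real eps)) \<longlongrightarrow> G_strip w1 w2 v) (at_right 0)"
    if "2 * \<bar>Im v\<bar> < Re w1 + Re w2" for v proof (rule isCont_tendsto_compose[OF G_strip_isCont[OF w that]])
    have "((\<lambda>eps::real. v + \<i> * of_real eps) \<longlongrightarrow> v + \<i> * of_real 0) (at_right 0)" by (intro tendsto_intros)
    then show "((\<lambda>eps::real. v + \<i> * of_real eps) \<longlongrightarrow> v) (at_right 0)" by simp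
  qed
  define L where "L eps = G_strip w1 w2 (y + \<i> * of_real eps) * (sinh (cpi * (\<i> * of_real eps) / w1) / of_real eps)" for eps :: real
  define R where "R eps = G_strip w1 w2 (- y + \<i> * of_real eps) * (sinh (cpi * (\<i> * of_real eps) / w2) / of_real eps)" for eps :: real
  have "(L \<longlongrightarrow> G_strip w1 w2 y * (\<i> * cpi / w1)) (at_right 0)"
    unfolding L_def by (intro tendsto_mult lim y sinh_quotient_tendsto w0)
  moreover have "(R \<longlongrightarrow> G_strip w1 w2 (- y) * (\<i> * cpi / w2)) (at_right 0)"
    unfolding R_def by (intro tendsto_mult lim sinh_quotient_tendsto w0) (use y in simp)
  moreover have "\<forall>\<^sub>F eps in at_right 0. L eps = R eps" proof -
    have "\<forall>\<^sub>F eps in at_right 0. eps \<in> {0<..<min (Re w1) (Re w2)}" by (rule eventually_at_right_real) (use w in simp)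
    then show ?thesis proof eventually_elim
      case (elim eps)
      define t where "t = G_strip w1 w2 (- (\<i> * (w1 + w2) / 2) + \<i> * of_real eps)"
      have 1: "G_strip w1 w2 (y + \<i> * of_real eps) = t * (- 2 * \<i> * sinh (cpi * (\<i> * of_real eps) / w2))"
        unfolding y_def t_def using elim by (intro G_strip_half_period w) auto
      have "G_strip w2 w1 (- y + \<i> * of_real eps) =
          G_strip w2 w1 (- (\<i> * (w2 + w1) / 2) + \<i> * of_real eps) * (- 2 * \<i> * sinh (cpi * (\<i> * of_real eps) / w1))"
        unfolding y'[symmetric] using elim by (intro G_strip_half_period w) auto
      then have 2: "G_strip w1 w2 (- y + \<i> * of_real eps) = t * (- 2 * \<i> * sinh (cpi * (\<i> * of_real eps) / w1))"
        by (simp add: t_def add.commute G_strip_commute[of w2 w1])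
      show ?case unfolding L_def R_def 1 2 by simp
    qed
  qed
  ultimately have "(R \<longlongrightarrow> G_strip w1 w2 y * (\<i> * cpi / w1)) (at_right 0)" using tendsto_cong by blast
  then have "G_strip w1 w2 y * (\<i> * cpi / w1) = G_strip w1 w2 (- y) * (\<i> * cpi / w2)"
    using \<open>(R \<longlongrightarrow> G_strip w1 w2 (- y) * (\<i> * cpi / w2)) (at_right 0)\<close> by (intro tendsto_unique[of "at_right 0" R]) auto
  then have "G_strip w1 w2 y / w1 * (\<i> * cpi) = inverse (G_strip w1 w2 y) / w2 * (\<i> * cpi)" by (simp add: G_strip_minus)
  then have "G_strip w1 w2 y / w1 = inverse (G_strip w1 w2 y) / w2" unfolding mult_cancel_right by simp
  then have "G_strip w1 w2 y * G_strip w1 w2 y * w2 = w1" using w0 by (simp add: field_simps)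
  then show ?thesis unfolding y_def[symmetric] power2_eq_square using w0 by (simp add: field_simps)
qed

text \<open>The square determines the value up to sign. Deforming w1 to w2 along a segment in the
  right half plane fixes the sign, because for equal periods the value is G(0) = 1 and a continuous
  function with values 1 and -1 is constant.\<close>

lemma G_strip_half_diff:
  assumes w: "Re w1 > 0" "Re w2 > 0"
  shows "w2 * G_strip w1 w2 (\<i> * (w1 - w2) / 2) = csqrt (w1 * w2)"
proof -
  define W where "W s = (1 - s) * w2 + s * w1" for s
  define h where "h s = w2 * G_strip (W s) w2 (\<i> * (W s - w2) / 2) / csqrt (W s * w2)" for s
  have W: "Re (W (of_real s)) > 0" if "s \<in> {0..1}" for s :: real proof (cases "s = 0")
    case False
    then have "s * Re w1 > 0" "(1 - s) * Re w2 \<ge> 0" using that w by auto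
    then show ?thesis by (simp add: W_def algebra_simps)
  qed (simp add: W_def w)
  have w0: "w2 \<noteq> 0" using w by auto
  have sq: "h (of_real s) = 1 \<or> h (of_real s) = - 1" if s: "s \<in> {0..1}" for s :: real proof -
    have "W (of_real s) \<noteq> 0" using W[OF s] by auto
    then have "h (of_real s) ^ 2 = 1"
      unfolding h_def power_divide power_mult_distrib G_strip_half_diff_square[OF W[OF s] w(2)] power2_csqrt
      using w0 by (simp add: power2_eq_square)
    then show ?thesis by (simp add: power2_eq_1_iff)
  qed
  have cont: "continuous_on {0..1} (\<lambda>s::real. Re (h (of_real s)))" proof (rule continuous_at_imp_continuous_on, rule ballI)
    fix s :: real assume s: "s \<in> {0..1}"
    have "cdiff h (of_real s)" unfolding h_def[abs_def] W_def proof (intro cdiff_intros; (fold W_def)?)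
      show "0 < Re (W (of_real s))" by (rule W[OF s])
      show "W (of_real s) * w2 \<notin> \<real>\<^sub>\<le>\<^sub>0" by (rule mult_notin_nonpos_Reals[OF W[OF s] w(2)])
      then show "csqrt (W (of_real s) * w2) \<noteq> 0" by auto
      show "2 * \<bar>Im (\<i> * (W (of_real s) - w2) / 2)\<bar> < Re (W (of_real s)) + Re w2"
        by (rule two_abs_less) (use W[OF s] w in \<open>simp_all add: diff_divide_distrib\<close>)
    qed (use w in simp_all)
    then have "isCont h (of_real s)" by (rule cdiff_isCont)
    moreover have "isCont (of_real :: real \<Rightarrow> complex) s" by (intro continuous_intros)
    ultimately have "isCont (\<lambda>s. h (of_real s)) s" by (rule isCont_o2[rotated])
    then show "isCont (\<lambda>s. Re (h (of_real s))) s" by (rule continuous_Re)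
  qed
  have h0: "h (of_real 0) = 1" proof -
    have "csqrt (w2 * w2) = w2" using csqrt_square[of w2] w by (simp add: power2_eq_square)
    moreover have "G_strip w2 w2 0 = 1" by (simp add: G_strip_def)
    ultimately show ?thesis using w0 by (simp add: h_def W_def)
  qed
  have "h (of_real 1) = 1" proof (rule ccontr)
    assume "h (of_real 1) \<noteq> 1"
    then have "h (of_real 1) = - 1" using sq[of 1] by auto
    then have "\<exists>s. 0 \<le> s \<and> s \<le> 1 \<and> Re (h (of_real s)) = 0" using h0 cont by (intro IVT2') auto
    then obtain s :: real where s: "s \<in> {0..1}" "Re (h (of_real s)) = 0" by auto
    then show False using sq[OF s(1)] by auto
  qed
  moreover have "csqrt (w1 * w2) \<noteq> 0" using mult_notin_nonpos_Reals[OF w] by auto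
  ultimately show ?thesis by (simp add: h_def W_def)
qed

section \<open>Meromorphy of S on the product of half planes\<close>

lemma mero_nz_holo:
  assumes "holo f A" "\<And>z. z \<in> A \<Longrightarrow> f z \<noteq> 0"
  shows "mero_nz f A"
proof -
  have "holo_nz f A" using assms by (rule holo_nz_nonzero)
  moreover have "mero_rep f f (\<lambda>_. 1) (\<lambda>_. 1) A" using assms(1) by (rule mero_rep_holo) simp
  ultimately show ?thesis unfolding mero_nz_def by blast
qed

definition half_planes :: "point set" where
  "half_planes = {p. Re (w1_of p) > 0 \<and> Re (w2_of p) > 0}"

lemma open_half_planes: "open half_planes"
  unfolding half_planes_def by (intro open_Collects continuous_intros)

text \<open>The direction v leaves the periods fixed and changes the argument e, so (w1, w2, e) maps
  onto the full space and the composition is again an invertible meromorphic function.\<close>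

lemma mero_nz_G_coords:
  assumes e: "\<And>p. cdiff e p" "linear e" and v: "w1_of v = 0" "w2_of v = 0" "e v \<noteq> 0" "\<And>c. e (scaleC c v) = c * e v"
  shows "mero_nz (\<lambda>p. G_at p (e p)) half_planes"
proof -
  define \<alpha> where "\<alpha> p = (w1_of p, w2_of p, e p)" for p
  have 1: "cdiff \<alpha> p" for p unfolding \<alpha>_def[abs_def] by (intro cdiff_intros e)
  have 2: "linear \<alpha>" using e(2) by (intro linearI) (auto simp: \<alpha>_def coord_defs linear_add linear_scale)
  have 3: "surj \<alpha>" proof (rule surjI)
    fix y :: "complex \<times> complex \<times> complex"
    define p :: point where "p = (fst y, fst (snd y), (0, 0, 0, 0), 0, 0)"
    define q where "q = p + scaleC ((snd (snd y) - e p) / e v) v"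
    have "w1_of q = fst y" "w2_of q = fst (snd y)"
      using v(1,2) by (simp_all add: q_def p_def coord_defs scaleC_prod_def scaleC_complex_def)
    moreover have "e q = snd (snd y)" using v(3,4) by (simp add: q_def linear_add[OF e(2)])
    ultimately show "\<alpha> (p + scaleC ((snd (snd y) - e p) / e v) v) = y" by (simp add: \<alpha>_def q_def[symmetric])
  qed
  have "mero_nz (\<lambda>p. (\<lambda>p. G (fst p) (fst (snd p)) (snd (snd p))) (\<alpha> p)) half_planes"
    by (rule mero_nz_compose[OF 1 2 3 mero_nz_G]) (auto simp: \<alpha>_def half_planes_def)
  then show ?thesis by (simp add: \<alpha>_def)
qed

lemma mero_S_fun:
  assumes "psi_extension \<Psi>"
  shows "mero (S_fun \<Psi>) half_planes"
proof -
  define \<alpha> where "\<alpha> p = (w1_of p, w2_of p, (rho_of p, sig_of p, tau_of p, ups_of p), x_of p, l_of p)" for p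
  have 1: "cdiff \<alpha> p" for p unfolding \<alpha>_def[abs_def] by (intro cdiff_intros)
  have 2: "linear \<alpha>"
    by (rule linearI) (simp_all add: prod_eq_iff \<alpha>_def coord_defs algebra_simps add_divide_distrib diff_divide_distrib scaleR_conv_of_real)
  have 3: "surj \<alpha>" proof (rule surjI)
    fix y :: "complex \<times> complex \<times> quadruple \<times> complex \<times> complex"
    show "\<alpha> (case y of (w1, w2, (\<rho>, \<sigma>, \<tau>, \<upsilon>), x, l) \<Rightarrow> (w1, w2, (\<sigma> - \<rho>, \<rho> + \<sigma>, - \<tau> - \<upsilon>, \<tau> - \<upsilon>), x, l)) = y"
      by (cases y) (auto simp: \<alpha>_def coord_defs)
  qed
  have \<Psi>: "mero (\<lambda>p. \<Psi> (\<alpha> p)) half_planes" by (rule mero_compose[OF 1 2 3, of \<Psi> "{(w1, w2, p, x, l). Re w1 > 0 \<and> Re w2 > 0}"])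
      (use assms in \<open>auto simp: psi_extension_def \<alpha>_def half_planes_def\<close>)
  \<comment> \<open>One general linear form for the eleven gamma arguments, so that meromorphy is
    checked once and then instantiated.\<close>
  have lin: "linear (\<lambda>p. a * sig_of p + b * rho_of p + c * tau_of p + d * ups_of p + e * w1_of p + f * w2_of p + g * x_of p + h * l_of p)"
    for a b c d e f g h :: complex
    by (rule linearI) (simp_all add: coord_defs algebra_simps add_divide_distrib diff_divide_distrib scaleR_conv_of_real)
  have g: "mero_nz (\<lambda>p. G_at p (e p)) half_planes"
    if e: "e = (\<lambda>p. a * sig_of p + b * rho_of p + c * tau_of p + d * ups_of p + k * w1_of p + f * w2_of p + g * x_of p + h * l_of p)"
      and nz: "a - b \<noteq> 0 \<or> g \<noteq> 0 \<or> h \<noteq> 0" for e a b c d k f g h proof -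
    have c: "cdiff e p" for p unfolding e by (intro cdiff_intros)
    have l: "linear e" unfolding e by (rule lin)
    have s: "e (scaleC c v) = c * e v" for c v
      unfolding e by (simp add: coord_defs scaleC_prod_def scaleC_complex_def algebra_simps add_divide_distrib diff_divide_distrib)
    consider "a - b \<noteq> 0" | "g \<noteq> 0" | "h \<noteq> 0" using nz by blast
    then show ?thesis proof cases
      case 1
      \<comment> \<open>The first \<gamma>-coordinate equal to 2 gives \<sigma> = 1 and \<rho> = -1,
        hence the value a - b.\<close>
      then show ?thesis by (intro mero_nz_G_coords[where v = "(0, 0, (2, 0, 0, 0), 0, 0)"] c l s) (auto simp: e coord_defs)
    next
      case 2
      then show ?thesis by (intro mero_nz_G_coords[where v = "(0, 0, (0, 0, 0, 0), 1, 0)"] c l s) (auto simp: e coord_defs)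
    next
      case 3
      then show ?thesis by (intro mero_nz_G_coords[where v = "(0, 0, (0, 0, 0, 0), 0, 1)"] c l s) (auto simp: e coord_defs)
    qed
  qed
  have sq: "mero_nz (\<lambda>p. csqrt (w1_of p * w2_of p)) half_planes" proof (rule mero_nz_holo)
    show "holo (\<lambda>p. csqrt (w1_of p * w2_of p)) half_planes"
      by (rule holoI[OF open_half_planes], intro cdiff_intros mult_notin_nonpos_Reals) (auto simp: half_planes_def)
    show "csqrt (w1_of p * w2_of p) \<noteq> 0" if "p \<in> half_planes" for p
      using mult_notin_nonpos_Reals[of "w1_of p" "w2_of p"] that by (auto simp: half_planes_def)
  qed
  have "S_fun \<Psi> = (\<lambda>p. S_prefactor (G_at p) p * (G_at p (mu_of p) * \<Psi> (\<alpha> p)))" by (rule ext) (simp add: S_fun_coords \<alpha>_def)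
  \<comment> \<open>In each instance below, the numbers after the first place are the coefficients
    of \<sigma>, \<rho>, \<tau>, \<upsilon>, w1, w2, x and \<lambda>, in this order.\<close>
  moreover have "mero \<dots> half_planes" unfolding S_prefactor_def
    apply (intro mero_mult[OF mero_nz_mero] \<Psi> mero_nz_mult mero_nz_divide sq)
    apply (rule g[of _ "2 * \<i>" 0 0 0 "\<i> / 2" "\<i> / 2" 0 0]; (rule ext)?, simp)
    apply (rule g[of _ "\<i>" "-\<i>" "-\<i>" "-\<i>" "\<i> / 2" "\<i> / 2" 0 0]; (rule ext)?, simp)
    apply (rule g[of _ "\<i>" "-\<i>" "\<i>" "-\<i>" "\<i> / 2" "\<i> / 2" 0 0]; (rule ext)?, simp)
    apply (rule g[of _ "-\<i>" "\<i>" 0 0 0 0 1 0]; (rule ext)?, simp)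
    apply (rule g[of _ "-\<i>" "-\<i>" 0 0 0 0 1 0]; (rule ext)?, simp)
    apply (rule g[of _ 0 0 "-\<i>" "-\<i>" 0 0 1 0]; (rule ext)?, simp)
    apply (rule g[of _ 0 0 "\<i>" "-\<i>" 0 0 1 0]; (rule ext)?, simp)
    apply (rule g[of _ "-\<i>" 0 0 "-\<i>" 0 0 0 1]; (rule ext)?, simp)
    apply (rule g[of _ 0 "-\<i>" "-\<i>" 0 0 0 0 1]; (rule ext)?, simp)
    apply (rule g[of _ 0 "-\<i>" "\<i>" 0 0 0 0 1]; (rule ext)?, simp)
    apply (rule g[of _ "-\<i>" 0 0 "\<i>" 0 0 0 1]; (rule ext)?, simp)
    done
  ultimately show ?thesis by simp
qed

section \<open>Sears' transformation\<close>

lemma qpoch_0 [simp]: "qpoch a q 0 = 1"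
  by (simp add: qpoch_def)

lemma qpoch_Suc: "qpoch a q (Suc n) = qpoch a q n * (1 - a * q ^ n)"
  by (simp add: qpoch_def)

lemma qpoch_add: "qpoch a q (m + n) = qpoch a q m * qpoch (a * q ^ m) q n"
  by (induction n) (simp_all add: qpoch_Suc power_add mult_ac)

lemma qpoch_nonzero_le:
  assumes "qpoch a q n \<noteq> 0" "k \<le> n"
  shows "qpoch a q k \<noteq> 0"
proof -
  have "n = k + (n - k)" using assms(2) by simp
  then have "qpoch a q n = qpoch a q k * qpoch (a * q ^ k) q (n - k)" by (metis qpoch_add)
  then show ?thesis using assms(1) by auto
qed

text \<open>The sum of a terminating balanced 3-phi-2 in convolution form. The proof is creative
  telescoping: the summand satisfies a first-order recurrence in k up to a difference in j.\<close>

lemma q_saalschuetz: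
  assumes "q \<noteq> 0" "qpoch q q k \<noteq> 0" "qpoch (e * u * v) q k \<noteq> 0"
  shows "(\<Sum>j\<le>k. qpoch u q j * qpoch v q j / (qpoch q q j * qpoch (e * u * v) q j) * e ^ j *
      (qpoch e q (k - j) / qpoch q q (k - j))) =
    qpoch (e * u) q k * qpoch (e * v) q k / (qpoch q q k * qpoch (e * u * v) q k)" using assms(2,3)
proof (induction k)
  case (Suc k)
  define D where "D = e * u * v"
  define a where "a j = qpoch u q j * qpoch v q j / (qpoch q q j * qpoch D q j)" for j
  define b where "b i = qpoch e q i / qpoch q q i" for i
  define S where "S k = (\<Sum>j\<le>k. a j * e ^ j * b (k - j))" for k
  have nz: "qpoch q q j \<noteq> 0" "qpoch D q j \<noteq> 0" if "j \<le> Suc k" for j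
    using qpoch_nonzero_le[OF Suc.prems(1) that] qpoch_nonzero_le[OF Suc.prems(2) that] by (simp_all add: D_def)
  have nz': "1 - q * q ^ j \<noteq> 0" "1 - D * q ^ j \<noteq> 0" if "j \<le> k" for j using nz[of "Suc j"] that by (auto simp: qpoch_Suc)
  have aS: "a (Suc j) * ((1 - q * q ^ j) * (1 - D * q ^ j)) = a j * ((1 - u * q ^ j) * (1 - v * q ^ j))" if "j \<le> k" for j
    using nz[of j] nz'[OF that] that by (simp add: a_def qpoch_Suc)
  have bS: "b (Suc i) * (1 - q * q ^ i) = b i * (1 - e * q ^ i)" if "i \<le> k" for i
    using nz[of i] nz'[OF that] that by (simp add: b_def qpoch_Suc)
  \<comment> \<open>The telescoping certificate. It vanishes at j = 0 through 1 -
    \<open>q ^ 0\<close>, and at j = k + 1 it supplies exactly the term of the longer sum that is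
    missing in the range j < k + 1.\<close>
  define G where "G j = - (q ^ (Suc k - j) * (1 - q ^ j) * (1 - D * q ^ j / q) * a j * e ^ j * b (Suc k - j))" for j
  define c where "c = (1 - q * q ^ k) * (1 - D * q ^ k)"
  have c0: "c \<noteq> 0" using nz'[of k] by (simp add: c_def)
  have "c * (a j * e ^ j * b (Suc k - j)) - (1 - e * u * q ^ k) * (1 - e * v * q ^ k) * (a j * e ^ j * b (k - j))
      = G (Suc j) - G j" if j: "j \<in> {..<Suc k}" for j proof -
    define i where "i = k - j"
    have k: "k = j + i" "Suc k - j = Suc i" "k - j = i" "i \<le> k" "j \<le> k" using j by (auto simp: i_def)
    define y where "y = q ^ j"
    define z where "z = q ^ i"
    have qk: "q ^ k = y * z" by (simp add: k(1) power_add y_def z_def)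
    have z1: "1 - q * z \<noteq> 0" using nz'[OF k(4)] by (simp add: z_def)
    have "G (Suc j) = - (z * e * e ^ j * b i * (a (Suc j) * ((1 - q * y) * (1 - D * y))))"
      using assms(1) by (simp add: G_def k(3) z_def y_def mult_ac)
    also have "\<dots> = - (z * e * e ^ j * b i * (a j * ((1 - u * y) * (1 - v * y))))" using aS[OF k(5)] by (simp add: y_def)
    finally have G1: "G (Suc j) = - (z * e * e ^ j * b i * (a j * ((1 - u * y) * (1 - v * y))))" .
    have G0: "G j = - (q * z * (1 - y) * (1 - D * y / q) * a j * e ^ j * b (Suc i))" by (simp add: G_def k(2) z_def y_def)
    have bi: "b (Suc i) = b i * (1 - e * z) / (1 - q * z)" using bS[OF k(4)] z1 by (simp add: z_def field_simps)
    \<comment> \<open>After division by the common summand, the certificate reduces to this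
      polynomial identity in y = \<open>q ^ j\<close> and z = \<open>q ^ i\<close>.\<close>
    have poly: "(1 - q * (y * z)) * (1 - D * (y * z)) * (1 - e * z) - (1 - e * u * (y * z)) * (1 - e * v * (y * z)) * (1 - q * z)
        = - (z * e * ((1 - u * y) * (1 - v * y))) * (1 - q * z) + z * (1 - y) * (q - D * y) * (1 - e * z)"
      unfolding D_def by algebra
    have qD: "q * z * (1 - y) * (1 - D * y / q) = z * (1 - y) * (q - D * y)" using assms(1) by (simp add: field_simps)
    have "(c * (a j * e ^ j * b (Suc k - j)) - (1 - e * u * q ^ k) * (1 - e * v * q ^ k) * (a j * e ^ j * b (k - j))) * (1 - q * z)
        = a j * e ^ j * b i * ((1 - q * (y * z)) * (1 - D * (y * z)) * (1 - e * z) - (1 - e * u * (y * z)) * (1 - e * v * (y * z)) * (1 - q * z))"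
      unfolding c_def k(2,3) qk bi using z1 by (simp add: field_simps)
    also have "\<dots> = (G (Suc j) - G j) * (1 - q * z)" unfolding poly G1 G0 qD bi using z1 by (simp add: field_simps)
    finally show ?thesis using z1 by simp
  qed
  then have "(\<Sum>j<Suc k. c * (a j * e ^ j * b (Suc k - j)) - (1 - e * u * q ^ k) * (1 - e * v * q ^ k) * (a j * e ^ j * b (k - j)))
      = (\<Sum>j<Suc k. G (Suc j) - G j)" by (intro sum.cong) auto
  also have "\<dots> = G (Suc k) - G 0" by (rule sum_lessThan_telescope)
  also have "\<dots> = - (c * (a (Suc k) * e ^ Suc k * b 0))" using assms(1) by (simp add: G_def c_def b_def mult_ac)
  also have "(\<Sum>j<Suc k. c * (a j * e ^ j * b (Suc k - j)) - (1 - e * u * q ^ k) * (1 - e * v * q ^ k) * (a j * e ^ j * b (k - j)))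
      = c * (\<Sum>j<Suc k. a j * e ^ j * b (Suc k - j)) - (1 - e * u * q ^ k) * (1 - e * v * q ^ k) * S k"
    by (simp only: sum_subtractf sum_distrib_left[symmetric] S_def lessThan_Suc_atMost)
  finally have "c * ((\<Sum>j<Suc k. a j * e ^ j * b (Suc k - j)) + a (Suc k) * e ^ Suc k * b 0) = (1 - e * u * q ^ k) * (1 - e * v * q ^ k) * S k"
    by (simp add: algebra_simps)
  also have "(\<Sum>j<Suc k. a j * e ^ j * b (Suc k - j)) + a (Suc k) * e ^ Suc k * b 0 = S (Suc k)"
    unfolding S_def by (simp add: lessThan_Suc_atMost)
  finally have rec: "c * S (Suc k) = (1 - e * u * q ^ k) * (1 - e * v * q ^ k) * S k" .
  have Sk: "S k = qpoch (e * u) q k * qpoch (e * v) q k / (qpoch q q k * qpoch D q k)"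
    unfolding S_def a_def b_def D_def using nz[of k] by (intro Suc.IH) (auto simp: D_def)
  have "S (Suc k) = (1 - e * u * q ^ k) * (1 - e * v * q ^ k) * S k / c" using rec c0 by (metis nonzero_mult_div_cancel_left)
  then have "S (Suc k) = qpoch (e * u) q (Suc k) * qpoch (e * v) q (Suc k) / (qpoch q q (Suc k) * qpoch D q (Suc k))"
    unfolding Sk qpoch_Suc c_def by (simp add: mult_ac)
  then show ?case unfolding S_def a_def b_def D_def .
qed simp

text \<open>Reading a q-shifted factorial from its last factor backwards. The statement is kept free
  of division so that it holds even when some factors vanish.\<close>

lemma qpoch_reverse:
  assumes "q \<noteq> 0" "A \<noteq> 0" "i \<le> M"
  shows "qpoch (q / (q ^ M * A)) q i * qpoch A q (M - i) * (A ^ i * q ^ (M * i)) = qpoch A q M * (- 1) ^ i * (\<Prod>l<i. q ^ Suc l)"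
  using assms(3)
proof (induction i)
  case (Suc i)
  define r where "r = M - Suc i"
  have M: "M - i = Suc r" "M = Suc (r + i)" using Suc.prems by (auto simp: r_def)
  have "q ^ M = q ^ r * (q * q ^ i)" by (simp add: M(2) power_add)
  then have f: "(1 - q / (q ^ M * A) * q ^ i) * (A * q ^ M) = - (q * q ^ i) * (1 - A * q ^ r)"
    using assms(1,2) by (simp add: field_simps)
  have "qpoch (q / (q ^ M * A)) q (Suc i) * qpoch A q (M - Suc i) * (A ^ Suc i * q ^ (M * Suc i))
      = qpoch (q / (q ^ M * A)) q i * qpoch A q r * (A ^ i * q ^ (M * i)) * ((1 - q / (q ^ M * A) * q ^ i) * (A * q ^ M))"
    by (simp add: qpoch_Suc r_def[symmetric] power_add mult_ac)
  also have "\<dots> = (qpoch (q / (q ^ M * A)) q i * qpoch A q (M - i) * (A ^ i * q ^ (M * i))) * (- (q * q ^ i))"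
    unfolding f M(1) qpoch_Suc by (simp add: mult_ac)
  also have "\<dots> = qpoch A q M * (- 1) ^ Suc i * (\<Prod>l<Suc i. q ^ Suc l)" using Suc by (simp add: mult_ac)
  finally show ?case .
qed simp

text \<open>The power of q with exponent i (i + 1) / 2, kept as a product to avoid halving
  exponents.\<close>

abbreviation tri :: "complex \<Rightarrow> nat \<Rightarrow> complex" where
  "tri q i \<equiv> \<Prod>l<i. q ^ Suc l"

lemma tri_add: "tri q (i + j) = tri q i * tri q j * q ^ (i * j)"
  by (induction j) (simp_all add: power_add mult_ac)

lemma tri_square: "tri q j * tri q j = q ^ (j * j) * q ^ j"
proof (induction j)
  case (Suc j)
  have "tri q (Suc j) * tri q (Suc j) = (tri q j * tri q j) * (q ^ Suc j * q ^ Suc j)" by simp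
  also have "\<dots> = q ^ (Suc j * Suc j) * q ^ Suc j" unfolding Suc by (simp add: power_add mult_ac)
  finally show ?case .
qed simp

lemma divide_sign_swap:
  fixes A B C P s T :: complex
  assumes "A * B * P = C * s * T" "s * s = 1" "T \<noteq> 0" "B \<noteq> 0"
  shows "C / B = A * (P * s / T)"
proof -
  have "A * B * P * s = C * T * (s * s)" using assms(1) by (simp add: mult_ac)
  then have "C * T = A * B * P * s" using assms(2) by simp
  then show ?thesis using assms(3,4) by (simp add: field_simps)
qed

definition aw_summand where
  "aw_summand a b c d X q n j = qpoch (1 / q ^ n) q j * qpoch (a * b * c * d * q ^ n / q) q j * qpoch (a * X) q j *
     qpoch (a / X) q j / (qpoch (a * b) q j * qpoch (a * c) q j * qpoch (a * d) q j * qpoch q q j) * q ^ j"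

text \<open>
  Sears' transformation of a terminating balanced \<open>\<^sub>4\<phi>3\<close>, with the transformed series written as a
  convolution; both the expansion of its terms and the resummation are instances of the
  q-Saalschuetz formula.
\<close>

theorem sears_askey_wilson:
  fixes a b c d q X :: complex
  assumes nz: "q \<noteq> 0" "X \<noteq> 0" "a \<noteq> 0" "c \<noteq> 0" "d \<noteq> 0"
    and pn: "qpoch q q n \<noteq> 0" "qpoch (a * b) q n \<noteq> 0" "qpoch (a * c) q n \<noteq> 0" "qpoch (a * d) q n \<noteq> 0"
      "qpoch (c * d) q n \<noteq> 0" "qpoch (a * c * d * X) q n \<noteq> 0"
  shows "a ^ n * (qpoch q q n * qpoch (c * d) q n / (qpoch (a * c) q n * qpoch (a * d) q n)) *
      (\<Sum>m\<le>n. qpoch (a / X) q m * qpoch (b / X) q m / (qpoch q q m * qpoch (a * b) q m) *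
        (qpoch (c * X) q (n - m) * qpoch (d * X) q (n - m) / (qpoch q q (n - m) * qpoch (c * d) q (n - m))) *
        (X ^ m * X ^ m / X ^ n)) =
    (\<Sum>j\<le>n. aw_summand a b c d X q n j)"
proof -
  \<comment> \<open>The values of e, u and v are chosen so that e u = b/X and e u v = ab, while e v
    is the base of the reversed factorial of cd. The first Saalschuetz sum then produces the factors
    of the m-th term.\<close>
  define e where "e = q / (q ^ n * (a * c * d * X))"
  define u where "u = a * b * c * d * q ^ n / q"
  define v where "v = a * X"
  define T where "T = tri q"
  have T0: "T i \<noteq> 0" for i using nz(1) by (simp add: T_def)
  have euv: "e * u = b / X" "e * v = q / (q ^ n * (c * d))" "e * u * v = a * b" using nz by (simp_all add: e_def u_def v_def)
  have nzn: "qpoch q q k \<noteq> 0" "qpoch (a * b) q k \<noteq> 0" "qpoch (a * c) q k \<noteq> 0" "qpoch (a * d) q k \<noteq> 0"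
      "qpoch (c * d) q k \<noteq> 0" "qpoch (a * c * d * X) q k \<noteq> 0" if "k \<le> n" for k using pn[THEN qpoch_nonzero_le] that by auto
  \<comment> \<open>The double sum to be summed in two orders: m = j + i is the index of the
    convolution, j that of the Askey-Wilson series.\<close>
  define g where "g j i = qpoch (a / X) q (j + i) * (qpoch (c * X) q (n - (j + i)) * qpoch (d * X) q (n - (j + i)) / qpoch q q (n - (j + i))) *
      (X ^ (j + i) * X ^ (j + i) / X ^ n) * ((c * d) ^ (j + i) * q ^ (n * (j + i)) * (- 1) ^ (j + i) / T (j + i)) *
      (qpoch u q j * qpoch v q j / (qpoch q q j * qpoch (a * b) q j) * e ^ j * (qpoch e q i / qpoch q q i))" for j i
  define h where "h j = qpoch (a / X) q j * (X ^ j * X ^ j / X ^ n) * ((c * d) ^ j * q ^ (n * j) * (- 1) ^ j / T j) *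
      (qpoch u q j * qpoch v q j / (qpoch q q j * qpoch (a * b) q j) * e ^ j)" for j
  define t where "t m = qpoch (a / X) q m * qpoch (b / X) q m / (qpoch q q m * qpoch (a * b) q m) *
        (qpoch (c * X) q (n - m) * qpoch (d * X) q (n - m) / (qpoch q q (n - m) * qpoch (c * d) q (n - m))) *
        (X ^ m * X ^ m / X ^ n)" for m
  define H where "H j = h j * (X / (a * q ^ j)) ^ (n - j) *
      (qpoch (a * c * q ^ j) q (n - j) * qpoch (a * d * q ^ j) q (n - j) / qpoch q q (n - j))" for j
  \<comment> \<open>The m-th term is expanded: the factorial of cd with index n - m is reversed,
    which makes its product with that of b/X the right side of the Saalschuetz formula.\<close>
  have A: "qpoch (c * d) q n * t m = (\<Sum>j\<le>m. g j (m - j))" if m: "m \<le> n" for m proof -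
    have "qpoch (q / (q ^ n * (c * d))) q m * qpoch (c * d) q (n - m) * ((c * d) ^ m * q ^ (n * m)) = qpoch (c * d) q n * (- 1) ^ m * T m"
      unfolding T_def using nz m by (intro qpoch_reverse) auto
    then have rev: "qpoch (c * d) q n / qpoch (c * d) q (n - m) =
        qpoch (q / (q ^ n * (c * d))) q m * ((c * d) ^ m * q ^ (n * m) * (- 1) ^ m / T m)"
      using T0[of m] nzn(5)[of "n - m"] by (intro divide_sign_swap) (auto simp flip: power_mult_distrib)
    have s: "(\<Sum>j\<le>m. qpoch u q j * qpoch v q j / (qpoch q q j * qpoch (a * b) q j) * e ^ j * (qpoch e q (m - j) / qpoch q q (m - j)))
        = qpoch (b / X) q m * qpoch (q / (q ^ n * (c * d))) q m / (qpoch q q m * qpoch (a * b) q m)"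
      using q_saalschuetz[of q m e u v] nz(1) nzn(1,2)[OF m] unfolding euv(3) unfolding euv(1,2) by blast
    define w where "w = qpoch (a / X) q m * (qpoch (c * X) q (n - m) * qpoch (d * X) q (n - m) / qpoch q q (n - m)) *
      (X ^ m * X ^ m / X ^ n) * ((c * d) ^ m * q ^ (n * m) * (- 1) ^ m / T m)"
    have "(\<Sum>j\<le>m. g j (m - j)) = (\<Sum>j\<le>m. w * (qpoch u q j * qpoch v q j / (qpoch q q j * qpoch (a * b) q j) * e ^ j * (qpoch e q (m - j) / qpoch q q (m - j))))"
      by (rule sum.cong) (auto simp: g_def w_def)
    also have "\<dots> = w * (qpoch (b / X) q m * qpoch (q / (q ^ n * (c * d))) q m / (qpoch q q m * qpoch (a * b) q m))"
      unfolding sum_distrib_left[symmetric] s ..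
    also have "\<dots> = (qpoch (q / (q ^ n * (c * d))) q m * ((c * d) ^ m * q ^ (n * m) * (- 1) ^ m / T m)) *
        (qpoch (a / X) q m * qpoch (b / X) q m / (qpoch q q m * qpoch (a * b) q m) *
        (qpoch (c * X) q (n - m) * qpoch (d * X) q (n - m) / qpoch q q (n - m)) * (X ^ m * X ^ m / X ^ n))"
      unfolding w_def by (simp add: mult_ac)
    finally show ?thesis unfolding rev[symmetric] t_def by (simp add: mult_ac)
  qed
  \<comment> \<open>For fixed j the sum over i, read backwards, is again a Saalschuetz sum, now with
    \<alpha> in the role of e and D as balanced lower parameter. The powers collected in
    \<open>pw\<close> are what makes the two signs and the Gaussian factors cancel.\<close>
  have C: "(\<Sum>i\<le>n - j. g j i) = H j" if j: "j \<le> n" for j proof -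
    define M where "M = n - j"
    have n: "n = j + M" using j by (simp add: M_def)
    define \<alpha> where "\<alpha> = a * q ^ j / X"
    define D where "D = a * c * d * X * q ^ j"
    have \<alpha>0: "\<alpha> \<noteq> 0" "D \<noteq> 0" using nz by (auto simp: \<alpha>_def D_def)
    have D: "\<alpha> * (c * X) * (d * X) = D" "\<alpha> * (c * X) = a * c * q ^ j" "\<alpha> * (d * X) = a * d * q ^ j"
      using nz by (simp_all add: \<alpha>_def D_def field_simps)
    have eD: "e = q / (q ^ M * D)" by (simp add: e_def D_def n power_add mult_ac)
    have "qpoch (a * c * d * X) q n = qpoch (a * c * d * X) q j * qpoch D q M" unfolding n D_def by (rule qpoch_add)
    then have D0: "qpoch D q M \<noteq> 0" using pn(6) by auto
    have g: "g j i = h j * qpoch D q M * (qpoch (c * X) q (M - i) * qpoch (d * X) q (M - i) / (qpoch q q (M - i) * qpoch D q (M - i)) *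
        (qpoch \<alpha> q i / qpoch q q i)) / \<alpha> ^ i" if i: "i \<le> M" for i proof -
      have "qpoch e q i * qpoch D q (M - i) * (D ^ i * q ^ (M * i)) = qpoch D q M * (- 1) ^ i * T i"
        unfolding eD T_def using nz \<alpha>0 i by (intro qpoch_reverse) auto
      then have rev: "qpoch e q i = qpoch D q M * (- 1) ^ i * T i / (qpoch D q (M - i) * (D ^ i * q ^ (M * i)))"
        using nz \<alpha>0 qpoch_nonzero_le[OF D0, of "M - i"] by (simp add: field_simps)
      have nji: "n - (j + i) = M - i" by (simp add: M_def)
      have aX: "qpoch (a / X) q (j + i) = qpoch (a / X) q j * qpoch \<alpha> q i" unfolding qpoch_add \<alpha>_def by simp
      have Tji: "T (j + i) = T j * T i * q ^ (j * i)" unfolding T_def by (rule tri_add)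
      have m1: "(- 1) ^ i * (- 1) ^ i = (1::complex)" by (simp flip: power_mult_distrib)
      have "X * X * (c * d) * q ^ n * \<alpha> = q ^ j * D * q ^ M" using nz by (simp add: \<alpha>_def D_def n power_add)
      then have "(X * X * (c * d) * q ^ n * \<alpha>) ^ i = (q ^ j * D * q ^ M) ^ i" by simp
      then have pw: "X ^ i * X ^ i * ((c * d) ^ i * q ^ (n * i)) * \<alpha> ^ i = q ^ (j * i) * D ^ i * q ^ (M * i)"
        by (simp only: power_mult_distrib power_mult[symmetric] mult.assoc)
      then have pw': "X ^ i * X ^ i * ((c * d) ^ i * q ^ (n * i)) / (q ^ (j * i) * (D ^ i * q ^ (M * i))) = 1 / \<alpha> ^ i"
        using nz \<alpha>0 by (simp add: field_simps)
      have "g j i = h j * qpoch D q M * (qpoch (c * X) q (M - i) * qpoch (d * X) q (M - i) / (qpoch q q (M - i) * qpoch D q (M - i)) *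
        (qpoch \<alpha> q i / qpoch q q i)) * ((- 1) ^ i * (- 1) ^ i) * (X ^ i * X ^ i * ((c * d) ^ i * q ^ (n * i)) / (q ^ (j * i) * (D ^ i * q ^ (M * i))))"
        unfolding g_def h_def nji aX Tji rev using T0 by (simp add: power_add distrib_left mult_ac)
      then show ?thesis unfolding m1 pw' by simp
    qed
    have "(\<Sum>i\<le>M. g j i) = (\<Sum>l\<le>M. g j (M - l))" by (rule sum.reindex_bij_witness[of _ "\<lambda>i. M - i" "\<lambda>i. M - i"]) auto
    also have "\<dots> = (\<Sum>l\<le>M. h j * qpoch D q M / \<alpha> ^ M * (qpoch (c * X) q l * qpoch (d * X) q l / (qpoch q q l * qpoch D q l) * \<alpha> ^ l *
        (qpoch \<alpha> q (M - l) / qpoch q q (M - l))))" proof (rule sum.cong[OF refl])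
      fix l assume "l \<in> {..M}"
      then have l: "l \<le> M" "M - (M - l) = l" by auto
      then have "\<alpha> ^ M = \<alpha> ^ (M - l) * \<alpha> ^ l" by (simp flip: power_add)
      then show "g j (M - l) = h j * qpoch D q M / \<alpha> ^ M * (qpoch (c * X) q l * qpoch (d * X) q l / (qpoch q q l * qpoch D q l) * \<alpha> ^ l *
        (qpoch \<alpha> q (M - l) / qpoch q q (M - l)))" using g[of "M - l"] l \<alpha>0 by (simp add: mult_ac)
    qed
    also have "\<dots> = h j * qpoch D q M / \<alpha> ^ M * (qpoch (a * c * q ^ j) q M * qpoch (a * d * q ^ j) q M / (qpoch q q M * qpoch D q M))"
      unfolding sum_distrib_left[symmetric]
      using q_saalschuetz[of q M \<alpha> "c * X" "d * X"] nz(1) nzn(1)[of M] D0 unfolding D(1) unfolding D(2,3) by (simp add: n)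
    also have "\<dots> = h j * (X / (a * q ^ j)) ^ M * (qpoch (a * c * q ^ j) q M * qpoch (a * d * q ^ j) q M / qpoch q q M)"
      using D0 by (simp add: \<alpha>_def power_divide)
    finally show ?thesis by (simp add: M_def H_def)
  qed
  \<comment> \<open>What is left is one reversal of (q;q) with index n - j, which creates the
    factorial with base 1 / \<open>q ^ n\<close>, and a count of powers that leaves
    \<open>q ^ j\<close>.\<close>
  have E: "a ^ n * qpoch q q n / (qpoch (a * c) q n * qpoch (a * d) q n) * H j = aw_summand a b c d X q n j" if j: "j \<le> n" for j
  proof -
    define M where "M = n - j"
    have n: "n = j + M" using j by (simp add: M_def)
    have rev: "qpoch (1 / q ^ n) q j * qpoch q q M * (q ^ j * q ^ (n * j)) = qpoch q q n * (- 1) ^ j * T j"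
      using qpoch_reverse[of q q j n] nz j unfolding T_def M_def by simp
    have qM: "qpoch q q M \<noteq> 0" using nzn(1)[of M] n by simp
    have m1: "(- 1) ^ j * (- 1) ^ j = (1::complex)" by (simp flip: power_mult_distrib)
    have qn: "qpoch q q n / qpoch q q M = qpoch (1 / q ^ n) q j * ((q ^ j * q ^ (n * j)) * (- 1) ^ j / T j)"
      by (rule divide_sign_swap[OF rev m1 T0 qM])
    have ac: "qpoch (a * c) q n = qpoch (a * c) q j * qpoch (a * c * q ^ j) q M"
      "qpoch (a * d) q n = qpoch (a * d) q j * qpoch (a * d * q ^ j) q M" unfolding n by (rule qpoch_add)+
    have ac0: "qpoch (a * c * q ^ j) q M \<noteq> 0" "qpoch (a * d * q ^ j) q M \<noteq> 0" using ac pn(3,4) by auto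
    have TT: "T j * T j = q ^ (j * j) * q ^ j" unfolding T_def by (rule tri_square)
    have pw: "a ^ n * (X ^ j * X ^ j / X ^ n) * ((c * d) ^ j * q ^ (n * j)) * e ^ j * (X / (a * q ^ j)) ^ M * (q ^ j * q ^ (n * j)) / (T j * T j) = q ^ j"
      unfolding TT e_def n using nz by (simp add: power_divide power_mult_distrib power_add field_simps flip: power_mult)
    have "a ^ n * qpoch q q n / (qpoch (a * c) q n * qpoch (a * d) q n) * (h j * (X / (a * q ^ j)) ^ M *
        (qpoch (a * c * q ^ j) q M * qpoch (a * d * q ^ j) q M / qpoch q q M))
      = (qpoch q q n / qpoch q q M) * a ^ n / (qpoch (a * c) q j * qpoch (a * d) q j) * (h j * (X / (a * q ^ j)) ^ M)"
      unfolding ac using ac0 by (simp add: mult_ac)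
    also have "\<dots> = qpoch (1 / q ^ n) q j * qpoch u q j * qpoch v q j * qpoch (a / X) q j /
       (qpoch (a * b) q j * qpoch (a * c) q j * qpoch (a * d) q j * qpoch q q j) * ((- 1) ^ j * (- 1) ^ j) *
       (a ^ n * (X ^ j * X ^ j / X ^ n) * ((c * d) ^ j * q ^ (n * j)) * e ^ j * (X / (a * q ^ j)) ^ M * (q ^ j * q ^ (n * j)) / (T j * T j))"
      unfolding qn h_def by (simp add: mult_ac)
    finally show ?thesis unfolding pw m1 mult_1_right unfolding M_def u_def v_def aw_summand_def H_def .
  qed
  have "(\<Sum>m\<le>n. \<Sum>j\<le>m. g j (m - j)) = (\<Sum>j\<le>n. \<Sum>i\<le>n - j. g j i)" proof -
    have "{(i, j). i + j \<le> n} = Sigma {..n} (\<lambda>j. {..n - j})" by auto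
    then show ?thesis unfolding sum.triangle_reindex_eq[symmetric] by (simp add: sum.Sigma)
  qed
  moreover have "(\<Sum>j\<le>n. \<Sum>i\<le>n - j. g j i) = (\<Sum>j\<le>n. H j)" by (intro sum.cong refl C) simp
  moreover have "qpoch (c * d) q n * (\<Sum>m\<le>n. t m) = (\<Sum>m\<le>n. \<Sum>j\<le>m. g j (m - j))"
    unfolding sum_distrib_left by (intro sum.cong refl A) simp
  ultimately have "a ^ n * qpoch q q n / (qpoch (a * c) q n * qpoch (a * d) q n) * (qpoch (c * d) q n * (\<Sum>m\<le>n. t m)) = a ^ n * qpoch q q n / (qpoch (a * c) q n * qpoch (a * d) q n) * (\<Sum>j\<le>n. H j)"
    by presburger
  also have "\<dots> = (\<Sum>j\<le>n. aw_summand a b c d X q n j)" unfolding sum_distrib_left by (intro sum.cong refl E) simp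
  finally show ?thesis unfolding t_def by (simp only: mult.assoc times_divide_eq_left times_divide_eq_right)
qed

text \<open>The factorial of 1 / \<open>q ^ n\<close> with index k > n contains the factor with
  exponent n, which is 0, so the infinite series stops at n.\<close>

lemma askey_wilson_sum:
  assumes "q \<noteq> 0"
  shows "askey_wilson w n x a b c d q =
    (\<Sum>j\<le>n. aw_summand a b c d (exp (2 * cpi * x / w)) q n j)"
proof -
  have 1: "q powi (- int n) = 1 / q ^ n" by (simp add: power_int_minus field_simps)
  have 2: "q powi (int n - 1) = q ^ n / q" using assms by (simp add: power_int_diff)
  have 3: "a * exp (- (2 * cpi * x / w)) = a / exp (2 * cpi * x / w)" by (simp add: exp_minus field_simps)
  have z: "qpoch (1 / q ^ n) q k = 0" if "n < k" for k
    unfolding qpoch_def using assms that by (intro prod_zero bexI[of _ n]) auto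
  have "askey_wilson w n x a b c d q = (\<Sum>k. aw_summand a b c d (exp (2 * cpi * x / w)) q n k)"
    unfolding askey_wilson_def qhyp_def 1 2 3 aw_summand_def by (simp add: mult.assoc)
  also have "\<dots> = (\<Sum>j\<le>n. aw_summand a b c d (exp (2 * cpi * x / w)) q n j)" by (rule suminf_finite) (auto simp: z aw_summand_def)
  finally show ?thesis .
qed

section \<open>Products of hyperbolic cosines as q-shifted factorials\<close>

abbreviation (input) nome_at :: "complex \<Rightarrow> complex \<Rightarrow> complex" where
  "nome_at w1 w2 \<equiv> exp (cpi * \<i> * w1 / w2)"

definition aw_arg where
  "aw_arg w1 w2 y = - exp (2 * cpi * y / w2) * nome_at w1 w2"

text \<open>Each factor is exp (-u) (1 + exp (2 u)), and consecutive values of exp (2 u) differ by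
  the square of the nome. The prefactors exp (-u) multiply to a Gaussian in k.\<close>

lemma cosh_shift_qpoch:
  assumes "w2 \<noteq> 0"
  shows "cosh_shift w1 w2 y k = exp (- (cpi * of_nat k * y + cpi * \<i> * w1 * of_nat (k * k) / 2) / w2) *
    qpoch (aw_arg w1 w2 y) (nome_at w1 w2 ^ 2) k"
proof (induction k)
  case (Suc k)
  define u where "u = cpi * (y + \<i> * (of_nat k + 1 / 2) * w1) / w2"
  have "exp (2 * u) = exp u * exp u" by (simp only: mult_2 exp_add)
  then have "2 * cosh u = exp (- u) * (1 + exp (2 * u))" by (simp add: cosh_field_def exp_minus field_simps)
  moreover have "exp (2 * u) = exp (2 * cpi * y / w2) * nome_at w1 w2 * (nome_at w1 w2 ^ 2) ^ k" proof -
    have "(nome_at w1 w2 ^ 2) ^ k = exp (of_nat k * (of_nat 2 * (cpi * \<i> * w1 / w2)))" by (simp only: exp_of_nat_mult)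
    then have "exp (2 * cpi * y / w2) * nome_at w1 w2 * (nome_at w1 w2 ^ 2) ^ k
        = exp (2 * cpi * y / w2 + cpi * \<i> * w1 / w2 + of_nat k * (of_nat 2 * (cpi * \<i> * w1 / w2)))" by (simp only: exp_add)
    also have "2 * cpi * y / w2 + cpi * \<i> * w1 / w2 + of_nat k * (of_nat 2 * (cpi * \<i> * w1 / w2)) = 2 * u"
      unfolding u_def using assms by (simp add: field_simps)
    finally show ?thesis ..
  qed
  ultimately have cu: "2 * cosh u = exp (- u) * (1 - aw_arg w1 w2 y * (nome_at w1 w2 ^ 2) ^ k)" by (simp add: aw_arg_def)
  have e: "- (cpi * of_nat k * y + cpi * \<i> * w1 * of_nat (k * k) / 2) / w2 + (- u)
      = - (cpi * of_nat (Suc k) * y + cpi * \<i> * w1 * of_nat (Suc k * Suc k) / 2) / w2"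
    unfolding u_def using assms by (simp add: field_simps)
  show ?case unfolding cosh_shift_Suc u_def[symmetric] cu Suc e[symmetric] exp_add qpoch_Suc by (simp only: mult_ac)
qed simp

text \<open>With two products above and two below, the Gaussian factors cancel and only the k-th
  power of an exponential in s survives.\<close>

lemma cosh_shift_ratio:
  assumes "w2 \<noteq> 0" "y + y' - z - z' = s"
  shows "cosh_shift w1 w2 y k * cosh_shift w1 w2 y' k / (cosh_shift w1 w2 z k * cosh_shift w1 w2 z' k) =
    exp (- (cpi * s / w2)) ^ k *
    (qpoch (aw_arg w1 w2 y) (nome_at w1 w2 ^ 2) k * qpoch (aw_arg w1 w2 y') (nome_at w1 w2 ^ 2) k /
     (qpoch (aw_arg w1 w2 z) (nome_at w1 w2 ^ 2) k * qpoch (aw_arg w1 w2 z') (nome_at w1 w2 ^ 2) k))"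
proof -
  define E where "E y = - (cpi * of_nat k * y + cpi * \<i> * w1 * of_nat (k * k) / 2) / w2" for y
  define Q where "Q y = qpoch (aw_arg w1 w2 y) (nome_at w1 w2 ^ 2) k" for y
  have c: "cosh_shift w1 w2 y k = exp (E y) * Q y" for y unfolding E_def Q_def by (rule cosh_shift_qpoch[OF assms(1)])
  have "E y + E y' - E z - E z' = of_nat k * (- (cpi * s / w2))"
    unfolding E_def assms(2)[symmetric] using assms(1) by (simp add: field_simps)
  then have "exp (- (cpi * s / w2)) ^ k = exp (E y) * exp (E y') / (exp (E z) * exp (E z'))"
    by (simp only: exp_of_nat_mult[symmetric]) (metis diff_diff_eq exp_add exp_diff)
  then show ?thesis unfolding c Q_def[symmetric] by (simp add: mult_ac)
qed

text \<open>A sine is a cosh at a quarter period, so the residue coefficient is the same kind of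
  product as the other factors; it becomes the factorial (q;q) of the series.\<close>

lemma psi_coeff_cosh_shift:
  assumes "w2 \<noteq> 0"
  shows "psi_coeff m w1 w2 = 1 / cosh_shift w1 w2 (\<i> * w1 / 2 + \<i> * w2 / 2) m"
proof -
  have "- 2 * sin t = 2 * cosh (\<i> * t + \<i> * cpi / 2)" for t :: complex proof -
    have "\<i> * t + \<i> * cpi / 2 = (\<i> * t + \<i> * cpi) - \<i> * cpi / 2" by simp
    then have "2 * cosh (\<i> * t + \<i> * cpi / 2) = - 2 * \<i> * sinh (\<i> * t + \<i> * cpi)" by (simp only: cosh_diff_half_pi) simp
    moreover have "sinh (\<i> * t + \<i> * cpi) = - (\<i> * sin t)"
      by (simp add: sinh_field_def sin_exp_eq exp_add exp_minus exp_diff field_simps)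
    ultimately show ?thesis by simp
  qed
  note s = this
  have "(\<Prod>j<m. - 2 * sin (cpi * of_nat (Suc j) * w1 / w2)) = cosh_shift w1 w2 (\<i> * w1 / 2 + \<i> * w2 / 2) m"
    unfolding cosh_shift_def proof (rule prod.cong[OF refl])
    fix j
    have "\<i> * (cpi * of_nat (Suc j) * w1 / w2) + \<i> * cpi / 2
        = cpi * (\<i> * w1 / 2 + \<i> * w2 / 2 + \<i> * (of_nat j + 1 / 2) * w1) / w2" using assms by (simp add: field_simps)
    then show "- 2 * sin (cpi * of_nat (Suc j) * w1 / w2)
        = 2 * cosh (cpi * (\<i> * w1 / 2 + \<i> * w2 / 2 + \<i> * (of_nat j + 1 / 2) * w1) / w2)" unfolding s by (simp only:)
  qed
  then show ?thesis by (simp add: psi_coeff_def)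
qed

lemma cosh_shift_tail:
  assumes "m \<le> n" "cosh_shift w1 w2 y (n - m) \<noteq> 0"
  shows "cosh_shift w1 w2 (y + \<i> * of_nat (n - m) * w1) m = cosh_shift w1 w2 y n / cosh_shift w1 w2 y (n - m)"
  using cosh_shift_add[of w1 w2 y "n - m" m] assms by simp

text \<open>Every gamma value meets its reciprocal: those from the prefactor cancel those from the
  residue, and only cosh products remain.\<close>

lemma gamma_cancel:
  fixes g2 g3 g0 g1 gB gB1 gB2 gB3 :: complex
  assumes "g2 \<noteq> 0" "g3 \<noteq> 0" "g0 \<noteq> 0" "g1 \<noteq> 0" "gB \<noteq> 0" "gB1 \<noteq> 0" "gB2 \<noteq> 0" "gB3 \<noteq> 0"
  shows "1 / cbm * ((g3 * C3) * (g2 * C2) * inverse (gB1 * cB1) / (inverse (g0 * c0) * inverse (g1 * c1) * (gB * cBm))) * (cbn / cbk) *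
      (gB1 * gB2 * gB3 * (inverse g0 * inverse g1 / (g2 * g3)) * (gB * cBn / (gB2 * cB2 * (gB3 * cB3))))
    = cbn * cBn / (cB2 * cB3) * (c0 * c1 / (cbm * cB1) * (C2 * C3 / (cbk * cBm)))" (is "?L = ?R")
proof -
  have c: "g * inverse g = 1" if "g \<noteq> 0" for g :: complex using that by simp
  have "?L = (g2 * inverse g2) * (g3 * inverse g3) * (g0 * inverse g0) * (g1 * inverse g1) * (gB * inverse gB) *
      (gB1 * inverse gB1) * (gB2 * inverse gB2) * (gB3 * inverse gB3) * ?R"
    by (simp only: divide_inverse inverse_mult_distrib inverse_inverse_eq mult_1_left mult_ac)
  then show ?thesis unfolding c[OF assms(1)] c[OF assms(2)] c[OF assms(3)] c[OF assms(4)] c[OF assms(5)]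
    c[OF assms(6)] c[OF assms(7)] c[OF assms(8)] mult_1_left .
qed

text \<open>At the special \<lambda> the coefficient of the line integral is 0, and the prefactor
  cancels the gamma functions of the residues up to whole periods. Under \<open>aw_arg\<close> the
  points b, B, B1, B2, B3 become the squared nome, cd, ab, ac, ad, and y0, y1, y2, y3 become a/X,
  b/X, cX, dX.\<close>

lemma S_reduced_eq_sum:
  assumes p: "p \<in> domain (Suc n)"
    and l: "l_of p = \<i> * w1_of p / 2 + \<i> * w2_of p / 2 + \<i> * sig_of p - \<i> * ups_of p + \<i> * of_nat n * w1_of p"
  defines "c \<equiv> cosh_at p"
    and "b \<equiv> \<i> * w1_of p / 2 + \<i> * w2_of p / 2"
    and "B \<equiv> \<i> * w1_of p / 2 + \<i> * w2_of p / 2 - 2 * \<i> * ups_of p"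
    and "B1 \<equiv> 2 * \<i> * sig_of p + \<i> * w1_of p / 2 + \<i> * w2_of p / 2"
    and "B2 \<equiv> \<i> * sig_of p - \<i> * rho_of p - \<i> * tau_of p - \<i> * ups_of p + \<i> * w1_of p / 2 + \<i> * w2_of p / 2"
    and "B3 \<equiv> \<i> * sig_of p - \<i> * rho_of p + \<i> * tau_of p - \<i> * ups_of p + \<i> * w1_of p / 2 + \<i> * w2_of p / 2"
    and "y0 \<equiv> \<i> * sig_of p - \<i> * rho_of p - x_of p"
    and "y1 \<equiv> \<i> * sig_of p + \<i> * rho_of p - x_of p"
    and "y2 \<equiv> x_of p - \<i> * tau_of p - \<i> * ups_of p"
    and "y3 \<equiv> x_of p + \<i> * tau_of p - \<i> * ups_of p"
  shows "S_reduced (Suc n) p = c b n * c B n / (c B2 n * c B3 n) *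
    (\<Sum>m\<le>n. c y0 m * c y1 m / (c b m * c B1 m) * (c y2 (n - m) * c y3 (n - m) / (c b (n - m) * c B (n - m))))"
    and "c b n * c B n \<noteq> 0"
proof -
  note D = domainD[OF p]
  let ?w1 = "w1_of p" and ?w2 = "w2_of p"
  define g where "g = strip_at p"
  define k where k: "k = real (Suc n) * Re ?w1"
  have "Suc n \<ge> 1" by simp
  note h = domain_linear[OF p this k]
  have shift: "g (y + \<i> * of_nat m * ?w1) = g y * c y m" if "m \<le> n" and y: "- (Re ?w2 / 3) < Im y" "Im y < Re ?w2 / 3" for y m
  proof -
    have "real m * Re ?w1 \<le> real (Suc n) * Re ?w1" using that D(1) by (intro mult_right_mono) auto
    then have m: "real m * Re ?w1 \<le> k" by (simp add: k)
    have m0: "0 \<le> real m * Re ?w1" using D(1) by simp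
    have im: "Im (y + \<i> * of_nat m * ?w1) = Im y + real m * Re ?w1" by simp
    have "2 * \<bar>Im y\<bar> < Re ?w1 + Re ?w2" by (rule two_abs_less; use y h in linarith)
    moreover have "2 * \<bar>Im (y + \<i> * of_nat m * ?w1)\<bar> < Re ?w1 + Re ?w2"
      by (rule two_abs_less; unfold im; use y h m m0 in linarith)
    ultimately show ?thesis unfolding g_def c_def by (intro G_strip_shift D)
  qed
  have im: "Im B = Re ?w1 / 2 + Re ?w2 / 2 - 2 * Re (ups_of p)"
    "Im B1 = 2 * Re (sig_of p) + Re ?w1 / 2 + Re ?w2 / 2"
    "Im B2 = Re (sig_of p) - Re (rho_of p) - Re (tau_of p) - Re (ups_of p) + Re ?w1 / 2 + Re ?w2 / 2"
    "Im B3 = Re (sig_of p) - Re (rho_of p) + Re (tau_of p) - Re (ups_of p) + Re ?w1 / 2 + Re ?w2 / 2"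
    "Im y0 = Re (sig_of p) - Re (rho_of p) - Im (x_of p)" "Im y1 = Re (sig_of p) + Re (rho_of p) - Im (x_of p)"
    "Im y2 = Im (x_of p) - Re (tau_of p) - Re (ups_of p)" "Im y3 = Im (x_of p) + Re (tau_of p) - Re (ups_of p)"
    by (simp_all add: B_def B1_def B2_def B3_def y0_def y1_def y2_def y3_def)
  have sh: "g (B + \<i> * of_nat m * ?w1) = g B * c B m" "g (B1 + \<i> * of_nat m * ?w1) = g B1 * c B1 m"
    "g (B2 + \<i> * of_nat m * ?w1) = g B2 * c B2 m" "g (B3 + \<i> * of_nat m * ?w1) = g B3 * c B3 m"
    "g (y0 + \<i> * of_nat m * ?w1) = g y0 * c y0 m" "g (y1 + \<i> * of_nat m * ?w1) = g y1 * c y1 m"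
    "g (y2 + \<i> * of_nat m * ?w1) = g y2 * c y2 m" "g (y3 + \<i> * of_nat m * ?w1) = g y3 * c y3 m" if "m \<le> n" for m
    by (rule shift[OF that]; unfold im; use h in linarith)+
  have g0: "g y \<noteq> 0" for y by (simp add: g_def)
  have gm: "g (- y) = inverse (g y)" for y by (simp add: g_def G_strip_minus)
  have cB: "c B m \<noteq> 0" if "m \<le> n" for m using sh(1)[OF that] g0 by (metis mult_zero_right)
  have cb: "c b m \<noteq> 0" if "m \<le> n" for m proof -
    have "psi_coeff m (w1_of p) (w2_of p) \<noteq> 0"
      unfolding psi_coeff_def using domain_sin_nonzero[OF p] that by (simp del: of_nat_Suc)
    then show ?thesis unfolding psi_coeff_cosh_shift[OF D(3)] c_def b_def by auto
  qed
  show "c b n * c B n \<noteq> 0" using cb cB by simp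
  \<comment> \<open>The factor j = 0 is cosh (i \<pi> / 2). This is why N = n + 1 steps are taken:
    with only n of them this factor would be absent.\<close>
  have zero: "cosh_at p (mu_of p - \<i> * of_nat (Suc n) * ?w1) (Suc n) = 0" proof -
    have "cpi * (mu_of p - \<i> * of_nat (Suc n) * ?w1 + \<i> * (of_nat 0 + 1 / 2) * ?w1) / ?w2
        = \<i> * cpi / 2" unfolding l using D(3) by (simp add: field_simps)
    note e = this
    have "cosh (\<i> * cpi / 2) = (0::complex)" using cosh_diff_half_pi[of "\<i> * cpi"] by (simp add: sinh_field_def exp_minus)
    then have "2 * cosh (cpi * (mu_of p - \<i> * of_nat (Suc n) * ?w1 + \<i> * (of_nat 0 + 1 / 2) * ?w1) / ?w2) = 0"
      unfolding e by simp
    then show ?thesis unfolding cosh_shift_def by (intro prod_zero[OF finite_lessThan] bexI[of _ "0::nat"]) simp_all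
  qed
  define P where "P = g B1 * g B2 * g B3 * (g (- y0) * g (- y1) / (g y2 * g y3)) * (g (B + \<i> * of_nat n * ?w1) /
      (g (B2 + \<i> * of_nat n * ?w1) * g (B3 + \<i> * of_nat n * ?w1)))"
  have pre: "S_prefactor (strip_at p) p = P / csqrt (?w1 * ?w2)" proof -
    have "x_of p - \<i> * sig_of p + \<i> * rho_of p = - y0" "x_of p - \<i> * sig_of p - \<i> * rho_of p = - y1"
      "l_of p - \<i> * sig_of p - \<i> * ups_of p = B + \<i> * of_nat n * ?w1"
      "l_of p - \<i> * rho_of p - \<i> * tau_of p = B2 + \<i> * of_nat n * ?w1"
      "l_of p - \<i> * rho_of p + \<i> * tau_of p = B3 + \<i> * of_nat n * ?w1" by (simp_all add: l y0_def y1_def B_def B2_def B3_def)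
    note e = this
    show ?thesis
      unfolding S_prefactor_def e P_def g_def B1_def[symmetric] B2_def[symmetric] B3_def[symmetric] y2_def[symmetric] y3_def[symmetric] ..
  qed
  define t where "t m = psi_coeff m (w1_of p) (w2_of p) * regular_at p
          (pole_at m p) *
        cosh_at p (mu_of p - \<i> * of_nat m * ?w1) m" for m
  have summand: "t m * P =
     c b n * c B n / (c B2 n * c B3 n) *
      (c y0 m * c y1 m / (c b m * c B1 m) * (c y2 (n - m) * c y3 (n - m) / (c b (n - m) * c B (n - m))))" if m: "m \<le> n" for m
  proof -
    let ?z = "pole_at m p"
    have nm: "of_nat (n - m) = (of_nat n - of_nat m :: complex)" using m by (simp add: of_nat_diff)
    have e: "?z + x_of p + l_of p / 2 - \<i> * ?w1 / 4 - \<i> * ?w2 / 4 + \<i> * tau_of p = y3 + \<i> * of_nat (n - m) * ?w1"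
      "?z + x_of p + l_of p / 2 - \<i> * ?w1 / 4 - \<i> * ?w2 / 4 - \<i> * tau_of p = y2 + \<i> * of_nat (n - m) * ?w1"
      "?z - l_of p / 2 - \<i> * ?w1 / 4 - \<i> * ?w2 / 4 - \<i> * sig_of p = - (B1 + \<i> * of_nat m * ?w1)"
      "?z + x_of p - l_of p / 2 + \<i> * ?w1 / 4 + \<i> * ?w2 / 4 + \<i> * rho_of p = - (y0 + \<i> * of_nat m * ?w1)"
      "?z + x_of p - l_of p / 2 + \<i> * ?w1 / 4 + \<i> * ?w2 / 4 - \<i> * rho_of p = - (y1 + \<i> * of_nat m * ?w1)"
      "?z + l_of p / 2 + \<i> * ?w1 / 4 + \<i> * ?w2 / 4 - \<i> * ups_of p = B + \<i> * of_nat (n - m) * ?w1"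
      unfolding nm psi_pole_def l y3_def y2_def B1_def y0_def y1_def B_def by (simp_all add: field_simps)
    have reg: "regular_at p ?z =
        (g y3 * c y3 (n - m)) * (g y2 * c y2 (n - m)) * inverse (g B1 * c B1 m) /
        (inverse (g y0 * c y0 m) * inverse (g y1 * c y1 m) * (g B * c B (n - m)))"
      unfolding psi_regular_def e g_def[symmetric] gm using m by (simp only: sh diff_le_self)
    \<comment> \<open>In the m-th residue the product starts n - m periods above b, so it is the
      tail of the product of length n from b and misses the zero.\<close>
    have "mu_of p - \<i> * of_nat m * ?w1 = b + \<i> * of_nat (n - m) * ?w1" unfolding nm l b_def by (simp add: field_simps)
    then have tail: "cosh_at p (mu_of p - \<i> * of_nat m * ?w1) m = c b n / c b (n - m)"
      using cosh_shift_tail[OF m] cb[of "n - m"] by (simp add: c_def)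
    have coeff: "psi_coeff m (w1_of p) (w2_of p) = 1 / c b m" unfolding c_def b_def by (rule psi_coeff_cosh_shift[OF D(3)])
    have Psh: "P = g B1 * g B2 * g B3 * (inverse (g y0) * inverse (g y1) / (g y2 * g y3)) * (g B * c B n / (g B2 * c B2 n * (g B3 * c B3 n)))"
      unfolding P_def gm by (simp only: sh order_refl)
    show ?thesis unfolding t_def reg tail coeff Psh by (rule gamma_cancel) (rule g0)+
  qed
  have "S_reduced (Suc n) p = S_prefactor (strip_at p) p * S_residues (Suc n) p" unfolding S_reduced_def zero by simp
  also have "S_residues (Suc n) p = csqrt (?w1 * ?w2) * (\<Sum>m\<le>n. t m)"
    unfolding S_residues_def G_strip_half_diff[OF D(1,2)] lessThan_Suc_atMost t_def ..
  also have "S_prefactor (strip_at p) p * \<dots> = (\<Sum>m\<le>n. t m * P)" proof -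
    have "csqrt (?w1 * ?w2) \<noteq> 0" using mult_notin_nonpos_Reals[OF D(1,2)] by auto
    then have "P / csqrt (?w1 * ?w2) * (csqrt (?w1 * ?w2) * s) = s * P" for s by simp
    then show ?thesis unfolding pre sum_distrib_right[symmetric] .
  qed
  also have "\<dots> = c b n * c B n / (c B2 n * c B3 n) *
    (\<Sum>m\<le>n. c y0 m * c y1 m / (c b m * c B1 m) * (c y2 (n - m) * c y3 (n - m) / (c b (n - m) * c B (n - m))))"
    unfolding sum_distrib_left by (intro sum.cong refl summand) simp
  finally show "S_reduced (Suc n) p = c b n * c B n / (c B2 n * c B3 n) *
    (\<Sum>m\<le>n. c y0 m * c y1 m / (c b m * c B1 m) * (c y2 (n - m) * c y3 (n - m) / (c b (n - m) * c B (n - m))))" .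
qed

section \<open>The Askey-Wilson side and the hyperplane of special \<lambda>\<close>

type_synonym aw_point = "complex \<times> complex \<times> quadruple \<times> complex"

definition nome :: "aw_point \<Rightarrow> complex" where
  "nome q = exp (cpi * \<i> * fst q / fst (snd q))"

definition aw_a :: "aw_point \<Rightarrow> complex" where
  "aw_a q = - exp (2 * cpi * \<i> * fst (fst (snd (snd q))) / fst (snd q)) * nome q"

definition aw_b :: "aw_point \<Rightarrow> complex" where
  "aw_b q = - exp (2 * cpi * \<i> * fst (snd (fst (snd (snd q)))) / fst (snd q)) * nome q"

definition aw_c :: "aw_point \<Rightarrow> complex" where
  "aw_c q = - exp (2 * cpi * \<i> * fst (snd (snd (fst (snd (snd q))))) / fst (snd q)) * nome q"

definition aw_d :: "aw_point \<Rightarrow> complex" where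
  "aw_d q = - exp (2 * cpi * \<i> * snd (snd (snd (fst (snd (snd q))))) / fst (snd q)) * nome q"

definition aw_X :: "aw_point \<Rightarrow> complex" where
  "aw_X q = exp (2 * cpi * snd (snd (snd q)) / fst (snd q))"

lemma cdiff_aw [cdiff_intros]:
  assumes "fst (snd q) \<noteq> 0"
  shows "cdiff nome q" "cdiff aw_a q" "cdiff aw_b q" "cdiff aw_c q" "cdiff aw_d q" "cdiff aw_X q"
proof -
  show n: "cdiff nome q" unfolding nome_def[abs_def] using assms by (intro cdiff_intros)
  show "cdiff aw_a q" "cdiff aw_b q" "cdiff aw_c q" "cdiff aw_d q" "cdiff aw_X q"
    unfolding aw_a_def[abs_def] aw_b_def[abs_def] aw_c_def[abs_def] aw_d_def[abs_def] aw_X_def[abs_def]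
    by (intro cdiff_intros n assms)+
qed

lemma cdiff_qpoch [cdiff_intros]:
  assumes "cdiff f p" "cdiff g p"
  shows "cdiff (\<lambda>x. qpoch (f x) (g x) k) p" unfolding qpoch_def by (intro cdiff_intros assms)

definition hyperplane :: "nat \<Rightarrow> aw_point \<Rightarrow> point" where
  "hyperplane n q = (fst q, fst (snd q), fst (snd (snd q)), snd (snd (snd q)),
     \<i> * ((fst q + fst (snd q)) / 2) + \<i> * fst (dual (fst (snd (snd q)))) + \<i> * of_nat n * fst q)"

definition aw_value :: "nat \<Rightarrow> aw_point \<Rightarrow> complex" where
  "aw_value n q = askey_wilson (fst (snd q)) n (snd (snd (snd q))) (aw_a q) (aw_b q) (aw_c q) (aw_d q) ((nome q)\<^sup>2)"

lemma fst_dual: "fst (dual g) = (fst g + fst (snd g) + fst (snd (snd g)) + snd (snd (snd g))) / 2"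
  by (cases g) (simp add: dual_def)

text \<open>The special \<lambda> is a linear function of the periods and \<gamma>, so the set is
  the graph of a linear map and the \<lambda>-axis is a transversal direction.\<close>

lemma graph_hyperplane_hyperplane:
  "graph_hyperplane (hyperplane n) (\<lambda>z. (fst z, fst (snd z), fst (snd (snd z)), fst (snd (snd (snd z)))))
     (\<lambda>z. snd (snd (snd (snd z))) - (\<i> * ((fst z + fst (snd z)) / 2) + \<i> * fst (dual (fst (snd (snd z)))) + \<i> * of_nat n * fst z))
     (0, 0, (0, 0, 0, 0), 0, 1)"
proof (rule graph_hyperplane.intro)
  show "cdiff (hyperplane n) u" for u unfolding hyperplane_def[abs_def] fst_dual by (intro cdiff_intros) simp_all
  show "linear (hyperplane n)" by (rule linearI)
      (simp_all add: prod_eq_iff hyperplane_def fst_dual algebra_simps add_divide_distrib scaleR_conv_of_real)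
  show "isCont (\<lambda>z. (fst z, fst (snd z), fst (snd (snd z)), fst (snd (snd (snd z))))) z" for z :: point
    by (intro cdiff_isCont cdiff_intros)
  show "cdiff (\<lambda>z. snd (snd (snd (snd z))) - (\<i> * ((fst z + fst (snd z)) / 2) + \<i> * fst (dual (fst (snd (snd z)))) + \<i> * of_nat n * fst z)) z" for z :: point
    unfolding fst_dual by (intro cdiff_intros) simp_all
qed (simp_all add: prod_eq_iff hyperplane_def fst_dual scaleC_prod_def scaleC_complex_def)

lemma hyperplane_coords:
  "w1_of (hyperplane n q) = fst q" "w2_of (hyperplane n q) = fst (snd q)"
  "x_of (hyperplane n q) = snd (snd (snd q))"
  "l_of (hyperplane n q) = \<i> * w1_of (hyperplane n q) / 2 + \<i> * w2_of (hyperplane n q) / 2 +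
     \<i> * sig_of (hyperplane n q) - \<i> * ups_of (hyperplane n q) + \<i> * of_nat n * w1_of (hyperplane n q)"
  by (simp_all add: hyperplane_def coord_defs fst_dual field_simps)

text \<open>The nonvanishing conditions of Sears' transformation that the domain does not guarantee;
  those on (q;q) and on cd follow from the second part of \<open>S_reduced_eq_sum\<close>. The last
  factor belongs to the transformation only and is no denominator of the Askey-Wilson
  series.\<close>

definition aw_generic :: "nat \<Rightarrow> aw_point \<Rightarrow> complex" where
  "aw_generic n q = qpoch (aw_a q * aw_b q) ((nome q)\<^sup>2) n * qpoch (aw_a q * aw_c q) ((nome q)\<^sup>2) n *
     qpoch (aw_a q * aw_d q) ((nome q)\<^sup>2) n * qpoch (aw_a q * aw_c q * aw_d q * aw_X q) ((nome q)\<^sup>2) n"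

lemma S_reduced_eq_aw_value:
  assumes q: "hyperplane n q \<in> domain (Suc n)" and nz: "aw_generic n q \<noteq> 0"
  shows "S_reduced (Suc n) (hyperplane n q) = aw_value n q"
    and "qpoch ((nome q)\<^sup>2) ((nome q)\<^sup>2) n \<noteq> 0"
proof -
  define p where "p = hyperplane n q"
  obtain w1 w2 \<gamma>0 \<gamma>1 \<gamma>2 \<gamma>3 x where fields: "q = (w1, w2, (\<gamma>0, \<gamma>1, \<gamma>2, \<gamma>3), x)" by (metis surj_pair)
  have w0: "w2 \<noteq> 0" using domainD(3)[OF q] by (simp add: hyperplane_coords fields)
  define Q where "Q = nome q"
  define X where "X = aw_X q"
  define A where "A g = - exp (2 * cpi * \<i> * g / w2) * Q" for g
  have Q0: "Q \<noteq> 0" "X \<noteq> 0" "A g \<noteq> 0" for g by (simp_all add: Q_def nome_def X_def aw_X_def A_def)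
  have aw: "aw_a q = A \<gamma>0" "aw_b q = A \<gamma>1" "aw_c q = A \<gamma>2" "aw_d q = A \<gamma>3"
    by (simp_all add: aw_a_def aw_b_def aw_c_def aw_d_def A_def Q_def fields)
  define b where "b = \<i> * w1 / 2 + \<i> * w2 / 2"
  have Q': "Q = exp (cpi * \<i> * w1 / w2)" by (simp add: Q_def nome_def fields)
  have X': "X = exp (2 * cpi * x / w2)" by (simp add: X_def aw_X_def fields)
  have arg1: "aw_arg w1 w2 (b + \<i> * g + \<i> * h) = A g * A h" for g h proof -
    have "2 * cpi * (b + \<i> * g + \<i> * h) / w2 = cpi * \<i> * w1 / w2 + \<i> * cpi + 2 * cpi * \<i> * g / w2 + 2 * cpi * \<i> * h / w2"
      unfolding b_def using w0 by (simp add: field_simps)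
    then show ?thesis unfolding aw_arg_def A_def Q'[symmetric] by (simp add: exp_add Q')
  qed
  have arg0: "aw_arg w1 w2 b = Q\<^sup>2" proof -
    have "2 * cpi * b / w2 = cpi * \<i> * w1 / w2 + \<i> * cpi" unfolding b_def using w0 by (simp add: field_simps)
    then show ?thesis unfolding aw_arg_def by (simp add: exp_add Q' power2_eq_square)
  qed
  have arg2: "aw_arg w1 w2 (\<i> * g - x) = A g / X" for g proof -
    have "2 * cpi * (\<i> * g - x) / w2 = 2 * cpi * \<i> * g / w2 - 2 * cpi * x / w2" by (simp add: diff_divide_distrib algebra_simps)
    then show ?thesis unfolding aw_arg_def A_def X' by (simp add: exp_diff Q')
  qed
  have arg3: "aw_arg w1 w2 (x + \<i> * g) = A g * X" for g proof -
    have "2 * cpi * (x + \<i> * g) / w2 = 2 * cpi * \<i> * g / w2 + 2 * cpi * x / w2" by (simp add: add_divide_distrib algebra_simps)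
    then show ?thesis unfolding aw_arg_def A_def X' by (simp add: exp_add Q')
  qed
  have co: "w1_of p = w1" "w2_of p = w2"
    "\<i> * w1 / 2 + \<i> * w2 / 2 = b"
    "b - 2 * \<i> * ups_of p = b + \<i> * \<gamma>2 + \<i> * \<gamma>3"
    "2 * \<i> * sig_of p + \<i> * w1 / 2 + \<i> * w2 / 2 = b + \<i> * \<gamma>0 + \<i> * \<gamma>1"
    "\<i> * sig_of p - \<i> * rho_of p - \<i> * tau_of p - \<i> * ups_of p + \<i> * w1 / 2 + \<i> * w2 / 2 = b + \<i> * \<gamma>0 + \<i> * \<gamma>2"
    "\<i> * sig_of p - \<i> * rho_of p + \<i> * tau_of p - \<i> * ups_of p + \<i> * w1 / 2 + \<i> * w2 / 2 = b + \<i> * \<gamma>0 + \<i> * \<gamma>3"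
    "\<i> * sig_of p - \<i> * rho_of p - x_of p = \<i> * \<gamma>0 - x" "\<i> * sig_of p + \<i> * rho_of p - x_of p = \<i> * \<gamma>1 - x"
    "x_of p - \<i> * tau_of p - \<i> * ups_of p = x + \<i> * \<gamma>2" "x_of p + \<i> * tau_of p - \<i> * ups_of p = x + \<i> * \<gamma>3"
    by (simp_all add: p_def hyperplane_def coord_defs fields b_def field_simps)
  note S = S_reduced_eq_sum[OF q hyperplane_coords(4), folded p_def, unfolded co]
  define c where "c = cosh_shift w1 w2"
  have "c b n \<noteq> 0" "c (b + \<i> * \<gamma>2 + \<i> * \<gamma>3) n \<noteq> 0" using S(2) by (auto simp: c_def)
  then have nz': "qpoch (Q\<^sup>2) (Q\<^sup>2) n \<noteq> 0" "qpoch (A \<gamma>2 * A \<gamma>3) (Q\<^sup>2) n \<noteq> 0"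
    unfolding c_def cosh_shift_qpoch[OF w0] arg0 arg1 Q'[symmetric] by auto
  then show "qpoch ((nome q)\<^sup>2) ((nome q)\<^sup>2) n \<noteq> 0" by (simp add: Q_def)
  have ratio: "c y k * c y' k / (c z k * c z' k) = exp (- (cpi * s / w2)) ^ k *
      (qpoch (aw_arg w1 w2 y) (Q\<^sup>2) k * qpoch (aw_arg w1 w2 y') (Q\<^sup>2) k / (qpoch (aw_arg w1 w2 z) (Q\<^sup>2) k * qpoch (aw_arg w1 w2 z') (Q\<^sup>2) k))"
    if "y + y' - z - z' = s" for y y' z z' s k unfolding c_def Q' by (rule cosh_shift_ratio[OF w0 that])
  define K where "K = qpoch (Q\<^sup>2) (Q\<^sup>2) n * qpoch (A \<gamma>2 * A \<gamma>3) (Q\<^sup>2) n /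
       (qpoch (A \<gamma>0 * A \<gamma>2) (Q\<^sup>2) n * qpoch (A \<gamma>0 * A \<gamma>3) (Q\<^sup>2) n)"
  define t1 where "t1 k = qpoch (A \<gamma>0 / X) (Q\<^sup>2) k * qpoch (A \<gamma>1 / X) (Q\<^sup>2) k / (qpoch (Q\<^sup>2) (Q\<^sup>2) k * qpoch (A \<gamma>0 * A \<gamma>1) (Q\<^sup>2) k)" for k
  define t2 where "t2 k = qpoch (A \<gamma>2 * X) (Q\<^sup>2) k * qpoch (A \<gamma>3 * X) (Q\<^sup>2) k / (qpoch (Q\<^sup>2) (Q\<^sup>2) k * qpoch (A \<gamma>2 * A \<gamma>3) (Q\<^sup>2) k)" for k
  have r0: "c b n * c (b + \<i> * \<gamma>2 + \<i> * \<gamma>3) n / (c (b + \<i> * \<gamma>0 + \<i> * \<gamma>2) n * c (b + \<i> * \<gamma>0 + \<i> * \<gamma>3) n) =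
     (- A \<gamma>0 / Q) ^ n * K" proof -
    have "- (cpi * (- 2 * \<i> * \<gamma>0) / w2) = 2 * cpi * \<i> * \<gamma>0 / w2" by simp
    then have "exp (- (cpi * (- 2 * \<i> * \<gamma>0) / w2)) = exp (2 * cpi * \<i> * \<gamma>0 / w2)" by (rule arg_cong)
    also have "\<dots> = - A \<gamma>0 / Q" using Q0 by (simp add: A_def)
    finally have e: "exp (- (cpi * (- 2 * \<i> * \<gamma>0) / w2)) = - A \<gamma>0 / Q" .
    show ?thesis unfolding K_def e[symmetric] arg0[symmetric] arg1[symmetric] unfolding arg0
      by (subst ratio[where s = "- 2 * \<i> * \<gamma>0"]) (simp_all add: arg0)
  qed
  have r1: "c (\<i> * \<gamma>0 - x) k * c (\<i> * \<gamma>1 - x) k / (c b k * c (b + \<i> * \<gamma>0 + \<i> * \<gamma>1) k) =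
     (- Q * X) ^ k * t1 k" for k proof -
    have "- (cpi * (- 2 * x - 2 * b) / w2) = 2 * cpi * x / w2 + (cpi * \<i> * w1 / w2 + \<i> * cpi)"
      unfolding b_def using w0 by (simp add: field_simps)
    then have e: "exp (- (cpi * (- 2 * x - 2 * b) / w2)) = - Q * X" by (simp add: exp_add Q' X')
    show ?thesis
      unfolding t1_def by (subst ratio[where s = "- 2 * x - 2 * b"]) (simp_all only: e arg0 arg1 arg2, simp add: algebra_simps)
  qed
  have r2: "c (x + \<i> * \<gamma>2) k * c (x + \<i> * \<gamma>3) k / (c b k * c (b + \<i> * \<gamma>2 + \<i> * \<gamma>3) k) =
     (- Q / X) ^ k * t2 k" for k proof -
    have "- (cpi * (2 * x - 2 * b) / w2) = (cpi * \<i> * w1 / w2 + \<i> * cpi) - 2 * cpi * x / w2"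
      unfolding b_def using w0 by (simp add: field_simps)
    then have e: "exp (- (cpi * (2 * x - 2 * b) / w2)) = - Q / X" by (simp add: exp_add exp_diff Q' X')
    show ?thesis
      unfolding t2_def by (subst ratio[where s = "2 * x - 2 * b"]) (simp_all only: e arg0 arg1 arg3, simp add: algebra_simps)
  qed
  \<comment> \<open>The three exponential factors left by \<open>cosh_shift_ratio\<close> combine:
    the powers of the nome cancel, the signs square away, and what remains is the weight of the
    convolution in Sears' formula.\<close>
  have pw: "(- A \<gamma>0 / Q) ^ n * ((- Q * X) ^ m * (- Q / X) ^ (n - m)) = A \<gamma>0 ^ n * (X ^ m * X ^ m / X ^ n)" if m: "m \<le> n" for m
  proof -
    obtain k where k: "n = m + k" using m le_Suc_ex by blast
    have m1: "(- 1) ^ n * (- 1) ^ n = (1::complex)" by (simp flip: power_mult_distrib)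
    have "- A \<gamma>0 / Q = (- 1) * (A \<gamma>0 / Q)" "- Q * X = (- 1) * (Q * X)" "- Q / X = (- 1) * (Q / X)" by simp_all
    then have "(- A \<gamma>0 / Q) ^ n * ((- Q * X) ^ m * (- Q / X) ^ (n - m))
        = ((- 1) ^ n * (- 1) ^ (m + (n - m))) * ((A \<gamma>0 / Q) ^ n * ((Q * X) ^ m * (Q / X) ^ (n - m)))"
      by (simp only: power_mult_distrib power_add mult_ac)
    also have "\<dots> = (A \<gamma>0 / Q) ^ n * ((Q * X) ^ m * (Q / X) ^ (n - m))" using m m1 by simp
    also have "\<dots> = A \<gamma>0 ^ n * (X ^ m * X ^ m / X ^ n)"
      unfolding k using Q0 by (simp add: power_divide power_mult_distrib power_add field_simps)
    finally show ?thesis .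
  qed
  have "S_reduced (Suc n) p = A \<gamma>0 ^ n * K * (\<Sum>m\<le>n. t1 m * t2 (n - m) * (X ^ m * X ^ m / X ^ n))" proof -
    have "S_reduced (Suc n) p = (- A \<gamma>0 / Q) ^ n * K * (\<Sum>m\<le>n. ((- Q * X) ^ m * t1 m) * ((- Q / X) ^ (n - m) * t2 (n - m)))"
      unfolding S(1) c_def[symmetric] r0 r1 r2 ..
    also have "\<dots> = (\<Sum>m\<le>n. K * t1 m * t2 (n - m) * ((- A \<gamma>0 / Q) ^ n * ((- Q * X) ^ m * (- Q / X) ^ (n - m))))"
      unfolding sum_distrib_left by (intro sum.cong refl) (simp only: mult_ac)
    also have "\<dots> = (\<Sum>m\<le>n. K * t1 m * t2 (n - m) * (A \<gamma>0 ^ n * (X ^ m * X ^ m / X ^ n)))"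
      by (intro sum.cong refl arg_cong2[where f = "(*)"] pw) simp
    also have "\<dots> = A \<gamma>0 ^ n * K * (\<Sum>m\<le>n. t1 m * t2 (n - m) * (X ^ m * X ^ m / X ^ n))"
      unfolding sum_distrib_left by (intro sum.cong refl) (simp only: mult_ac)
    finally show ?thesis .
  qed
  also have "\<dots> = (\<Sum>j\<le>n. aw_summand (A \<gamma>0) (A \<gamma>1) (A \<gamma>2) (A \<gamma>3) X (Q\<^sup>2) n j)" unfolding K_def t1_def t2_def
    using nz[unfolded aw_generic_def aw, folded Q_def X_def] nz' Q0 by (intro sears_askey_wilson) simp_all
  also have "\<dots> = aw_value n q" proof -
    have Q2: "Q\<^sup>2 \<noteq> 0" using Q0 by simp
    have "exp (2 * cpi * snd (snd (snd q)) / fst (snd q)) = X" by (simp add: X_def aw_X_def)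
    then show ?thesis unfolding aw_value_def aw Q_def[symmetric] askey_wilson_sum[OF Q2] by simp
  qed
  finally show "S_reduced (Suc n) (hyperplane n q) = aw_value n q" by (simp add: p_def)
qed

definition aw_half_planes :: "aw_point set" where
  "aw_half_planes = {q. Re (fst q) > 0 \<and> Re (fst (snd q)) > 0}"

lemma open_aw_half_planes: "open aw_half_planes"
  unfolding aw_half_planes_def by (intro open_Collects continuous_intros)

lemma convex_aw_half_planes: "convex aw_half_planes"
  unfolding aw_half_planes_def by (intro convex_Collect_conj convex_linear_less linearI) (simp_all add: algebra_simps)

text \<open>A common denominator of all terms of the series, independent of x.\<close>

definition aw_denominator :: "nat \<Rightarrow> aw_point \<Rightarrow> complex" where
  "aw_denominator n q = qpoch (aw_a q * aw_b q) ((nome q)\<^sup>2) n * qpoch (aw_a q * aw_c q) ((nome q)\<^sup>2) n *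
     qpoch (aw_a q * aw_d q) ((nome q)\<^sup>2) n * qpoch ((nome q)\<^sup>2) ((nome q)\<^sup>2) n"

lemma cdiff_aw_denominator: "fst (snd q) \<noteq> 0 \<Longrightarrow> cdiff (aw_denominator n) q"
  unfolding aw_denominator_def[abs_def] by (intro cdiff_intros)

text \<open>One point where everything is defined. The real part of g is -w2/8 for w2 = 200 (n + 1),
  so \<sigma> = g and \<upsilon> = -g lie at the centre of the region and \<rho> = \<tau> = 0. The
  imaginary part of g equals w2, which gives a, b, c, d the modulus exp (-2 \<pi>).\<close>

definition base_point :: "nat \<Rightarrow> aw_point" where
  "base_point n = (let g = of_real (- 25 * real (Suc n)) + \<i> * of_real (200 * real (Suc n))
     in (1, of_real (200 * real (Suc n)), (g, g, g, g), 0))"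

lemma hyperplane_base_point: "hyperplane n (base_point n) \<in> domain (Suc n)"
  by (simp add: hyperplane_def base_point_def Let_def domain_def region_def coord_defs fst_dual field_simps)

lemma qpoch_nonzero_small:
  assumes "cmod z < 1" "cmod q \<le> 1"
  shows "qpoch z q n \<noteq> 0"
proof -
  have "1 - z * q ^ k \<noteq> 0" for k proof
    assume "1 - z * q ^ k = 0"
    then have "cmod z * cmod q ^ k = 1" by (metis eq_iff_diff_eq_0 norm_mult norm_one norm_power)
    moreover have "cmod z * cmod q ^ k \<le> cmod z * 1" using assms by (intro mult_left_mono power_le_one) auto
    ultimately show False using assms by simp
  qed
  then show ?thesis by (simp add: qpoch_def)
qed

lemma base_point_norms:
  "cmod (nome (base_point n)) = 1" "cmod (aw_a (base_point n)) < 1" "cmod (aw_b (base_point n)) < 1"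
  "cmod (aw_c (base_point n)) < 1" "cmod (aw_d (base_point n)) < 1" "cmod (aw_X (base_point n)) = 1"
proof -
  define s where "s = real (Suc n)"
  have s: "s > 0" by (simp add: s_def)
  define g where "g = of_real (- 25 * s) + \<i> * of_real (200 * s)"
  have b: "base_point n = (1, of_real (200 * s), (g, g, g, g), 0)" by (simp add: base_point_def Let_def s_def g_def)
  have "cpi * \<i> * 1 / of_real (200 * s) = \<i> * of_real (pi / (200 * s))" by simp
  then have n: "nome (base_point n) = exp (\<i> * of_real (pi / (200 * s)))" by (simp add: b nome_def mult.commute)
  show n1: "cmod (nome (base_point n)) = 1" unfolding n by (rule norm_exp_i_times)
  have "2 * cpi * \<i> * g / of_real (200 * s) = of_real (- 2 * pi) + \<i> * of_real (- pi / 4)"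
    using s by (simp add: g_def field_simps)
  then have e: "cmod (exp (2 * cpi * \<i> * g / of_real (200 * s))) = exp (- 2 * pi)" by (simp only: norm_exp_eq_Re) simp
  have "exp (- 2 * pi) < exp (0::real)" by (subst exp_less_cancel_iff) simp
  then have e1: "cmod (exp (2 * cpi * \<i> * g / of_real (200 * s))) < 1" unfolding e by simp
  show "cmod (aw_a (base_point n)) < 1" "cmod (aw_b (base_point n)) < 1" "cmod (aw_c (base_point n)) < 1"
    "cmod (aw_d (base_point n)) < 1" unfolding aw_a_def aw_b_def aw_c_def aw_d_def norm_mult norm_minus_cancel n1 mult_1_right
    using e1 by (simp_all only: b fst_conv snd_conv)
  show "cmod (aw_X (base_point n)) = 1" by (simp add: aw_X_def b)
qed

lemma base_point_generic: "aw_generic n (base_point n) \<noteq> 0"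
proof -
  note N = base_point_norms[of n]
  have m: "cmod (u * v) < 1" if "cmod u < 1" "cmod v \<le> 1" for u v
    using mult_left_mono[OF that(2), of "cmod u"] that(1) by (simp add: norm_mult)
  have q: "cmod ((nome (base_point n))\<^sup>2) \<le> 1" by (simp add: norm_power N)
  show ?thesis unfolding aw_generic_def mult_eq_0_iff de_Morgan_disj
    by (intro conjI qpoch_nonzero_small q m; simp add: N less_imp_le)
qed

text \<open>For real periods the nome has modulus 1, so the size argument does not reach the factor
  (q;q). Its nonvanishing comes instead from the cosh products, by the second part of
  \<open>S_reduced_eq_aw_value\<close>.\<close>

lemma base_point_denominator: "aw_denominator n (base_point n) \<noteq> 0"
  using base_point_generic[of n] S_reduced_eq_aw_value(2)[OF hyperplane_base_point base_point_generic]
  by (simp add: aw_denominator_def aw_generic_def)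

text \<open>Over the common denominator the terminating series is a quotient of holomorphic
  functions, and one nonzero value of the denominator on the convex set of parameters makes it
  nontrivial.\<close>

lemma mero_aw_value: "mero (aw_value n) aw_half_planes"
proof -
  define p where "p q = (nome q)\<^sup>2" for q
  \<comment> \<open>The j-th term multiplied by the common denominator: each short factorial below
    is completed by its tail of length n - j.\<close>
  define R where "R q j = qpoch (1 / p q ^ n) (p q) j * qpoch (aw_a q * aw_b q * aw_c q * aw_d q * p q ^ n / p q) (p q) j *
       qpoch (aw_a q * aw_X q) (p q) j * qpoch (aw_a q / aw_X q) (p q) j * p q ^ j *
       (qpoch (aw_a q * aw_b q * p q ^ j) (p q) (n - j) * qpoch (aw_a q * aw_c q * p q ^ j) (p q) (n - j) *
        qpoch (aw_a q * aw_d q * p q ^ j) (p q) (n - j) * qpoch (p q * p q ^ j) (p q) (n - j))" for q j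
  define P where "P q = (\<Sum>j\<le>n. R q j)" for q
  have p0: "p q \<noteq> 0" "aw_X q \<noteq> 0" for q by (simp_all add: p_def nome_def aw_X_def)
  have eq: "aw_value n q = P q / aw_denominator n q" if D: "aw_denominator n q \<noteq> 0" for q proof -
    have s: "qpoch z (p q) n = qpoch z (p q) j * qpoch (z * p q ^ j) (p q) (n - j)" if "j \<le> n" for z j
      using qpoch_add[of z "p q" j "n - j"] that by simp
    have "aw_value n q = (\<Sum>j\<le>n. aw_summand (aw_a q) (aw_b q) (aw_c q) (aw_d q) (aw_X q) (p q) n j)"
      unfolding aw_value_def p_def[symmetric] askey_wilson_sum[OF p0(1)] aw_X_def ..
    also have "\<dots> = P q / aw_denominator n q" unfolding P_def sum_divide_distrib proof (rule sum.cong[OF refl])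
      fix j assume "j \<in> {..n}"
      then have j: "j \<le> n" by simp
      have cancel: "N / (d1 * d2 * d3 * d4) * y = N * y * (e1 * e2 * e3 * e4) / ((d1 * e1) * (d2 * e2) * (d3 * e3) * (d4 * e4))"
        if "(d1 * e1) * (d2 * e2) * (d3 * e3) * (d4 * e4) \<noteq> 0" for N y d1 d2 d3 d4 e1 e2 e3 e4 :: complex
        using that by (simp add: field_simps)
      have D': "aw_denominator n q = (qpoch (aw_a q * aw_b q) (p q) j * qpoch (aw_a q * aw_b q * p q ^ j) (p q) (n - j)) *
          (qpoch (aw_a q * aw_c q) (p q) j * qpoch (aw_a q * aw_c q * p q ^ j) (p q) (n - j)) *
          (qpoch (aw_a q * aw_d q) (p q) j * qpoch (aw_a q * aw_d q * p q ^ j) (p q) (n - j)) *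
          (qpoch (p q) (p q) j * qpoch (p q * p q ^ j) (p q) (n - j))"
        unfolding aw_denominator_def p_def[symmetric] s[OF j, symmetric] ..
      show "aw_summand (aw_a q) (aw_b q) (aw_c q) (aw_d q) (aw_X q) (p q) n j = R q j / aw_denominator n q"
        unfolding aw_summand_def R_def using D unfolding D' by (rule cancel)
    qed
    finally show ?thesis .
  qed
  have w2: "fst (snd q) \<noteq> 0" if "q \<in> aw_half_planes" for q using that by (auto simp: aw_half_planes_def)
  have "holo P aw_half_planes" proof (rule holoI[OF open_aw_half_planes])
    fix q assume q: "q \<in> aw_half_planes"
    have c: "cdiff p q" unfolding p_def[abs_def] by (intro cdiff_intros w2 q)
    show "cdiff P q" unfolding P_def[abs_def] R_def by (intro cdiff_intros c w2 q) (simp_all add: p0)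
  qed
  moreover have "holo_nz (aw_denominator n) aw_half_planes" proof (rule holo_nz_convex[where z = "base_point n"])
    show "holo (aw_denominator n) aw_half_planes" by (rule holoI[OF open_aw_half_planes]) (intro cdiff_aw_denominator w2)
    show "base_point n \<in> aw_half_planes" by (simp add: base_point_def Let_def aw_half_planes_def)
  qed (rule convex_aw_half_planes, rule base_point_denominator)
  ultimately have "mero_rep (aw_value n) P (aw_denominator n) (aw_denominator n) aw_half_planes"
    using eq unfolding mero_rep_def by simp
  then show ?thesis by (intro mero_if_rep) blast
qed

section \<open>Continuation to all parameters\<close>

lemma hyperplane_half_planes: "q \<in> aw_half_planes \<Longrightarrow> hyperplane n q \<in> half_planes"
  by (simp add: aw_half_planes_def half_planes_def hyperplane_coords)

lemma domain_half_planes: "domain N \<subseteq> half_planes"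
  using domainD(1,2) by (auto simp: half_planes_def)

lemma mero_mono: "mero f A \<Longrightarrow> B \<subseteq> A \<Longrightarrow> mero f B"
  unfolding mero_def by blast

text \<open>S and the holomorphic expression agree at real periods in the start domain, a uniqueness
  set. The representation has denominator 1, so it can be restricted to the hyperplane at
  once.\<close>

lemma mero_quotient_S_fun:
  assumes "psi_extension \<Psi>"
  shows "mero_quotient (S_fun \<Psi>) (S_reduced (Suc n)) (\<lambda>_. 1) (domain (Suc n))"
proof (rule mero_eq_holo)
  show "mero (S_fun \<Psi>) (domain (Suc n))" by (rule mero_mono[OF mero_S_fun[OF assms] domain_half_planes])
  show "convex (domain (Suc n))" by (rule convex_domain)
  show "holo (S_reduced (Suc n)) (domain (Suc n))" by (rule holo_S_reduced) simp
  show "open (start_domain (Suc n))" by (rule open_start_domain)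
  show "start_domain (Suc n) \<subseteq> domain (Suc n)" by (auto simp: start_domain_def)
  \<comment> \<open>A point of the start domain with real periods 1 and w2 = 200 (n + 1). Here l -
    \<sigma> + \<upsilon> is w2/2 + 1/4, which is above the lower bound w2/2 - 1/2 of the region and
    below the limit w2/2 + 1/2 for the original contour.\<close>
  let ?g = "complex_of_real (- 25 * real (Suc n))"
  show "(of_real 1, of_real (200 * real (Suc n)), (?g, ?g, ?g, ?g), 0, \<i> * of_real (50 * real (Suc n) + 1 / 4)) \<in> start_domain (Suc n)"
    by (simp add: start_domain_def domain_def region_def coord_defs field_simps)
  show "S_fun \<Psi> (of_real x, of_real y, z) = S_reduced (Suc n) (of_real x, of_real y, z)"
    if "(of_real x, of_real y, z) \<in> start_domain (Suc n)" for x y z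
    by (rule S_fun_eq_S_reduced[OF assms that, of x y]) (simp_all add: coord_defs)
qed

text \<open>Near the base point both sides are given by explicit holomorphic expressions that
  coincide; both are meromorphic on the connected set of all parameters, so the identity
  propagates.\<close>

lemma S_fun_hyperplane:
  assumes "psi_extension \<Psi>"
  shows "mero_pullback_eq (S_fun \<Psi>) (hyperplane n) (aw_value n) aw_half_planes"
proof -
  interpret graph_hyperplane "hyperplane n" "\<lambda>z. (fst z, fst (snd z), fst (snd (snd z)), fst (snd (snd (snd z))))"
     "\<lambda>z. snd (snd (snd (snd z))) - (\<i> * ((fst z + fst (snd z)) / 2) + \<i> * fst (dual (fst (snd (snd z)))) + \<i> * of_nat n * fst z)"
     "(0, 0, (0, 0, 0, 0), 0, 1)" by (rule graph_hyperplane_hyperplane)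
  have w2: "fst (snd q) \<noteq> 0" if "q \<in> aw_half_planes" for q using that by (auto simp: aw_half_planes_def)
  have cD: "cdiff (aw_generic n) q" if "q \<in> aw_half_planes" for q
    unfolding aw_generic_def[abs_def] by (intro cdiff_intros w2 that)
  define V where "V = aw_half_planes \<inter> hyperplane n -` domain (Suc n)"
  have "open V" unfolding V_def by (intro open_Int open_aw_half_planes open_vimage_cdiff cdiff_phi open_domain)
  define U where "U = {q \<in> V. aw_generic n q \<noteq> 0}"
  have U: "open U" unfolding U_def proof (rule open_nonzero)
    show "holo (aw_generic n) V" by (rule holoI[OF \<open>open V\<close>]) (auto simp: V_def intro: cD)
  qed
  have val: "S_reduced (Suc n) (hyperplane n q) = aw_value n q" if "q \<in> U" for q
    using that by (intro S_reduced_eq_aw_value) (auto simp: U_def V_def)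
  have bp: "base_point n \<in> aw_half_planes" by (simp add: base_point_def Let_def aw_half_planes_def)
  show ?thesis
  proof (rule mero_pullback_eq_propagate[OF mero_S_fun[OF assms] mero_aw_value open_aw_half_planes convex_aw_half_planes
        _ open_half_planes bp mero_quotient_S_fun[OF assms]])
    show "hyperplane n ` aw_half_planes \<subseteq> half_planes" using hyperplane_half_planes by blast
    show "base_point n \<in> U" using bp hyperplane_base_point base_point_generic[of n] by (simp add: U_def V_def)
    show "hyperplane n ` U \<subseteq> domain (Suc n)" by (auto simp: U_def V_def)
    have h: "holo (S_reduced (Suc n) \<circ> hyperplane n) U" unfolding comp_def
      by (rule holo_compose[OF holo_S_reduced U cdiff_phi]) (auto simp: U_def V_def)
    have "mero_eq (aw_value n) (\<lambda>z. (S_reduced (Suc n) \<circ> hyperplane n) z / ((\<lambda>_. 1) \<circ> hyperplane n) z) U"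
      unfolding mero_eq_def using holo_nz_const1[OF U] val by (intro ballI exI[of _ U] exI[of _ "\<lambda>_. 1"]) simp
    then show "mero_quotient (aw_value n) (S_reduced (Suc n) \<circ> hyperplane n) ((\<lambda>_. 1) \<circ> hyperplane n) U"
      unfolding mero_quotient_def using h holo_nz_const1[OF U] by (simp add: comp_def)
  qed
qed

theorem theorem7p1:
  fixes \<Psi> :: "complex \<times> complex \<times> quadruple \<times> complex \<times> complex \<Rightarrow> complex"
    and n :: nat
  assumes "psi_extension \<Psi>"
  shows "mero_pullback_eq
    (S_fun \<Psi>)
    (\<lambda>(w\<^sub>1, w\<^sub>2, \<gamma>, x).
       let w = (w\<^sub>1 + w\<^sub>2) / 2; \<gamma>_hat\<^sub>0 = fst (dual \<gamma>)
       in (w\<^sub>1, w\<^sub>2, \<gamma>, x, \<i> * w + \<i> * \<gamma>_hat\<^sub>0 + \<i> * of_nat n * w\<^sub>1))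
    (\<lambda>(w\<^sub>1, w\<^sub>2, (\<gamma>\<^sub>0, \<gamma>\<^sub>1, \<gamma>\<^sub>2, \<gamma>\<^sub>3), x).
       let q = exp (of_real pi * \<i> * w\<^sub>1 / w\<^sub>2);
           a = - exp (2 * of_real pi * \<i> * \<gamma>\<^sub>0 / w\<^sub>2) * q;
           b = - exp (2 * of_real pi * \<i> * \<gamma>\<^sub>1 / w\<^sub>2) * q;
           c = - exp (2 * of_real pi * \<i> * \<gamma>\<^sub>2 / w\<^sub>2) * q;
           d = - exp (2 * of_real pi * \<i> * \<gamma>\<^sub>3 / w\<^sub>2) * q
       in askey_wilson w\<^sub>2 n x a b c d (q\<^sup>2))
    {(w\<^sub>1, w\<^sub>2, \<gamma>, x). Re w\<^sub>1 > 0 \<and> Re w\<^sub>2 > 0}"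
proof -
  have eqI: "mero_pullback_eq (S_fun \<Psi>) f g A"
    if "\<And>q. f q = hyperplane n q" "\<And>q. g q = aw_value n q" "A = aw_half_planes" for f g A proof -
    have "f = hyperplane n" "g = aw_value n" using that by auto
    then show ?thesis using S_fun_hyperplane[OF assms, of n] that(3) by simp
  qed
  show ?thesis
    by (rule eqI) (auto simp: hyperplane_def aw_value_def aw_a_def aw_b_def aw_c_def aw_d_def nome_def aw_half_planes_def Let_def)
qed

end
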